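(* Let $(\mathcal M,g_R)$ be a split Riemannian supermanifold of odd dimension $2(2m+r)$, $m\geq 0$, $r\in\{0,1\}$, with $g_R=g_0+g_2$. The (isomorphism classes of) Riemannian supermanifolds $(\mathcal M,g)$ with reduction $g_R$ that are split up to terms of degree $(2m+r)+3$ and higher correspond bijectively, via $g=g_R\exp(W)\mapsto$ orbit of the class $[W]$, to the $Iso(\mathcal M,g_R,2(m+2))$-orbits on $$F_{g_R}\big(End_{g_0}^{(2(m+1))}(\mathcal V_{\mathcal M})_{\bar 0}\big)\big/G_{g_R}\big(\mathcal V_{\mathcal M,g_0,\bar 0}^{(2(m+1))}\big).$$
   Context: $\mathcal M=(M,\mathcal C^\infty_{\mathcal M})$ is a real supermanifold; $\mathcal V_{\mathcal M}$ is the $\mathcal C^\infty_{\mathcal M}(M)$-module of global superderivations of $\mathcal C^\infty_{\mathcal M}$, $\mathcal V_{\mathcal M}^*$ its $\mathcal C^\infty_{\mathcal M}(M)$-dual, and $End$, $Hom$ denote $\mathcal C^\infty_{\mathcal M}(M)$-linear maps. A fixed Batchelor model (an isomorphism $\mathcal M\to(M,\Gamma^\infty_{\Lambda E^*})$, $E\to M$ a real vector bundle) induces $\mathbb Z$-gradings on $\mathcal C^\infty_{\mathcal M}$ (form degree), $\mathcal V_{\mathcal M}$, $\mathcal V_{\mathcal M}^*$, $End(\mathcal V_{\mathcal M})$ and $Hom(\mathcal V_{\mathcal M},\mathcal V_{\mathcal M}^* )$ (degree shift), denoted by lower indices, and filtrations: the upper index $(k)$ denotes elements all of whose homogeneous components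 have degree $\geq k$. A Riemannian metric on $\mathcal M$ is an even non-degenerate supersymmetric form $g\in Hom(\mathcal V_{\mathcal M}\otimes_{\mathcal C^\infty_{\mathcal M}(M)}\mathcal V_{\mathcal M},\mathcal C^\infty_{\mathcal M}(M))_{\bar 0}$, also regarded as an isomorphism $g\in Hom(\mathcal V_{\mathcal M},\mathcal V_{\mathcal M}^* )_{\bar 0}$ with $g(X)(Y)=(-1)^{|X||Y|}g(Y)(X)$. One writes $g=g_R\exp(W)$, where the reduction $g_R=g_0+g_2$ is the sum of the degree $0$ and degree $2$ components of $g$ and $W\in End^{(2)}_{g_0}(\mathcal V_{\mathcal M})_{\bar 0}$. Here $End^{(2k)}_{g_0}(\mathcal V_{\mathcal M})_{\bar 0}$ denotes those $W\in End^{(2k)}(\mathcal V_{\mathcal M})_{\bar 0}$ with $g_0W\in Hom^{(2k+2)}(\mathcal V_{\mathcal M},\mathcal V_{\mathcal M}^* )_{\bar 0}$. The metric is split if the Batchelor model can be chosen such that $W=0$, and split up to terms of degree $d$ and higher if it can be chosen such that $g-g_R\in Hom^{(d)}(\mathcal V_{\mathcal M},\mathcal V_{\mathcal M}^* )_{\bar 0}$; with the Batchelor model fixed, changing it amounts to replacing $g$ by $\varphi^*.g$ for an automorphism $\varphi^*$ of $\mathcal M$. Automorphisms are even superalgebra automorphisms $\varphi^*$ of $\mathcal C^\infty_{\mathcal M}(M)$ over diffeomorphisms of $M$; $(\varphi^*.g)(\chi)(\chi'):=\varphi^*\big(g((\varphi^* )^{-1}\chi\varphi^*,(\varphi^* )^{-1}\chi'\varphi^*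 )\big)$ and $(\varphi^*.W)(\chi):=\varphi^*\big(W((\varphi^* )^{-1}\chi\varphi^* )\big)(\varphi^* )^{-1}$; $(\mathcal M,g)$ and $(\mathcal M,g')$ are isomorphic if $g'=\varphi^*.g$ for some $\varphi^*$. With $ad(\zeta):=[\zeta,\cdot]$ (supercommutator), $\mathcal V^{(2k)}_{\mathcal M,g_0,\bar 0}$ denotes those $\zeta\in\mathcal V^{(2k)}_{\mathcal M,\bar 0}$ with $-g_0(ad(\zeta)\otimes Id+Id\otimes ad(\zeta))+\zeta g_0\in Hom^{(2k+2)}(\mathcal V_{\mathcal M},\mathcal V_{\mathcal M}^* )_{\bar 0}$, where $\zeta g_0$ is $(X,Y)\mapsto\zeta(g_0(X,Y))$. The maps $F_{g_R}:End(\mathcal V_{\mathcal M})\to End(\mathcal V_{\mathcal M})$ and $G_{g_R}:\mathcal V_{\mathcal M}\to End(\mathcal V_{\mathcal M})$ are $$F_{g_R}(\gamma):=\gamma+g_R^{-1}\gamma^*g_R,\qquad G_{g_R}(\zeta):=ad(\zeta)+g_R^{-1}(ad^*(\zeta)-\zeta)g_R,$$ where, for even $\gamma$ and $\zeta$, $\gamma^*(\alpha)=\alpha\circ\gamma$, $ad^*(\zeta)(\alpha)=\alpha\circ ad(\zeta)$, and $\zeta$ acts by $\alpha\mapsto\zeta\circ\alpha$. One has $G_{g_R}(\mathcal V^{(2k)}_{\mathcal M,g_0,\bar 0})\subset F_{g_R}(End^{(2k)}_{g_0}(\mathcal V_{\mathcal M})_{\bar 0})$. $Iso(\mathcal M,g_R,2k+2)$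 denotes the automorphisms $\psi^*$ of $\mathcal M$ with $g_R-\psi^*.g_R\in Hom^{(2k+2)}(\mathcal V_{\mathcal M},\mathcal V_{\mathcal M}^* )_{\bar 0}$. It acts on $F_{g_R}(End^{(2k)}_{g_0}(\mathcal V_{\mathcal M})_{\bar 0})$, up to terms in $End^{(4k)}(\mathcal V_{\mathcal M})_{\bar 0}$, by $(\psi^*,W)\mapsto g_R^{-1}(\psi^*.g_R-g_R)+\psi^*.W$, and this induces an action on the quotient by $G_{g_R}(\mathcal V^{(2k)}_{\mathcal M,g_0,\bar 0})$. For $k=m+1$ the error terms in $End^{(4k)}$ vanish, since $4k$ exceeds the odd dimension. *)

theory Defs
  imports
    "HOL-Analysis.Analysis"
    "HOL-Library.Function_Algebras"
    "HOL-Library.Groups_Big_Fun"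
begin

section \<open>Smooth manifolds\<close>

text \<open>
  The model space is the library's \<^const>\<open>Euclidean_space\<close> \<open>p\<close>, i.e. the sequences supported
  on \<open>{..<p}\<close>; here \<open>p\<close> is a number (possibly \<open>0\<close>), not a type. A function is of class \<open>C\<^sup>k\<close> on an
  open set if its iterated partial derivatives up to order \<open>k\<close> exist and are continuous.
\<close>

fun Ck_on :: "nat \<Rightarrow> nat \<Rightarrow> (nat \<Rightarrow> real) set \<Rightarrow> ((nat \<Rightarrow> real) \<Rightarrow> real) \<Rightarrow> bool" where
  "Ck_on p 0 V f \<longleftrightarrow>
     continuous_map (subtopology (Euclidean_space p) V) euclideanreal f"
| "Ck_on p (Suc k) V f \<longleftrightarrow>
     continuous_map (subtopology (Euclidean_space p) V) euclideanreal f \<and>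
     (\<forall>i<p. \<exists>f'. (\<forall>x\<in>V. ((\<lambda>t. f (x(i := t))) has_real_derivative f' x) (at (x i))) \<and>
                 Ck_on p k V f')"

definition Cinf_on :: "nat \<Rightarrow> (nat \<Rightarrow> real) set \<Rightarrow> ((nat \<Rightarrow> real) \<Rightarrow> real) \<Rightarrow> bool" where
  "Cinf_on p V f \<longleftrightarrow> (\<forall>k. Ck_on p k V f)"

text \<open>
  A real supermanifold together with a Batchelor model. The base manifold \<open>M\<close> is the type \<open>'m\<close>
  with an atlas of charts \<open>(U, x)\<close>. The vector bundle \<open>E \<rightarrow> M\<close> has as fibres \<open>E\<^sub>p\<close> linear subspaces of
  an arbitrary real vector space \<open>'v\<close>; its smooth structure is an atlas of local frames \<open>(U, e)\<close>.
  The type \<open>'a\<close> is the superalgebra of global superfunctions of the supermanifold, and \<open>model\<close> is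
  the isomorphism of \<open>'a\<close> with the global smooth sections of the exterior bundle of \<open>E\<^sup>*\<close>.
  The \<open>\<int>\<^sub>2\<close>-grading of \<open>'a\<close> and the \<open>\<int>\<close>-grading induced by the Batchelor model are the parity and the
  degree of forms, carried over by \<open>model\<close>.
\<close>

record ('m, 'v, 'a) batchelor =
  even_dim :: nat
  odd_dim :: nat
  charts :: "('m set \<times> ('m \<Rightarrow> nat \<Rightarrow> real)) set"
  fibre :: "'m \<Rightarrow> 'v set"
  frames :: "('m set \<times> (nat \<Rightarrow> 'm \<Rightarrow> 'v)) set"
  model :: "'a \<Rightarrow> 'm \<Rightarrow> 'v list \<Rightarrow> real"

definition smooth_atlas ::
  "nat \<Rightarrow> ('m::topological_space set \<times> ('m \<Rightarrow> nat \<Rightarrow> real)) set \<Rightarrow> bool" where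
  "smooth_atlas p At \<longleftrightarrow>
     \<Union> (fst ` At) = UNIV \<and>
     (\<forall>(U, x)\<in>At. open U \<and> openin (Euclidean_space p) (x ` U) \<and>
        homeomorphic_map (top_of_set U) (subtopology (Euclidean_space p) (x ` U)) x) \<and>
     (\<forall>(U, x)\<in>At. \<forall>(U', x')\<in>At. \<forall>i<p.
        Cinf_on p (x ` (U \<inter> U')) (\<lambda>y. x' (inv_into U x y) i))"

definition smooth_on ::
  "('m::topological_space, 'v, 'a) batchelor \<Rightarrow> 'm set \<Rightarrow> ('m \<Rightarrow> real) \<Rightarrow> bool" where
  "smooth_on S W f \<longleftrightarrow>
     (\<forall>(U, x)\<in>charts S. Cinf_on (even_dim S) (x ` (U \<inter> W)) (\<lambda>y. f (inv_into U x y)))"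

text \<open>Smooth maps as morphisms of the ringed space of smooth functions.\<close>

definition smooth_map ::
  "('m::topological_space, 'v, 'a) batchelor \<Rightarrow> ('m \<Rightarrow> 'm) \<Rightarrow> bool" where
  "smooth_map S \<sigma> \<longleftrightarrow> continuous_on UNIV \<sigma> \<and>
     (\<forall>W f. open W \<and> smooth_on S W f \<longrightarrow> smooth_on S (\<sigma> -` W) (f \<circ> \<sigma>))"

definition diffeo ::
  "('m::topological_space, 'v, 'a) batchelor \<Rightarrow> ('m \<Rightarrow> 'm) \<Rightarrow> bool" where
  "diffeo S \<sigma> \<longleftrightarrow> bij \<sigma> \<and> smooth_map S \<sigma> \<and> smooth_map S (inv \<sigma>)"


section \<open>Vector bundles and exterior forms\<close>

definition vector_bundle ::
  "('m::topological_space, 'v::real_vector, 'a) batchelor \<Rightarrow> bool" where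
  "vector_bundle S \<longleftrightarrow>
     \<Union> (fst ` frames S) = UNIV \<and>
     (\<forall>(U, e)\<in>frames S. open U \<and>
        (\<forall>p\<in>U. inj_on (\<lambda>i. e i p) {..<odd_dim S} \<and>
               independent ((\<lambda>i. e i p) ` {..<odd_dim S}) \<and>
               span ((\<lambda>i. e i p) ` {..<odd_dim S}) = fibre S p)) \<and>
     (\<forall>(U, e)\<in>frames S. \<forall>(U', e')\<in>frames S. \<exists>c.
        (\<forall>i<odd_dim S. \<forall>j<odd_dim S. smooth_on S (U \<inter> U') (c i j)) \<and>
        (\<forall>j<odd_dim S. \<forall>p\<in>U \<inter> U'. e' j p = (\<Sum>i<odd_dim S. c i j p *\<^sub>R e i p)))"

text \<open>
  An element of the exterior algebra of the dual of a vector space \<open>E\<close> is an alternating multilinear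
  form of mixed degree: its part of degree \<open>k\<close> is its restriction to lists of length \<open>k\<close>.
  The value is \<open>0\<close> on lists that are not contained in \<open>E\<close>.
\<close>

definition ext_forms :: "'v::real_vector set \<Rightarrow> ('v list \<Rightarrow> real) set" where
  "ext_forms E = {\<omega>.
     (\<forall>vs. \<not> set vs \<subseteq> E \<longrightarrow> \<omega> vs = 0) \<and>
     (\<forall>us ws x y a b. set us \<subseteq> E \<and> set ws \<subseteq> E \<and> x \<in> E \<and> y \<in> E \<longrightarrow>
        \<omega> (us @ (a *\<^sub>R x + b *\<^sub>R y) # ws) = a * \<omega> (us @ x # ws) + b * \<omega> (us @ y # ws)) \<and>
     (\<forall>vs. \<not> distinct vs \<longrightarrow> \<omega> vs = 0)}"

text \<open>
  The wedge product as a sum over shuffles: \<open>I\<close> is the set of positions of the arguments that are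
  passed to the first factor, and the sign is that of the corresponding shuffle.
\<close>

definition wedge :: "('v list \<Rightarrow> real) \<Rightarrow> ('v list \<Rightarrow> real) \<Rightarrow> 'v list \<Rightarrow> real" where
  "wedge \<omega> \<eta> vs =
     (\<Sum>I\<in>Pow {..<length vs}.
        (-1) ^ card {(i, j). i \<in> I \<and> j \<in> {..<length vs} - I \<and> j < i} *
        \<omega> (nths vs I) * \<eta> (nths vs ({..<length vs} - I)))"

definition ext_sections ::
  "('m::topological_space, 'v::real_vector, 'a) batchelor \<Rightarrow> ('m \<Rightarrow> 'v list \<Rightarrow> real) set" where
  "ext_sections S = {s.
     (\<forall>p. s p \<in> ext_forms (fibre S p)) \<and>
     (\<forall>(U, e)\<in>frames S. \<forall>is. set is \<subseteq> {..<odd_dim S} \<longrightarrow>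
        smooth_on S U (\<lambda>p. s p (map (\<lambda>i. e i p) is)))}"

definition batchelor_model ::
  "('m::{t2_space, second_countable_topology}, 'v::real_vector, 'a::real_algebra_1) batchelor \<Rightarrow> bool"
  where
  "batchelor_model S \<longleftrightarrow>
     smooth_atlas (even_dim S) (charts S) \<and>
     vector_bundle S \<and>
     bij_betw (model S) UNIV (ext_sections S) \<and>
     (\<forall>a b p vs. model S (a + b) p vs = model S a p vs + model S b p vs) \<and>
     (\<forall>r a p vs. model S (r *\<^sub>R a) p vs = r * model S a p vs) \<and>
     (\<forall>a b p. model S (a * b) p = wedge (model S a p) (model S b p))"


section \<open>Graded objects\<close>

text \<open>
  A grading is a family \<open>G\<close> of sets of homogeneous elements. Here \<open>s\<close> is the family of homogeneous
  components of \<open>x\<close>.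
\<close>

definition hdecomp :: "(int \<Rightarrow> 'x::comm_monoid_add set) \<Rightarrow> 'x \<Rightarrow> (int \<Rightarrow> 'x) \<Rightarrow> bool" where
  "hdecomp G x s \<longleftrightarrow> (\<forall>j. s j \<in> G j) \<and> finite {j. s j \<noteq> 0} \<and> x = Sum_any s"

definition hcomponent :: "(int \<Rightarrow> 'x::comm_monoid_add set) \<Rightarrow> int \<Rightarrow> 'x \<Rightarrow> 'x" where
  "hcomponent G j x = (THE s. hdecomp G x s) j"

definition filt :: "(int \<Rightarrow> 'x::comm_monoid_add set) \<Rightarrow> int \<Rightarrow> 'x set" where
  "filt G k = {x. \<exists>s. hdecomp G x s \<and> (\<forall>j<k. s j = 0)}"

definition fun_deg :: "('m, 'v, 'a) batchelor \<Rightarrow> int \<Rightarrow> 'a set" where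
  "fun_deg S j = {a. \<forall>p vs. model S a p vs \<noteq> 0 \<longrightarrow> int (length vs) = j}"

text \<open>Parities are natural numbers that only matter modulo \<open>2\<close>.\<close>

definition fun_par :: "('m, 'v, 'a::real_algebra_1) batchelor \<Rightarrow> nat \<Rightarrow> 'a set" where
  "fun_par S \<epsilon> =
     {a. \<exists>s. hdecomp (fun_deg S) a s \<and> (\<forall>j. s j \<noteq> 0 \<longrightarrow> even (j - int \<epsilon>))}"

text \<open>The underlying smooth function on \<open>M\<close> of a superfunction.\<close>

definition body :: "('m, 'v, 'a) batchelor \<Rightarrow> 'a \<Rightarrow> 'm \<Rightarrow> real" where
  "body S a p = model S a p []"


section \<open>Vector fields, the dual module, and linear maps\<close>

definition vf_par :: "('m, 'v, 'a::real_algebra_1) batchelor \<Rightarrow> nat \<Rightarrow> ('a \<Rightarrow> 'a) set" where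
  "vf_par S \<epsilon> = {X. linear X \<and>
     (\<forall>\<delta>. \<forall>a\<in>fun_par S \<delta>. X a \<in> fun_par S (\<delta> + \<epsilon>)) \<and>
     (\<forall>\<delta>. \<forall>a\<in>fun_par S \<delta>. \<forall>b. X (a * b) = X a * b + (-1) ^ (\<epsilon> * \<delta>) *\<^sub>R (a * X b))}"

definition vf :: "('m, 'v, 'a::real_algebra_1) batchelor \<Rightarrow> ('a \<Rightarrow> 'a) set" where
  "vf S = {X + Y | X Y. X \<in> vf_par S 0 \<and> Y \<in> vf_par S 1}"

definition vf_deg :: "('m, 'v, 'a::real_algebra_1) batchelor \<Rightarrow> int \<Rightarrow> ('a \<Rightarrow> 'a) set" where
  "vf_deg S j = {X \<in> vf S. \<forall>i. X ` fun_deg S i \<subseteq> fun_deg S (i + j)}"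

text \<open>
  Maps defined on vector fields are total functions with value \<open>0\<close> outside \<^const>\<open>vf\<close>. Linearity over
  superfunctions follows the sign rule: for homogeneous arguments,
  \<open>\<alpha> (f X) = (-1)\<^bsup>|\<alpha>||f|\<^esup> f \<alpha> X\<close>. This is the convention that is compatible with \<open>g X \<in> V\<^sup>*\<close> for
  a supersymmetric bilinear form \<open>g\<close> and odd \<open>X\<close>.
\<close>

definition dual_par ::
  "('m, 'v, 'a::real_algebra_1) batchelor \<Rightarrow> nat \<Rightarrow> (('a \<Rightarrow> 'a) \<Rightarrow> 'a) set" where
  "dual_par S \<epsilon> = {\<alpha>.
     (\<forall>X. X \<notin> vf S \<longrightarrow> \<alpha> X = 0) \<and>
     (\<forall>X\<in>vf S. \<forall>Y\<in>vf S. \<alpha> (X + Y) = \<alpha> X + \<alpha> Y) \<and>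
     (\<forall>\<delta>. \<forall>f\<in>fun_par S \<delta>. \<forall>X\<in>vf S. \<alpha> (\<lambda>a. f * X a) = (-1) ^ (\<epsilon> * \<delta>) *\<^sub>R (f * \<alpha> X)) \<and>
     (\<forall>\<delta>. \<forall>X\<in>vf_par S \<delta>. \<alpha> X \<in> fun_par S (\<delta> + \<epsilon>))}"

definition dual :: "('m, 'v, 'a::real_algebra_1) batchelor \<Rightarrow> (('a \<Rightarrow> 'a) \<Rightarrow> 'a) set" where
  "dual S = {\<alpha> + \<beta> | \<alpha> \<beta>. \<alpha> \<in> dual_par S 0 \<and> \<beta> \<in> dual_par S 1}"

definition dual_deg ::
  "('m, 'v, 'a::real_algebra_1) batchelor \<Rightarrow> int \<Rightarrow> (('a \<Rightarrow> 'a) \<Rightarrow> 'a) set" where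
  "dual_deg S j = {\<alpha> \<in> dual S. \<forall>i. \<alpha> ` vf_deg S i \<subseteq> fun_deg S (i + j)}"

text \<open>The even part of \<open>End(V)\<close>; even linear maps involve no signs.\<close>

definition end_even ::
  "('m, 'v, 'a::real_algebra_1) batchelor \<Rightarrow> (('a \<Rightarrow> 'a) \<Rightarrow> ('a \<Rightarrow> 'a)) set" where
  "end_even S = {\<gamma>.
     (\<forall>X. X \<notin> vf S \<longrightarrow> \<gamma> X = 0) \<and>
     (\<forall>X\<in>vf S. \<forall>Y\<in>vf S. \<gamma> (X + Y) = \<gamma> X + \<gamma> Y) \<and>
     (\<forall>f. \<forall>X\<in>vf S. \<gamma> (\<lambda>a. f * X a) = (\<lambda>a. f * \<gamma> X a)) \<and>
     (\<forall>\<delta>. \<gamma> ` vf_par S \<delta> \<subseteq> vf_par S \<delta>)}"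

definition end_deg ::
  "('m, 'v, 'a::real_algebra_1) batchelor \<Rightarrow> int \<Rightarrow> (('a \<Rightarrow> 'a) \<Rightarrow> ('a \<Rightarrow> 'a)) set" where
  "end_deg S j = {\<gamma> \<in> end_even S. \<forall>i. \<gamma> ` vf_deg S i \<subseteq> vf_deg S (i + j)}"

text \<open>The even part of \<open>Hom(V, V\<^sup>*)\<close>, which is also that of \<open>Hom(V \<otimes> V, C\<^sup>\<infinity>)\<close> by currying.\<close>

definition hom_even ::
  "('m, 'v, 'a::real_algebra_1) batchelor \<Rightarrow> (('a \<Rightarrow> 'a) \<Rightarrow> (('a \<Rightarrow> 'a) \<Rightarrow> 'a)) set" where
  "hom_even S = {h.
     (\<forall>X. X \<notin> vf S \<longrightarrow> h X = 0) \<and>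
     (\<forall>X\<in>vf S. \<forall>Y\<in>vf S. h (X + Y) = h X + h Y) \<and>
     (\<forall>f. \<forall>X\<in>vf S. h (\<lambda>a. f * X a) = (\<lambda>Y. f * h X Y)) \<and>
     (\<forall>\<delta>. h ` vf_par S \<delta> \<subseteq> dual_par S \<delta>)}"

definition hom_deg ::
  "('m, 'v, 'a::real_algebra_1) batchelor \<Rightarrow> int \<Rightarrow> (('a \<Rightarrow> 'a) \<Rightarrow> (('a \<Rightarrow> 'a) \<Rightarrow> 'a)) set" where
  "hom_deg S j = {h \<in> hom_even S. \<forall>i. h ` vf_deg S i \<subseteq> dual_deg S (i + j)}"


section \<open>Riemannian metrics\<close>

definition riemannian_metric ::
  "('m, 'v, 'a::real_algebra_1) batchelor \<Rightarrow> (('a \<Rightarrow> 'a) \<Rightarrow> (('a \<Rightarrow> 'a) \<Rightarrow> 'a)) \<Rightarrow> bool" where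
  "riemannian_metric S g \<longleftrightarrow> g \<in> hom_even S \<and> bij_betw g (vf S) (dual S) \<and>
     (\<forall>\<epsilon> \<delta>. \<forall>X\<in>vf_par S \<epsilon>. \<forall>Y\<in>vf_par S \<delta>. g X Y = (-1) ^ (\<epsilon> * \<delta>) *\<^sub>R g Y X)"

definition reduction ::
  "('m, 'v, 'a::real_algebra_1) batchelor \<Rightarrow>
   (('a \<Rightarrow> 'a) \<Rightarrow> (('a \<Rightarrow> 'a) \<Rightarrow> 'a)) \<Rightarrow> (('a \<Rightarrow> 'a) \<Rightarrow> (('a \<Rightarrow> 'a) \<Rightarrow> 'a))" where
  "reduction S g = hcomponent (hom_deg S) 0 g + hcomponent (hom_deg S) 2 g"

text \<open>The exponential series, for maps \<open>W\<close> for which it is a finite sum.\<close>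

definition nilp_exp ::
  "(('a::real_algebra_1 \<Rightarrow> 'a) \<Rightarrow> ('a \<Rightarrow> 'a)) \<Rightarrow> (('a \<Rightarrow> 'a) \<Rightarrow> ('a \<Rightarrow> 'a))" where
  "nilp_exp W X a = Sum_any (\<lambda>n. (1 / fact n) *\<^sub>R (W ^^ n) X a)"

definition automorphisms ::
  "('m::topological_space, 'v, 'a::real_algebra_1) batchelor \<Rightarrow> ('a \<Rightarrow> 'a) set" where
  "automorphisms S = {\<phi>. bij \<phi> \<and> linear \<phi> \<and> (\<forall>a b. \<phi> (a * b) = \<phi> a * \<phi> b) \<and>
     (\<forall>\<delta>. \<phi> ` fun_par S \<delta> \<subseteq> fun_par S \<delta>) \<and>
     (\<exists>\<sigma>. diffeo S \<sigma> \<and> (\<forall>a. body S (\<phi> a) = body S a \<circ> \<sigma>))}"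

definition act_metric ::
  "('a \<Rightarrow> 'a) \<Rightarrow> (('a \<Rightarrow> 'a) \<Rightarrow> (('a \<Rightarrow> 'a) \<Rightarrow> 'a)) \<Rightarrow> (('a \<Rightarrow> 'a) \<Rightarrow> (('a \<Rightarrow> 'a) \<Rightarrow> 'a))" where
  "act_metric \<phi> g X Y = \<phi> (g (inv \<phi> \<circ> X \<circ> \<phi>) (inv \<phi> \<circ> Y \<circ> \<phi>))"

definition act_end ::
  "('a \<Rightarrow> 'a) \<Rightarrow> (('a \<Rightarrow> 'a) \<Rightarrow> ('a \<Rightarrow> 'a)) \<Rightarrow> (('a \<Rightarrow> 'a) \<Rightarrow> ('a \<Rightarrow> 'a))" where
  "act_end \<phi> W X = \<phi> \<circ> W (inv \<phi> \<circ> X \<circ> \<phi>) \<circ> inv \<phi>"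

text \<open>
  The metrics that, in a suitable Batchelor model, have reduction \<open>gR\<close> and agree with it up to terms
  of degree \<open>d\<close> and higher. A change of the Batchelor model is a replacement of \<open>g\<close> by its
  transform under an automorphism.
\<close>

definition metrics_split_upto ::
  "('m::topological_space, 'v, 'a::real_algebra_1) batchelor \<Rightarrow>
   (('a \<Rightarrow> 'a) \<Rightarrow> (('a \<Rightarrow> 'a) \<Rightarrow> 'a)) \<Rightarrow> int \<Rightarrow> (('a \<Rightarrow> 'a) \<Rightarrow> (('a \<Rightarrow> 'a) \<Rightarrow> 'a)) set" where
  "metrics_split_upto S gR d = {g. riemannian_metric S g \<and>
     (\<exists>\<phi>\<in>automorphisms S. reduction S (act_metric \<phi> g) = gR \<and>
        act_metric \<phi> g - gR \<in> filt (hom_deg S) d)}"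

definition isometry_rel ::
  "('m::topological_space, 'v, 'a::real_algebra_1) batchelor \<Rightarrow>
   (('a \<Rightarrow> 'a) \<Rightarrow> (('a \<Rightarrow> 'a) \<Rightarrow> 'a)) set \<Rightarrow>
   ((('a \<Rightarrow> 'a) \<Rightarrow> (('a \<Rightarrow> 'a) \<Rightarrow> 'a)) \<times> (('a \<Rightarrow> 'a) \<Rightarrow> (('a \<Rightarrow> 'a) \<Rightarrow> 'a))) set" where
  "isometry_rel S N =
     {(g, g'). g \<in> N \<and> g' \<in> N \<and> (\<exists>\<phi>\<in>automorphisms S. g' = act_metric \<phi> g)}"


section \<open>The parameter space\<close>

text \<open>In this section \<open>gR\<close> is a metric with \<open>gR = reduction S gR\<close>.\<close>

definition end_filt_g0 ::
  "('m, 'v, 'a::real_algebra_1) batchelor \<Rightarrow> (('a \<Rightarrow> 'a) \<Rightarrow> (('a \<Rightarrow> 'a) \<Rightarrow> 'a)) \<Rightarrow> int \<Rightarrow>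
   (('a \<Rightarrow> 'a) \<Rightarrow> ('a \<Rightarrow> 'a)) set" where
  "end_filt_g0 S gR l = {W \<in> filt (end_deg S) l.
     hcomponent (hom_deg S) 0 gR \<circ> W \<in> filt (hom_deg S) (l + 2)}"

text \<open>For even \<open>\<zeta>\<close> the supercommutator with \<open>\<zeta>\<close> is the commutator.\<close>

definition ad ::
  "('m, 'v, 'a::real_algebra_1) batchelor \<Rightarrow> ('a \<Rightarrow> 'a) \<Rightarrow> (('a \<Rightarrow> 'a) \<Rightarrow> ('a \<Rightarrow> 'a))" where
  "ad S \<zeta> X = (if X \<in> vf S then (\<zeta> \<circ> X) - (X \<circ> \<zeta>) else 0)"

definition vf_filt_g0 ::
  "('m, 'v, 'a::real_algebra_1) batchelor \<Rightarrow> (('a \<Rightarrow> 'a) \<Rightarrow> (('a \<Rightarrow> 'a) \<Rightarrow> 'a)) \<Rightarrow> int \<Rightarrow>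
   ('a \<Rightarrow> 'a) set" where
  "vf_filt_g0 S gR l = {\<zeta> \<in> vf_par S 0 \<inter> filt (vf_deg S) l.
     (let g0 = hcomponent (hom_deg S) 0 gR in
      (\<lambda>X Y. - (g0 (ad S \<zeta> X) Y + g0 X (ad S \<zeta> Y)) + \<zeta> (g0 X Y)) \<in> filt (hom_deg S) (l + 2))}"

definition F_map ::
  "('m, 'v, 'a::real_algebra_1) batchelor \<Rightarrow> (('a \<Rightarrow> 'a) \<Rightarrow> (('a \<Rightarrow> 'a) \<Rightarrow> 'a)) \<Rightarrow>
   (('a \<Rightarrow> 'a) \<Rightarrow> ('a \<Rightarrow> 'a)) \<Rightarrow> (('a \<Rightarrow> 'a) \<Rightarrow> ('a \<Rightarrow> 'a))" where
  "F_map S gR \<gamma> X = \<gamma> X + inv_into (vf S) gR (gR X \<circ> \<gamma>)"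

definition G_map ::
  "('m, 'v, 'a::real_algebra_1) batchelor \<Rightarrow> (('a \<Rightarrow> 'a) \<Rightarrow> (('a \<Rightarrow> 'a) \<Rightarrow> 'a)) \<Rightarrow>
   ('a \<Rightarrow> 'a) \<Rightarrow> (('a \<Rightarrow> 'a) \<Rightarrow> ('a \<Rightarrow> 'a))" where
  "G_map S gR \<zeta> X = ad S \<zeta> X + inv_into (vf S) gR ((gR X \<circ> ad S \<zeta>) - (\<zeta> \<circ> gR X))"

definition Iso ::
  "('m::topological_space, 'v, 'a::real_algebra_1) batchelor \<Rightarrow>
   (('a \<Rightarrow> 'a) \<Rightarrow> (('a \<Rightarrow> 'a) \<Rightarrow> 'a)) \<Rightarrow> int \<Rightarrow> ('a \<Rightarrow> 'a) set" where
  "Iso S gR l = {\<psi> \<in> automorphisms S. gR - act_metric \<psi> gR \<in> filt (hom_deg S) l}"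

definition iso_act ::
  "('m, 'v, 'a::real_algebra_1) batchelor \<Rightarrow> (('a \<Rightarrow> 'a) \<Rightarrow> (('a \<Rightarrow> 'a) \<Rightarrow> 'a)) \<Rightarrow>
   ('a \<Rightarrow> 'a) \<Rightarrow> (('a \<Rightarrow> 'a) \<Rightarrow> ('a \<Rightarrow> 'a)) \<Rightarrow> (('a \<Rightarrow> 'a) \<Rightarrow> ('a \<Rightarrow> 'a))" where
  "iso_act S gR \<psi> W X =
     inv_into (vf S) gR (act_metric \<psi> gR X - gR X) + act_end \<psi> W X"

definition F_space ::
  "('m, 'v, 'a::real_algebra_1) batchelor \<Rightarrow> (('a \<Rightarrow> 'a) \<Rightarrow> (('a \<Rightarrow> 'a) \<Rightarrow> 'a)) \<Rightarrow> int \<Rightarrow>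
   (('a \<Rightarrow> 'a) \<Rightarrow> ('a \<Rightarrow> 'a)) set" where
  "F_space S gR l = F_map S gR ` end_filt_g0 S gR l"

definition G_rel ::
  "('m, 'v, 'a::real_algebra_1) batchelor \<Rightarrow> (('a \<Rightarrow> 'a) \<Rightarrow> (('a \<Rightarrow> 'a) \<Rightarrow> 'a)) \<Rightarrow> int \<Rightarrow>
   ((('a \<Rightarrow> 'a) \<Rightarrow> ('a \<Rightarrow> 'a)) \<times> (('a \<Rightarrow> 'a) \<Rightarrow> ('a \<Rightarrow> 'a))) set" where
  "G_rel S gR l = {(W, W'). W \<in> F_space S gR l \<and> W' \<in> F_space S gR l \<and>
     W' - W \<in> G_map S gR ` vf_filt_g0 S gR l}"

text \<open>
  The elements of the quotient \<open>F_space S gR l // G_rel S gR l\<close> are cosets, i.e. sets of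
  endomorphisms, and the induced action is by taking images of cosets.
\<close>

definition iso_orbit ::
  "('m::topological_space, 'v, 'a::real_algebra_1) batchelor \<Rightarrow>
   (('a \<Rightarrow> 'a) \<Rightarrow> (('a \<Rightarrow> 'a) \<Rightarrow> 'a)) \<Rightarrow> int \<Rightarrow>
   (('a \<Rightarrow> 'a) \<Rightarrow> ('a \<Rightarrow> 'a)) set \<Rightarrow> (('a \<Rightarrow> 'a) \<Rightarrow> ('a \<Rightarrow> 'a)) set set" where
  "iso_orbit S gR l C = {iso_act S gR \<psi> ` C | \<psi>. \<psi> \<in> Iso S gR l}"

end

theory Submission
  imports Defs
begin

text \<open>
  Let \<open>l = 2 (m + 1)\<close>, so that \<open>2 l\<close> exceeds the odd dimension by more than \<open>1\<close>. Upper indices \<open>(k)\<close> denote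
  the terms of form degree at least \<open>k\<close>. The metrics that are to be classified are, after a change of
  the Batchelor model, those of the form \<open>gR + h\<close> with a symmetric form \<open>h\<close> in \<open>Hom\<^sup>(\<^sup>l\<^sup>+\<^sup>2\<^sup>)\<close>; the bound in
  the statement amounts to \<open>l + 2\<close> because even forms have no components of odd degree. Raising an index turns
  \<open>h\<close> into \<open>W = gR\<^sup>-\<^sup>1 h\<close>, and everything about \<open>W\<close> is read off from \<open>h\<close>: the space \<^const>\<open>F_space\<close> consists of
  these \<open>W\<close>, since \<^const>\<open>F_map\<close> is symmetrisation; \<^const>\<open>G_map\<close> takes \<open>\<zeta>\<close> to \<open>- gR\<^sup>-\<^sup>1 (L\<^sub>\<zeta> gR)\<close> with the Lie
  derivative \<open>L\<^sub>\<zeta>\<close>; and \<open>exp W = 1 + W\<close>.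

  All second order terms vanish for degree reasons. This rests on two facts.

  No superderivation lowers the degree by more than \<open>1\<close> (\<open>vf_lowers_by_1\<close>). Near each point, superfunctions
  of positive degree are generated by those of degrees \<open>0\<close> and \<open>1\<close> (\<open>local_generation\<close>, by Euler's identity in
  the fibres and bump functions on the base), and a derivation is controlled by its values on generators. For
  the same reason automorphisms, and their actions on vector fields and metrics, preserve the filtrations
  (\<open>automorphism_filt\<close>).

  The inverse metric lowers the degree by at most \<open>2\<close> (\<open>metric_inverse_filt\<close>), although the leading term
  \<open>g\<^sub>0\<close> of \<open>gR\<close> is degenerate in the odd directions. The value \<open>X a\<close> is up to sign \<open>gR X (grad a)\<close>, and the
  gradient of \<open>a\<close> has degree at least \<open>-1\<close> like every vector field. So a lower bound for the degree of \<open>gR X\<close>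
  bounds the degrees of \<open>X a\<close> for all \<open>a\<close>, and generators determine the rest.

  For an isometry \<open>\<phi>\<close> from \<open>gR + h\<close> to \<open>gR + h'\<close> the form \<open>\<phi>.h\<close> has degree at least \<open>l + 2\<close>, hence also
  \<open>\<phi>.gR - gR\<close>, and \<open>\<phi>\<close> belongs to \<open>Iso\<close>. The action of \<open>Iso\<close> on the parameters \<open>W\<close> is the natural action on
  the metrics \<open>gR (1 + W)\<close>, without error terms (\<open>iso_act_log_of\<close>). An even vector field \<open>\<zeta>\<close> of degree at
  least \<open>l\<close> has square zero, so that its exponential \<open>1 + \<zeta>\<close> is an automorphism; if \<open>L\<^sub>\<zeta> gR\<close> has degree at least
  \<open>l + 2\<close>, then this automorphism takes \<open>g = gR + h\<close> to \<open>g + L\<^sub>\<zeta> gR\<close> (\<open>flow_act\<close>). Therefore the cosets modulo the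
  range of \<^const>\<open>G_map\<close> are the orbits of these flows (\<open>G_rel_iff\<close>). The conjugates of flows under \<open>Iso\<close> are
  again flows, so \<open>Iso\<close> acts on the cosets. As flows belong to \<open>Iso\<close>, two metrics have cosets in
  the same orbit if and only if they are isometric (\<open>orbit_of_eq_iff\<close>).
\<close>

section \<open>Calculus of smooth functions in charts\<close>

lemma Euclidean_space_eq_top_of_set:
  "Euclidean_space p = top_of_set (topspace (Euclidean_space p))"
  by (simp add: Euclidean_space_def euclidean_product_topology)

lemma continuous_map_Euclidean_iff_continuous_on:
  assumes "V \<subseteq> topspace (Euclidean_space p)"
  shows "continuous_map (subtopology (Euclidean_space p) V) euclideanreal f \<longleftrightarrow> continuous_on V f"
proof -
  have "subtopology (Euclidean_space p) V = top_of_set V"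
    using assms by (metis Euclidean_space_eq_top_of_set inf.absorb_iff2 subtopology_subtopology)
  then show ?thesis by simp
qed

lemma openin_coordinate_line:
  assumes V: "openin (Euclidean_space p) V" and x: "x \<in> V" and i: "i < p"
  shows "eventually (\<lambda>t. x(i := t) \<in> V) (at (x i))"
proof -
  obtain W where W: "open W" "V = topspace (Euclidean_space p) \<inter> W"
    using V by (metis Euclidean_space_eq_top_of_set openin_open)
  have "continuous_on UNIV (\<lambda>t. (x(i := t)) j)" for j
    by (cases "j = i") simp_all
  then have c: "continuous_on UNIV (\<lambda>t. x(i := t))"
    by (rule continuous_on_coordinatewise_then_product)
  have "open ((\<lambda>t. x(i := t)) -` W)"
    using c W(1) by (simp add: continuous_on_open_vimage)
  moreover have "x i \<in> (\<lambda>t. x(i := t)) -` W" using x W by simp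
  ultimately have "eventually (\<lambda>t. t \<in> (\<lambda>t. x(i := t)) -` W) (at (x i))"
    by (rule eventually_at_in_open')
  moreover have "x(i := t) \<in> topspace (Euclidean_space p)" for t
    using x W i by (auto simp: topspace_Euclidean_space)
  ultimately show ?thesis using W by (auto elim: eventually_mono)
qed

text \<open>A partial derivative at a point of an open set only sees the values on that set. This is what makes
  \<^const>\<open>Ck_on\<close> independent of the values of the function outside.\<close>

lemma has_real_derivative_cong_open:
  assumes V: "openin (Euclidean_space p) V" and x: "x \<in> V" and i: "i < p"
    and eq: "\<And>y. y \<in> V \<Longrightarrow> f y = g y"
    and D: "((\<lambda>t. f (x(i := t))) has_real_derivative d) (at (x i))"
  shows "((\<lambda>t. g (x(i := t))) has_real_derivative d) (at (x i))"
proof -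
  have "eventually (\<lambda>t. f (x(i := t)) = g (x(i := t))) (nhds (x i))"
    using openin_coordinate_line[OF V x i] eq x by (auto simp: eventually_at_filter elim: eventually_mono)
  then show ?thesis using D by (rule DERIV_cong_ev[OF refl _ refl, THEN iffD1])
qed

lemma Ck_on_SucE:
  assumes "Ck_on p (Suc k) V f" and "i < p"
  obtains f' where "\<And>x. x \<in> V \<Longrightarrow> ((\<lambda>t. f (x(i := t))) has_real_derivative f' x) (at (x i))"
    and "Ck_on p k V f'"
  using assms unfolding Ck_on.simps by blast

lemma Ck_on_SucI:
  assumes "continuous_map (subtopology (Euclidean_space p) V) euclideanreal f"
    and "\<And>i. i < p \<Longrightarrow> \<exists>f'. (\<forall>x\<in>V. ((\<lambda>t. f (x(i := t))) has_real_derivative f' x) (at (x i))) \<and>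
                 Ck_on p k V f'"
  shows "Ck_on p (Suc k) V f"
  using assms by (simp only: Ck_on.simps) blast

lemma Ck_on_imp_continuous:
  "Ck_on p k V f \<Longrightarrow> continuous_map (subtopology (Euclidean_space p) V) euclideanreal f"
  by (cases k) auto

lemma Ck_on_cong:
  assumes V: "openin (Euclidean_space p) V" and eq: "\<And>x. x \<in> V \<Longrightarrow> f x = g x"
    and f: "Ck_on p k V f"
  shows "Ck_on p k V g"
proof -
  have VE: "V \<subseteq> topspace (Euclidean_space p)" using V by (rule openin_subset)
  have c: "continuous_map (subtopology (Euclidean_space p) V) euclideanreal g"
    using Ck_on_imp_continuous[OF f] eq continuous_on_cong[OF refl eq]
    by (simp add: continuous_map_Euclidean_iff_continuous_on[OF VE])
  show ?thesis
  proof (cases k)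
    case 0
    then show ?thesis using c by simp
  next
    case (Suc k')
    show ?thesis unfolding Suc
    proof (rule Ck_on_SucI[OF c])
      fix i assume i: "i < p"
      obtain f' where f': "\<And>x. x \<in> V \<Longrightarrow> ((\<lambda>t. f (x(i := t))) has_real_derivative f' x) (at (x i))"
        "Ck_on p k' V f'"
        by (rule Ck_on_SucE[OF f[unfolded Suc] i]) blast
      have "((\<lambda>t. g (x(i := t))) has_real_derivative f' x) (at (x i))" if "x \<in> V" for x
        by (rule has_real_derivative_cong_open[OF V that i eq f'(1)[OF that]])
      then show "\<exists>f'. (\<forall>x\<in>V. ((\<lambda>t. g (x(i := t))) has_real_derivative f' x) (at (x i))) \<and> Ck_on p k' V f'"
        using f'(2) by (intro exI[of _ f']) simp
    qed
  qed
qed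

lemma Ck_on_subset: "Ck_on p k V f \<Longrightarrow> V' \<subseteq> V \<Longrightarrow> Ck_on p k V' f"
proof (induction k arbitrary: f)
  case 0
  then show ?case by (auto intro: continuous_map_from_subtopology_mono)
next
  case (Suc k)
  show ?case
  proof (rule Ck_on_SucI)
    show "continuous_map (subtopology (Euclidean_space p) V') euclideanreal f"
      using Ck_on_imp_continuous[OF Suc.prems(1)] Suc.prems(2) by (rule continuous_map_from_subtopology_mono)
    fix i assume i: "i < p"
    obtain f' where "\<And>x. x \<in> V \<Longrightarrow> ((\<lambda>t. f (x(i := t))) has_real_derivative f' x) (at (x i))"
      "Ck_on p k V f'"
      by (rule Ck_on_SucE[OF Suc.prems(1) i]) blast
    then show "\<exists>f'. (\<forall>x\<in>V'. ((\<lambda>t. f (x(i := t))) has_real_derivative f' x) (at (x i))) \<and> Ck_on p k V' f'"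
      using Suc.IH[OF _ Suc.prems(2)] Suc.prems(2) by (intro exI[of _ f']) auto
  qed
qed

lemma Ck_on_Suc_imp: "Ck_on p (Suc k) V f \<Longrightarrow> Ck_on p k V f"
proof (induction k arbitrary: f)
  case (Suc k)
  show ?case
  proof (rule Ck_on_SucI[OF Ck_on_imp_continuous[OF Suc.prems]])
    fix i assume i: "i < p"
    obtain f' where "\<And>x. x \<in> V \<Longrightarrow> ((\<lambda>t. f (x(i := t))) has_real_derivative f' x) (at (x i))"
      "Ck_on p (Suc k) V f'"
      by (rule Ck_on_SucE[OF Suc.prems i]) blast
    then show "\<exists>f'. (\<forall>x\<in>V. ((\<lambda>t. f (x(i := t))) has_real_derivative f' x) (at (x i))) \<and> Ck_on p k V f'"
      using Suc.IH by (intro exI[of _ f']) simp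
  qed
qed auto

text \<open>Smoothness is local. Two open sets suffice here: the gluing that is needed is the extension of a
  function by zero. The partial derivatives on the two sets agree on the intersection, since derivatives are unique.\<close>

lemma Ck_on_Un:
  assumes V1: "openin (Euclidean_space p) V1" and V2: "openin (Euclidean_space p) V2"
  shows "Ck_on p k V1 f \<Longrightarrow> Ck_on p k V2 f \<Longrightarrow> Ck_on p k (V1 \<union> V2) f"
proof (induction k arbitrary: f)
  have sub: "V1 \<subseteq> topspace (Euclidean_space p)" "V2 \<subseteq> topspace (Euclidean_space p)"
    using V1 V2 openin_subset by auto
  have op: "openin (top_of_set (V1 \<union> V2)) V1" "openin (top_of_set (V1 \<union> V2)) V2"
    using V1 V2 sub by (metis Euclidean_space_eq_top_of_set le_sup_iff openin_subset_trans sup_ge1,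
        metis Euclidean_space_eq_top_of_set le_sup_iff openin_subset_trans sup_ge2)
  have cont: "continuous_map (subtopology (Euclidean_space p) (V1 \<union> V2)) euclideanreal f"
    if "Ck_on p k V1 f" "Ck_on p k V2 f" for f k
    using continuous_on_Un_local_open[OF op, of f] Ck_on_imp_continuous[OF that(1)] Ck_on_imp_continuous[OF that(2)] sub
    by (simp add: continuous_map_Euclidean_iff_continuous_on)
  {
    case 0
    then show ?case using cont[of 0] by simp
  next
    case (Suc k)
    show ?case
    proof (rule Ck_on_SucI[OF cont[OF Suc.prems]])
      fix i assume i: "i < p"
      obtain f1 where f1: "\<And>x. x \<in> V1 \<Longrightarrow> ((\<lambda>t. f (x(i := t))) has_real_derivative f1 x) (at (x i))" "Ck_on p k V1 f1"
        by (rule Ck_on_SucE[OF Suc.prems(1) i]) blast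
      obtain f2 where f2: "\<And>x. x \<in> V2 \<Longrightarrow> ((\<lambda>t. f (x(i := t))) has_real_derivative f2 x) (at (x i))" "Ck_on p k V2 f2"
        by (rule Ck_on_SucE[OF Suc.prems(2) i]) blast
      define f' where "f' = (\<lambda>x. if x \<in> V1 then f1 x else f2 x)"
      have e: "f2 x = f' x" if "x \<in> V2" for x
        using DERIV_unique[OF f1(1) f2(1)[OF that]] by (auto simp: f'_def)
      have "Ck_on p k V1 f'" by (rule Ck_on_cong[OF V1 _ f1(2)]) (simp add: f'_def)
      moreover have "Ck_on p k V2 f'" by (rule Ck_on_cong[OF V2 e f2(2)])
      ultimately have "Ck_on p k (V1 \<union> V2) f'" by (rule Suc.IH)
      moreover have "((\<lambda>t. f (x(i := t))) has_real_derivative f' x) (at (x i))" if "x \<in> V1 \<union> V2" for x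
        using f1(1) f2(1) that by (auto simp: f'_def)
      ultimately show "\<exists>f'. (\<forall>x\<in>V1 \<union> V2. ((\<lambda>t. f (x(i := t))) has_real_derivative f' x) (at (x i)))
        \<and> Ck_on p k (V1 \<union> V2) f'" by (intro exI[of _ f']) simp
    qed
  }
qed

lemma Ck_on_const: "Ck_on p k V (\<lambda>_. c)"
  by (induction k arbitrary: c) (auto intro!: exI[of _ "\<lambda>_. 0"])

lemma Ck_on_add: "Ck_on p k V f \<Longrightarrow> Ck_on p k V g \<Longrightarrow> Ck_on p k V (\<lambda>x. f x + g x)"
proof (induction k arbitrary: f g)
  case 0
  then show ?case by (auto intro: continuous_map_add)
next
  case (Suc k)
  show ?case
  proof (rule Ck_on_SucI)
    show "continuous_map (subtopology (Euclidean_space p) V) euclideanreal (\<lambda>x. f x + g x)"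
      using Suc.prems by (intro continuous_map_add Ck_on_imp_continuous)
    fix i assume i: "i < p"
    obtain f' where f': "\<And>x. x \<in> V \<Longrightarrow> ((\<lambda>t. f (x(i := t))) has_real_derivative f' x) (at (x i))" "Ck_on p k V f'"
      by (rule Ck_on_SucE[OF Suc.prems(1) i]) blast
    obtain g' where g': "\<And>x. x \<in> V \<Longrightarrow> ((\<lambda>t. g (x(i := t))) has_real_derivative g' x) (at (x i))" "Ck_on p k V g'"
      by (rule Ck_on_SucE[OF Suc.prems(2) i]) blast
    show "\<exists>h. (\<forall>x\<in>V. ((\<lambda>t. f (x(i := t)) + g (x(i := t))) has_real_derivative h x) (at (x i))) \<and> Ck_on p k V h"
      using f'(1) g'(1) Suc.IH[OF f'(2) g'(2)] by (intro exI[of _ "\<lambda>x. f' x + g' x"]) (auto intro: DERIV_add)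
  qed
qed

lemma Ck_on_mult: "Ck_on p k V f \<Longrightarrow> Ck_on p k V g \<Longrightarrow> Ck_on p k V (\<lambda>x. f x * g x)"
proof (induction k arbitrary: f g)
  case 0
  then show ?case by (auto intro: continuous_map_real_mult)
next
  case (Suc k)
  show ?case
  proof (rule Ck_on_SucI)
    show "continuous_map (subtopology (Euclidean_space p) V) euclideanreal (\<lambda>x. f x * g x)"
      using Suc.prems by (intro continuous_map_real_mult Ck_on_imp_continuous)
    fix i assume i: "i < p"
    obtain f' where f': "\<And>x. x \<in> V \<Longrightarrow> ((\<lambda>t. f (x(i := t))) has_real_derivative f' x) (at (x i))" "Ck_on p k V f'"
      by (rule Ck_on_SucE[OF Suc.prems(1) i]) blast
    obtain g' where g': "\<And>x. x \<in> V \<Longrightarrow> ((\<lambda>t. g (x(i := t))) has_real_derivative g' x) (at (x i))" "Ck_on p k V g'"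
      by (rule Ck_on_SucE[OF Suc.prems(2) i]) blast
    have "((\<lambda>t. f (x(i := t)) * g (x(i := t))) has_real_derivative f' x * g x + g' x * f x) (at (x i))"
      if "x \<in> V" for x
      using DERIV_mult[OF f'(1)[OF that] g'(1)[OF that]] by simp
    moreover have "Ck_on p k V (\<lambda>x. f' x * g x + g' x * f x)"
      by (rule Ck_on_add[OF Suc.IH[OF f'(2) Ck_on_Suc_imp[OF Suc.prems(2)]]
            Suc.IH[OF g'(2) Ck_on_Suc_imp[OF Suc.prems(1)]]])
    ultimately show "\<exists>h. (\<forall>x\<in>V. ((\<lambda>t. f (x(i := t)) * g (x(i := t))) has_real_derivative h x) (at (x i))) \<and> Ck_on p k V h"
      by (intro exI[of _ "\<lambda>x. f' x * g x + g' x * f x"]) simp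
  qed
qed

text \<open>The only chain rule that is needed has a function of one variable on the outside: bump functions
  on the manifold will be functions of a squared distance in a chart.\<close>

lemma Ck_on_compose_real:
  fixes D :: "nat \<Rightarrow> real \<Rightarrow> real"
  assumes D: "\<And>n t. (D n has_real_derivative D (Suc n) t) (at t)"
  shows "Ck_on p k V u \<Longrightarrow> Ck_on p k V (\<lambda>x. D n (u x))"
proof (induction k arbitrary: n)
  have c: "continuous_map euclideanreal euclideanreal (D n)" for n
    using D by (metis DERIV_isCont continuous_at_imp_continuous_on continuous_map_iff_continuous2)
  have cc: "continuous_map X euclideanreal (\<lambda>x. D n (u x))" if "continuous_map X euclideanreal u" for X n
    using continuous_map_compose[OF that c[of n]] by (simp add: o_def)
  {
    case 0
    then show ?case using cc by simp
  next
    case (Suc k)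
    show ?case
    proof (rule Ck_on_SucI[OF cc[OF Ck_on_imp_continuous[OF Suc.prems]]])
      fix i assume i: "i < p"
      obtain u' where u': "\<And>x. x \<in> V \<Longrightarrow> ((\<lambda>t. u (x(i := t))) has_real_derivative u' x) (at (x i))" "Ck_on p k V u'"
        by (rule Ck_on_SucE[OF Suc.prems i]) blast
      have "((\<lambda>t. D n (u (x(i := t)))) has_real_derivative D (Suc n) (u x) * u' x) (at (x i))"
        if "x \<in> V" for x
        using DERIV_chain2[OF _ u'(1)[OF that], of "D n"] D by simp
      moreover have "Ck_on p k V (\<lambda>x. D (Suc n) (u x) * u' x)"
        by (rule Ck_on_mult[OF Suc.IH[OF Ck_on_Suc_imp[OF Suc.prems]] u'(2)])
      ultimately show "\<exists>h. (\<forall>x\<in>V. ((\<lambda>t. D n (u (x(i := t)))) has_real_derivative h x) (at (x i))) \<and> Ck_on p k V h"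
        by (intro exI[of _ "\<lambda>x. D (Suc n) (u x) * u' x"]) simp
    qed
  }
qed

section \<open>A flat function on the line\<close>

text \<open>The functions \<open>q(1/t) exp(-1/t)\<close> for \<open>t > 0\<close>, extended by zero. With all polynomials \<open>q\<close>
  allowed, the family is closed under differentiation, and so each member is smooth.\<close>

definition flat :: "real poly \<Rightarrow> real \<Rightarrow> real" where
  "flat q t = (if t > 0 then poly q (1 / t) * exp (- (1 / t)) else 0)"

lemma flat_tendsto_0: "(flat q \<longlongrightarrow> 0) (at 0)"
proof -
  have lim: "((\<lambda>x::real. poly q x * exp (- x)) \<longlongrightarrow> 0) at_top" for q
  proof -
    have "((\<lambda>x::real. coeff q i * (x ^ i / exp x)) \<longlongrightarrow> coeff q i * 0) at_top" for i
      by (intro tendsto_mult tendsto_power_div_exp_0 tendsto_const)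
    then have "((\<lambda>x::real. \<Sum>i\<le>degree q. coeff q i * (x ^ i / exp x)) \<longlongrightarrow> (\<Sum>i\<le>degree q. coeff q i * 0)) at_top"
      by (intro tendsto_sum) auto
    moreover have "(\<Sum>i\<le>degree q. coeff q i * (x ^ i / exp x)) = poly q x * exp (- x)" for x :: real
      by (simp add: poly_altdef sum_distrib_right exp_minus divide_inverse mult.assoc)
    ultimately show ?thesis by simp
  qed
  have "((\<lambda>t. poly q (1 / t) * exp (- (1 / t))) \<longlongrightarrow> 0) (at_right 0)"
    using filterlim_compose[OF lim filterlim_inverse_at_top_right] by (simp add: divide_inverse)
  then have "(flat q \<longlongrightarrow> 0) (at_right 0)"
    by (rule tendsto_cong[THEN iffD1, rotated])
      (auto simp: flat_def eventually_at_right_less intro: eventually_mono[OF eventually_at_right_less])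
  moreover have "(flat q \<longlongrightarrow> 0) (at_left 0)"
    by (rule tendsto_eventually) (auto simp: flat_def eventually_at_filter)
  ultimately show ?thesis by (simp add: filterlim_split_at)
qed

text \<open>The polynomial \<open>X\<^sup>2 (q - q')\<close>, from differentiating \<open>q(1/t) exp(-1/t)\<close>.\<close>

definition flat_deriv :: "real poly \<Rightarrow> real poly" where
  "flat_deriv q = [:0, 0, 1:] * (q - pderiv q)"

lemma flat_has_derivative: "(flat q has_real_derivative flat (flat_deriv q) t) (at t)"
proof -
  consider "t > 0" | "t < 0" | "t = 0" by linarith
  then show ?thesis
  proof cases
    case 1
    have "((\<lambda>t. poly q (1 / t) * exp (- (1 / t))) has_real_derivative flat (flat_deriv q) t) (at t)"
      using 1 by (auto intro!: derivative_eq_intros DERIV_chain'[of "\<lambda>t. 1 / t" _ _ _ "poly q", OF _ poly_DERIV]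
          simp: flat_def flat_deriv_def field_simps power2_eq_square)
    then show ?thesis
      by (rule has_field_derivative_transform_within_open[of _ _ _ "{0<..}"]) (use 1 in \<open>auto simp: flat_def\<close>)
  next
    case 2
    have "((\<lambda>_. 0) has_real_derivative flat (flat_deriv q) t) (at t)"
      using 2 by (simp add: flat_def)
    then show ?thesis
      by (rule has_field_derivative_transform_within_open[of _ _ _ "{..<0}"]) (use 2 in \<open>auto simp: flat_def\<close>)
  next
    case 3
    have "((\<lambda>h. (flat q (0 + h) - flat q 0) / h) \<longlongrightarrow> 0) (at 0)"
      \<comment> \<open>the difference quotient at \<open>0\<close> is the member of the family with the polynomial \<open>X q\<close>\<close>
      using flat_tendsto_0[of "pCons 0 q"]
      by (rule tendsto_cong[THEN iffD1, rotated]) (auto simp: flat_def)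
    then show ?thesis using 3 by (simp add: DERIV_def flat_def)
  qed
qed

section \<open>Smooth functions on the base manifold\<close>

lemma smooth_on_subset: "smooth_on S W f \<Longrightarrow> W' \<subseteq> W \<Longrightarrow> smooth_on S W' f"
  unfolding smooth_on_def Cinf_on_def
  by (fastforce intro: Ck_on_subset[OF _ image_mono])

lemma smooth_on_const: "smooth_on S W (\<lambda>_. c)"
  by (simp add: smooth_on_def Cinf_on_def Ck_on_const)

lemma smooth_on_add: "smooth_on S W f \<Longrightarrow> smooth_on S W g \<Longrightarrow> smooth_on S W (\<lambda>q. f q + g q)"
  unfolding smooth_on_def Cinf_on_def by (fastforce intro: Ck_on_add)

lemma smooth_on_mult: "smooth_on S W f \<Longrightarrow> smooth_on S W g \<Longrightarrow> smooth_on S W (\<lambda>q. f q * g q)"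
  unfolding smooth_on_def Cinf_on_def by (fastforce intro: Ck_on_mult)

lemma smooth_on_sum:
  "(\<And>i. i \<in> I \<Longrightarrow> smooth_on S W (f i)) \<Longrightarrow> smooth_on S W (\<lambda>q. \<Sum>i\<in>I. f i q)"
  by (induction I rule: infinite_finite_induct) (auto intro: smooth_on_const smooth_on_add)

lemma smooth_on_compose_real:
  fixes D :: "nat \<Rightarrow> real \<Rightarrow> real"
  assumes "\<And>n t. (D n has_real_derivative D (Suc n) t) (at t)" and "smooth_on S W u"
  shows "smooth_on S W (\<lambda>q. D n (u q))"
  using assms(2) unfolding smooth_on_def Cinf_on_def
  by (fastforce intro: Ck_on_compose_real[of D, OF assms(1)])

context
  fixes S :: "('m::t2_space, 'v, 'a) batchelor"
  assumes atlas: "smooth_atlas (even_dim S) (charts S)"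
begin

lemma chart_inj: "(U, x) \<in> charts S \<Longrightarrow> inj_on x U"
  using atlas homeomorphic_imp_injective_map[of "top_of_set U" _ x]
  unfolding smooth_atlas_def by fastforce

lemma chart_openin:
  assumes c: "(U, x) \<in> charts S" and W: "open W"
  shows "openin (Euclidean_space (even_dim S)) (x ` (U \<inter> W))"
proof -
  have o: "openin (Euclidean_space (even_dim S)) (x ` U)"
    and h: "homeomorphic_map (top_of_set U) (subtopology (Euclidean_space (even_dim S)) (x ` U)) x"
    using atlas c unfolding smooth_atlas_def by auto
  have "openin (subtopology (Euclidean_space (even_dim S)) (x ` U)) (x ` (U \<inter> W))"
    using homeomorphic_imp_open_map[OF h] W unfolding open_map_def by (simp add: openin_open_Int)
  then show ?thesis using o openin_trans_full by blast
qed

lemma smooth_on_cong: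
  assumes W: "open W" and eq: "\<And>q. q \<in> W \<Longrightarrow> f q = g q" and f: "smooth_on S W f"
  shows "smooth_on S W g"
  unfolding smooth_on_def Cinf_on_def
proof clarify
  fix U x k assume c: "(U, x) \<in> charts S"
  show "Ck_on (even_dim S) k (x ` (U \<inter> W)) (\<lambda>y. g (inv_into U x y))"
  proof (rule Ck_on_cong[OF chart_openin[OF c W]])
    show "Ck_on (even_dim S) k (x ` (U \<inter> W)) (\<lambda>y. f (inv_into U x y))"
      using f c unfolding smooth_on_def Cinf_on_def by auto
    show "f (inv_into U x y) = g (inv_into U x y)" if "y \<in> x ` (U \<inter> W)" for y
      using that eq chart_inj[OF c] by auto
  qed
qed

lemma smooth_on_Un:
  assumes "open W1" "open W2" "smooth_on S W1 f" "smooth_on S W2 f"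
  shows "smooth_on S (W1 \<union> W2) f"
  unfolding smooth_on_def Cinf_on_def
proof clarify
  fix U x k assume c: "(U, x) \<in> charts S"
  have e: "x ` (U \<inter> (W1 \<union> W2)) = x ` (U \<inter> W1) \<union> x ` (U \<inter> W2)" by auto
  show "Ck_on (even_dim S) k (x ` (U \<inter> (W1 \<union> W2))) (\<lambda>y. f (inv_into U x y))"
    unfolding e
  proof (rule Ck_on_Un[OF chart_openin[OF c assms(1)] chart_openin[OF c assms(2)]])
    show "Ck_on (even_dim S) k (x ` (U \<inter> W1)) (\<lambda>y. f (inv_into U x y))"
      using assms(3) c unfolding smooth_on_def Cinf_on_def by blast
    show "Ck_on (even_dim S) k (x ` (U \<inter> W2)) (\<lambda>y. f (inv_into U x y))"
      using assms(4) c unfolding smooth_on_def Cinf_on_def by blast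
  qed
qed

text \<open>The smoothness of the coordinates of one chart, seen from all the others, is the smoothness of the
  transition maps.\<close>

lemma smooth_on_coordinate:
  assumes "(U, x) \<in> charts S" and "i < even_dim S"
  shows "smooth_on S U (\<lambda>q. x q i)"
proof -
  have *: "\<forall>(U, x)\<in>charts S. \<forall>(U', x')\<in>charts S. \<forall>i<even_dim S.
        Cinf_on (even_dim S) (x ` (U \<inter> U')) (\<lambda>y. x' (inv_into U x y) i)"
    using atlas unfolding smooth_atlas_def by blast
  show ?thesis using * assms unfolding smooth_on_def by blast
qed

lemma smooth_on_extend_by_zero:
  assumes "open W" "open W'" "closed K" "K \<subseteq> W" "smooth_on S (W \<inter> W') f"
    "\<And>q. q \<in> W' \<Longrightarrow> q \<notin> K \<Longrightarrow> f q = 0"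
  shows "smooth_on S W' f"
proof -
  have "smooth_on S (W' - K) f"
    by (rule smooth_on_cong[OF _ _ smooth_on_const[of S _ 0]]) (use assms in auto)
  then have "smooth_on S ((W \<inter> W') \<union> (W' - K)) f"
    using assms by (intro smooth_on_Un) auto
  moreover have "(W \<inter> W') \<union> (W' - K) = W'" using assms(4) by auto
  ultimately show ?thesis by simp
qed

text \<open>A small closed box in a chart is compact, hence closed in the Hausdorff manifold. This is the point
  where the support of a bump function is prevented from leaving the chart.\<close>

lemma chart_box:
  assumes c: "(U, x) \<in> charts S" and W: "open W" and q: "q0 \<in> U \<inter> W"
  obtains \<epsilon> where "\<epsilon> > 0"
    "closed {q \<in> U. \<forall>i<even_dim S. \<bar>x q i - x q0 i\<bar> \<le> \<epsilon>}"
    "{q \<in> U. \<forall>i<even_dim S. \<bar>x q i - x q0 i\<bar> \<le> \<epsilon>} \<subseteq> W"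
proof -
  define n where "n = even_dim S"
  define E where "E = topspace (Euclidean_space n)"
  have o: "openin (Euclidean_space n) (x ` U)"
    and h: "homeomorphic_map (top_of_set U) (subtopology (Euclidean_space n) (x ` U)) x"
    using atlas c unfolding smooth_atlas_def n_def by auto
  have UE: "x ` U \<subseteq> E" using o openin_subset E_def by auto
  have "openin (top_of_set E) (x ` (U \<inter> W))"
    using chart_openin[OF c W] Euclidean_space_eq_top_of_set unfolding E_def n_def by metis
  then obtain O' where O': "open O'" "x ` (U \<inter> W) = E \<inter> O'" unfolding openin_open by blast
  define y0 where "y0 = x q0"
  have y0: "y0 \<in> O'" "y0 \<in> E" using O' q y0_def by auto
  have "openin (powertop_real UNIV) O'" using O'(1) by (simp add: euclidean_product_topology)
  from product_topology_open_contains_basis[OF this y0(1)]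
  obtain X where X: "y0 \<in> Pi\<^sub>E UNIV X" "\<And>i. open (X i)" "Pi\<^sub>E UNIV X \<subseteq> O'"
    by auto
  have "\<exists>e>0. \<forall>t. \<bar>t - y0 i\<bar> \<le> e \<longrightarrow> t \<in> X i" for i
  proof -
    have "y0 i \<in> X i" using X(1) by auto
    then obtain e where "e > 0" "cball (y0 i) e \<subseteq> X i" using X(2) open_contains_cball by blast
    then show ?thesis by (intro exI[of _ e]) (auto simp: dist_real_def abs_minus_commute)
  qed
  then obtain e where e: "\<And>i. e i > 0" "\<And>i t. \<bar>t - y0 i\<bar> \<le> e i \<Longrightarrow> t \<in> X i" by metis
  define \<epsilon> where "\<epsilon> = Min (insert 1 (e ` {..<n}))"
  have \<epsilon>: "\<epsilon> > 0" "\<And>i. i < n \<Longrightarrow> \<epsilon> \<le> e i" unfolding \<epsilon>_def using e(1) by auto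
  define B where "B = {y. (\<forall>i<n. \<bar>y i - y0 i\<bar> \<le> \<epsilon>) \<and> (\<forall>i\<ge>n. y i = 0)}"
  have BE: "B \<subseteq> E" unfolding B_def E_def topspace_Euclidean_space by auto
  have "B \<subseteq> Pi\<^sub>E UNIV X"
  proof
    fix y assume y: "y \<in> B"
    have "y i \<in> X i" for i
    proof (cases "i < n")
      case True
      then show ?thesis using y e(2) \<epsilon>(2) unfolding B_def by force
    next
      case False
      then have "y i = y0 i" using y y0(2) unfolding B_def E_def topspace_Euclidean_space by auto
      then show ?thesis using X(1) by auto
    qed
    then show "y \<in> Pi\<^sub>E UNIV X" by auto
  qed
  then have BU: "B \<subseteq> x ` (U \<inter> W)" using X(3) BE O'(2) by auto
  \<comment> \<open>the box is a product of compact intervals and, beyond the dimension, of singletons\<close>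
  have "B = Pi\<^sub>E UNIV (\<lambda>i. if i < n then {y0 i - \<epsilon>..y0 i + \<epsilon>} else {0})"
  proof (intro set_eqI iffI)
    fix y assume y: "y \<in> Pi\<^sub>E UNIV (\<lambda>i. if i < n then {y0 i - \<epsilon>..y0 i + \<epsilon>} else {0})"
    have "y i \<in> (if i < n then {y0 i - \<epsilon>..y0 i + \<epsilon>} else {0})" for i
      using PiE_mem[OF y] by simp
    then show "y \<in> B" unfolding B_def
      by (smt (verit, best) atLeastAtMost_iff linorder_not_le mem_Collect_eq singletonD)
  next
    fix y assume "y \<in> B"
    then show "y \<in> Pi\<^sub>E UNIV (\<lambda>i. if i < n then {y0 i - \<epsilon>..y0 i + \<epsilon>} else {0})"
      unfolding B_def by (intro PiE_I) (auto simp: abs_le_iff algebra_simps)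
  qed
  then have "compactin (powertop_real UNIV) B"
    by (simp add: compactin_PiE)
  then have B: "compact B" by (simp add: euclidean_product_topology)
  obtain g where g: "homeomorphic_maps (top_of_set U) (subtopology (Euclidean_space n) (x ` U)) x g"
    using h homeomorphic_map_maps by blast
  have "continuous_map (subtopology (Euclidean_space n) (x ` U)) (top_of_set U) g"
    using g unfolding homeomorphic_maps_def by blast
  moreover have "subtopology (Euclidean_space n) (x ` U) = top_of_set (x ` U)"
    using UE unfolding E_def by (metis Euclidean_space_eq_top_of_set inf.absorb_iff2 subtopology_subtopology)
  ultimately have gc: "continuous_on (x ` U) g" by simp
  have gx: "g (x q) = q" if "q \<in> U" for q
    using g that unfolding homeomorphic_maps_def by simp
  define K where "K = {q \<in> U. \<forall>i<n. \<bar>x q i - x q0 i\<bar> \<le> \<epsilon>}"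
  have KB: "q \<in> K \<longleftrightarrow> x q \<in> B" if "q \<in> U" for q
    using that UE unfolding K_def B_def y0_def E_def topspace_Euclidean_space by auto
  have "K = g ` B"
  proof
    show "K \<subseteq> g ` B"
    proof
      fix q assume q: "q \<in> K"
      then have "q \<in> U" unfolding K_def by simp
      then show "q \<in> g ` B" using KB q gx by (intro image_eqI[of _ _ "x q"]) simp_all
    qed
    show "g ` B \<subseteq> K"
    proof
      fix q assume "q \<in> g ` B"
      then obtain y where y: "y \<in> B" "q = g y" by blast
      then obtain q' where "q' \<in> U" "y = x q'" using BU by blast
      then show "q \<in> K" using KB gx y by simp
    qed
  qed
  moreover have "compact (g ` B)"
    by (rule compact_continuous_image[OF continuous_on_subset[OF gc] B]) (use BU in auto)
  ultimately have "closed K" using compact_imp_closed by simp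
  moreover have "K \<subseteq> W"
  proof
    fix q assume q: "q \<in> K"
    then have "q \<in> U" and "x q \<in> x ` (U \<inter> W)" using BU KB K_def by auto
    then obtain q' where "q' \<in> U \<inter> W" "x q = x q'" by blast
    then show "q \<in> W" using inj_onD[OF chart_inj[OF c], of q q'] \<open>q \<in> U\<close> by auto
  qed
  ultimately show ?thesis by (intro that[OF \<epsilon>(1)]) (auto simp: K_def n_def)
qed

text \<open>The bump function is \<open>\<psi>(\<epsilon>\<^sup>2 - |x - x\<^sub>0|\<^sup>2)\<close> in a chart, normalised at the centre, where \<open>\<psi>\<close> is
  the flat function. It vanishes outside the closed box with half-width \<open>\<epsilon>\<close>.\<close>

lemma exists_bump_function:
  assumes W: "open W" and q0: "q0 \<in> W"
  obtains b K where "smooth_on S UNIV b" "b q0 = 1" "closed K" "K \<subseteq> W" "\<And>q. q \<notin> K \<Longrightarrow> b q = 0"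
proof -
  have "q0 \<in> \<Union> (fst ` charts S)" using atlas unfolding smooth_atlas_def by blast
  then obtain U x where c: "(U, x) \<in> charts S" and qU: "q0 \<in> U" by auto
  have U: "open U" using atlas c unfolding smooth_atlas_def by auto
  define n where "n = even_dim S"
  obtain \<epsilon> where \<epsilon>: "\<epsilon> > 0" "closed {q \<in> U. \<forall>i<n. \<bar>x q i - x q0 i\<bar> \<le> \<epsilon>}"
    "{q \<in> U. \<forall>i<n. \<bar>x q i - x q0 i\<bar> \<le> \<epsilon>} \<subseteq> W"
    using chart_box[OF c W] qU q0 unfolding n_def by blast
  define K where "K = {q \<in> U. \<forall>i<n. \<bar>x q i - x q0 i\<bar> \<le> \<epsilon>}"
  define D :: "nat \<Rightarrow> real \<Rightarrow> real"
    where "D = (\<lambda>k t. (- 1) ^ k * flat ((flat_deriv ^^ k) 1) (\<epsilon>\<^sup>2 - t) / flat 1 (\<epsilon>\<^sup>2))"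
  define u where "u = (\<lambda>q. \<Sum>i<n. (x q i - x q0 i) * (x q i - x q0 i))"
  define b where "b = (\<lambda>q. if q \<in> U then D 0 (u q) else 0)"
  have D: "(D k has_real_derivative D (Suc k) t) (at t)" for k t
  proof -
    have "((\<lambda>t. \<epsilon>\<^sup>2 - t) has_real_derivative - 1) (at t)"
      by (auto intro!: derivative_eq_intros)
    from DERIV_chain2[OF flat_has_derivative this]
    have "((\<lambda>t. (- 1) ^ k * flat ((flat_deriv ^^ k) 1) (\<epsilon>\<^sup>2 - t) / flat 1 (\<epsilon>\<^sup>2)) has_real_derivative
      (- 1) ^ k * (flat (flat_deriv ((flat_deriv ^^ k) 1)) (\<epsilon>\<^sup>2 - t) * - 1) / flat 1 (\<epsilon>\<^sup>2)) (at t)"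
      by (intro DERIV_cdivide DERIV_cmult)
    then show ?thesis unfolding D_def by simp
  qed
  have f1: "flat 1 (\<epsilon>\<^sup>2) > 0" using \<epsilon>(1) by (simp add: flat_def)
  have "smooth_on S U u"
  proof -
    have "smooth_on S U (\<lambda>q. x q i + - x q0 i)" if "i < n" for i
      by (intro smooth_on_add smooth_on_const smooth_on_coordinate c) (use that n_def in auto)
    then show ?thesis unfolding u_def by (intro smooth_on_sum smooth_on_mult) auto
  qed
  then have "smooth_on S U (\<lambda>q. D 0 (u q))" by (rule smooth_on_compose_real[of D, OF D])
  then have bU: "smooth_on S (U \<inter> UNIV) b"
    by (simp) (rule smooth_on_cong[OF U], auto simp: b_def)
  have b0: "b q = 0" if "q \<notin> K" for q
  proof (cases "q \<in> U")
    case True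
    then obtain i where i: "i < n" "\<bar>x q i - x q0 i\<bar> > \<epsilon>" using \<open>q \<notin> K\<close> unfolding K_def by auto
    have "\<epsilon>\<^sup>2 \<le> \<bar>x q i - x q0 i\<bar>\<^sup>2" using i \<epsilon>(1) by (intro power_mono) auto
    also have "\<dots> = (x q i - x q0 i) * (x q i - x q0 i)" by (simp add: power2_eq_square)
    also have "\<dots> \<le> u q" unfolding u_def by (rule member_le_sum) (use i in auto)
    finally show ?thesis unfolding b_def D_def flat_def by simp
  qed (simp add: b_def)
  have KU: "K \<subseteq> U" unfolding K_def by auto
  have "smooth_on S UNIV b"
    by (rule smooth_on_extend_by_zero[OF U _ _ KU bU]) (use \<epsilon> b0 in \<open>auto simp: K_def\<close>)
  moreover have "b q0 = 1" using qU f1 unfolding b_def D_def u_def by simp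
  moreover have "closed K" "K \<subseteq> W" using \<epsilon> unfolding K_def by auto
  ultimately show ?thesis using b0 by (intro that)
qed

end

section \<open>Alternating forms and the wedge product\<close>

lemma ext_forms_outside: "\<omega> \<in> ext_forms E \<Longrightarrow> \<not> set vs \<subseteq> E \<Longrightarrow> \<omega> vs = 0"
  by (simp add: ext_forms_def)

lemma ext_forms_not_distinct: "\<omega> \<in> ext_forms E \<Longrightarrow> \<not> distinct vs \<Longrightarrow> \<omega> vs = 0"
  by (simp add: ext_forms_def)

lemma ext_forms_linear:
  assumes "\<omega> \<in> ext_forms E" "set us \<subseteq> E" "set ws \<subseteq> E" "x \<in> E" "y \<in> E"
  shows "\<omega> (us @ (a *\<^sub>R x + b *\<^sub>R y) # ws) = a * \<omega> (us @ x # ws) + b * \<omega> (us @ y # ws)"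
  using assms by (simp add: ext_forms_def)

lemma ext_forms_sum_Cons:
  assumes \<omega>: "\<omega> \<in> ext_forms E" and E: "subspace E" and ws: "set ws \<subseteq> E" and e: "\<And>i. i \<in> I \<Longrightarrow> e i \<in> E"
    and I: "finite I"
  shows "\<omega> ((\<Sum>i\<in>I. c i *\<^sub>R e i) # ws) = (\<Sum>i\<in>I. c i * \<omega> (e i # ws))"
  using I e
proof (induction I)
  case empty
  show ?case using ext_forms_linear[OF \<omega> _ ws, of "[]" 0 0 0 0] subspace_0[OF E] by simp
next
  case (insert i I)
  have "(\<Sum>i\<in>I. c i *\<^sub>R e i) \<in> E" using insert by (intro subspace_sum E subspace_scale) auto
  then show ?case
    using insert ext_forms_linear[OF \<omega> _ ws, of "[]" "e i" "\<Sum>i\<in>I. c i *\<^sub>R e i" "c i" 1] by simp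
qed

lemma ext_forms_swap:
  assumes \<omega>: "\<omega> \<in> ext_forms E" and E: "subspace E"
    and s: "set us \<subseteq> E" "x \<in> E" "y \<in> E" "set ws \<subseteq> E"
  shows "\<omega> (us @ x # y # ws) = - \<omega> (us @ y # x # ws)"
proof -
  have xy: "x + y \<in> E" using E s by (simp add: subspace_add)
  have 0: "\<omega> (us @ z # z # ws) = 0" for z by (rule ext_forms_not_distinct[OF \<omega>]) simp
  have "0 = \<omega> (us @ (x + y) # (x + y) # ws)" using 0 by simp
  also have "\<dots> = \<omega> (us @ x # (x + y) # ws) + \<omega> (us @ y # (x + y) # ws)"
    using ext_forms_linear[OF \<omega> s(1), of "(x + y) # ws" x y 1 1] s xy by simp
  also have "\<omega> (us @ x # (x + y) # ws) = \<omega> (us @ x # x # ws) + \<omega> (us @ x # y # ws)"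
    using ext_forms_linear[OF \<omega>, of "us @ [x]" ws x y 1 1] s by simp
  also have "\<omega> (us @ y # (x + y) # ws) = \<omega> (us @ y # x # ws) + \<omega> (us @ y # y # ws)"
    using ext_forms_linear[OF \<omega>, of "us @ [y]" ws x y 1 1] s by simp
  finally show ?thesis using 0 by simp
qed

lemma ext_forms_move_to_front:
  assumes \<omega>: "\<omega> \<in> ext_forms E" and E: "subspace E"
  shows "set us \<subseteq> E \<Longrightarrow> x \<in> E \<Longrightarrow> set ws \<subseteq> E \<Longrightarrow>
    \<omega> (x # us @ ws) = (- 1) ^ length us * \<omega> (us @ x # ws)"
proof (induction us arbitrary: ws rule: rev_induct)
  case (snoc u us)
  have "\<omega> (x # (us @ [u]) @ ws) = (- 1) ^ length us * \<omega> (us @ x # u # ws)"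
    using snoc.IH[of "u # ws"] snoc.prems by simp
  also have "\<omega> (us @ x # u # ws) = - \<omega> (us @ u # x # ws)"
    using snoc.prems by (intro ext_forms_swap[OF \<omega> E]) auto
  finally show ?case by simp
qed simp

text \<open>Expand every argument in the spanning set: by the pigeonhole principle each resulting term
  has a repeated argument.\<close>

lemma ext_forms_above_dimension:
  assumes \<omega>: "\<omega> \<in> ext_forms (span B)" and B: "finite B"
    and len: "card B < length vs"
  shows "\<omega> vs = 0"
proof -
  have main: "\<omega> (us @ ws) = 0"
    if "set us \<subseteq> B" "set ws \<subseteq> span B" "card B < length us + length ws" for us ws
    using that
  proof (induction ws arbitrary: us)
    case Nil
    have "\<not> distinct us"
      using Nil B by (metis card_mono distinct_card leD add.right_neutral list.size(3))
    then show ?case by (simp add: ext_forms_not_distinct[OF \<omega>])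
  next
    case (Cons w ws)
    have us: "set us \<subseteq> span B" using Cons.prems(1) span_superset by blast
    have ws: "set ws \<subseteq> span B" using Cons.prems(2) by simp
    have w: "w \<in> span B" using Cons.prems(2) by simp
    let ?T = "{w \<in> span B. \<omega> (us @ w # ws) = 0}"
    have "subspace ?T"
    proof (rule subspaceI)
      show "0 \<in> ?T"
        using ext_forms_linear[OF \<omega> us ws, of 0 0 0 0] by (simp add: span_zero)
    next
      fix x y assume "x \<in> ?T" "y \<in> ?T"
      then show "x + y \<in> ?T"
        using ext_forms_linear[OF \<omega> us ws, of x y 1 1] by (simp add: span_add)
    next
      fix c x assume "x \<in> ?T"
      then show "c *\<^sub>R x \<in> ?T"
        using ext_forms_linear[OF \<omega> us ws, of x x c 0] by (simp add: span_scale)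
    qed
    moreover have "B \<subseteq> ?T"
    proof
      fix b assume "b \<in> B"
      then show "b \<in> ?T"
        using Cons.IH[of "us @ [b]"] Cons.prems by (simp add: span_base)
    qed
    ultimately have "span B \<subseteq> ?T" by (intro span_minimal)
    then show ?case using w by blast
  qed
  show ?thesis
  proof (cases "set vs \<subseteq> span B")
    case True
    then show ?thesis using main[of "[]" vs] len by simp
  next
    case False
    then show ?thesis by (rule ext_forms_outside[OF \<omega>])
  qed
qed

lemma length_nths_lessThan: "I \<subseteq> {..<length vs} \<Longrightarrow> length (nths vs I) = card I"
  by (simp add: length_nths) (metis (mono_tags, lifting) Collect_mem_eq lessThan_iff subset_iff Collect_cong)

lemma wedge_nonzero_split:
  assumes "wedge \<omega> \<eta> vs \<noteq> 0"
  obtains us ws where "length vs = length us + length ws" "\<omega> us \<noteq> 0" "\<eta> ws \<noteq> 0"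
proof -
  obtain I where I: "I \<in> Pow {..<length vs}" "\<omega> (nths vs I) \<noteq> 0" "\<eta> (nths vs ({..<length vs} - I)) \<noteq> 0"
    using assms unfolding wedge_def by (metis (no_types, lifting) mult_eq_0_iff sum.neutral)
  have "card I + card ({..<length vs} - I) = length vs"
    using I(1) by (metis PowD card_Diff_subset card_lessThan card_mono finite_lessThan finite_subset le_add_diff_inverse)
  then show ?thesis
    using I by (intro that[of "nths vs I" "nths vs ({..<length vs} - I)"]) (auto simp: length_nths_lessThan)
qed

text \<open>Only the empty set of positions contributes.\<close>

lemma wedge_scalar_left:
  assumes "\<And>us. us \<noteq> [] \<Longrightarrow> \<omega> us = 0"
  shows "wedge \<omega> \<eta> vs = \<omega> [] * \<eta> vs"
proof -
  have "nths vs I \<noteq> []" if "I \<in> Pow {..<length vs} - {{}}" for I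
    using that length_nths_lessThan[of I vs] by (auto simp: finite_subset)
  then have "wedge \<omega> \<eta> vs = (\<Sum>I\<in>{{}}.
        (-1) ^ card {(i, j). i \<in> I \<and> j \<in> {..<length vs} - I \<and> j < i} *
        \<omega> (nths vs I) * \<eta> (nths vs ({..<length vs} - I)))"
    unfolding wedge_def using assms by (intro sum.mono_neutral_right) auto
  then show ?thesis by (simp add: nths_all)
qed

lemma nths_lessThan_Diff_singleton:
  assumes "j < length vs"
  shows "nths vs ({..<length vs} - {j}) = take j vs @ drop (Suc j) vs"
proof -
  have vs: "vs = take j vs @ vs ! j # drop (Suc j) vs" using assms by (rule id_take_nth_drop)
  have "nths (take j vs @ vs ! j # drop (Suc j) vs) ({..<length vs} - {j}) = take j vs @ drop (Suc j) vs"
  proof -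
    have "nths (take j vs) ({..<length vs} - {j}) = take j vs"
      by (rule nths_all) (use assms in auto)
    moreover have "nths (drop (Suc j) vs) {i. Suc (i + j) < length vs} = drop (Suc j) vs"
      by (rule nths_all) auto
    ultimately show ?thesis using assms unfolding nths_append nths_Cons by auto
  qed
  then show ?thesis by (simp only: vs[symmetric])
qed

lemma nths_singleton_index: "j < length vs \<Longrightarrow> nths vs {j} = [vs ! j]"
proof (induction vs arbitrary: j)
  case (Cons v vs)
  have "{i. Suc i \<in> {j}} = (if j = 0 then {} else {j - 1})" by auto
  then show ?case using Cons by (cases j) (auto simp: nths_Cons)
qed simp

text \<open>Only the singletons of positions contribute, and \<open>{j}\<close> has the \<open>j\<close> inversions with the smaller
  positions.\<close>

lemma wedge_one_form_left:
  assumes "\<And>us. length us \<noteq> 1 \<Longrightarrow> \<omega> us = 0"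
  shows "wedge \<omega> \<eta> vs =
    (\<Sum>j<length vs. (- 1) ^ j * \<omega> [vs ! j] * \<eta> (take j vs @ drop (Suc j) vs))"
proof -
  let ?t = "\<lambda>I. (-1) ^ card {(i, j). i \<in> I \<and> j \<in> {..<length vs} - I \<and> j < i} *
        \<omega> (nths vs I) * \<eta> (nths vs ({..<length vs} - I))"
  have "\<omega> (nths vs I) = 0" if "I \<in> Pow {..<length vs} - (\<lambda>j. {j}) ` {..<length vs}" for I
  proof -
    have "card I \<noteq> 1" using that by (auto simp: card_1_singleton_iff)
    then show ?thesis using that assms length_nths_lessThan[of I vs] by simp
  qed
  then have "wedge \<omega> \<eta> vs = (\<Sum>I\<in>(\<lambda>j. {j}) ` {..<length vs}. ?t I)"
    unfolding wedge_def by (intro sum.mono_neutral_right) auto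
  also have "\<dots> = (\<Sum>j<length vs. ?t {j})"
    by (subst sum.reindex) (auto simp: inj_on_def)
  also have "\<dots> = (\<Sum>j<length vs. (- 1) ^ j * \<omega> [vs ! j] * \<eta> (take j vs @ drop (Suc j) vs))"
  proof (rule sum.cong[OF refl])
    fix j assume j: "j \<in> {..<length vs}"
    have "{(i, k). i \<in> {j} \<and> k \<in> {..<length vs} - {j} \<and> k < i} = {j} \<times> {..<j}"
      using j by auto
    then have "card {(i, k). i \<in> {j} \<and> k \<in> {..<length vs} - {j} \<and> k < i} = j"
      by (simp only: card_cartesian_product_singleton card_lessThan)
    then show "?t {j} = (- 1) ^ j * \<omega> [vs ! j] * \<eta> (take j vs @ drop (Suc j) vs)"
      using j nths_lessThan_Diff_singleton[of j vs] nths_singleton_index[of j vs] by (simp only: lessThan_iff)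
  qed
  finally show ?thesis .
qed

text \<open>Passing to the complementary set of positions exchanges inversions and non-inversions, and
  there are \<open>j k\<close> pairs in total.\<close>

lemma wedge_commute:
  assumes \<omega>: "\<And>us. length us \<noteq> j \<Longrightarrow> \<omega> us = 0" and \<eta>: "\<And>us. length us \<noteq> k \<Longrightarrow> \<eta> us = 0"
  shows "wedge \<omega> \<eta> vs = (- 1) ^ (j * k) * wedge \<eta> \<omega> vs"
proof -
  let ?N = "{..<length vs}"
  let ?inv = "\<lambda>I. {(i, k). i \<in> I \<and> k \<in> ?N - I \<and> k < i}"
  let ?t = "\<lambda>\<omega> \<eta> I. (-1) ^ card (?inv I) * \<omega> (nths vs I) * \<eta> (nths vs (?N - I))"
  have summand: "?t \<omega> \<eta> I = (- 1) ^ (j * k) * ?t \<eta> \<omega> (?N - I)" if I: "I \<in> Pow ?N" for I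
  proof (cases "card I = j \<and> card (?N - I) = k")
    case True
    have fin: "finite I" using I finite_subset by auto
    have ii: "?N - (?N - I) = I" using I by auto
    have f: "finite (?inv I)" "finite (?inv (?N - I))"
      by (rule finite_subset[of _ "?N \<times> ?N"]; use I in auto)+
    have "card (?inv (?N - I)) = card ((\<lambda>(a, b). (b, a)) ` ?inv (?N - I))"
      by (rule card_image[symmetric]) (auto simp: inj_on_def)
    then have "card (?inv I) + card (?inv (?N - I)) = card (?inv I) + card ((\<lambda>(a, b). (b, a)) ` ?inv (?N - I))"
      by simp
    also have "\<dots> = card (?inv I \<union> (\<lambda>(a, b). (b, a)) ` ?inv (?N - I))"
      by (rule card_Un_disjoint[symmetric]) (use f in auto)
    also have "?inv I \<union> (\<lambda>(a, b). (b, a)) ` ?inv (?N - I) = I \<times> (?N - I)"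
    proof (intro set_eqI iffI)
      fix z assume "z \<in> I \<times> (?N - I)"
      then obtain a b where z: "z = (a, b)" "a \<in> I" "b \<in> ?N - I" by auto
      show "z \<in> ?inv I \<union> (\<lambda>(a, b). (b, a)) ` ?inv (?N - I)"
      proof (cases "b < a")
        case False
        then have "a < b" using z by (metis Diff_iff linorder_neqE_nat)
        then have "(b, a) \<in> ?inv (?N - I)" using z I by auto
        then show ?thesis unfolding z by force
      qed (use z in auto)
    qed (use I in auto)
    also have "card (I \<times> (?N - I)) = j * k" using True fin by (simp add: card_cartesian_product)
    finally have ab: "card (?inv I) + card (?inv (?N - I)) = j * k" .
    have sign: "(- 1 :: real) ^ (a + b) * ((- 1) ^ b * Y * X) = (- 1) ^ a * X * Y" for a b X Y
      by (simp add: minus_one_power_iff)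
    show ?thesis unfolding ii ab[symmetric] by (rule sign[symmetric])
  next
    case False
    have "?N - I \<subseteq> ?N" "?N - (?N - I) = I" using I by auto
    then have "\<omega> (nths vs I) = 0 \<or> \<eta> (nths vs (?N - I)) = 0"
      using False \<omega>[of "nths vs I"] \<eta>[of "nths vs (?N - I)"] length_nths_lessThan[of I vs]
        length_nths_lessThan[of "?N - I" vs] I by auto
    then show ?thesis using \<open>?N - (?N - I) = I\<close> by auto
  qed
  have "wedge \<omega> \<eta> vs = (\<Sum>I\<in>Pow ?N. (- 1) ^ (j * k) * ?t \<eta> \<omega> (?N - I))"
    unfolding wedge_def by (rule sum.cong[OF refl summand])
  also have "\<dots> = (\<Sum>I\<in>Pow ?N. (- 1) ^ (j * k) * ?t \<eta> \<omega> I)"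
    by (rule sum.reindex_bij_witness[of _ "\<lambda>I. ?N - I" "\<lambda>I. ?N - I"]) (auto simp: double_diff)
  also have "\<dots> = (- 1) ^ (j * k) * wedge \<eta> \<omega> vs" unfolding wedge_def by (simp add: sum_distrib_left)
  finally show ?thesis .
qed

text \<open>Euler's identity \<open>\<Sum>\<^sub>i e\<^sup>i \<and> \<iota>\<^sub>i \<omega> = k \<omega>\<close> for a form of degree \<open>k\<close>, where \<open>\<theta> i\<close> are the coordinates
  of the frame \<open>e\<close>.\<close>

lemma wedge_Euler_identity:
  assumes \<omega>: "\<omega> \<in> ext_forms E" and E: "subspace E" and I: "finite I"
    and e: "\<And>i. i \<in> I \<Longrightarrow> e i \<in> E" and \<theta>: "\<And>v. v \<in> E \<Longrightarrow> v = (\<Sum>i\<in>I. \<theta> i [v] *\<^sub>R e i)"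
    and \<theta>1: "\<And>i us. length us \<noteq> 1 \<Longrightarrow> \<theta> i us = 0" and vs: "set vs \<subseteq> E"
    and \<iota>: "\<And>i ws. set ws \<subseteq> E \<Longrightarrow> \<iota> i ws = \<omega> (e i # ws)"
  shows "(\<Sum>i\<in>I. wedge (\<theta> i) (\<iota> i) vs) = real (length vs) * \<omega> vs"
proof -
  let ?r = "\<lambda>j. take j vs @ drop (Suc j) vs"
  have r: "set (?r j) \<subseteq> E" for j using vs set_take_subset[of j vs] set_drop_subset[of "Suc j" vs] by auto
  have "(\<Sum>i\<in>I. wedge (\<theta> i) (\<iota> i) vs) = (\<Sum>i\<in>I. \<Sum>j<length vs. (- 1) ^ j * (\<theta> i [vs ! j] * \<omega> (e i # ?r j)))"
    by (simp add: wedge_one_form_left \<theta>1 \<iota>[OF r] mult.assoc)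
  also have "\<dots> = (\<Sum>j<length vs. (- 1) ^ j * (\<Sum>i\<in>I. \<theta> i [vs ! j] * \<omega> (e i # ?r j)))"
    by (subst sum.swap) (simp add: sum_distrib_left)
  also have "\<dots> = (\<Sum>j<length vs. \<omega> vs)"
  proof (rule sum.cong[OF refl])
    fix j assume "j \<in> {..<length vs}"
    then have j: "j < length vs" by simp
    then have vj: "vs ! j \<in> E" using vs nth_mem by blast
    have "(\<Sum>i\<in>I. \<theta> i [vs ! j] * \<omega> (e i # ?r j)) = \<omega> (vs ! j # ?r j)"
      by (rule trans[OF ext_forms_sum_Cons[symmetric, OF \<omega> E r e I]])
        (use \<theta>[OF vj, symmetric] in simp_all)
    also have "\<dots> = (- 1) ^ j * \<omega> (take j vs @ vs ! j # drop (Suc j) vs)"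
      using ext_forms_move_to_front[OF \<omega> E _ vj, of "take j vs" "drop (Suc j) vs"] r[of j] j by simp
    also have "\<dots> = (- 1) ^ j * \<omega> vs" by (simp only: id_take_nth_drop[OF j, symmetric])
    finally have "(- 1) ^ j * (\<Sum>i\<in>I. \<theta> i [vs ! j] * \<omega> (e i # ?r j)) = ((- 1) * (- 1)) ^ j * \<omega> vs"
      by (simp only: power_mult_distrib mult.assoc)
    then show "(- 1) ^ j * (\<Sum>i\<in>I. \<theta> i [vs ! j] * \<omega> (e i # ?r j)) = \<omega> vs"
      by simp
  qed
  finally show ?thesis by simp
qed

section \<open>Graded abelian groups\<close>

lemma fun_sum_apply: "(sum f I) x = (\<Sum>i\<in>I. f i x)" for f :: "'i \<Rightarrow> 'p \<Rightarrow> 'q::ab_group_add"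
  by (induction I rule: infinite_finite_induct) auto

text \<open>A grading of a subgroup \<open>C\<close> of the ambient group by finitely many non-zero degrees. The carrier
  is a set, since vector fields, forms and linear maps only form a part of a function type.\<close>

locale grading =
  fixes G :: "int \<Rightarrow> 'x::ab_group_add set" and C :: "'x set" and lo hi :: int
  assumes zero_mem: "0 \<in> G j"
    and diff_mem: "x \<in> G j \<Longrightarrow> y \<in> G j \<Longrightarrow> x - y \<in> G j"
    and mem_carrier: "x \<in> G j \<Longrightarrow> x \<in> C"
    and carrier_diff: "x \<in> C \<Longrightarrow> y \<in> C \<Longrightarrow> x - y \<in> C"
    and bounded: "x \<in> G j \<Longrightarrow> j \<notin> {lo..hi} \<Longrightarrow> x = 0"
    and decomp: "x \<in> C \<Longrightarrow> \<exists>s. (\<forall>j. s j \<in> G j) \<and> x = (\<Sum>j\<in>{lo..hi}. s j)"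
    and direct: "(\<And>j. s j \<in> G j) \<Longrightarrow> (\<Sum>j\<in>{lo..hi}. s j) = 0 \<Longrightarrow> s j = 0"
begin

lemma uminus_mem: "x \<in> G j \<Longrightarrow> - x \<in> G j"
  using diff_mem[OF zero_mem] by force

lemma add_mem: "x \<in> G j \<Longrightarrow> y \<in> G j \<Longrightarrow> x + y \<in> G j"
  using diff_mem[OF _ uminus_mem, of x j y] by simp

lemma carrier_zero: "0 \<in> C"
  using mem_carrier zero_mem by blast

lemma carrier_uminus: "x \<in> C \<Longrightarrow> - x \<in> C"
  using carrier_diff[OF carrier_zero] by force

lemma carrier_add: "x \<in> C \<Longrightarrow> y \<in> C \<Longrightarrow> x + y \<in> C"
  using carrier_diff[OF _ carrier_uminus, of x y] by simp

lemma carrier_sum: "(\<And>i. i \<in> I \<Longrightarrow> f i \<in> C) \<Longrightarrow> sum f I \<in> C"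
  by (induction I rule: infinite_finite_induct) (auto intro: carrier_add carrier_zero)

text \<open>The finite support in \<^const>\<open>hdecomp\<close> is automatic, since there are only finitely many degrees.\<close>

lemma hdecomp_iff:
  "hdecomp G x s \<longleftrightarrow> (\<forall>j. s j \<in> G j) \<and> x = (\<Sum>j\<in>{lo..hi}. s j)"
proof -
  have "{j. s j \<noteq> 0} \<subseteq> {lo..hi}" if "\<forall>j. s j \<in> G j"
    using bounded that by blast
  then show ?thesis unfolding hdecomp_def
    by (auto simp: Sum_any.expand_superset[of "{lo..hi}"] intro: finite_subset[of _ "{lo..hi}"])
qed

lemma hdecomp_unique: "hdecomp G x s \<Longrightarrow> hdecomp G x t \<Longrightarrow> s = t"
proof
  fix j assume "hdecomp G x s" "hdecomp G x t"
  then have "(\<And>j. s j - t j \<in> G j)" "(\<Sum>j\<in>{lo..hi}. s j - t j) = 0"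
    by (auto simp: hdecomp_iff diff_mem sum_subtractf)
  from direct[OF this, of j] show "s j = t j" by simp
qed

lemma hcomponent_eq: "hdecomp G x s \<Longrightarrow> hcomponent G j x = s j"
proof -
  assume s: "hdecomp G x s"
  have "(THE s. hdecomp G x s) = s" by (rule the_equality, rule s, rule hdecomp_unique[OF _ s])
  then show ?thesis by (simp add: hcomponent_def)
qed

lemma hdecomp_hcomponent: "x \<in> C \<Longrightarrow> hdecomp G x (\<lambda>j. hcomponent G j x)"
proof -
  assume "x \<in> C"
  then obtain s where s: "hdecomp G x s" using decomp unfolding hdecomp_iff by blast
  then have "(\<lambda>j. hcomponent G j x) = s" by (auto simp: hcomponent_eq)
  with s show "hdecomp G x (\<lambda>j. hcomponent G j x)" by simp
qed

lemma hcomponent_mem: "x \<in> C \<Longrightarrow> hcomponent G j x \<in> G j"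
  using hdecomp_hcomponent[of x] unfolding hdecomp_iff by blast

lemma hcomponent_carrier: "x \<in> C \<Longrightarrow> hcomponent G j x \<in> C"
  using hcomponent_mem mem_carrier by blast

lemma sum_hcomponent: "x \<in> C \<Longrightarrow> (\<Sum>j\<in>{lo..hi}. hcomponent G j x) = x"
  by (rule sym) (use hdecomp_hcomponent[of x] hdecomp_iff in blast)

lemma hdecomp_carrier: "hdecomp G x s \<Longrightarrow> x \<in> C"
  unfolding hdecomp_iff by (blast intro: carrier_sum mem_carrier)

lemma hcomponent_diff:
  assumes "x \<in> C" "y \<in> C"
  shows "hcomponent G j (x - y) = hcomponent G j x - hcomponent G j y"
  using assms sum_hcomponent[of x] sum_hcomponent[of y]
  by (intro hcomponent_eq[of _ "\<lambda>j. hcomponent G j x - hcomponent G j y"])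
    (simp add: hdecomp_iff hcomponent_mem diff_mem sum_subtractf)

lemma hcomponent_0: "hcomponent G j 0 = 0"
  by (rule hcomponent_eq[of _ "\<lambda>_. 0"]) (simp add: hdecomp_iff zero_mem)

lemma hcomponent_add:
  assumes "x \<in> C" "y \<in> C"
  shows "hcomponent G j (x + y) = hcomponent G j x + hcomponent G j y"
  using assms sum_hcomponent[of x] sum_hcomponent[of y]
  by (intro hcomponent_eq[of _ "\<lambda>j. hcomponent G j x + hcomponent G j y"])
    (simp add: hdecomp_iff hcomponent_mem add_mem sum.distrib)

lemma hcomponent_sum:
  "(\<And>i. i \<in> I \<Longrightarrow> f i \<in> C) \<Longrightarrow> hcomponent G j (sum f I) = (\<Sum>i\<in>I. hcomponent G j (f i))"
  by (induction I rule: infinite_finite_induct) (auto simp: hcomponent_0 hcomponent_add carrier_sum)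

lemma hcomponent_homogeneous:
  assumes "x \<in> G i"
  shows "hcomponent G j x = (if j = i then x else 0)"
proof -
  have "(\<Sum>j\<in>{lo..hi}. if j = i then x else 0) = x"
    using bounded[OF assms] by auto
  then show ?thesis
    using assms by (intro hcomponent_eq[of _ "\<lambda>j. if j = i then x else 0"]) (simp add: hdecomp_iff zero_mem)
qed

lemma filt_iff: "x \<in> filt G k \<longleftrightarrow> x \<in> C \<and> (\<forall>j<k. hcomponent G j x = 0)"
proof
  assume "x \<in> filt G k"
  then obtain s where s: "hdecomp G x s" "\<forall>j<k. s j = 0" unfolding filt_def by blast
  then show "x \<in> C \<and> (\<forall>j<k. hcomponent G j x = 0)"
    using hdecomp_carrier[OF s(1)] hcomponent_eq[OF s(1)] by simp
next
  assume x: "x \<in> C \<and> (\<forall>j<k. hcomponent G j x = 0)"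
  then show "x \<in> filt G k"
    unfolding filt_def using hdecomp_hcomponent[of x] by (auto intro!: exI[of _ "\<lambda>j. hcomponent G j x"])
qed

lemma filt_carrier: "x \<in> filt G k \<Longrightarrow> x \<in> C"
  by (simp add: filt_iff)

lemma filt_diff: "x \<in> filt G k \<Longrightarrow> y \<in> filt G k \<Longrightarrow> x - y \<in> filt G k"
  by (simp add: filt_iff carrier_diff hcomponent_diff)

lemma filt_add: "x \<in> filt G k \<Longrightarrow> y \<in> filt G k \<Longrightarrow> x + y \<in> filt G k"
  by (simp add: filt_iff carrier_add hcomponent_add)

lemma filt_zero: "0 \<in> filt G k"
  by (simp add: filt_iff carrier_zero hcomponent_0)

lemma filt_uminus: "x \<in> filt G k \<Longrightarrow> - x \<in> filt G k"
  using filt_diff[OF filt_zero] by force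

lemma filt_sum: "(\<And>i. i \<in> I \<Longrightarrow> f i \<in> filt G k) \<Longrightarrow> sum f I \<in> filt G k"
  by (induction I rule: infinite_finite_induct) (auto intro: filt_add filt_zero)

lemma filt_mono: "x \<in> filt G k \<Longrightarrow> k' \<le> k \<Longrightarrow> x \<in> filt G k'"
  by (simp add: filt_iff)

lemma homogeneous_filt: "x \<in> G j \<Longrightarrow> k \<le> j \<Longrightarrow> x \<in> filt G k"
  by (auto simp: filt_iff mem_carrier hcomponent_homogeneous)

lemma filt_all: "k \<le> lo \<Longrightarrow> filt G k = C"
  using bounded[OF hcomponent_mem] by (auto simp: filt_iff)

lemma filt_trivial:
  assumes "hi < k" and "x \<in> filt G k"
  shows "x = 0"
proof -
  have "x = (\<Sum>j\<in>{lo..hi}. hcomponent G j x)"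
    using sum_hcomponent[OF filt_carrier[OF assms(2)]] by (rule sym)
  also have "\<dots> = 0" using assms by (intro sum.neutral) (auto simp: filt_iff)
  finally show ?thesis .
qed

end

text \<open>Additive maps between graded groups, with the value zero outside the carrier. The gradings of
  vector fields, linear forms, endomorphisms and bilinear forms all arise in this way.\<close>

locale graded_maps =
  B: grading GB CB lob hib + D: grading GD CD lod hid
  for GB :: "int \<Rightarrow> 'x::ab_group_add set" and CB lob hib
    and GD :: "int \<Rightarrow> 'y::ab_group_add set" and CD lod hid +
  fixes M :: "('x \<Rightarrow> 'y) set"
  assumes maps_zero: "0 \<in> M"
    and maps_diff: "T \<in> M \<Longrightarrow> T' \<in> M \<Longrightarrow> T - T' \<in> M"
    and maps_into: "T \<in> M \<Longrightarrow> x \<in> CB \<Longrightarrow> T x \<in> CD"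
    and maps_add: "T \<in> M \<Longrightarrow> x \<in> CB \<Longrightarrow> y \<in> CB \<Longrightarrow> T (x + y) = T x + T y"
    and maps_outside: "T \<in> M \<Longrightarrow> x \<notin> CB \<Longrightarrow> T x = 0"
begin

definition Deg :: "int \<Rightarrow> ('x \<Rightarrow> 'y) set" where
  "Deg j = {T \<in> M. \<forall>i. T ` GB i \<subseteq> GD (i + j)}"

text \<open>The candidate for the component of \<open>T\<close> of degree \<open>n\<close>.\<close>

definition shift_part :: "int \<Rightarrow> ('x \<Rightarrow> 'y) \<Rightarrow> 'x \<Rightarrow> 'y" where
  "shift_part n T x =
    (if x \<in> CB then \<Sum>i\<in>{lob..hib}. hcomponent GD (i + n) (T (hcomponent GB i x)) else 0)"

lemma maps_0: "T \<in> M \<Longrightarrow> T 0 = 0"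
  using maps_add[of T 0 0] B.carrier_zero by simp

lemma maps_sum:
  "T \<in> M \<Longrightarrow> (\<And>i. i \<in> I \<Longrightarrow> f i \<in> CB) \<Longrightarrow> T (sum f I) = (\<Sum>i\<in>I. T (f i))"
  by (induction I rule: infinite_finite_induct) (auto simp: maps_0 maps_add B.carrier_sum)

lemma maps_sum_hcomponent:
  "T \<in> M \<Longrightarrow> x \<in> CB \<Longrightarrow> T x = (\<Sum>i\<in>{lob..hib}. T (hcomponent GB i x))"
  using maps_sum[of T "{lob..hib}" "\<lambda>i. hcomponent GB i x"] B.hcomponent_carrier[of x] B.sum_hcomponent[of x]
  by simp

lemma shift_part_homogeneous:
  assumes T: "T \<in> M" and x: "x \<in> GB i"
  shows "shift_part n T x = hcomponent GD (i + n) (T x)"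
proof -
  have "(\<Sum>k\<in>{lob..hib}. hcomponent GD (k + n) (T (hcomponent GB k x))) =
        (\<Sum>k\<in>{lob..hib}. if k = i then hcomponent GD (i + n) (T x) else 0)"
    by (rule sum.cong) (auto simp: B.hcomponent_homogeneous[OF x] maps_0[OF T] D.hcomponent_0)
  also have "\<dots> = hcomponent GD (i + n) (T x)"
    using B.bounded[OF x] by (auto simp: maps_0[OF T] D.hcomponent_0)
  finally show ?thesis using B.mem_carrier[OF x] by (simp add: shift_part_def)
qed

lemma shift_part_add:
  assumes T: "T \<in> M" and xy: "x \<in> CB" "y \<in> CB"
  shows "shift_part n T (x + y) = shift_part n T x + shift_part n T y"
proof -
  have "hcomponent GD (i + n) (T (hcomponent GB i (x + y))) =
    hcomponent GD (i + n) (T (hcomponent GB i x)) + hcomponent GD (i + n) (T (hcomponent GB i y))" for i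
    using xy T by (simp add: B.hcomponent_add maps_add B.hcomponent_carrier D.hcomponent_add maps_into)
  then show ?thesis using xy by (simp add: shift_part_def B.carrier_add sum.distrib)
qed

lemma shift_part_outside: "x \<notin> CB \<Longrightarrow> shift_part n T x = 0"
  by (simp add: shift_part_def)

lemma shift_part_plus:
  assumes "T \<in> M" "T' \<in> M"
  shows "shift_part n (T + T') = shift_part n T + shift_part n T'"
  using assms by (auto simp: fun_eq_iff shift_part_def sum.distrib D.hcomponent_add maps_into B.hcomponent_carrier)

end

text \<open>A group of additive maps between graded groups is graded by the degree shift, as soon as it
  contains with each map its components \<open>x \<mapsto> \<Sum>\<^sub>i (T x\<^sub>i)\<^sub>i\<^sub>+\<^sub>n\<close>.\<close>

locale hom_grading = graded_maps +
  assumes maps_component: "T \<in> M \<Longrightarrow> shift_part n T \<in> M"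
begin

lemma shift_part_Deg: "T \<in> M \<Longrightarrow> shift_part n T \<in> Deg n"
  unfolding Deg_def using maps_component[of T n] D.hcomponent_mem maps_into B.mem_carrier
  by (auto simp: shift_part_homogeneous)

lemma maps_eqI:
  assumes T: "T \<in> M" "T' \<in> M" and eq: "\<And>i x. x \<in> GB i \<Longrightarrow> T x = T' x"
  shows "T = T'"
proof
  fix x show "T x = T' x"
  proof (cases "x \<in> CB")
    case True
    have "T x = (\<Sum>i\<in>{lob..hib}. T (hcomponent GB i x))"
      using T(1) True by (rule maps_sum_hcomponent)
    also have "\<dots> = (\<Sum>i\<in>{lob..hib}. T' (hcomponent GB i x))"
      using True by (intro sum.cong refl eq) (rule B.hcomponent_mem)
    also have "\<dots> = T' x"
      using maps_sum_hcomponent[OF T(2) True] by (rule sym)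
    finally show ?thesis .
  qed (simp add: maps_outside T)
qed

lemma maps_uminus: "T \<in> M \<Longrightarrow> - T \<in> M"
  using maps_diff[OF maps_zero] by force

lemma maps_plus: "T \<in> M \<Longrightarrow> T' \<in> M \<Longrightarrow> T + T' \<in> M"
  using maps_diff[OF _ maps_uminus, of T T'] by simp

lemma maps_sum_mem: "(\<And>i. i \<in> I \<Longrightarrow> f i \<in> M) \<Longrightarrow> sum f I \<in> M"
  by (induction I rule: infinite_finite_induct) (auto intro: maps_plus maps_zero)

lemma Deg_apply: "T \<in> Deg j \<Longrightarrow> x \<in> GB i \<Longrightarrow> T x \<in> GD (i + j)"
  by (auto simp: Deg_def)

lemma sum_shift_part:
  assumes T: "T \<in> M"
  shows "(\<Sum>n\<in>{lod - hib..hid - lob}. shift_part n T) = T"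
proof (rule maps_eqI)
  show "(\<Sum>n\<in>{lod - hib..hid - lob}. shift_part n T) \<in> M"
    using shift_part_Deg[OF T] by (intro maps_sum_mem) (auto simp: Deg_def)
  fix i x assume x: "x \<in> GB i"
  show "(\<Sum>n\<in>{lod - hib..hid - lob}. shift_part n T) x = T x"
  proof (cases "i \<in> {lob..hib}")
    case True
    have Tx: "T x \<in> CD" using maps_into[OF T] B.mem_carrier[OF x] .
    have "(\<Sum>n\<in>{lod - hib..hid - lob}. shift_part n T) x =
        (\<Sum>n\<in>{lod - hib..hid - lob}. hcomponent GD (i + n) (T x))"
      by (simp add: fun_sum_apply shift_part_homogeneous[OF T x])
    also have "\<dots> = (\<Sum>k\<in>(\<lambda>n. i + n) ` {lod - hib..hid - lob}. hcomponent GD k (T x))"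
      by (subst sum.reindex) (auto simp: inj_on_def)
    also have "\<dots> = (\<Sum>k\<in>{lod..hid}. hcomponent GD k (T x))"
      using True D.bounded[OF D.hcomponent_mem[OF Tx]]
      by (intro sum.mono_neutral_right) auto
    also have "\<dots> = T x" using Tx by (rule D.sum_hcomponent)
    finally show ?thesis .
  next
    case False
    then have "x = 0" using B.bounded[OF x] by blast
    moreover have "shift_part n T 0 = 0" for n
      using shift_part_Deg[OF T, of n] maps_0 by (simp add: Deg_def)
    ultimately show ?thesis by (simp add: fun_sum_apply maps_0 T)
  qed
qed (rule T)

lemma grading_Deg: "grading Deg M (lod - hib) (hid - lob)"
proof
  show "0 \<in> Deg j" for j by (auto simp: Deg_def maps_zero D.zero_mem)
  show "T - T' \<in> Deg j" if "T \<in> Deg j" "T' \<in> Deg j" for T T' j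
    using that unfolding Deg_def image_subset_iff by (simp add: maps_diff D.diff_mem)
  show "T \<in> M" if "T \<in> Deg j" for T j using that by (simp add: Deg_def)
  show "T - T' \<in> M" if "T \<in> M" "T' \<in> M" for T T' using that by (rule maps_diff)
  show "T = 0" if T: "T \<in> Deg j" and j: "j \<notin> {lod - hib..hid - lob}" for T j
  proof (rule maps_eqI[OF _ maps_zero])
    show "T \<in> M" using T by (simp add: Deg_def)
    fix i x assume x: "x \<in> GB i"
    show "T x = 0 x"
    proof (cases "i \<in> {lob..hib}")
      case True
      then show ?thesis using D.bounded[OF Deg_apply[OF T x]] j by auto
    next
      case False
      then show ?thesis using B.bounded[OF x] maps_0 T by (auto simp: Deg_def)
    qed
  qed
  show "\<exists>s. (\<forall>j. s j \<in> Deg j) \<and> T = (\<Sum>j\<in>{lod - hib..hid - lob}. s j)" if "T \<in> M" for T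
    using shift_part_Deg[OF that] sum_shift_part[OF that]
    by (intro exI[of _ "\<lambda>j. shift_part j T"]) simp
  show "s j = 0" if s: "\<And>j. s j \<in> Deg j" and sum: "(\<Sum>j\<in>{lod - hib..hid - lob}. s j) = 0" for s j
  proof (rule maps_eqI[OF _ maps_zero])
    show "s j \<in> M" using s by (simp add: Deg_def)
    fix i x assume x: "x \<in> GB i"
    show "s j x = 0 x"
    proof (cases "i \<in> {lob..hib}")
      case True
      let ?t = "\<lambda>k. s (k - i) x"
      have t: "?t k \<in> GD k" for k using Deg_apply[OF s x, of "k - i"] by simp
      have "(\<Sum>k\<in>{lod..hid}. ?t k) = (\<Sum>k\<in>(\<lambda>n. i + n) ` {lod - hib..hid - lob}. ?t k)"
        using True D.bounded[OF t] by (intro sum.mono_neutral_left) auto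
      also have "\<dots> = (\<Sum>n\<in>{lod - hib..hid - lob}. s n x)"
        by (subst sum.reindex) (auto simp: inj_on_def)
      also have "\<dots> = 0" using sum by (metis fun_sum_apply zero_fun_apply)
      finally have "?t (i + j) = 0" using D.direct[of ?t, OF t] by blast
      then show ?thesis by simp
    next
      case False
      then show ?thesis using B.bounded[OF x] maps_0 s by (auto simp: Deg_def)
    qed
  qed
qed

lemma hcomponent_Deg:
  assumes T: "T \<in> M"
  shows "hcomponent Deg n T = shift_part n T"
proof -
  interpret H: grading Deg M "lod - hib" "hid - lob" by (rule grading_Deg)
  have "hdecomp Deg T (\<lambda>n. shift_part n T)"
    using shift_part_Deg[OF T] sum_shift_part[OF T] by (simp add: H.hdecomp_iff)
  then show ?thesis by (rule H.hcomponent_eq)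
qed

lemma hcomponent_Deg_apply:
  assumes T: "T \<in> M" and x: "x \<in> GB i"
  shows "hcomponent Deg n T x = hcomponent GD (i + n) (T x)"
  by (simp add: hcomponent_Deg[OF T] shift_part_homogeneous[OF T x])

text \<open>The upper index: a map all of whose components have degree at least \<open>k\<close> is the same as a map that
  raises the filtrations by \<open>k\<close>.\<close>

lemma filt_Deg_iff:
  "T \<in> filt Deg k \<longleftrightarrow> T \<in> M \<and> (\<forall>i. \<forall>x\<in>filt GB i. T x \<in> filt GD (i + k))"
proof -
  interpret H: grading Deg M "lod - hib" "hid - lob" by (rule grading_Deg)
  show ?thesis
  proof (intro iffI conjI allI ballI)
    assume T: "T \<in> filt Deg k"
    then show TM: "T \<in> M" by (rule H.filt_carrier)
    fix i x assume x: "x \<in> filt GB i"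
    have "T (hcomponent GB j x) \<in> filt GD (i + k)" for j
    proof (cases "j < i")
      case True
      then have "hcomponent GB j x = 0" using x by (simp add: B.filt_iff)
      then show ?thesis using maps_0[OF TM] D.filt_zero by simp
    next
      case False
      have xj: "hcomponent GB j x \<in> GB j" using x B.filt_carrier B.hcomponent_mem by blast
      have "hcomponent GD n (T (hcomponent GB j x)) = 0" if "n < i + k" for n
        using hcomponent_Deg_apply[OF TM xj, of "n - j"] T that False by (simp add: H.filt_iff)
      moreover have "T (hcomponent GB j x) \<in> CD" using maps_into[OF TM B.mem_carrier[OF xj]] .
      ultimately show ?thesis by (simp add: D.filt_iff)
    qed
    moreover have "T x = (\<Sum>j\<in>{lob..hib}. T (hcomponent GB j x))"
      using maps_sum_hcomponent[OF TM B.filt_carrier[OF x]] .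
    ultimately show "T x \<in> filt GD (i + k)" by (simp add: D.filt_sum)
  next
    assume T: "T \<in> M \<and> (\<forall>i. \<forall>x\<in>filt GB i. T x \<in> filt GD (i + k))"
    have "hcomponent Deg n T = 0" if n: "n < k" for n
    proof (rule maps_eqI[OF _ maps_zero])
      show "hcomponent Deg n T \<in> M" using T H.hcomponent_carrier by blast
      fix i x assume x: "x \<in> GB i"
      have "x \<in> filt GB i" using x by (simp add: B.homogeneous_filt)
      then have "T x \<in> filt GD (i + k)" using T by blast
      then show "hcomponent Deg n T x = 0 x"
        using n hcomponent_Deg_apply[OF _ x] T by (simp add: D.filt_iff)
    qed
    then show "T \<in> filt Deg k" using T by (simp add: H.filt_iff)
  qed
qed

end

section \<open>The graded algebra of superfunctions\<close>

locale supermanifold =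
  fixes S :: "('m::{t2_space, second_countable_topology}, 'v::real_vector, 'a::real_algebra_1) batchelor"
  assumes model: "batchelor_model S"
begin

lemma model_add: "model S (a + b) p vs = model S a p vs + model S b p vs"
  and model_scale: "model S (r *\<^sub>R a) p vs = r * model S a p vs"
  and model_mult: "model S (a * b) p vs = wedge (model S a p) (model S b p) vs"
  and model_bij: "bij_betw (model S) UNIV (ext_sections S)"
  and atlas: "smooth_atlas (even_dim S) (charts S)"
  and vbundle: "vector_bundle S"
  using model unfolding batchelor_model_def by auto

lemma model_zero: "model S 0 p vs = 0"
  using model_scale[of 0 0] by simp

lemma model_diff: "model S (a - b) p vs = model S a p vs - model S b p vs"
  using model_add[of "a - b" b p vs] by simp

lemma model_sum: "model S (sum f I) p vs = (\<Sum>i\<in>I. model S (f i) p vs)"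
  by (induction I rule: infinite_finite_induct) (auto simp: model_zero model_add)

lemma model_eqI: "(\<And>p vs. model S a p vs = model S b p vs) \<Longrightarrow> a = b"
  using injD[OF bij_betw_imp_inj_on[OF model_bij]] by blast

lemma model_section: "model S a \<in> ext_sections S"
  using model_bij by (auto simp: bij_betw_def)

lemma model_surj: "s \<in> ext_sections S \<Longrightarrow> \<exists>a. \<forall>p vs. model S a p vs = s p vs"
  using model_bij unfolding bij_betw_def by (metis imageE)

lemma model_form: "model S a p \<in> ext_forms (fibre S p)"
  using model_section by (simp add: ext_sections_def)

lemma model_smooth:
  "(U, e) \<in> frames S \<Longrightarrow> set is \<subseteq> {..<odd_dim S} \<Longrightarrow> smooth_on S U (\<lambda>p. model S a p (map (\<lambda>i. e i p) is))"
  using model_section[of a] by (auto simp: ext_sections_def)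

lemma frame_basis:
  assumes "(U, e) \<in> frames S" "p \<in> U"
  shows "inj_on (\<lambda>i. e i p) {..<odd_dim S}" "independent ((\<lambda>i. e i p) ` {..<odd_dim S})"
    "span ((\<lambda>i. e i p) ` {..<odd_dim S}) = fibre S p"
proof -
  have "\<forall>(U, e)\<in>frames S. open U \<and>
        (\<forall>p\<in>U. inj_on (\<lambda>i. e i p) {..<odd_dim S} \<and>
               independent ((\<lambda>i. e i p) ` {..<odd_dim S}) \<and>
               span ((\<lambda>i. e i p) ` {..<odd_dim S}) = fibre S p)"
    using vbundle unfolding vector_bundle_def by (elim conjE)
  from bspec[OF this assms(1)] assms(2)
  show "inj_on (\<lambda>i. e i p) {..<odd_dim S}" "independent ((\<lambda>i. e i p) ` {..<odd_dim S})"
    "span ((\<lambda>i. e i p) ` {..<odd_dim S}) = fibre S p" by auto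
qed

lemma frame_open: "(U, e) \<in> frames S \<Longrightarrow> open U"
proof -
  assume f: "(U, e) \<in> frames S"
  have "\<forall>(U, e)\<in>frames S. open U" using vbundle unfolding vector_bundle_def by fast
  from bspec[OF this f] show "open U" by simp
qed

lemma frame_fibre: "(U, e) \<in> frames S \<Longrightarrow> p \<in> U \<Longrightarrow> i < odd_dim S \<Longrightarrow> e i p \<in> fibre S p"
proof -
  assume f: "(U, e) \<in> frames S" "p \<in> U" and i: "i < odd_dim S"
  have "e i p \<in> span ((\<lambda>i. e i p) ` {..<odd_dim S})" using i by (intro span_base) simp
  then show "e i p \<in> fibre S p" using frame_basis(3)[OF f] by simp
qed

lemma frame_change:
  assumes "(U, e) \<in> frames S" "(U', e') \<in> frames S"
  obtains c where "\<And>i j. i < odd_dim S \<Longrightarrow> j < odd_dim S \<Longrightarrow> smooth_on S (U \<inter> U') (c i j)"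
    "\<And>j p. j < odd_dim S \<Longrightarrow> p \<in> U \<inter> U' \<Longrightarrow> e' j p = (\<Sum>i<odd_dim S. c i j p *\<^sub>R e i p)"
proof -
  have "\<forall>(U, e)\<in>frames S. \<forall>(U', e')\<in>frames S. \<exists>c.
        (\<forall>i<odd_dim S. \<forall>j<odd_dim S. smooth_on S (U \<inter> U') (c i j)) \<and>
        (\<forall>j<odd_dim S. \<forall>p\<in>U \<inter> U'. e' j p = (\<Sum>i<odd_dim S. c i j p *\<^sub>R e i p))"
    using vbundle unfolding vector_bundle_def by (elim conjE)
  from bspec[OF this assms(1)]
  have "\<forall>(U', e')\<in>frames S. \<exists>c. (\<forall>i<odd_dim S. \<forall>j<odd_dim S. smooth_on S (U \<inter> U') (c i j)) \<and>
        (\<forall>j<odd_dim S. \<forall>p\<in>U \<inter> U'. e' j p = (\<Sum>i<odd_dim S. c i j p *\<^sub>R e i p))"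
    by simp
  from bspec[OF this assms(2)]
  have "\<exists>c. (\<forall>i<odd_dim S. \<forall>j<odd_dim S. smooth_on S (U \<inter> U') (c i j)) \<and>
        (\<forall>j<odd_dim S. \<forall>p\<in>U \<inter> U'. e' j p = (\<Sum>i<odd_dim S. c i j p *\<^sub>R e i p))"
    by simp
  then obtain c where "\<forall>i<odd_dim S. \<forall>j<odd_dim S. smooth_on S (U \<inter> U') (c i j)"
    "\<forall>j<odd_dim S. \<forall>p\<in>U \<inter> U'. e' j p = (\<Sum>i<odd_dim S. c i j p *\<^sub>R e i p)" by (elim exE conjE)
  then show ?thesis by (intro that[of c]) simp_all
qed

lemma exists_frame: "\<exists>U e. (U, e) \<in> frames S \<and> p \<in> U"
proof -
  have "p \<in> \<Union> (fst ` frames S)" using vbundle unfolding vector_bundle_def by simp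
  then show ?thesis by auto
qed

lemma subspace_fibre: "subspace (fibre S p)"
proof -
  obtain U e where "(U, e) \<in> frames S" "p \<in> U" using exists_frame by blast
  from frame_basis(3)[OF this] show ?thesis by (metis subspace_span)
qed

lemma model_above_dimension:
  assumes "odd_dim S < length vs"
  shows "model S a p vs = 0"
proof -
  obtain U e where f: "(U, e) \<in> frames S" "p \<in> U" using exists_frame by blast
  show ?thesis
  proof (rule ext_forms_above_dimension)
    show "model S a p \<in> ext_forms (span ((\<lambda>i. e i p) ` {..<odd_dim S}))"
      using model_form frame_basis(3)[OF f] by simp
    show "card ((\<lambda>i. e i p) ` {..<odd_dim S}) < length vs"
      using card_image[OF frame_basis(1)[OF f]] assms by simp
  qed simp
qed

lemma exists_degree_part:
  "\<exists>b. \<forall>p vs. model S b p vs = (if int (length vs) = j then model S a p vs else 0)"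
proof (rule model_surj)
  show "(\<lambda>p vs. if int (length vs) = j then model S a p vs else 0) \<in> ext_sections S"
    unfolding ext_sections_def
  proof (intro CollectI conjI allI ballI, goal_cases)
    case (1 p)
    show ?case using model_form[of a p] unfolding ext_forms_def by auto
  next
    case (2 x)
    show ?case
    proof (cases x)
      case (Pair U e)
      show ?thesis unfolding Pair
      proof (clarify)
        fix "is" assume "set is \<subseteq> {..<odd_dim S}"
        then show "smooth_on S U (\<lambda>p. if int (length (map (\<lambda>i. e i p) is)) = j
            then model S a p (map (\<lambda>i. e i p) is) else 0)"
          using model_smooth[of U e "is" a] 2 Pair
          by (cases "int (length is) = j") (auto simp: smooth_on_const)
      qed
    qed
  qed
qed

lemma fun_deg_diff:
  assumes "a \<in> fun_deg S j" "b \<in> fun_deg S j"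
  shows "a - b \<in> fun_deg S j"
  unfolding fun_deg_def
proof (intro CollectI allI impI)
  fix p vs assume "model S (a - b) p vs \<noteq> 0"
  then have "model S a p vs \<noteq> 0 \<or> model S b p vs \<noteq> 0" by (auto simp: model_diff)
  then show "int (length vs) = j" using assms by (auto simp: fun_deg_def)
qed

text \<open>The degrees end at the rank of the bundle, because alternating forms vanish above it.\<close>

lemma grading_fun: "grading (fun_deg S) UNIV 0 (int (odd_dim S))"
proof
  show "x = 0" if "x \<in> fun_deg S j" "j \<notin> {0..int (odd_dim S)}" for x j
  proof (rule model_eqI)
    fix p vs show "model S x p vs = model S 0 p vs"
    proof (rule ccontr)
      assume *: "model S x p vs \<noteq> model S 0 p vs"
      then have "int (length vs) = j" using that by (auto simp: fun_deg_def model_zero)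
      moreover have "length vs \<le> odd_dim S" using * model_above_dimension[of vs x p] by (fastforce simp: model_zero)
      ultimately show False using that(2) by auto
    qed
  qed
  show "\<exists>s. (\<forall>j. s j \<in> fun_deg S j) \<and> x = (\<Sum>j\<in>{0..int (odd_dim S)}. s j)" for x
  proof -
    obtain s where s: "\<And>j p vs. model S (s j) p vs = (if int (length vs) = j then model S x p vs else 0)"
      using exists_degree_part[of _ x] by metis
    have "x = (\<Sum>j\<in>{0..int (odd_dim S)}. s j)"
    proof (rule model_eqI)
      fix p vs
      show "model S x p vs = model S (\<Sum>j\<in>{0..int (odd_dim S)}. s j) p vs"
        using model_above_dimension[of vs x p] by (auto simp: model_sum s)
    qed
    moreover have "\<forall>j. s j \<in> fun_deg S j" by (auto simp: fun_deg_def s split: if_splits)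
    ultimately show ?thesis by blast
  qed
  show "s j = 0" if s: "\<And>j. s j \<in> fun_deg S j" and sum: "(\<Sum>j\<in>{0..int (odd_dim S)}. s j) = 0" for s j
  proof (rule model_eqI)
    fix p vs
    show "model S (s j) p vs = model S 0 p vs"
    proof (cases "int (length vs) = j \<and> length vs \<le> odd_dim S")
      case True
      have "0 = (\<Sum>i\<in>{0..int (odd_dim S)}. model S (s i) p vs)"
        using sum model_sum[of s "{0..int (odd_dim S)}" p vs] by (simp add: model_zero)
      also have "\<dots> = (\<Sum>i\<in>{0..int (odd_dim S)}. if i = j then model S (s j) p vs else 0)"
        using s True by (intro sum.cong) (auto simp: fun_deg_def)
      also have "\<dots> = model S (s j) p vs" using True by auto
      finally show ?thesis by (simp add: model_zero)
    next
      case False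
      have "model S (s j) p vs = 0"
        using False s[of j] model_above_dimension[of vs "s j" p] by (auto simp: fun_deg_def)
      then show ?thesis by (simp add: model_zero)
    qed
  qed
qed (auto simp: fun_deg_diff, simp add: fun_deg_def model_zero)

sublocale A: grading "fun_deg S" UNIV 0 "int (odd_dim S)"
  by (rule grading_fun)

lemma model_hcomponent:
  "model S (hcomponent (fun_deg S) j a) p vs = (if int (length vs) = j then model S a p vs else 0)"
proof -
  have z: "model S (hcomponent (fun_deg S) i a) p vs = 0" if "i \<noteq> int (length vs)" for i
    using A.hcomponent_mem[of a i] that by (auto simp: fun_deg_def)
  have "model S a p vs = (\<Sum>i\<in>{0..int (odd_dim S)}. model S (hcomponent (fun_deg S) i a) p vs)"
    using A.sum_hcomponent[of a] model_sum[of "\<lambda>i. hcomponent (fun_deg S) i a" "{0..int (odd_dim S)}" p vs] by simp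
  also have "\<dots> = (\<Sum>i\<in>{0..int (odd_dim S)}. if i = int (length vs) then model S (hcomponent (fun_deg S) (int (length vs)) a) p vs else 0)"
    by (rule sum.cong) (auto simp: z)
  also have "\<dots> = model S (hcomponent (fun_deg S) (int (length vs)) a) p vs"
    using model_above_dimension[of vs] by auto
  finally show ?thesis using z by auto
qed

lemma fun_deg_mult:
  assumes "a \<in> fun_deg S i" "b \<in> fun_deg S j"
  shows "a * b \<in> fun_deg S (i + j)"
  unfolding fun_deg_def
proof (intro CollectI allI impI)
  fix p vs assume "model S (a * b) p vs \<noteq> 0"
  then have "wedge (model S a p) (model S b p) vs \<noteq> 0" by (simp add: model_mult)
  then obtain us ws where "length vs = length us + length ws" "model S a p us \<noteq> 0" "model S b p ws \<noteq> 0"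
    by (rule wedge_nonzero_split)
  then show "int (length vs) = i + j" using assms by (auto simp: fun_deg_def)
qed

lemma fun_deg_commute:
  assumes "a \<in> fun_deg S (int i)" "b \<in> fun_deg S (int j)"
  shows "a * b = (- 1) ^ (i * j) *\<^sub>R (b * a)"
proof (rule model_eqI)
  fix p vs
  show "model S (a * b) p vs = model S ((- 1) ^ (i * j) *\<^sub>R (b * a)) p vs"
    unfolding model_scale model_mult
    by (rule wedge_commute) (use assms in \<open>auto simp: fun_deg_def\<close>)
qed

lemma model_scalar_mult:
  assumes "c \<in> fun_deg S 0"
  shows "model S (c * a) p vs = model S c p [] * model S a p vs"
  unfolding model_mult by (rule wedge_scalar_left) (use assms in \<open>auto simp: fun_deg_def\<close>)

lemma fun_deg_scale: "a \<in> fun_deg S j \<Longrightarrow> r *\<^sub>R a \<in> fun_deg S j"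
  by (auto simp: fun_deg_def model_scale)

lemma hcomponent_scale:
  "hcomponent (fun_deg S) j (r *\<^sub>R a) = r *\<^sub>R hcomponent (fun_deg S) j a"
  by (rule model_eqI) (simp add: model_hcomponent model_scale)

lemma hcomponent_mult_left:
  assumes "a \<in> fun_deg S i"
  shows "hcomponent (fun_deg S) (i + j) (a * b) = a * hcomponent (fun_deg S) j b"
proof -
  have "hcomponent (fun_deg S) (i + j) (a * b) =
      (\<Sum>k\<in>{0..int (odd_dim S)}. hcomponent (fun_deg S) (i + j) (a * hcomponent (fun_deg S) k b))"
    by (simp add: A.sum_hcomponent flip: A.hcomponent_sum sum_distrib_left)
  also have "\<dots> = (\<Sum>k\<in>{0..int (odd_dim S)}. if k = j then a * hcomponent (fun_deg S) j b else 0)"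
    by (rule sum.cong)
      (auto simp: A.hcomponent_homogeneous[OF fun_deg_mult[OF assms A.hcomponent_mem[OF UNIV_I]]])
  also have "\<dots> = a * hcomponent (fun_deg S) j b"
    using A.bounded[OF A.hcomponent_mem[OF UNIV_I], of j b] by auto
  finally show ?thesis .
qed

lemma hcomponent_mult_right:
  assumes "b \<in> fun_deg S i"
  shows "hcomponent (fun_deg S) (j + i) (a * b) = hcomponent (fun_deg S) j a * b"
proof -
  have "hcomponent (fun_deg S) (j + i) (a * b) =
      (\<Sum>k\<in>{0..int (odd_dim S)}. hcomponent (fun_deg S) (j + i) (hcomponent (fun_deg S) k a * b))"
    by (simp add: A.sum_hcomponent flip: A.hcomponent_sum sum_distrib_right)
  also have "\<dots> = (\<Sum>k\<in>{0..int (odd_dim S)}. if k = j then hcomponent (fun_deg S) j a * b else 0)"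
    by (rule sum.cong)
      (auto simp: A.hcomponent_homogeneous[OF fun_deg_mult[OF A.hcomponent_mem[OF UNIV_I] assms]])
  also have "\<dots> = hcomponent (fun_deg S) j a * b"
    using A.bounded[OF A.hcomponent_mem[OF UNIV_I], of j a] by auto
  finally show ?thesis .
qed

text \<open>The component of degree \<open>0\<close> of the unit is a left unit on homogeneous elements, hence it is the unit.\<close>

lemma one_fun_deg: "1 \<in> fun_deg S 0"
proof -
  let ?e = "hcomponent (fun_deg S) 0 1"
  have *: "?e * a = a" if "a \<in> fun_deg S k" for a k
    using hcomponent_mult_right[OF that, of 0 1] A.hcomponent_homogeneous[OF that, of k] by simp
  have "?e * 1 = (\<Sum>k\<in>{0..int (odd_dim S)}. ?e * hcomponent (fun_deg S) k 1)"
    by (simp add: A.sum_hcomponent flip: sum_distrib_left)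
  also have "\<dots> = 1" by (simp add: *[OF A.hcomponent_mem] A.sum_hcomponent)
  finally have "?e = 1" by simp
  then show ?thesis using A.hcomponent_mem[of 1 0] by simp
qed

lemma filt_fun_mult:
  assumes "a \<in> filt (fun_deg S) i" "b \<in> filt (fun_deg S) j"
  shows "a * b \<in> filt (fun_deg S) (i + j)"
proof -
  have "hcomponent (fun_deg S) k a * hcomponent (fun_deg S) n b \<in> filt (fun_deg S) (i + j)" for k n
  proof (cases "k < i \<or> n < j")
    case True
    then have "hcomponent (fun_deg S) k a * hcomponent (fun_deg S) n b = 0"
      using assms by (auto simp: A.filt_iff)
    then show ?thesis by (simp add: A.filt_zero)
  next
    case False
    then show ?thesis
      by (intro A.homogeneous_filt[OF fun_deg_mult[OF A.hcomponent_mem A.hcomponent_mem]]) auto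
  qed
  then have "(\<Sum>k\<in>{0..int (odd_dim S)}. \<Sum>n\<in>{0..int (odd_dim S)}.
      hcomponent (fun_deg S) k a * hcomponent (fun_deg S) n b) \<in> filt (fun_deg S) (i + j)"
    by (intro A.filt_sum)
  then show ?thesis
    unfolding sum_product[symmetric] by (simp add: A.sum_hcomponent)
qed

lemma filt_fun_scale: "a \<in> filt (fun_deg S) i \<Longrightarrow> r *\<^sub>R a \<in> filt (fun_deg S) i"
  by (simp add: A.filt_iff hcomponent_scale)

end

section \<open>Local generation in degrees zero and one\<close>

lemma wedge_scale:
  "wedge (\<lambda>vs. r * \<omega> vs) (\<lambda>vs. s * \<eta> vs) vs = r * s * wedge \<omega> \<eta> vs"
  by (simp add: wedge_def sum_distrib_left ac_simps)

context supermanifold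
begin

definition frame_coord :: "(nat \<Rightarrow> 'm \<Rightarrow> 'v) \<Rightarrow> nat \<Rightarrow> 'm \<Rightarrow> 'v \<Rightarrow> real" where
  "frame_coord e i p v = representation ((\<lambda>i. e i p) ` {..<odd_dim S}) v (e i p)"

context
  fixes U e
  assumes frame: "(U, e) \<in> frames S"
begin

lemma frame_coord_linear:
  assumes "p \<in> U" "v \<in> fibre S p" "w \<in> fibre S p"
  shows "frame_coord e i p (a *\<^sub>R v + b *\<^sub>R w) = a * frame_coord e i p v + b * frame_coord e i p w"
  using assms frame_basis[OF frame assms(1)]
  by (simp add: frame_coord_def representation_add representation_scale subspace_scale subspace_fibre)

lemma frame_coord_expansion:
  assumes p: "p \<in> U" and v: "v \<in> fibre S p"
  shows "v = (\<Sum>i<odd_dim S. frame_coord e i p v *\<^sub>R e i p)"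
proof -
  note b = frame_basis[OF frame p]
  let ?B = "(\<lambda>i. e i p) ` {..<odd_dim S}"
  have "(\<Sum>b\<in>?B. representation ?B v b *\<^sub>R b) = v"
    using b v by (intro sum_representation_eq) auto
  then show ?thesis using b(1) by (simp add: sum.reindex frame_coord_def)
qed

lemma frame_coord_sum:
  assumes p: "p \<in> U" and i: "i < odd_dim S"
  shows "frame_coord e i p (\<Sum>k<odd_dim S. c k *\<^sub>R e k p) = c i"
proof -
  note b = frame_basis[OF frame p]
  let ?B = "(\<lambda>i. e i p) ` {..<odd_dim S}"
  have "representation ?B (\<Sum>k<odd_dim S. c k *\<^sub>R e k p) = (\<lambda>u. \<Sum>k<odd_dim S. representation ?B (c k *\<^sub>R e k p) u)"
    by (rule representation_sum) (use b in \<open>auto intro: span_scale span_base\<close>)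
  then have "frame_coord e i p (\<Sum>k<odd_dim S. c k *\<^sub>R e k p) =
      (\<Sum>k<odd_dim S. representation ?B (c k *\<^sub>R e k p) (e i p))"
    by (simp add: frame_coord_def)
  also have "\<dots> = (\<Sum>k<odd_dim S. if k = i then c i else 0)"
  proof (rule sum.cong[OF refl])
    fix k assume k: "k \<in> {..<odd_dim S}"
    have "representation ?B (c k *\<^sub>R e k p) (e i p) = c k * representation ?B (e k p) (e i p)"
      using b k by (subst representation_scale) (auto intro: span_base)
    also have "representation ?B (e k p) (e i p) = (if e i p = e k p then 1 else 0)"
      using b(2) k by (subst representation_basis) auto
    finally show "representation ?B (c k *\<^sub>R e k p) (e i p) = (if k = i then c i else 0)"
      using inj_onD[OF b(1), of i k] i k by auto
  qed
  also have "\<dots> = c i" using i by simp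
  finally show ?thesis .
qed

text \<open>Three kinds of sections with support in the domain of a frame: functions, the coordinate forms,
  and contractions with the frame. All are cut off by a bump function.\<close>

context
  fixes b K
  assumes b: "smooth_on S UNIV b" and K: "closed K" "K \<subseteq> U" and b0: "\<forall>q. q \<notin> K \<longrightarrow> b q = 0"
begin

lemma cutoff_outside: "q \<notin> U \<Longrightarrow> b q = 0"
  using K b0 by blast

text \<open>A function that is smooth on the domain of the frame becomes smooth everywhere after multiplication
  with the bump function.\<close>

lemma smooth_on_cutoff:
  assumes U': "open U'" and f: "smooth_on S (U \<inter> U') f"
    and h: "\<And>q. q \<in> U \<inter> U' \<Longrightarrow> h q = b q * f q" and h0: "\<And>q. q \<notin> U \<Longrightarrow> h q = 0"
  shows "smooth_on S U' h"
proof (rule smooth_on_extend_by_zero[OF atlas frame_open[OF frame] U' K])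
  show "smooth_on S (U \<inter> U') h"
  proof (rule smooth_on_cong[OF atlas])
    show "open (U \<inter> U')" using frame_open[OF frame] U' by auto
    show "b q * f q = h q" if "q \<in> U \<inter> U'" for q using h[OF that] by simp
    show "smooth_on S (U \<inter> U') (\<lambda>q. b q * f q)"
      using f smooth_on_subset[OF b] by (intro smooth_on_mult) auto
  qed
  show "h q = 0" if "q \<in> U'" "q \<notin> K" for q
    using h[of q] h0[of q] b0 that by (cases "q \<in> U") auto
qed

lemma cutoff_function:
  "\<exists>c\<in>fun_deg S 0. \<forall>p. model S c p [] = b p"
proof -
  have "(\<lambda>p vs. if vs = [] then b p else 0) \<in> ext_sections S"
    unfolding ext_sections_def
  proof (intro CollectI conjI allI ballI, goal_cases)
    case (1 p)
    show ?case unfolding ext_forms_def by auto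
  next
    case (2 x)
    show ?case
    proof (cases x)
      case (Pair U' e')
      show ?thesis unfolding Pair
      proof clarify
        fix "is" :: "nat list"
        show "smooth_on S U' (\<lambda>p. if map (\<lambda>i. e' i p) is = [] then b p else 0)"
          using smooth_on_subset[OF b] by (cases "is = []") (auto simp: smooth_on_const)
      qed
    qed
  qed
  from model_surj[OF this] obtain c where "\<forall>p vs. model S c p vs = (if vs = [] then b p else 0)" ..
  then show ?thesis by (intro bexI[of _ c]) (auto simp: fun_deg_def)
qed

lemma cutoff_coordinate_form:
  assumes i: "i < odd_dim S"
  shows "\<exists>\<alpha>. \<forall>p vs. model S \<alpha> p vs =
    b p * (if length vs = 1 \<and> hd vs \<in> fibre S p then frame_coord e i p (hd vs) else 0)"
proof -
  let ?s = "\<lambda>p vs. b p * (if length vs = 1 \<and> hd vs \<in> fibre S p then frame_coord e i p (hd vs) else 0)"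
  have "?s \<in> ext_sections S"
    unfolding ext_sections_def
  proof (intro CollectI conjI allI ballI, goal_cases)
    case (1 p)
    show ?case unfolding ext_forms_def
    proof (intro CollectI conjI allI impI)
      fix vs :: "'v list" assume "\<not> set vs \<subseteq> fibre S p"
      then show "?s p vs = 0" by (cases vs) auto
    next
      fix us ws and x y :: 'v and a c :: real
      assume *: "set us \<subseteq> fibre S p \<and> set ws \<subseteq> fibre S p \<and> x \<in> fibre S p \<and> y \<in> fibre S p"
      then have "a *\<^sub>R x + c *\<^sub>R y \<in> fibre S p"
        using subspace_fibre by (simp add: subspace_add subspace_scale)
      then show "?s p (us @ (a *\<^sub>R x + c *\<^sub>R y) # ws) = a * ?s p (us @ x # ws) + c * ?s p (us @ y # ws)"
        using * frame_coord_linear[of p x y i a c] cutoff_outside[of p]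
        by (cases "p \<in> U"; cases "us = [] \<and> ws = []") (auto simp: algebra_simps)
    next
      fix vs :: "'v list" assume "\<not> distinct vs"
      then show "?s p vs = 0" by (auto simp: length_Suc_conv)
    qed
  next
    case (2 x)
    show ?case
    proof (cases x)
      case (Pair U' e')
      with 2 have f': "(U', e') \<in> frames S" by simp
      obtain c where c: "\<And>i j. i < odd_dim S \<Longrightarrow> j < odd_dim S \<Longrightarrow> smooth_on S (U \<inter> U') (c i j)"
        "\<And>j p. j < odd_dim S \<Longrightarrow> p \<in> U \<inter> U' \<Longrightarrow> e' j p = (\<Sum>i<odd_dim S. c i j p *\<^sub>R e i p)"
        using frame_change[OF frame f'] by blast
      show ?thesis unfolding Pair
      proof clarify
        fix "is" :: "nat list" assume "is": "set is \<subseteq> {..<odd_dim S}"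
        show "smooth_on S U' (\<lambda>p. ?s p (map (\<lambda>i. e' i p) is))"
        proof (cases "length is = 1")
          case True
          then obtain j where j: "is = [j]" "j < odd_dim S" using "is" by (auto simp: length_Suc_conv)
          have "?s q (map (\<lambda>i. e' i q) is) = b q * c i j q" if q: "q \<in> U \<inter> U'" for q
          proof -
            have "frame_coord e i q (e' j q) = c i j q"
              using q by (simp add: c(2)[OF j(2) q] frame_coord_sum i)
            then show ?thesis using j frame_fibre[OF f' _ j(2), of q] q by simp
          qed
          then show ?thesis
            by (rule smooth_on_cutoff[OF frame_open[OF f'] c(1)[OF i j(2)]]) (simp_all add: cutoff_outside)
        next
          case False
          then show ?thesis by (simp add: smooth_on_const)
        qed
      qed
    qed
  qed
  from model_surj[OF this] show ?thesis .
qed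

lemma cutoff_contraction:
  assumes i: "i < odd_dim S"
  shows "\<exists>\<beta>. \<forall>p vs. model S \<beta> p vs =
    b p * (if set vs \<subseteq> fibre S p then model S a p (e i p # vs) else 0)"
proof -
  let ?s = "\<lambda>p vs. b p * (if set vs \<subseteq> fibre S p then model S a p (e i p # vs) else 0)"
  have "?s \<in> ext_sections S"
    unfolding ext_sections_def
  proof (intro CollectI conjI allI ballI, goal_cases)
    case (1 p)
    show ?case unfolding ext_forms_def
    proof (intro CollectI conjI allI impI)
      fix vs :: "'v list" assume "\<not> set vs \<subseteq> fibre S p"
      then show "?s p vs = 0" by auto
    next
      fix us ws and x y :: 'v and r t :: real
      assume *: "set us \<subseteq> fibre S p \<and> set ws \<subseteq> fibre S p \<and> x \<in> fibre S p \<and> y \<in> fibre S p"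
      then have "r *\<^sub>R x + t *\<^sub>R y \<in> fibre S p"
        using subspace_fibre by (simp add: subspace_add subspace_scale)
      then show "?s p (us @ (r *\<^sub>R x + t *\<^sub>R y) # ws) = r * ?s p (us @ x # ws) + t * ?s p (us @ y # ws)"
        using * ext_forms_linear[OF model_form, of "e i p # us" p ws x y a r t] frame_fibre[OF frame _ i, of p]
          cutoff_outside[of p]
        by (cases "p \<in> U") (auto simp: algebra_simps)
    next
      fix vs :: "'v list" assume "\<not> distinct vs"
      then show "?s p vs = 0" using ext_forms_not_distinct[OF model_form, of "e i p # vs" a p] by auto
    qed
  next
    case (2 x)
    show ?case
    proof (cases x)
      case (Pair U' e')
      with 2 have f': "(U', e') \<in> frames S" by simp
      obtain c where c: "\<And>i j. i < odd_dim S \<Longrightarrow> j < odd_dim S \<Longrightarrow> smooth_on S (U' \<inter> U) (c i j)"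
        "\<And>j p. j < odd_dim S \<Longrightarrow> p \<in> U' \<inter> U \<Longrightarrow> e j p = (\<Sum>i<odd_dim S. c i j p *\<^sub>R e' i p)"
        using frame_change[OF f' frame] by blast
      show ?thesis unfolding Pair
      proof clarify
        fix "is" :: "nat list" assume "is": "set is \<subseteq> {..<odd_dim S}"
        let ?f = "\<lambda>q. \<Sum>k<odd_dim S. c k i q * model S a q (map (\<lambda>j. e' j q) (k # is))"
        have "smooth_on S (U \<inter> U') (\<lambda>q. c k i q * model S a q (map (\<lambda>j. e' j q) (k # is)))" if "k < odd_dim S" for k
        proof (rule smooth_on_mult)
          show "smooth_on S (U \<inter> U') (c k i)" using c(1)[OF that i] by (simp add: Int_commute)
          have "smooth_on S U' (\<lambda>q. model S a q (map (\<lambda>j. e' j q) (k # is)))"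
            by (rule model_smooth[OF f']) (use "is" that in auto)
          then show "smooth_on S (U \<inter> U') (\<lambda>q. model S a q (map (\<lambda>j. e' j q) (k # is)))"
            by (rule smooth_on_subset) auto
        qed
        then have "smooth_on S (U \<inter> U') ?f" by (intro smooth_on_sum) auto
        moreover have "?s q (map (\<lambda>i. e' i q) is) = b q * ?f q" if q: "q \<in> U \<inter> U'" for q
        proof -
          have sub: "set (map (\<lambda>i. e' i q) is) \<subseteq> fibre S q"
            using frame_fibre[OF f', of q] "is" q by auto
          have "model S a q (e i q # map (\<lambda>i. e' i q) is) = ?f q"
            using ext_forms_sum_Cons[OF model_form subspace_fibre sub, of "{..<odd_dim S}" "\<lambda>k. e' k q" a "\<lambda>k. c k i q"]
              frame_fibre[OF f', of q] c(2)[OF i, of q] q by simp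
          then show ?thesis using sub q by simp
        qed
        ultimately show "smooth_on S U' (\<lambda>p. ?s p (map (\<lambda>i. e' i p) is))"
          by (intro smooth_on_cutoff[OF frame_open[OF f'], where f = ?f]) (simp_all add: cutoff_outside)
      qed
    qed
  qed
  from model_surj[OF this] show ?thesis .
qed

end

end

text \<open>Near each point a superfunction of positive degree \<open>k\<close> is a sum of products of degrees \<open>1\<close> and
  \<open>k - 1\<close>, by Euler's identity. The bump function \<open>b\<close> enters each factor, whence \<open>c = b\<^sup>2\<close>.\<close>

lemma local_generation:
  assumes a: "a \<in> fun_deg S k" and k: "k \<ge> 1"
  obtains c \<alpha> \<beta> where "c \<in> fun_deg S 0" "model S c p [] = 1"
    "\<And>i. i < odd_dim S \<Longrightarrow> \<alpha> i \<in> fun_deg S 1" "\<And>i. i < odd_dim S \<Longrightarrow> \<beta> i \<in> fun_deg S (k - 1)"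
    "c * a = (\<Sum>i<odd_dim S. \<alpha> i * \<beta> i)"
proof -
  obtain U e where f: "(U, e) \<in> frames S" and p: "p \<in> U" using exists_frame by blast
  obtain b K where b: "smooth_on S UNIV b" "b p = 1" and K: "closed K" "K \<subseteq> U"
    and b0: "\<And>q. q \<notin> K \<Longrightarrow> b q = 0"
    using exists_bump_function[OF atlas frame_open[OF f] p] by blast
  have b0': "\<forall>q. q \<notin> K \<longrightarrow> b q = 0" using b0 by simp
  note cut = f b(1) K b0'
  obtain c where c: "c \<in> fun_deg S 0" "\<And>p. model S c p [] = b p"
    using cutoff_function[OF cut] by blast
  define \<theta> where "\<theta> = (\<lambda>q i vs. if length vs = 1 \<and> hd vs \<in> fibre S q then frame_coord e i q (hd vs) else 0)"
  define \<iota> where "\<iota> = (\<lambda>q i vs. if set vs \<subseteq> fibre S q then model S a q (e i q # vs) else 0)"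
  have "\<forall>i. \<exists>\<alpha>. i < odd_dim S \<longrightarrow> (\<forall>q vs. model S \<alpha> q vs = b q * \<theta> q i vs)"
    using cutoff_coordinate_form[OF cut] unfolding \<theta>_def by simp
  from choice[OF this] obtain \<alpha> where \<alpha>: "\<And>i q vs. i < odd_dim S \<Longrightarrow> model S (\<alpha> i) q vs = b q * \<theta> q i vs"
    by blast
  have "\<forall>i. \<exists>\<beta>. i < odd_dim S \<longrightarrow> (\<forall>q vs. model S \<beta> q vs = b q * \<iota> q i vs)"
    using cutoff_contraction[OF cut, of _ a] unfolding \<iota>_def by simp
  from choice[OF this] obtain \<beta> where \<beta>: "\<And>i q vs. i < odd_dim S \<Longrightarrow> model S (\<beta> i) q vs = b q * \<iota> q i vs"
    by blast
  have bU: "b q = 0" if "q \<notin> U" for q using b0[of q] K(2) that by auto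
  have \<alpha>1: "\<alpha> i \<in> fun_deg S 1" if "i < odd_dim S" for i
    using \<alpha>[OF that] unfolding fun_deg_def \<theta>_def by auto
  have \<beta>1: "\<beta> i \<in> fun_deg S (k - 1)" if "i < odd_dim S" for i
    unfolding fun_deg_def
  proof (intro CollectI allI impI)
    fix q vs assume "model S (\<beta> i) q vs \<noteq> 0"
    then have "model S a q (e i q # vs) \<noteq> 0" using \<beta>[OF that, of q vs] by (auto simp: \<iota>_def split: if_splits)
    then have "int (length (e i q # vs)) = k" using a unfolding fun_deg_def by blast
    then show "int (length vs) = k - 1" by simp
  qed
  have eq: "(1 / real_of_int k) *\<^sub>R (\<Sum>i<odd_dim S. \<alpha> i * \<beta> i) = (c * c) * a"
  proof (rule model_eqI)
    fix q vs
    have ccq: "model S ((c * c) * a) q vs = b q * b q * model S a q vs"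
      using fun_deg_mult[OF c(1) c(1)] by (simp add: model_scalar_mult c mult.assoc)
    show "model S ((1 / real_of_int k) *\<^sub>R (\<Sum>i<odd_dim S. \<alpha> i * \<beta> i)) q vs = model S ((c * c) * a) q vs"
    proof (cases "q \<in> U \<and> set vs \<subseteq> fibre S q")
      case True
      have "model S (\<Sum>i<odd_dim S. \<alpha> i * \<beta> i) q vs = (\<Sum>i<odd_dim S. wedge (model S (\<alpha> i) q) (model S (\<beta> i) q) vs)"
        by (simp add: model_sum model_mult)
      also have "\<dots> = (\<Sum>i<odd_dim S. wedge (\<lambda>vs. b q * \<theta> q i vs) (\<lambda>vs. b q * \<iota> q i vs) vs)"
        using \<alpha> \<beta> by (intro sum.cong refl arg_cong2[where f = "\<lambda>x y. wedge x y vs"]) auto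
      also have "\<dots> = b q * b q * (\<Sum>i<odd_dim S. wedge (\<theta> q i) (\<iota> q i) vs)"
        by (simp add: wedge_scale sum_distrib_left)
      \<comment> \<open>Euler's identity in the fibre over \<open>q\<close>\<close>
      also have "(\<Sum>i<odd_dim S. wedge (\<theta> q i) (\<iota> q i) vs) = real (length vs) * model S a q vs"
      proof (rule wedge_Euler_identity[OF model_form subspace_fibre, where e = "\<lambda>i. e i q"])
        show "v = (\<Sum>i<odd_dim S. \<theta> q i [v] *\<^sub>R e i q)" if "v \<in> fibre S q" for v
          using frame_coord_expansion[OF f, of q v] True that by (simp add: \<theta>_def)
        show "e i q \<in> fibre S q" if "i \<in> {..<odd_dim S}" for i
          using frame_fibre[OF f] True that by auto
      qed (use True in \<open>auto simp: \<theta>_def \<iota>_def\<close>)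
      also have "real (length vs) * model S a q vs = real_of_int k * model S a q vs"
      proof (cases "model S a q vs = 0")
        case False
        then have "int (length vs) = k" using a unfolding fun_deg_def by blast
        then show ?thesis by (metis of_int_of_nat_eq)
      qed simp
      finally show ?thesis using k by (simp add: model_scale ccq)
    next
      case False
      show ?thesis
      proof (cases "set vs \<subseteq> fibre S q")
        case True
        then have "q \<notin> U" using False by simp
        then have "model S (\<alpha> i * \<beta> i) q vs = 0" if "i < odd_dim S" for i
          using \<alpha>[OF that, of q] bU[of q] \<open>q \<notin> U\<close> unfolding model_mult wedge_def by simp
        then show ?thesis using bU[of q] \<open>q \<notin> U\<close> by (simp add: model_scale model_sum ccq)
      next
        case False
        then show ?thesis by (simp add: ext_forms_outside[OF model_form])
      qed
    qed
  qed
  show ?thesis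
  proof (rule that[of "c * c" "\<lambda>i. (1 / real_of_int k) *\<^sub>R \<alpha> i" \<beta>])
    show "c * c \<in> fun_deg S 0" using fun_deg_mult[OF c(1) c(1)] by simp
    show "model S (c * c) p [] = 1" by (simp add: model_scalar_mult c b)
    show "c * c * a = (\<Sum>i<odd_dim S. (1 / real_of_int k) *\<^sub>R \<alpha> i * \<beta> i)"
      using eq by (simp add: scaleR_right.sum)
  qed (auto simp: fun_deg_scale \<alpha>1 \<beta>1)
qed

end

section \<open>Parity\<close>

context supermanifold
begin

lemma hcomp_mem: "hcomponent (fun_deg S) j a \<in> fun_deg S j"
  by (rule A.hcomponent_mem) simp

lemma hcomp_hcomp: "hcomponent (fun_deg S) i (hcomponent (fun_deg S) j a) = (if i = j then hcomponent (fun_deg S) j a else 0)"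
  by (rule A.hcomponent_homogeneous[OF hcomp_mem])

lemma fun_par_iff:
  "a \<in> fun_par S \<epsilon> \<longleftrightarrow> (\<forall>j. hcomponent (fun_deg S) j a \<noteq> 0 \<longrightarrow> even (j - int \<epsilon>))"
proof
  assume "a \<in> fun_par S \<epsilon>"
  then obtain s where s: "hdecomp (fun_deg S) a s" "\<forall>j. s j \<noteq> 0 \<longrightarrow> even (j - int \<epsilon>)"
    unfolding fun_par_def by blast
  then show "\<forall>j. hcomponent (fun_deg S) j a \<noteq> 0 \<longrightarrow> even (j - int \<epsilon>)"
    using A.hcomponent_eq[OF s(1)] by simp
next
  assume "\<forall>j. hcomponent (fun_deg S) j a \<noteq> 0 \<longrightarrow> even (j - int \<epsilon>)"
  then show "a \<in> fun_par S \<epsilon>"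
    unfolding fun_par_def using A.hdecomp_hcomponent[OF UNIV_I, of a] by blast
qed

lemma fun_par_cong: "even \<epsilon> = even \<delta> \<Longrightarrow> fun_par S \<epsilon> = fun_par S \<delta>"
  by (auto simp: fun_par_iff)

lemma fun_par_zero: "0 \<in> fun_par S \<epsilon>"
  by (simp add: fun_par_iff A.hcomponent_0)

lemma fun_par_diff: "a \<in> fun_par S \<epsilon> \<Longrightarrow> b \<in> fun_par S \<epsilon> \<Longrightarrow> a - b \<in> fun_par S \<epsilon>"
  unfolding fun_par_iff A.hcomponent_diff[OF UNIV_I UNIV_I] by (metis diff_self)

lemma fun_par_uminus: "a \<in> fun_par S \<epsilon> \<Longrightarrow> - a \<in> fun_par S \<epsilon>"
  using fun_par_diff[OF fun_par_zero] by force

lemma fun_par_add: "a \<in> fun_par S \<epsilon> \<Longrightarrow> b \<in> fun_par S \<epsilon> \<Longrightarrow> a + b \<in> fun_par S \<epsilon>"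
  using fun_par_diff[OF _ fun_par_uminus, of a \<epsilon> b] by simp

lemma fun_par_sum: "(\<And>i. i \<in> I \<Longrightarrow> f i \<in> fun_par S \<epsilon>) \<Longrightarrow> sum f I \<in> fun_par S \<epsilon>"
  by (induction I rule: infinite_finite_induct) (auto intro: fun_par_add fun_par_zero)

lemma fun_par_scale: "a \<in> fun_par S \<epsilon> \<Longrightarrow> r *\<^sub>R a \<in> fun_par S \<epsilon>"
  by (auto simp: fun_par_iff hcomponent_scale)

lemma fun_deg_par: "a \<in> fun_deg S j \<Longrightarrow> even (j - int \<epsilon>) \<Longrightarrow> a \<in> fun_par S \<epsilon>"
  by (auto simp: fun_par_iff A.hcomponent_homogeneous)

lemma hcomponent_par: "a \<in> fun_par S \<epsilon> \<Longrightarrow> hcomponent (fun_deg S) j a \<in> fun_par S \<epsilon>"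
  by (simp add: fun_par_iff hcomp_hcomp)

lemma fun_par_disjoint: "a \<in> fun_par S \<epsilon> \<Longrightarrow> a \<in> fun_par S (Suc \<epsilon>) \<Longrightarrow> a = 0"
proof -
  assume a: "a \<in> fun_par S \<epsilon>" "a \<in> fun_par S (Suc \<epsilon>)"
  have "hcomponent (fun_deg S) j a = 0" for j
  proof (rule ccontr)
    assume "hcomponent (fun_deg S) j a \<noteq> 0"
    then have "even (j - int \<epsilon>)" "even (j - int (Suc \<epsilon>))" using a unfolding fun_par_iff by blast+
    then show False by presburger
  qed
  then show "a = 0" using A.sum_hcomponent[of a] by simp
qed

lemma fun_par_decomp: obtains b c where "b \<in> fun_par S 0" "c \<in> fun_par S 1" "a = b + c"
proof -
  let ?h = "\<lambda>j. hcomponent (fun_deg S) j a"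
  let ?I = "{0..int (odd_dim S)}"
  have "(\<Sum>j\<in>?I. if even j then ?h j else 0) \<in> fun_par S 0"
    by (rule fun_par_sum) (auto intro: fun_deg_par[OF A.hcomponent_mem] fun_par_zero)
  moreover have "(\<Sum>j\<in>?I. if even j then 0 else ?h j) \<in> fun_par S 1"
    by (rule fun_par_sum) (auto intro: fun_deg_par[OF A.hcomponent_mem] fun_par_zero)
  moreover have "a = (\<Sum>j\<in>?I. if even j then ?h j else 0) + (\<Sum>j\<in>?I. if even j then 0 else ?h j)"
  proof -
    have "(\<Sum>j\<in>?I. if even j then ?h j else 0) + (\<Sum>j\<in>?I. if even j then 0 else ?h j) = (\<Sum>j\<in>?I. ?h j)"
      unfolding sum.distrib[symmetric] by (rule sum.cong) auto
    then show ?thesis by (simp add: A.sum_hcomponent)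
  qed
  ultimately show ?thesis by (rule that)
qed

lemma fun_par_mult:
  assumes a: "a \<in> fun_par S \<delta>" and b: "b \<in> fun_par S \<epsilon>"
  shows "a * b \<in> fun_par S (\<delta> + \<epsilon>)"
proof -
  let ?h = "hcomponent (fun_deg S)"
  have "?h i a * ?h j b \<in> fun_par S (\<delta> + \<epsilon>)" for i j
  proof (cases "?h i a = 0 \<or> ?h j b = 0")
    case False
    then have "even (i - int \<delta>)" "even (j - int \<epsilon>)" using a b unfolding fun_par_iff by blast+
    then show ?thesis
      by (intro fun_deg_par[OF fun_deg_mult[OF A.hcomponent_mem A.hcomponent_mem]]) auto
  qed (auto simp: fun_par_zero)
  then have "(\<Sum>i\<in>{0..int (odd_dim S)}. \<Sum>j\<in>{0..int (odd_dim S)}. ?h i a * ?h j b) \<in> fun_par S (\<delta> + \<epsilon>)"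
    by (intro fun_par_sum)
  then show ?thesis unfolding sum_product[symmetric] by (simp add: A.sum_hcomponent)
qed

lemma fun_par_commute:
  assumes a: "a \<in> fun_par S \<delta>" and b: "b \<in> fun_par S \<epsilon>"
  shows "a * b = (- 1) ^ (\<delta> * \<epsilon>) *\<^sub>R (b * a)"
proof -
  let ?h = "hcomponent (fun_deg S)"
  let ?I = "{0..int (odd_dim S)}"
  have *: "?h i a * ?h j b = (- 1) ^ (\<delta> * \<epsilon>) *\<^sub>R (?h j b * ?h i a)" for i j
  proof (cases "?h i a = 0 \<or> ?h j b = 0")
    case False
    then have e: "even (i - int \<delta>)" "even (j - int \<epsilon>)" using a b unfolding fun_par_iff by blast+
    have "0 \<le> i" "0 \<le> j" using False A.bounded[OF hcomp_mem] by fastforce+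
    then obtain i' j' where ij: "i = int i'" "j = int j'" using nonneg_int_cases by metis
    have "?h i a * ?h j b = (- 1) ^ (i' * j') *\<^sub>R (?h j b * ?h i a)"
      using fun_deg_commute[of "?h i a" i' "?h j b" j'] hcomp_mem unfolding ij by blast
    moreover have "even i' = even \<delta>" "even j' = even \<epsilon>" using e unfolding ij by auto
    ultimately show ?thesis by (simp add: minus_one_power_iff)
  qed auto
  have "a * b = (\<Sum>i\<in>?I. \<Sum>j\<in>?I. ?h i a * ?h j b)"
    unfolding sum_product[symmetric] by (simp add: A.sum_hcomponent)
  also have "\<dots> = (- 1) ^ (\<delta> * \<epsilon>) *\<^sub>R (\<Sum>j\<in>?I. \<Sum>i\<in>?I. ?h j b * ?h i a)"
    unfolding scaleR_right.sum * by (rule sum.swap)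
  also have "(\<Sum>j\<in>?I. \<Sum>i\<in>?I. ?h j b * ?h i a) = b * a"
    unfolding sum_product[symmetric] by (simp add: A.sum_hcomponent)
  finally show ?thesis .
qed

lemma filt_par_parts:
  assumes "b \<in> fun_par S \<epsilon>" "c \<in> fun_par S (Suc \<epsilon>)" "b + c \<in> filt (fun_deg S) k"
  shows "b \<in> filt (fun_deg S) k" "c \<in> filt (fun_deg S) k"
proof -
  let ?h = "hcomponent (fun_deg S)"
  have "?h j b = 0 \<and> ?h j c = 0" if "j < k" for j
  proof -
    have "?h j b + ?h j c = 0" using assms(3) that by (simp add: A.filt_iff A.hcomponent_add)
    moreover have "?h j b = 0 \<or> ?h j c = 0"
    proof (rule ccontr)
      assume "\<not> (?h j b = 0 \<or> ?h j c = 0)"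
      then have "even (j - int \<epsilon>)" "even (j - int (Suc \<epsilon>))" using assms unfolding fun_par_iff by blast+
      then show False by presburger
    qed
    ultimately show ?thesis by auto
  qed
  then show "b \<in> filt (fun_deg S) k" "c \<in> filt (fun_deg S) k" by (auto simp: A.filt_iff)
qed

lemma filt_par_improve:
  assumes "a \<in> fun_par S \<epsilon>" "a \<in> filt (fun_deg S) k" "odd (k - int \<epsilon>)"
  shows "a \<in> filt (fun_deg S) (k + 1)"
proof -
  have "hcomponent (fun_deg S) k a = 0" using assms(1,3) unfolding fun_par_iff by blast
  then show ?thesis using assms(2) by (auto simp: A.filt_iff) (metis zle_add1_eq_le order_le_less)
qed

lemma odd_filt_1: "a \<in> fun_par S 1 \<Longrightarrow> a \<in> filt (fun_deg S) 1"
  using filt_par_improve[of a 1 0] A.filt_all[of 0] by simp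

section \<open>Vector fields and the form filtration\<close>

text \<open>Membership in the filtration can be tested pointwise after multiplication with a superfunction
  whose value at the point is \<open>1\<close>: the lowest component is not changed at the point.\<close>

lemma filt_local:
  assumes loc: "\<And>p. \<exists>c. model S c p [] = 1 \<and> c * x \<in> filt (fun_deg S) n"
  shows "x \<in> filt (fun_deg S) n"
proof -
  let ?h = "hcomponent (fun_deg S)"
  have "x \<in> filt (fun_deg S) (min (int m) n)" for m
  proof (induction m)
    case 0
    then show ?case using A.filt_all[of "min 0 n"] by simp
  next
    case (Suc m)
    show ?case
    proof (cases "int m < n")
      case True
      have x: "x \<in> filt (fun_deg S) (int m)" using Suc True by simp
      have "?h (int m) x = 0"
      proof (rule model_eqI)
        fix p vs
        obtain c where c: "model S c p [] = 1" "c * x \<in> filt (fun_deg S) n" using loc by blast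
        have "?h j (c - ?h 0 c) = 0" if "j < 1" for j
        proof (cases "j = 0")
          case False
          then have "j \<notin> {0..int (odd_dim S)}" using that by auto
          then show ?thesis using A.bounded[OF hcomp_mem] by blast
        qed (simp add: A.hcomponent_diff hcomp_hcomp)
        then have c1: "c - ?h 0 c \<in> filt (fun_deg S) 1" by (simp add: A.filt_iff)
        have "0 = ?h (int m) (c * x)" using c(2) True by (simp add: A.filt_iff)
        also have "c * x = ?h 0 c * x + (c - ?h 0 c) * x" by (simp add: algebra_simps)
        also have "?h (int m) \<dots> = ?h (int m) (?h 0 c * x) + ?h (int m) ((c - ?h 0 c) * x)"
          by (rule A.hcomponent_add) auto
        also have "?h (int m) ((c - ?h 0 c) * x) = 0"
          using filt_fun_mult[OF c1 x] by (simp add: A.filt_iff)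
        also have "?h (int m) (?h 0 c * x) = ?h 0 c * ?h (int m) x"
          using hcomponent_mult_left[OF hcomp_mem[of 0 c], of "int m" x] by simp
        finally have "model S (?h 0 c * ?h (int m) x) p vs = 0" by (simp add: model_zero)
        then show "model S (?h (int m) x) p vs = model S 0 p vs"
          using c(1) by (simp add: model_scalar_mult[OF hcomp_mem] model_hcomponent model_zero)
      qed
      then show ?thesis using x True
        by (auto simp: A.filt_iff) (metis not_less_iff_gr_or_eq zless_add1_eq add.commute)
    next
      case False
      then show ?thesis using Suc by simp
    qed
  qed
  from this[of "nat n"] show ?thesis
    using A.filt_all[of n] by (cases "0 \<le> n") auto
qed

lemma vf_par_linear: "X \<in> vf_par S \<epsilon> \<Longrightarrow> linear X"
  by (simp add: vf_par_def)

lemma vf_par_maps: "X \<in> vf_par S \<epsilon> \<Longrightarrow> a \<in> fun_par S \<delta> \<Longrightarrow> X a \<in> fun_par S (\<delta> + \<epsilon>)"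
  by (simp add: vf_par_def)

lemma vf_par_Leibniz:
  "X \<in> vf_par S \<epsilon> \<Longrightarrow> a \<in> fun_par S \<delta> \<Longrightarrow> X (a * b) = X a * b + (- 1) ^ (\<epsilon> * \<delta>) *\<^sub>R (a * X b)"
  by (simp add: vf_par_def)

text \<open>A derivation is controlled by its values in degrees \<open>0\<close> and \<open>1\<close>. By induction on the degree of the
  argument: near a point, \<open>c a = \<Sum> \<alpha>\<^sub>i \<beta>\<^sub>i\<close> with \<open>\<alpha>\<^sub>i\<close> of degree \<open>1\<close>, the Leibniz rule bounds the degree of
  \<open>X (c a)\<close>, and \<open>c (X a) = X (c a) - (X c) a\<close>.\<close>

lemma vf_par_filt:
  assumes X: "X \<in> vf_par S \<epsilon>"
    and X0: "\<And>a. a \<in> fun_deg S 0 \<Longrightarrow> X a \<in> filt (fun_deg S) j"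
    and X1: "\<And>a. a \<in> fun_deg S 1 \<Longrightarrow> X a \<in> filt (fun_deg S) (j + 1)"
    and a: "a \<in> filt (fun_deg S) i"
  shows "X a \<in> filt (fun_deg S) (i + j)"
proof -
  have hom: "X a \<in> filt (fun_deg S) (int k + j)" if "a \<in> fun_deg S (int k)" for a k
    using that
  proof (induction k arbitrary: a)
    case 0
    then show ?case using X0 by simp
  next
    case (Suc k)
    show ?case
    proof (rule filt_local)
      fix p
      obtain c \<alpha> \<beta> where c: "c \<in> fun_deg S 0" "model S c p [] = 1"
        and \<alpha>: "\<And>i. i < odd_dim S \<Longrightarrow> \<alpha> i \<in> fun_deg S 1"
        and \<beta>: "\<And>i. i < odd_dim S \<Longrightarrow> \<beta> i \<in> fun_deg S (int (Suc k) - 1)"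
        and ca: "c * a = (\<Sum>i<odd_dim S. \<alpha> i * \<beta> i)"
        using local_generation[OF Suc.prems, of p] by auto
      have "X (\<alpha> i * \<beta> i) \<in> filt (fun_deg S) (int (Suc k) + j)" if i: "i < odd_dim S" for i
      proof -
        have \<alpha>i: "\<alpha> i \<in> fun_par S 1" using \<alpha>[OF i] by (rule fun_deg_par) simp
        have "X (\<alpha> i) * \<beta> i \<in> filt (fun_deg S) ((j + 1) + int k)"
          using filt_fun_mult[OF X1[OF \<alpha>[OF i]] A.homogeneous_filt[OF \<beta>[OF i] order_refl]] by simp
        moreover have "\<alpha> i * X (\<beta> i) \<in> filt (fun_deg S) (1 + (int k + j))"
          using filt_fun_mult[OF A.homogeneous_filt[OF \<alpha>[OF i] order_refl] Suc.IH[of "\<beta> i"]] \<beta>[OF i] by simp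
        ultimately show ?thesis unfolding vf_par_Leibniz[OF X \<alpha>i]
          by (intro A.filt_add filt_fun_scale) (simp_all add: algebra_simps)
      qed
      then have 1: "X (c * a) \<in> filt (fun_deg S) (int (Suc k) + j)"
        unfolding ca linear_sum[OF vf_par_linear[OF X]] by (intro A.filt_sum) auto
      have 2: "X c * a \<in> filt (fun_deg S) (j + int (Suc k))"
        by (rule filt_fun_mult[OF X0[OF c(1)] A.homogeneous_filt[OF Suc.prems order_refl]])
      have "c * X a = X (c * a) - X c * a"
        using vf_par_Leibniz[OF X fun_deg_par[OF c(1), of 0]] by simp
      then have "c * X a \<in> filt (fun_deg S) (int (Suc k) + j)"
        using A.filt_diff[OF 1] 2 by (simp add: add.commute)
      then show "\<exists>c. model S c p [] = 1 \<and> c * X a \<in> filt (fun_deg S) (int (Suc k) + j)"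
        using c(2) by blast
    qed
  qed
  have "X (hcomponent (fun_deg S) k a) \<in> filt (fun_deg S) (i + j)" for k
  proof (cases "0 \<le> k \<and> i \<le> k")
    case True
    have "X (hcomponent (fun_deg S) k a) \<in> filt (fun_deg S) (int (nat k) + j)"
      using True by (intro hom) (simp add: A.hcomponent_mem)
    then show ?thesis using True by (elim A.filt_mono) simp
  next
    case False
    then have "hcomponent (fun_deg S) k a = 0"
      using a A.bounded[OF hcomp_mem, of k a] by (auto simp: A.filt_iff)
    then show ?thesis using linear_0[OF vf_par_linear[OF X]] A.filt_zero by simp
  qed
  then have "X (\<Sum>k\<in>{0..int (odd_dim S)}. hcomponent (fun_deg S) k a) \<in> filt (fun_deg S) (i + j)"
    unfolding linear_sum[OF vf_par_linear[OF X]] by (intro A.filt_sum)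
  then show ?thesis by (simp add: A.sum_hcomponent)
qed

lemma vf_linear: "X \<in> vf S \<Longrightarrow> linear X"
  unfolding vf_def using vf_par_linear linear_compose_add by (auto simp: plus_fun_def) blast

lemma vf_filt_from_generators:
  assumes X: "X \<in> vf S"
    and X0: "\<And>a. a \<in> fun_deg S 0 \<Longrightarrow> X a \<in> filt (fun_deg S) j"
    and X1: "\<And>a. a \<in> fun_deg S 1 \<Longrightarrow> X a \<in> filt (fun_deg S) (j + 1)"
    and a: "a \<in> filt (fun_deg S) i"
  shows "X a \<in> filt (fun_deg S) (i + j)"
proof -
  obtain Y Z where YZ: "Y \<in> vf_par S 0" "Z \<in> vf_par S 1" "X = Y + Z" using X unfolding vf_def by blast
  have parts: "Y b \<in> filt (fun_deg S) k" "Z b \<in> filt (fun_deg S) k"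
    if b: "b \<in> fun_par S \<delta>" and "X b \<in> filt (fun_deg S) k" for b k \<delta>
    using filt_par_parts[of "Y b" \<delta> "Z b" k] vf_par_maps[OF YZ(1) b] vf_par_maps[OF YZ(2) b] that YZ(3) by auto
  have "Y a \<in> filt (fun_deg S) (i + j)"
    by (rule vf_par_filt[OF YZ(1) _ _ a])
      (use parts(1)[OF fun_deg_par[of _ 0 0]] parts(1)[OF fun_deg_par[of _ 1 1]] X0 X1 in auto)
  moreover have "Z a \<in> filt (fun_deg S) (i + j)"
    by (rule vf_par_filt[OF YZ(2) _ _ a])
      (use parts(2)[OF fun_deg_par[of _ 0 0]] parts(2)[OF fun_deg_par[of _ 1 1]] X0 X1 in auto)
  ultimately show ?thesis unfolding YZ(3) by (simp add: A.filt_add)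
qed

text \<open>Superfunctions have no negative degrees, so that the bounds on generators hold with \<open>j = -1\<close>.\<close>

lemma vf_lowers_by_1:
  assumes "X \<in> vf S" "a \<in> filt (fun_deg S) i"
  shows "X a \<in> filt (fun_deg S) (i - 1)"
  using vf_filt_from_generators[OF assms(1) _ _ assms(2), of "- 1"] A.filt_all[of "-1"] A.filt_all[of 0] by simp

section \<open>Automorphisms\<close>

lemma automorphismD:
  assumes "\<phi> \<in> automorphisms S"
  shows "bij \<phi>" "linear \<phi>" "\<phi> (a * b) = \<phi> a * \<phi> b" "a \<in> fun_par S \<delta> \<Longrightarrow> \<phi> a \<in> fun_par S \<delta>"
    "\<exists>\<sigma>. diffeo S \<sigma> \<and> (\<forall>a. body S (\<phi> a) = body S a \<circ> \<sigma>)"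
  using assms unfolding automorphisms_def by blast+

text \<open>Automorphisms need not preserve the degree, but they cannot lower it. In degree \<open>1\<close> this is
  parity. The general case follows by local generation at the image \<open>\<sigma> q\<close> of the point \<open>q\<close>, since
  the value of \<open>\<phi> c\<close> at \<open>q\<close> is that of \<open>c\<close> at \<open>\<sigma> q\<close>.\<close>

lemma automorphism_filt:
  assumes \<phi>: "\<phi> \<in> automorphisms S" and a: "a \<in> filt (fun_deg S) i"
  shows "\<phi> a \<in> filt (fun_deg S) i"
proof -
  obtain \<sigma> where "\<forall>a. body S (\<phi> a) = body S a \<circ> \<sigma>" using automorphismD(5)[OF \<phi>] by blast
  then have \<sigma>: "model S (\<phi> a) q [] = model S a (\<sigma> q) []" for a q by (metis body_def comp_apply)
  have hom: "\<phi> a \<in> filt (fun_deg S) (int k)" if "a \<in> fun_deg S (int k)" for a k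
    using that
  proof (induction k arbitrary: a)
    case 0
    then show ?case using A.filt_all[of 0] by simp
  next
    case (Suc k)
    show ?case
    proof (rule filt_local)
      fix q
      obtain c \<alpha> \<beta> where c: "c \<in> fun_deg S 0" "model S c (\<sigma> q) [] = 1"
        and \<alpha>: "\<And>i. i < odd_dim S \<Longrightarrow> \<alpha> i \<in> fun_deg S 1"
        and \<beta>: "\<And>i. i < odd_dim S \<Longrightarrow> \<beta> i \<in> fun_deg S (int (Suc k) - 1)"
        and ca: "c * a = (\<Sum>i<odd_dim S. \<alpha> i * \<beta> i)"
        using local_generation[OF Suc.prems, of "\<sigma> q"] by auto
      have "\<phi> (\<alpha> i * \<beta> i) \<in> filt (fun_deg S) (1 + int k)" if i: "i < odd_dim S" for i
      proof -
        have "\<phi> (\<alpha> i) \<in> filt (fun_deg S) 1"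
          by (intro odd_filt_1 automorphismD(4)[OF \<phi>] fun_deg_par[OF \<alpha>[OF i]]) simp
        then show ?thesis unfolding automorphismD(3)[OF \<phi>]
          using Suc.IH[of "\<beta> i"] \<beta>[OF i] by (intro filt_fun_mult) auto
      qed
      then have "\<phi> (c * a) \<in> filt (fun_deg S) (int (Suc k))"
        unfolding ca linear_sum[OF automorphismD(2)[OF \<phi>]] by (intro A.filt_sum) auto
      then show "\<exists>c. model S c q [] = 1 \<and> c * \<phi> a \<in> filt (fun_deg S) (int (Suc k))"
        using c(2) \<sigma> automorphismD(3)[OF \<phi>] by (intro exI[of _ "\<phi> c"]) simp
    qed
  qed
  have "\<phi> (hcomponent (fun_deg S) k a) \<in> filt (fun_deg S) i" for k
  proof (cases "0 \<le> k \<and> i \<le> k")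
    case True
    have "\<phi> (hcomponent (fun_deg S) k a) \<in> filt (fun_deg S) (int (nat k))"
      using True by (intro hom) (simp add: A.hcomponent_mem)
    then show ?thesis using True by (elim A.filt_mono) simp
  next
    case False
    then have "hcomponent (fun_deg S) k a = 0"
      using a A.bounded[OF hcomp_mem, of k a] by (auto simp: A.filt_iff)
    then show ?thesis using linear_0[OF automorphismD(2)[OF \<phi>]] A.filt_zero by simp
  qed
  then have "\<phi> (\<Sum>k\<in>{0..int (odd_dim S)}. hcomponent (fun_deg S) k a) \<in> filt (fun_deg S) i"
    unfolding linear_sum[OF automorphismD(2)[OF \<phi>]] by (intro A.filt_sum)
  then show ?thesis by (simp add: A.sum_hcomponent)
qed

lemma automorphism_id: "id \<in> automorphisms S"
  unfolding automorphisms_def diffeo_def smooth_map_def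
  by (auto simp: o_def linear_id intro!: exI[of _ id] simp flip: id_def)

lemma automorphism_comp:
  assumes \<phi>: "\<phi> \<in> automorphisms S" and \<psi>: "\<psi> \<in> automorphisms S"
  shows "\<phi> \<circ> \<psi> \<in> automorphisms S"
proof -
  obtain \<sigma> where \<sigma>: "diffeo S \<sigma>" "\<And>a. body S (\<phi> a) = body S a \<circ> \<sigma>" using automorphismD(5)[OF \<phi>] by blast
  obtain \<tau> where \<tau>: "diffeo S \<tau>" "\<And>a. body S (\<psi> a) = body S a \<circ> \<tau>" using automorphismD(5)[OF \<psi>] by blast
  have sm: "smooth_map S (f \<circ> g)" if f: "smooth_map S f" and g: "smooth_map S g" for f g
    unfolding smooth_map_def
  proof (intro conjI allI impI)
    have "continuous_on UNIV f" "continuous_on UNIV g" using f g by (simp_all add: smooth_map_def)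
    then show "continuous_on UNIV (f \<circ> g)"
      using continuous_on_compose[of UNIV g f] continuous_on_subset[of UNIV f "range g"] by simp
    fix W h assume W: "open W \<and> smooth_on S W h"
    then have "smooth_on S (f -` W) (h \<circ> f)" "open (f -` W)"
      using f unfolding smooth_map_def by (auto intro: open_vimage)
    then have "smooth_on S (g -` (f -` W)) ((h \<circ> f) \<circ> g)"
      using g unfolding smooth_map_def by blast
    then show "smooth_on S ((f \<circ> g) -` W) (h \<circ> (f \<circ> g))" by (simp add: o_assoc vimage_comp)
  qed
  have "diffeo S (\<tau> \<circ> \<sigma>)"
    using \<sigma>(1) \<tau>(1) sm unfolding diffeo_def by (auto simp: o_inv_distrib bij_comp)
  then show ?thesis
    unfolding automorphisms_def
    using automorphismD[OF \<phi>] automorphismD[OF \<psi>] \<sigma>(2) \<tau>(2)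
    by (auto simp: bij_comp linear_compose o_assoc intro!: exI[of _ "\<tau> \<circ> \<sigma>"])
qed

text \<open>The inverse preserves parity because the even and the odd part of a preimage are mapped to the even
  and the odd part.\<close>

lemma automorphism_inv:
  assumes \<phi>: "\<phi> \<in> automorphisms S"
  shows "inv \<phi> \<in> automorphisms S"
proof -
  note D = automorphismD[OF \<phi>]
  have inv: "\<phi> (inv \<phi> a) = a" "inv \<phi> (\<phi> a) = a" for a
    using D(1) by (simp_all add: bij_is_surj surj_f_inv_f bij_is_inj inv_f_f)
  obtain \<sigma> where \<sigma>: "diffeo S \<sigma>" "\<And>a. body S (\<phi> a) = body S a \<circ> \<sigma>" using D(5) by blast
  have b\<sigma>: "bij \<sigma>" using \<sigma>(1) by (simp add: diffeo_def)
  have "inv \<phi> a \<in> fun_par S \<delta>" if a: "a \<in> fun_par S \<delta>" for a \<delta>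
  proof -
    obtain b c where bc: "b \<in> fun_par S 0" "c \<in> fun_par S 1" "inv \<phi> a = b + c" by (rule fun_par_decomp)
    have a_eq: "a = \<phi> b + \<phi> c" using inv(1)[of a] bc(3) linear_add[OF D(2)] by simp
    have \<phi>bc: "\<phi> b \<in> fun_par S 0" "\<phi> c \<in> fun_par S 1" using D(4) bc by blast+
    have zero: "x = 0" if "\<phi> x = 0" for x using inv(2)[of x] inv(2)[of 0] that linear_0[OF D(2)] by simp
    show ?thesis
    proof (cases "even \<delta>")
      case True
      then have "a \<in> fun_par S 0" using a fun_par_cong[of \<delta> 0] by simp
      then have "\<phi> c \<in> fun_par S 0" using fun_par_diff[OF _ \<phi>bc(1)] a_eq by (metis add_diff_cancel_left')
      then have "c = 0" using \<phi>bc(2) fun_par_disjoint[of "\<phi> c" 0] zero by simp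
      then show ?thesis using bc True fun_par_cong[of \<delta> 0] by simp
    next
      case False
      then have "a \<in> fun_par S 1" using a fun_par_cong[of \<delta> 1] by simp
      then have "\<phi> b \<in> fun_par S 1" using fun_par_diff[OF _ \<phi>bc(2)] a_eq by (metis add_diff_cancel_right')
      then have "b = 0" using \<phi>bc(1) fun_par_disjoint[of "\<phi> b" 0] zero by simp
      then show ?thesis using bc False fun_par_cong[of \<delta> 1] by simp
    qed
  qed
  moreover have "linear (inv \<phi>)"
  proof (rule linearI)
    show "inv \<phi> (a + b) = inv \<phi> a + inv \<phi> b" for a b
      using inv(2)[of "inv \<phi> a + inv \<phi> b"] by (simp add: linear_add[OF D(2)] inv(1))
    show "inv \<phi> (r *\<^sub>R a) = r *\<^sub>R inv \<phi> a" for r a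
      using inv(2)[of "r *\<^sub>R inv \<phi> a"] by (simp add: linear_scale[OF D(2)] inv(1))
  qed
  moreover have "inv \<phi> (a * b) = inv \<phi> a * inv \<phi> b" for a b
    using inv(2)[of "inv \<phi> a * inv \<phi> b"] by (simp add: D(3) inv(1))
  moreover have "body S (inv \<phi> a) = body S a \<circ> inv \<sigma>" for a
  proof -
    have "body S a = body S (inv \<phi> a) \<circ> \<sigma>" using \<sigma>(2)[of "inv \<phi> a"] inv by simp
    moreover have "\<sigma> \<circ> inv \<sigma> = id" using b\<sigma> bij_is_surj surj_iff by blast
    ultimately show ?thesis by (simp flip: o_assoc)
  qed
  moreover have "diffeo S (inv \<sigma>)"
    using \<sigma>(1) by (simp add: diffeo_def bij_imp_bij_inv inv_inv_eq)
  ultimately show ?thesis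
    unfolding automorphisms_def image_subset_iff
    by (intro CollectI conjI allI ballI exI[of _ "inv \<sigma>"] bij_imp_bij_inv[OF D(1)]) blast+
qed

end

section \<open>The modules of vector fields and of linear forms\<close>

text \<open>Left multiplication with a superfunction is given by the same formula for vector fields and for
  linear forms. This allows a common treatment of the two modules.\<close>

definition lmult :: "'a::real_algebra_1 \<Rightarrow> ('z \<Rightarrow> 'a) \<Rightarrow> 'z \<Rightarrow> 'a" where
  "lmult f T = (\<lambda>z. f * T z)"

lemma lmult_add_right: "lmult f (T + T') = lmult f T + lmult f T'"
  and lmult_add_left: "lmult (f + f') T = lmult f T + lmult f' T"
  and lmult_zero: "lmult f 0 = 0" "lmult 0 T = 0"
  by (auto simp: lmult_def algebra_simps)

lemma lmult_sum_right: "lmult f (sum T I) = (\<Sum>i\<in>I. lmult f (T i))"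
  by (auto simp: lmult_def fun_sum_apply sum_distrib_left)

lemma lmult_sum_left: "lmult (sum f I) T = (\<Sum>i\<in>I. lmult (f i) T)"
  by (auto simp: lmult_def fun_sum_apply sum_distrib_right)

context supermanifold
begin

abbreviation hA :: "int \<Rightarrow> 'a \<Rightarrow> 'a" where
  "hA \<equiv> hcomponent (fun_deg S)"

lemma vf_parI:
  assumes "linear X" "\<And>\<delta> a. a \<in> fun_par S \<delta> \<Longrightarrow> X a \<in> fun_par S (\<delta> + \<epsilon>)"
    "\<And>\<delta> a b. a \<in> fun_par S \<delta> \<Longrightarrow> X (a * b) = X a * b + (- 1) ^ (\<epsilon> * \<delta>) *\<^sub>R (a * X b)"
  shows "X \<in> vf_par S \<epsilon>"
  using assms by (simp add: vf_par_def)

lemma vf_par_cong: "even \<epsilon> = even \<epsilon>' \<Longrightarrow> vf_par S \<epsilon> = vf_par S \<epsilon>'"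
proof -
  have "X \<in> vf_par S \<epsilon>'" if "even \<epsilon> = even \<epsilon>'" "X \<in> vf_par S \<epsilon>" for X \<epsilon> \<epsilon>'
  proof (rule vf_parI[OF vf_par_linear[OF that(2)]])
    fix \<delta> a b assume a: "a \<in> fun_par S \<delta>"
    show "X a \<in> fun_par S (\<delta> + \<epsilon>')"
      using vf_par_maps[OF that(2) a] fun_par_cong[of "\<delta> + \<epsilon>" "\<delta> + \<epsilon>'"] that(1) by simp
    show "X (a * b) = X a * b + (- 1) ^ (\<epsilon>' * \<delta>) *\<^sub>R (a * X b)"
      using vf_par_Leibniz[OF that(2) a] that(1) by (simp add: minus_one_power_iff)
  qed
  then show "even \<epsilon> = even \<epsilon>' \<Longrightarrow> vf_par S \<epsilon> = vf_par S \<epsilon>'" by blast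
qed

lemma vf_par_zero: "0 \<in> vf_par S \<epsilon>"
  by (rule vf_parI) (auto simp: fun_par_zero linear_zero zero_fun_def)

lemma vf_par_diff:
  assumes "X \<in> vf_par S \<epsilon>" "Y \<in> vf_par S \<epsilon>"
  shows "X - Y \<in> vf_par S \<epsilon>"
proof (rule vf_parI)
  show "linear (X - Y)"
    using linear_compose_sub[OF vf_par_linear[OF assms(1)] vf_par_linear[OF assms(2)]] by (simp add: fun_diff_def)
qed (use assms in \<open>simp_all add: vf_par_maps fun_par_diff vf_par_Leibniz algebra_simps\<close>)

lemma vf_par_uminus: "X \<in> vf_par S \<epsilon> \<Longrightarrow> - X \<in> vf_par S \<epsilon>"
  using vf_par_diff[OF vf_par_zero] by force

lemma vf_par_add: "X \<in> vf_par S \<epsilon> \<Longrightarrow> Y \<in> vf_par S \<epsilon> \<Longrightarrow> X + Y \<in> vf_par S \<epsilon>"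
  using vf_par_diff[OF _ vf_par_uminus, of X \<epsilon> Y] by simp

lemma vf_par_lmult:
  assumes f: "f \<in> fun_par S \<gamma>" and X: "X \<in> vf_par S \<epsilon>"
  shows "lmult f X \<in> vf_par S (\<gamma> + \<epsilon>)"
proof (rule vf_parI)
  show "linear (lmult f X)"
    unfolding lmult_def using vf_par_linear[OF X]
    by (intro linearI) (simp_all add: linear_add linear_scale distrib_left)
  fix \<delta> a b assume a: "a \<in> fun_par S \<delta>"
  show "lmult f X a \<in> fun_par S (\<delta> + (\<gamma> + \<epsilon>))"
    using fun_par_mult[OF f vf_par_maps[OF X a]] by (simp add: lmult_def ac_simps)
  have "f * (a * X b) = (f * a) * X b" by (simp add: mult.assoc)
  also have "\<dots> = (- 1) ^ (\<gamma> * \<delta>) *\<^sub>R (a * (f * X b))"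
    by (simp add: fun_par_commute[OF f a] mult.assoc)
  finally show "lmult f X (a * b) = lmult f X a * b + (- 1) ^ ((\<gamma> + \<epsilon>) * \<delta>) *\<^sub>R (a * lmult f X b)"
    by (simp add: lmult_def vf_par_Leibniz[OF X a] distrib_left mult.assoc power_add add_mult_distrib mult.commute)
qed

lemma vf_par_vf: "X \<in> vf_par S \<epsilon> \<Longrightarrow> X \<in> vf S"
proof -
  assume X: "X \<in> vf_par S \<epsilon>"
  show "X \<in> vf S"
  proof (cases "even \<epsilon>")
    case True
    then have "X \<in> vf_par S 0" using X vf_par_cong[of \<epsilon> 0] by simp
    then show ?thesis unfolding vf_def using vf_par_zero[of 1] by (metis (mono_tags, lifting) add.right_neutral mem_Collect_eq)
  next
    case False
    then have "X \<in> vf_par S 1" using X vf_par_cong[of \<epsilon> 1] by simp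
    then show ?thesis unfolding vf_def using vf_par_zero[of 0] by (metis (mono_tags, lifting) add.left_neutral mem_Collect_eq)
  qed
qed

lemma vf_decomp: assumes "X \<in> vf S" obtains Y Z where "Y \<in> vf_par S 0" "Z \<in> vf_par S 1" "X = Y + Z"
  using assms unfolding vf_def by blast

lemma vfI: "Y \<in> vf_par S 0 \<Longrightarrow> Z \<in> vf_par S 1 \<Longrightarrow> Y + Z \<in> vf S"
  unfolding vf_def by blast

lemma vf_diff: assumes "X \<in> vf S" "X' \<in> vf S" shows "X - X' \<in> vf S"
proof -
  obtain Y Z where "Y \<in> vf_par S 0" "Z \<in> vf_par S 1" "X = Y + Z" using vf_decomp[OF assms(1)] .
  moreover obtain Y' Z' where "Y' \<in> vf_par S 0" "Z' \<in> vf_par S 1" "X' = Y' + Z'" using vf_decomp[OF assms(2)] .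
  ultimately have "(Y - Y') + (Z - Z') \<in> vf S" by (intro vfI vf_par_diff)
  then show ?thesis using \<open>X = _\<close> \<open>X' = _\<close> by (simp add: algebra_simps)
qed

lemma vf_zero: "0 \<in> vf S" using vf_par_vf[OF vf_par_zero] .

lemma vf_add: "X \<in> vf S \<Longrightarrow> X' \<in> vf S \<Longrightarrow> X + X' \<in> vf S"
  using vf_diff[OF _ vf_diff[OF vf_zero], of X X'] by simp

lemma vf_sum: "(\<And>i. i \<in> I \<Longrightarrow> f i \<in> vf S) \<Longrightarrow> sum f I \<in> vf S"
  by (induction I rule: infinite_finite_induct) (auto intro: vf_add vf_zero)

lemma vf_lmult: assumes "X \<in> vf S" shows "lmult f X \<in> vf S"
proof -
  obtain Y Z where YZ: "Y \<in> vf_par S 0" "Z \<in> vf_par S 1" "X = Y + Z" using vf_decomp[OF assms] .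
  obtain b c where bc: "b \<in> fun_par S 0" "c \<in> fun_par S 1" "f = b + c" by (rule fun_par_decomp)
  have "lmult b Y + lmult b Z + lmult c Y + lmult c Z \<in> vf S"
    using YZ bc by (intro vf_add vf_par_vf[OF vf_par_lmult])
  then show ?thesis unfolding YZ bc lmult_add_left lmult_add_right by (simp add: ac_simps)
qed

lemma vf_par_disjoint: assumes "X \<in> vf_par S \<epsilon>" "X \<in> vf_par S (Suc \<epsilon>)" shows "X = 0"
proof
  fix a
  have z: "X b = 0" if "b \<in> fun_par S \<delta>" for b \<delta>
    using fun_par_disjoint[of "X b" "\<delta> + \<epsilon>"] vf_par_maps[OF _ that] assms by fastforce
  obtain b c where "b \<in> fun_par S 0" "c \<in> fun_par S 1" "a = b + c" by (rule fun_par_decomp)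
  then show "X a = 0 a" using z linear_add[OF vf_par_linear[OF assms(1)]] by simp
qed

text \<open>Identities between biadditive expressions, such as the Leibniz rule, need only be checked on
  homogeneous arguments.\<close>

lemma fun_bilinear_homogeneous:
  fixes R :: "'a \<Rightarrow> 'a \<Rightarrow> 'a"
  assumes R: "\<And>a a' b. R (a + a') b = R a b + R a' b" "\<And>a b b'. R a (b + b') = R a b + R a b'"
    and hom: "\<And>i k a b. a \<in> fun_deg S i \<Longrightarrow> a \<in> fun_par S \<delta> \<Longrightarrow> b \<in> fun_deg S k \<Longrightarrow> R a b = 0"
    and a: "a \<in> fun_par S \<delta>"
  shows "R a b = 0"
proof -
  have 0: "R 0 b = 0" "R a 0 = 0" for a b using R(1)[of 0 0 b] R(2)[of a 0 0] by simp_all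
  have s1: "R (sum f I) b = (\<Sum>i\<in>I. R (f i) b)" for f b and I :: "int set"
    by (induction I rule: infinite_finite_induct) (auto simp: 0 R)
  have s2: "R a (sum f I) = (\<Sum>i\<in>I. R a (f i))" for f a and I :: "int set"
    by (induction I rule: infinite_finite_induct) (auto simp: 0 R)
  have "R a b = R (\<Sum>i\<in>{0..int (odd_dim S)}. hA i a) (\<Sum>k\<in>{0..int (odd_dim S)}. hA k b)"
    by (simp add: A.sum_hcomponent)
  also have "\<dots> = 0"
    unfolding s1 s2 using hom[OF hcomp_mem hcomponent_par[OF a] hcomp_mem] by simp
  finally show ?thesis .
qed

lemma graded_maps_vf:
  "graded_maps (fun_deg S) UNIV 0 (int (odd_dim S)) (fun_deg S) UNIV 0 (int (odd_dim S)) (vf S)"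
  by unfold_locales (auto simp: vf_zero vf_diff linear_add[OF vf_linear])

interpretation V0: graded_maps "fun_deg S" UNIV 0 "int (odd_dim S)" "fun_deg S" UNIV 0 "int (odd_dim S)" "vf S"
  by (rule graded_maps_vf)

text \<open>The homogeneous components of a derivation are derivations: for homogeneous arguments the Leibniz
  rule of the component is the part of the Leibniz rule in a single degree.\<close>

lemma vf_par_component:
  assumes X: "X \<in> vf_par S \<epsilon>"
  shows "V0.shift_part n X \<in> vf_par S \<epsilon>"
proof (rule vf_parI)
  note Xv = vf_par_vf[OF X]
  let ?P = "V0.shift_part n X"
  have P_add: "?P (a + b) = ?P a + ?P b" for a b by (rule V0.shift_part_add[OF Xv]) auto
  have P_hom: "?P a = hA (i + n) (X a)" if "a \<in> fun_deg S i" for a i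
    by (rule V0.shift_part_homogeneous[OF Xv that])
  show "linear ?P"
  proof (rule linearI)
    show "?P (a + b) = ?P a + ?P b" for a b by (rule P_add)
    show "?P (r *\<^sub>R b) = r *\<^sub>R ?P b" for r b
      by (simp add: V0.shift_part_def hcomponent_scale linear_scale[OF vf_par_linear[OF X]] scaleR_right.sum)
  qed
  fix \<delta> a b assume a: "a \<in> fun_par S \<delta>"
  show "?P a \<in> fun_par S (\<delta> + \<epsilon>)"
    using vf_par_maps[OF X hcomponent_par[OF a]] by (auto simp: V0.shift_part_def intro!: fun_par_sum hcomponent_par)
  have "?P (a * b) - (?P a * b + (- 1) ^ (\<epsilon> * \<delta>) *\<^sub>R (a * ?P b)) = 0"
  proof (rule fun_bilinear_homogeneous[where R = "\<lambda>a b. ?P (a * b) - (?P a * b + (- 1) ^ (\<epsilon> * \<delta>) *\<^sub>R (a * ?P b))",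
        OF _ _ _ a])
    fix i k a b assume h: "a \<in> fun_deg S i" "a \<in> fun_par S \<delta>" "b \<in> fun_deg S k"
    have "?P (a * b) = hA (i + k + n) (X a * b) + hA (i + k + n) ((- 1) ^ (\<epsilon> * \<delta>) *\<^sub>R (a * X b))"
      by (simp add: P_hom[OF fun_deg_mult[OF h(1) h(3)]] vf_par_Leibniz[OF X h(2)] A.hcomponent_add)
    also have "hA (i + k + n) (X a * b) = ?P a * b"
      using hcomponent_mult_right[OF h(3), of "i + n" "X a"] P_hom[OF h(1)] by (simp add: ac_simps)
    also have "hA (i + k + n) ((- 1) ^ (\<epsilon> * \<delta>) *\<^sub>R (a * X b)) = (- 1) ^ (\<epsilon> * \<delta>) *\<^sub>R (a * ?P b)"
      using hcomponent_mult_left[OF h(1), of "k + n" "X b"] P_hom[OF h(3)] by (simp add: hcomponent_scale ac_simps)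
    finally show "?P (a * b) - (?P a * b + (- 1) ^ (\<epsilon> * \<delta>) *\<^sub>R (a * ?P b)) = 0" by simp
  qed (simp_all add: P_add algebra_simps)
  then show "?P (a * b) = ?P a * b + (- 1) ^ (\<epsilon> * \<delta>) *\<^sub>R (a * ?P b)" by simp
qed

lemma hom_grading_vf:
  "hom_grading (fun_deg S) UNIV 0 (int (odd_dim S)) (fun_deg S) UNIV 0 (int (odd_dim S)) (vf S)"
proof unfold_locales
  fix X n assume "X \<in> vf S"
  then obtain Y Z where YZ: "Y \<in> vf_par S 0" "Z \<in> vf_par S 1" "X = Y + Z" by (rule vf_decomp)
  then have "V0.shift_part n X = V0.shift_part n Y + V0.shift_part n Z"
    by (simp add: V0.shift_part_plus vf_par_vf)
  then show "V0.shift_part n X \<in> vf S"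
    using vfI[OF vf_par_component[OF YZ(1)] vf_par_component[OF YZ(2)]] by metis
qed

interpretation V1: hom_grading "fun_deg S" UNIV 0 "int (odd_dim S)" "fun_deg S" UNIV 0 "int (odd_dim S)" "vf S"
  by (rule hom_grading_vf)

lemma vf_deg_eq: "V0.Deg = vf_deg S"
  by (auto simp: fun_eq_iff V0.Deg_def vf_deg_def)

abbreviation hV :: "int \<Rightarrow> ('a \<Rightarrow> 'a) \<Rightarrow> 'a \<Rightarrow> 'a" where
  "hV \<equiv> hcomponent (vf_deg S)"

lemma grading_vf: "grading (vf_deg S) (vf S) (- int (odd_dim S)) (int (odd_dim S))"
  using V1.grading_Deg by (simp add: vf_deg_eq)

lemma filt_vf_iff:
  "X \<in> filt (vf_deg S) k \<longleftrightarrow> X \<in> vf S \<and> (\<forall>i. \<forall>a\<in>filt (fun_deg S) i. X a \<in> filt (fun_deg S) (i + k))"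
  using V1.filt_Deg_iff by (simp add: vf_deg_eq)

lemma hV_apply: "X \<in> vf S \<Longrightarrow> a \<in> fun_deg S i \<Longrightarrow> hV n X a = hA (i + n) (X a)"
  using V1.hcomponent_Deg_apply by (simp add: vf_deg_eq)

lemma hV_par: "X \<in> vf_par S \<epsilon> \<Longrightarrow> hV n X \<in> vf_par S \<epsilon>"
  using V1.hcomponent_Deg[OF vf_par_vf] vf_par_component by (simp add: vf_deg_eq)

end

text \<open>A graded module over the superfunctions with a compatible family \<open>P\<close> of parity parts.\<close>

locale supermodule = supermanifold S + D: grading G C lo hi
  for S :: "('m::{t2_space, second_countable_topology}, 'v::real_vector, 'a::real_algebra_1) batchelor"
    and G :: "int \<Rightarrow> ('z \<Rightarrow> 'a) set" and C lo hi +
  fixes P :: "nat \<Rightarrow> ('z \<Rightarrow> 'a) set"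
  assumes par_zero: "0 \<in> P \<delta>"
    and par_diff: "T \<in> P \<delta> \<Longrightarrow> T' \<in> P \<delta> \<Longrightarrow> T - T' \<in> P \<delta>"
    and par_carrier: "T \<in> P \<delta> \<Longrightarrow> T \<in> C"
    and lmult_deg: "f \<in> fun_deg S k \<Longrightarrow> T \<in> G j \<Longrightarrow> lmult f T \<in> G (k + j)"
    and lmult_carrier: "T \<in> C \<Longrightarrow> lmult f T \<in> C"
    and par_component: "T \<in> P \<delta> \<Longrightarrow> hcomponent G j T \<in> P \<delta>"
begin

lemma par_uminus: "T \<in> P \<delta> \<Longrightarrow> - T \<in> P \<delta>"
  using par_diff[OF par_zero] by force

lemma par_add: "T \<in> P \<delta> \<Longrightarrow> T' \<in> P \<delta> \<Longrightarrow> T + T' \<in> P \<delta>"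
  using par_diff[OF _ par_uminus, of T \<delta> T'] by simp

lemma par_sum: "(\<And>i. i \<in> I \<Longrightarrow> f i \<in> P \<delta>) \<Longrightarrow> sum f I \<in> P \<delta>"
  by (induction I rule: infinite_finite_induct) (auto intro: par_add par_zero)

lemma hcomponent_lmult:
  assumes f: "f \<in> fun_deg S k" and T: "T \<in> C"
  shows "hcomponent G (k + j) (lmult f T) = lmult f (hcomponent G j T)"
proof -
  have "hcomponent G (k + j) (lmult f T) = hcomponent G (k + j) (\<Sum>i\<in>{lo..hi}. lmult f (hcomponent G i T))"
    by (simp add: D.sum_hcomponent[OF T] flip: lmult_sum_right)
  also have "\<dots> = (\<Sum>i\<in>{lo..hi}. hcomponent G (k + j) (lmult f (hcomponent G i T)))"
    using T by (intro D.hcomponent_sum lmult_carrier D.hcomponent_carrier)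
  also have "\<dots> = (\<Sum>i\<in>{lo..hi}. if i = j then lmult f (hcomponent G j T) else 0)"
    by (rule sum.cong) (auto simp: D.hcomponent_homogeneous[OF lmult_deg[OF f D.hcomponent_mem[OF T]]])
  also have "\<dots> = lmult f (hcomponent G j T)"
    using D.bounded[OF D.hcomponent_mem[OF T], of j] by (auto simp: lmult_zero)
  finally show ?thesis .
qed

lemma filt_lmult:
  assumes f: "f \<in> filt (fun_deg S) i" and T: "T \<in> filt G j"
  shows "lmult f T \<in> filt G (i + j)"
proof -
  note TC = D.filt_carrier[OF T]
  have "lmult (hA k f) (hcomponent G n T) \<in> filt G (i + j)" for k n
  proof (cases "k < i \<or> n < j")
    case True
    then have "lmult (hA k f) (hcomponent G n T) = 0"
      using f T by (auto simp: A.filt_iff D.filt_iff lmult_zero)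
    then show ?thesis by (simp add: D.filt_zero)
  next
    case False
    then show ?thesis
      by (intro D.homogeneous_filt[OF lmult_deg[OF hcomp_mem D.hcomponent_mem[OF TC]]]) auto
  qed
  then have "(\<Sum>k\<in>{0..int (odd_dim S)}. \<Sum>n\<in>{lo..hi}. lmult (hA k f) (hcomponent G n T)) \<in> filt G (i + j)"
    by (intro D.filt_sum)
  then show ?thesis
    by (simp add: A.sum_hcomponent D.sum_hcomponent[OF TC] flip: lmult_sum_right lmult_sum_left)
qed

end

context supermanifold
begin

lemma vf_deg_lmult: "f \<in> fun_deg S k \<Longrightarrow> X \<in> vf_deg S j \<Longrightarrow> lmult f X \<in> vf_deg S (k + j)"
proof -
  assume f: "f \<in> fun_deg S k" and X: "X \<in> vf_deg S j"
  have "f * X a \<in> fun_deg S (i + (k + j))" if "a \<in> fun_deg S i" for a i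
    using fun_deg_mult[OF f, of "X a" "i + j"] X that by (auto simp: vf_deg_def image_subset_iff ac_simps)
  then show ?thesis using X by (auto simp: vf_deg_def vf_lmult) (simp add: lmult_def)
qed

sublocale V: supermodule S "vf_deg S" "vf S" "- int (odd_dim S)" "int (odd_dim S)" "vf_par S"
proof -
  interpret V: grading "vf_deg S" "vf S" "- int (odd_dim S)" "int (odd_dim S)" by (rule grading_vf)
  show "supermodule S (vf_deg S) (vf S) (- int (odd_dim S)) (int (odd_dim S)) (vf_par S)"
    by unfold_locales (auto simp: vf_par_zero vf_par_diff vf_par_vf vf_lmult vf_deg_lmult hV_par)
qed

lemma module_bilinear_homogeneous:
  fixes R :: "'a \<Rightarrow> ('a \<Rightarrow> 'a) \<Rightarrow> 'b::ab_group_add"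
  assumes R1: "\<And>f f' X. X \<in> vf S \<Longrightarrow> R (f + f') X = R f X + R f' X"
    and R2: "\<And>f X Y. X \<in> vf S \<Longrightarrow> Y \<in> vf S \<Longrightarrow> R f (X + Y) = R f X + R f Y"
    and hom: "\<And>k i. R (hA k f) (hV i X) = 0"
    and X: "X \<in> vf S"
  shows "R f X = 0"
proof -
  have 0: "R 0 X = 0" if "X \<in> vf S" for X using R1[OF that, of 0 0] by simp
  have zr: "R f 0 = 0" for f using R2[OF vf_zero vf_zero, of f] by simp
  have s1: "R (sum g I) X = (\<Sum>i\<in>I. R (g i) X)" if "X \<in> vf S" for g X and I :: "int set"
    by (induction I rule: infinite_finite_induct) (auto simp: 0 R1 that)
  have s2: "R f (sum g I) = (\<Sum>i\<in>I. R f (g i))" if "\<And>i. g i \<in> vf S" for g f and I :: "int set"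
  proof (induction I rule: infinite_finite_induct)
    case (insert i I)
    show ?case using insert.IH
      unfolding sum.insert[OF insert.hyps] R2[OF that vf_sum[OF that]] by metis
  qed (unfold sum.infinite sum.empty, metis zr, metis zr)
  let ?X = "\<Sum>i\<in>{- int (odd_dim S)..int (odd_dim S)}. hV i X"
  have "R f X = R (\<Sum>k\<in>{0..int (odd_dim S)}. hA k f) ?X"
    using V.D.sum_hcomponent[OF X] by (simp add: A.sum_hcomponent)
  also have "\<dots> = (\<Sum>k\<in>{0..int (odd_dim S)}. R (hA k f) ?X)"
    by (rule s1) (simp add: V.D.sum_hcomponent X)
  also have "\<dots> = 0"
    using hom by (simp add: s2 V.D.hcomponent_carrier[OF X])
  finally show ?thesis .
qed

end

context supermanifold
begin

lemma dual_parI: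
  assumes "\<And>X. X \<notin> vf S \<Longrightarrow> \<alpha> X = 0"
    "\<And>X Y. X \<in> vf S \<Longrightarrow> Y \<in> vf S \<Longrightarrow> \<alpha> (X + Y) = \<alpha> X + \<alpha> Y"
    "\<And>\<delta> f X. f \<in> fun_par S \<delta> \<Longrightarrow> X \<in> vf S \<Longrightarrow> \<alpha> (lmult f X) = (- 1) ^ (\<epsilon> * \<delta>) *\<^sub>R (f * \<alpha> X)"
    "\<And>\<delta> X. X \<in> vf_par S \<delta> \<Longrightarrow> \<alpha> X \<in> fun_par S (\<delta> + \<epsilon>)"
  shows "\<alpha> \<in> dual_par S \<epsilon>"
  using assms by (simp add: dual_par_def lmult_def)

lemma dual_parD:
  assumes "\<alpha> \<in> dual_par S \<epsilon>"
  shows "X \<notin> vf S \<Longrightarrow> \<alpha> X = 0"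
    "X \<in> vf S \<Longrightarrow> Y \<in> vf S \<Longrightarrow> \<alpha> (X + Y) = \<alpha> X + \<alpha> Y"
    "f \<in> fun_par S \<delta> \<Longrightarrow> X \<in> vf S \<Longrightarrow> \<alpha> (lmult f X) = (- 1) ^ (\<epsilon> * \<delta>) *\<^sub>R (f * \<alpha> X)"
    "X \<in> vf_par S \<delta> \<Longrightarrow> \<alpha> X \<in> fun_par S (\<delta> + \<epsilon>)"
  using assms unfolding dual_par_def lmult_def by blast+

lemma dual_par_cong: "even \<epsilon> = even \<epsilon>' \<Longrightarrow> dual_par S \<epsilon> = dual_par S \<epsilon>'"
proof -
  have "\<alpha> \<in> dual_par S \<epsilon>'" if "even \<epsilon> = even \<epsilon>'" "\<alpha> \<in> dual_par S \<epsilon>" for \<alpha> \<epsilon> \<epsilon>'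
  proof (rule dual_parI)
    fix \<delta> X assume X: "X \<in> vf_par S \<delta>"
    have "fun_par S (\<delta> + \<epsilon>) = fun_par S (\<delta> + \<epsilon>')" using that(1) by (intro fun_par_cong) simp
    then show "\<alpha> X \<in> fun_par S (\<delta> + \<epsilon>')"
      using dual_parD(4)[OF that(2) X] by metis
  next
    fix \<delta> f X assume "f \<in> fun_par S \<delta>" "X \<in> vf S"
    then show "\<alpha> (lmult f X) = (- 1) ^ (\<epsilon>' * \<delta>) *\<^sub>R (f * \<alpha> X)"
      using dual_parD(3)[OF that(2)] that(1) by (simp add: minus_one_power_iff)
  qed (use dual_parD[OF that(2)] in auto)
  then show "even \<epsilon> = even \<epsilon>' \<Longrightarrow> dual_par S \<epsilon> = dual_par S \<epsilon>'" by blast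
qed

lemma dual_par_zero: "0 \<in> dual_par S \<epsilon>"
  by (rule dual_parI) (auto simp: fun_par_zero)

lemma dual_par_diff:
  assumes "\<alpha> \<in> dual_par S \<epsilon>" "\<beta> \<in> dual_par S \<epsilon>"
  shows "\<alpha> - \<beta> \<in> dual_par S \<epsilon>"
  by (rule dual_parI)
    (simp_all add: dual_parD[OF assms(1)] dual_parD[OF assms(2)] fun_par_diff algebra_simps)

lemma dual_par_lmult:
  assumes f: "f \<in> fun_par S \<gamma>" and \<alpha>: "\<alpha> \<in> dual_par S \<epsilon>"
  shows "lmult f \<alpha> \<in> dual_par S (\<gamma> + \<epsilon>)"
proof (rule dual_parI)
  fix \<delta> h X assume h: "h \<in> fun_par S \<delta>" and X: "X \<in> vf S"
  have "f * (h * \<alpha> X) = (- 1) ^ (\<gamma> * \<delta>) *\<^sub>R (h * (f * \<alpha> X))"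
    by (simp add: fun_par_commute[OF f h] flip: mult.assoc)
  then show "lmult f \<alpha> (lmult h X) = (- 1) ^ ((\<gamma> + \<epsilon>) * \<delta>) *\<^sub>R (h * lmult f \<alpha> X)"
    by (simp add: lmult_def[of f] dual_parD(3)[OF \<alpha> h X] power_add add_mult_distrib add_mult_distrib2 mult.commute)
next
  fix \<delta> X assume "X \<in> vf_par S \<delta>"
  then show "lmult f \<alpha> X \<in> fun_par S (\<delta> + (\<gamma> + \<epsilon>))"
    using fun_par_mult[OF f dual_parD(4)[OF \<alpha>]] by (simp add: lmult_def ac_simps)
qed (simp_all add: lmult_def dual_parD[OF \<alpha>] distrib_left)

lemma dualI: "\<alpha> \<in> dual_par S 0 \<Longrightarrow> \<beta> \<in> dual_par S 1 \<Longrightarrow> \<alpha> + \<beta> \<in> dual S"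
  unfolding dual_def by blast

lemma dual_par_dual: assumes "\<alpha> \<in> dual_par S \<epsilon>" shows "\<alpha> \<in> dual S"
proof (cases "even \<epsilon>")
  case True
  then show ?thesis using assms dual_par_cong[of \<epsilon> 0] dualI[OF _ dual_par_zero, of \<alpha>] by simp
next
  case False
  then show ?thesis using assms dual_par_cong[of \<epsilon> 1] dualI[OF dual_par_zero, of \<alpha>] by simp
qed

lemma dual_decomp:
  assumes "\<alpha> \<in> dual S" obtains \<beta> \<gamma> where "\<beta> \<in> dual_par S 0" "\<gamma> \<in> dual_par S 1" "\<alpha> = \<beta> + \<gamma>"
  using assms unfolding dual_def by blast

lemma dual_zero: "0 \<in> dual S" using dual_par_dual[OF dual_par_zero] .

lemma dual_diff: assumes "X \<in> dual S" "X' \<in> dual S" shows "X - X' \<in> dual S"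
proof -
  obtain Y Z where 1: "Y \<in> dual_par S 0" "Z \<in> dual_par S 1" "X = Y + Z" using dual_decomp[OF assms(1)] .
  obtain Y' Z' where 2: "Y' \<in> dual_par S 0" "Z' \<in> dual_par S 1" "X' = Y' + Z'" using dual_decomp[OF assms(2)] .
  have "(Y - Y') + (Z - Z') \<in> dual S" using 1 2 by (intro dualI dual_par_diff)
  then show ?thesis unfolding 1 2 by (simp add: algebra_simps)
qed

lemma dual_add: "X \<in> dual S \<Longrightarrow> X' \<in> dual S \<Longrightarrow> X + X' \<in> dual S"
  using dual_diff[OF _ dual_diff[OF dual_zero], of X X'] by simp

lemma dual_lmult: assumes "X \<in> dual S" shows "lmult f X \<in> dual S"
proof -
  obtain Y Z where YZ: "Y \<in> dual_par S 0" "Z \<in> dual_par S 1" "X = Y + Z" using dual_decomp[OF assms] .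
  obtain b c where bc: "b \<in> fun_par S 0" "c \<in> fun_par S 1" "f = b + c" by (rule fun_par_decomp)
  have "lmult b Y + lmult b Z + lmult c Y + lmult c Z \<in> dual S"
    using YZ bc by (intro dual_add dual_par_dual[OF dual_par_lmult])
  then show ?thesis unfolding YZ bc lmult_add_left lmult_add_right by (simp add: ac_simps)
qed

lemma dual_outside: "\<alpha> \<in> dual S \<Longrightarrow> X \<notin> vf S \<Longrightarrow> \<alpha> X = 0"
  by (elim dual_decomp) (auto simp: dual_parD)

lemma dual_add_arg: "\<alpha> \<in> dual S \<Longrightarrow> X \<in> vf S \<Longrightarrow> Y \<in> vf S \<Longrightarrow> \<alpha> (X + Y) = \<alpha> X + \<alpha> Y"
  by (elim dual_decomp) (auto simp: dual_parD)

lemma graded_maps_dual: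
  "graded_maps (vf_deg S) (vf S) (- int (odd_dim S)) (int (odd_dim S))
     (fun_deg S) UNIV 0 (int (odd_dim S)) (dual S)"
  by unfold_locales (auto simp: dual_zero dual_diff dual_add_arg dual_outside)

interpretation D0: graded_maps "vf_deg S" "vf S" "- int (odd_dim S)" "int (odd_dim S)"
  "fun_deg S" UNIV 0 "int (odd_dim S)" "dual S"
  by (rule graded_maps_dual)

text \<open>As for vector fields, the components inherit linearity from the homogeneous arguments.\<close>

lemma dual_par_component:
  assumes \<alpha>: "\<alpha> \<in> dual_par S \<epsilon>"
  shows "D0.shift_part n \<alpha> \<in> dual_par S \<epsilon>"
proof (rule dual_parI)
  note \<alpha>d = dual_par_dual[OF \<alpha>]
  let ?P = "D0.shift_part n \<alpha>"
  have P_add: "?P (X + Y) = ?P X + ?P Y" if "X \<in> vf S" "Y \<in> vf S" for X Y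
    using that by (rule D0.shift_part_add[OF \<alpha>d])
  then show "\<And>X Y. X \<in> vf S \<Longrightarrow> Y \<in> vf S \<Longrightarrow> ?P (X + Y) = ?P X + ?P Y" .
  have P_hom: "?P X = hA (i + n) (\<alpha> X)" if "X \<in> vf_deg S i" for X i
    by (rule D0.shift_part_homogeneous[OF \<alpha>d that])
  show "?P X = 0" if "X \<notin> vf S" for X using that by (rule D0.shift_part_outside)
  show "?P X \<in> fun_par S (\<delta> + \<epsilon>)" if X: "X \<in> vf_par S \<delta>" for \<delta> X
    using vf_par_vf[OF X] dual_parD(4)[OF \<alpha> hV_par[OF X]]
    by (simp add: D0.shift_part_def fun_par_sum hcomponent_par)
  fix \<delta> f X assume f: "f \<in> fun_par S \<delta>" and X: "X \<in> vf S"
  let ?R = "\<lambda>f X. ?P (lmult f X) - (- 1) ^ (\<epsilon> * \<delta>) *\<^sub>R (f * ?P X)"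
  have "?R f X = 0"
  proof (rule module_bilinear_homogeneous[where R = ?R, OF _ _ _ X])
    show "?R (hA k f) (hV i X) = 0" for k i
    proof -
      have fk: "hA k f \<in> fun_deg S k" "hA k f \<in> fun_par S \<delta>" using hcomp_mem hcomponent_par[OF f] by auto
      have Xi: "hV i X \<in> vf_deg S i" using X by (rule V.D.hcomponent_mem)
      have "?P (lmult (hA k f) (hV i X)) = hA (k + i + n) (\<alpha> (lmult (hA k f) (hV i X)))"
        by (rule P_hom[OF vf_deg_lmult[OF fk(1) Xi]])
      also have "\<dots> = (- 1) ^ (\<epsilon> * \<delta>) *\<^sub>R hA (k + i + n) (hA k f * \<alpha> (hV i X))"
        by (simp add: dual_parD(3)[OF \<alpha> fk(2) V.D.hcomponent_carrier[OF X]] hcomponent_scale)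
      also have "hA (k + i + n) (hA k f * \<alpha> (hV i X)) = hA k f * ?P (hV i X)"
        using hcomponent_mult_left[OF fk(1), of "i + n"] by (simp add: P_hom[OF Xi] add.assoc)
      finally show ?thesis by simp
    qed
  qed (simp_all add: lmult_add_left lmult_add_right P_add vf_lmult algebra_simps)
  then show "?P (lmult f X) = (- 1) ^ (\<epsilon> * \<delta>) *\<^sub>R (f * ?P X)" by simp
qed

lemma hom_grading_dual:
  "hom_grading (vf_deg S) (vf S) (- int (odd_dim S)) (int (odd_dim S))
     (fun_deg S) UNIV 0 (int (odd_dim S)) (dual S)"
proof unfold_locales
  fix \<alpha> n assume "\<alpha> \<in> dual S"
  then obtain \<beta> \<gamma> where bc: "\<beta> \<in> dual_par S 0" "\<gamma> \<in> dual_par S 1" "\<alpha> = \<beta> + \<gamma>" by (rule dual_decomp)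
  then have "D0.shift_part n \<alpha> = D0.shift_part n \<beta> + D0.shift_part n \<gamma>"
    by (simp add: D0.shift_part_plus dual_par_dual)
  then show "D0.shift_part n \<alpha> \<in> dual S"
    using dualI[OF dual_par_component[OF bc(1)] dual_par_component[OF bc(2)]] by metis
qed

interpretation D1: hom_grading "vf_deg S" "vf S" "- int (odd_dim S)" "int (odd_dim S)"
  "fun_deg S" UNIV 0 "int (odd_dim S)" "dual S"
  by (rule hom_grading_dual)

lemma dual_deg_eq: "D0.Deg = dual_deg S"
  by (auto simp: fun_eq_iff D0.Deg_def dual_deg_def)

lemma filt_dual_iff:
  "\<alpha> \<in> filt (dual_deg S) k \<longleftrightarrow> \<alpha> \<in> dual S \<and> (\<forall>i. \<forall>X\<in>filt (vf_deg S) i. \<alpha> X \<in> filt (fun_deg S) (i + k))"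
  using D1.filt_Deg_iff by (simp add: dual_deg_eq)

lemma dual_deg_lmult: "f \<in> fun_deg S k \<Longrightarrow> \<alpha> \<in> dual_deg S j \<Longrightarrow> lmult f \<alpha> \<in> dual_deg S (k + j)"
proof -
  assume f: "f \<in> fun_deg S k" and \<alpha>: "\<alpha> \<in> dual_deg S j"
  have "f * \<alpha> X \<in> fun_deg S (i + (k + j))" if "X \<in> vf_deg S i" for X i
    using fun_deg_mult[OF f, of "\<alpha> X" "i + j"] \<alpha> that by (auto simp: dual_deg_def image_subset_iff ac_simps)
  then show ?thesis using \<alpha> by (auto simp: dual_deg_def dual_lmult) (simp add: lmult_def)
qed

sublocale D: supermodule S "dual_deg S" "dual S" "0 - int (odd_dim S)" "int (odd_dim S) - (- int (odd_dim S))" "dual_par S"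
proof -
  interpret D: grading "dual_deg S" "dual S" "0 - int (odd_dim S)" "int (odd_dim S) - (- int (odd_dim S))"
    using D1.grading_Deg unfolding dual_deg_eq .
  have "hcomponent (dual_deg S) j \<alpha> \<in> dual_par S \<delta>" if "\<alpha> \<in> dual_par S \<delta>" for \<alpha> \<delta> j
    using D1.hcomponent_Deg[OF dual_par_dual[OF that]] dual_par_component[OF that] by (simp add: dual_deg_eq)
  then show "supermodule S (dual_deg S) (dual S) (0 - int (odd_dim S)) (int (odd_dim S) - (- int (odd_dim S))) (dual_par S)"
    by unfold_locales (auto simp: dual_par_zero dual_par_diff dual_par_dual dual_lmult dual_deg_lmult)
qed

end

section \<open>Even linear maps from vector fields to a module\<close>

context supermodule
begin

text \<open>For the modules of vector fields and of linear forms, this is the even part of the endomorphisms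
  and of the bilinear forms, respectively.\<close>

definition even_maps :: "(('a \<Rightarrow> 'a) \<Rightarrow> 'z \<Rightarrow> 'a) set" where
  "even_maps = {h.
     (\<forall>X. X \<notin> vf S \<longrightarrow> h X = 0) \<and>
     (\<forall>X\<in>vf S. \<forall>Y\<in>vf S. h (X + Y) = h X + h Y) \<and>
     (\<forall>f. \<forall>X\<in>vf S. h (\<lambda>a. f * X a) = (\<lambda>z. f * h X z)) \<and>
     (\<forall>\<delta>. h ` vf_par S \<delta> \<subseteq> P \<delta>)}"

lemma even_mapsI:
  assumes "\<And>X. X \<notin> vf S \<Longrightarrow> h X = 0"
    "\<And>X Y. X \<in> vf S \<Longrightarrow> Y \<in> vf S \<Longrightarrow> h (X + Y) = h X + h Y"
    "\<And>f X. X \<in> vf S \<Longrightarrow> h (lmult f X) = lmult f (h X)"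
    "\<And>\<delta> X. X \<in> vf_par S \<delta> \<Longrightarrow> h X \<in> P \<delta>"
  shows "h \<in> even_maps"
  using assms by (auto simp: even_maps_def lmult_def)

lemma even_mapsD:
  assumes "h \<in> even_maps"
  shows "X \<notin> vf S \<Longrightarrow> h X = 0"
    "X \<in> vf S \<Longrightarrow> Y \<in> vf S \<Longrightarrow> h (X + Y) = h X + h Y"
    "X \<in> vf S \<Longrightarrow> h (lmult f X) = lmult f (h X)"
    "X \<in> vf_par S \<delta> \<Longrightarrow> h X \<in> P \<delta>"
  using assms unfolding even_maps_def lmult_def by blast+

lemma even_maps_carrier: "h \<in> even_maps \<Longrightarrow> X \<in> vf S \<Longrightarrow> h X \<in> C"
proof -
  assume h: "h \<in> even_maps" and "X \<in> vf S"
  then obtain Y Z where YZ: "Y \<in> vf_par S 0" "Z \<in> vf_par S 1" "X = Y + Z" by (elim vf_decomp)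
  then have "h X = h Y + h Z" using even_mapsD(2)[OF h] vf_par_vf by blast
  then show "h X \<in> C"
    using D.carrier_add[OF par_carrier[OF even_mapsD(4)[OF h YZ(1)]] par_carrier[OF even_mapsD(4)[OF h YZ(2)]]]
    by metis
qed

lemma even_maps_diff: "h \<in> even_maps \<Longrightarrow> k \<in> even_maps \<Longrightarrow> h - k \<in> even_maps"
proof (rule even_mapsI)
  assume h: "h \<in> even_maps" and k: "k \<in> even_maps"
  show "(h - k) X = 0" if "X \<notin> vf S" for X
    using even_mapsD(1)[OF h that] even_mapsD(1)[OF k that] by simp
  show "(h - k) (X + Y) = (h - k) X + (h - k) Y" if "X \<in> vf S" "Y \<in> vf S" for X Y
    by (rule ext) (simp add: even_mapsD(2)[OF h that] even_mapsD(2)[OF k that])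
  show "(h - k) (lmult f X) = lmult f ((h - k) X)" if "X \<in> vf S" for f X
    by (rule ext)
      (simp add: even_mapsD(3)[OF h that] even_mapsD(3)[OF k that], simp add: lmult_def right_diff_distrib)
  show "(h - k) X \<in> P \<delta>" if "X \<in> vf_par S \<delta>" for X \<delta>
    using par_diff[OF even_mapsD(4)[OF h that] even_mapsD(4)[OF k that]] by (simp add: fun_diff_def)
qed

lemma even_maps_zero: "0 \<in> even_maps"
  by (rule even_mapsI) (simp_all only: zero_fun_apply add_0 lmult_zero par_zero)

lemma graded_maps_even:
  "graded_maps (vf_deg S) (vf S) (- int (odd_dim S)) (int (odd_dim S)) G C lo hi even_maps"
  by unfold_locales (auto simp: even_maps_zero even_maps_diff even_maps_carrier even_mapsD(1,2))

interpretation M0: graded_maps "vf_deg S" "vf S" "- int (odd_dim S)" "int (odd_dim S)" G C lo hi even_maps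
  by (rule graded_maps_even)

lemma hom_grading_even:
  "hom_grading (vf_deg S) (vf S) (- int (odd_dim S)) (int (odd_dim S)) G C lo hi even_maps"
proof unfold_locales
  fix h n assume h: "h \<in> even_maps"
  let ?P = "M0.shift_part n h"
  have P_add: "?P (X + Y) = ?P X + ?P Y" if "X \<in> vf S" "Y \<in> vf S" for X Y
    using that by (rule M0.shift_part_add[OF h])
  have P_hom: "?P X = hcomponent G (i + n) (h X)" if "X \<in> vf_deg S i" for X i
    by (rule M0.shift_part_homogeneous[OF h that])
  show "?P \<in> even_maps"
  proof (rule even_mapsI)
    show "?P X = 0" if "X \<notin> vf S" for X using that by (rule M0.shift_part_outside)
    show "?P X \<in> P \<delta>" if X: "X \<in> vf_par S \<delta>" for \<delta> X
      using vf_par_vf[OF X] even_mapsD(4)[OF h hV_par[OF X]]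
      by (simp add: M0.shift_part_def par_sum par_component)
    fix f X assume X: "X \<in> vf S"
    let ?R = "\<lambda>f X. ?P (lmult f X) - lmult f (?P X)"
    have "?R f X = 0"
    proof (rule module_bilinear_homogeneous[where R = ?R, OF _ _ _ X])
      show "?R (hA k f) (hV i X) = 0" for k i
      proof -
        have Xi: "hV i X \<in> vf_deg S i" "hV i X \<in> vf S"
          using X by (auto intro: V.D.hcomponent_mem V.D.hcomponent_carrier)
        have "?P (lmult (hA k f) (hV i X)) = hcomponent G (k + i + n) (lmult (hA k f) (h (hV i X)))"
          by (simp add: P_hom[OF vf_deg_lmult[OF hcomp_mem Xi(1)]] even_mapsD(3)[OF h Xi(2)])
        also have "\<dots> = lmult (hA k f) (?P (hV i X))"
          using hcomponent_lmult[OF hcomp_mem even_maps_carrier[OF h Xi(2)], of k "i + n"]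
          by (simp add: P_hom[OF Xi(1)] add.assoc)
        finally show ?thesis by simp
      qed
    qed (simp_all add: lmult_add_left lmult_add_right P_add vf_lmult algebra_simps)
    then show "?P (lmult f X) = lmult f (?P X)" by simp
  qed (rule P_add)
qed

end

context supermanifold
begin

lemma even_maps_end: "V.even_maps = end_even S"
  by (simp add: V.even_maps_def end_even_def)

lemma even_maps_hom: "D.even_maps = hom_even S"
  by (simp add: D.even_maps_def hom_even_def)

interpretation E1: hom_grading "vf_deg S" "vf S" "- int (odd_dim S)" "int (odd_dim S)"
  "vf_deg S" "vf S" "- int (odd_dim S)" "int (odd_dim S)" "end_even S"
  using V.hom_grading_even unfolding even_maps_end .

interpretation H1: hom_grading "vf_deg S" "vf S" "- int (odd_dim S)" "int (odd_dim S)"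
  "dual_deg S" "dual S" "0 - int (odd_dim S)" "int (odd_dim S) - (- int (odd_dim S))" "hom_even S"
  using D.hom_grading_even unfolding even_maps_hom .

lemma end_deg_eq: "E1.Deg = end_deg S"
  by (auto simp: fun_eq_iff E1.Deg_def end_deg_def)

lemma hom_deg_eq: "H1.Deg = hom_deg S"
  by (auto simp: fun_eq_iff H1.Deg_def hom_deg_def)

lemma filt_end_iff:
  "W \<in> filt (end_deg S) k \<longleftrightarrow> W \<in> end_even S \<and> (\<forall>i. \<forall>X\<in>filt (vf_deg S) i. W X \<in> filt (vf_deg S) (i + k))"
  using E1.filt_Deg_iff by (simp add: end_deg_eq)

lemmas grading_hom = H1.grading_Deg[unfolded hom_deg_eq]

sublocale H: grading "hom_deg S" "hom_even S"
  "0 - int (odd_dim S) - int (odd_dim S)" "int (odd_dim S) - - int (odd_dim S) - - int (odd_dim S)"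
  by (rule grading_hom)

lemma filt_hom_iff:
  "h \<in> filt (hom_deg S) k \<longleftrightarrow> h \<in> hom_even S \<and>
    (\<forall>i j. \<forall>X\<in>filt (vf_deg S) i. \<forall>Y\<in>filt (vf_deg S) j. h X Y \<in> filt (fun_deg S) (i + j + k))"
proof -
  have "h \<in> filt (hom_deg S) k \<longleftrightarrow> h \<in> hom_even S \<and> (\<forall>i. \<forall>X\<in>filt (vf_deg S) i. h X \<in> filt (dual_deg S) (i + k))"
    using H1.filt_Deg_iff by (simp add: hom_deg_eq)
  moreover have "h X \<in> dual S" if "h \<in> hom_even S" "X \<in> filt (vf_deg S) i" for X i
    using H1.maps_into[OF that(1) V.D.filt_carrier[OF that(2)]] .
  moreover have "j + (i + k) = i + j + k" for i j :: int by simp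
  ultimately show ?thesis unfolding filt_dual_iff by (metis (no_types, lifting))
qed

lemmas hom_evenD = D.even_mapsD[unfolded even_maps_hom]
  and hom_evenI = D.even_mapsI[unfolded even_maps_hom]
  and hom_even_dual = D.even_maps_carrier[unfolded even_maps_hom]
  and end_evenD = V.even_mapsD[unfolded even_maps_end]
  and end_evenI = V.even_mapsI[unfolded even_maps_end]
  and end_even_vf = V.even_maps_carrier[unfolded even_maps_end]

end

section \<open>The action of automorphisms\<close>

context supermanifold
begin

text \<open>The vector field \<open>\<phi>\<^sup>-\<^sup>1 X \<phi>\<close>, in terms of which the actions on forms and metrics are defined.\<close>

definition pull :: "('a \<Rightarrow> 'a) \<Rightarrow> ('a \<Rightarrow> 'a) \<Rightarrow> 'a \<Rightarrow> 'a" where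
  "pull \<phi> X = inv \<phi> \<circ> X \<circ> \<phi>"

definition act_dual :: "('a \<Rightarrow> 'a) \<Rightarrow> (('a \<Rightarrow> 'a) \<Rightarrow> 'a) \<Rightarrow> ('a \<Rightarrow> 'a) \<Rightarrow> 'a" where
  "act_dual \<phi> \<alpha> = (\<lambda>Y. \<phi> (\<alpha> (pull \<phi> Y)))"

definition supersymmetric :: "(('a \<Rightarrow> 'a) \<Rightarrow> ('a \<Rightarrow> 'a) \<Rightarrow> 'a) \<Rightarrow> bool" where
  "supersymmetric h \<longleftrightarrow> (\<forall>\<epsilon> \<delta>. \<forall>X\<in>vf_par S \<epsilon>. \<forall>Y\<in>vf_par S \<delta>. h X Y = (-1) ^ (\<epsilon> * \<delta>) *\<^sub>R h Y X)"

lemma act_metric_eq: "act_metric \<phi> h X = act_dual \<phi> (h (pull \<phi> X))"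
  by (simp add: act_metric_def act_dual_def pull_def fun_eq_iff)

lemma act_metric_apply: "act_metric \<phi> h X Y = \<phi> (h (pull \<phi> X) (pull \<phi> Y))"
  by (simp add: act_metric_def pull_def)

lemma act_metric_id: "act_metric id h = h"
  by (simp add: act_metric_def fun_eq_iff)

lemma supersymmetricD:
  "supersymmetric h \<Longrightarrow> X \<in> vf_par S \<epsilon> \<Longrightarrow> Y \<in> vf_par S \<delta> \<Longrightarrow> h X Y = (-1) ^ (\<epsilon> * \<delta>) *\<^sub>R h Y X"
  unfolding supersymmetric_def by blast

lemma filt_vf_parts:
  assumes Y: "Y \<in> vf_par S 0" and Z: "Z \<in> vf_par S 1" and YZ: "Y + Z \<in> filt (vf_deg S) k"
  shows "Y \<in> filt (vf_deg S) k" "Z \<in> filt (vf_deg S) k"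
proof -
  have main: "Y a \<in> filt (fun_deg S) (i + k) \<and> Z a \<in> filt (fun_deg S) (i + k)" if a: "a \<in> filt (fun_deg S) i" for a i
  proof -
    obtain b c where bc: "b \<in> fun_par S 0" "c \<in> fun_par S 1" "a = b + c" by (rule fun_par_decomp)
    have f: "b \<in> filt (fun_deg S) i" "c \<in> filt (fun_deg S) i"
      using filt_par_parts[of b 0 c i] bc a by auto
    have "Y x \<in> filt (fun_deg S) (i + k) \<and> Z x \<in> filt (fun_deg S) (i + k)"
      if x: "x \<in> fun_par S \<delta>" "x \<in> filt (fun_deg S) i" for x \<delta>
    proof -
      have "Y x + Z x \<in> filt (fun_deg S) (i + k)"
        using YZ x(2) unfolding filt_vf_iff by (metis plus_fun_apply)
      then show ?thesis
        using filt_par_parts[of "Y x" \<delta> "Z x" "i + k"] vf_par_maps[OF Y x(1)] vf_par_maps[OF Z x(1)] by simp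
    qed
    from this[OF bc(1) f(1)] this[OF bc(2) f(2)] show ?thesis
      unfolding bc(3) by (simp add: linear_add[OF vf_par_linear[OF Y]] linear_add[OF vf_par_linear[OF Z]] A.filt_add)
  qed
  show "Y \<in> filt (vf_deg S) k" "Z \<in> filt (vf_deg S) k"
    unfolding filt_vf_iff using main vf_par_vf[OF Y] vf_par_vf[OF Z] by blast+
qed

lemma vf_eq_filt: "vf S = filt (vf_deg S) (- 1)"
  using vf_lowers_by_1 by (auto simp: filt_vf_iff)

lemma dual_par_disjoint: assumes "\<alpha> \<in> dual_par S \<epsilon>" "\<alpha> \<in> dual_par S (Suc \<epsilon>)" shows "\<alpha> = 0"
proof
  fix X
  have z: "\<alpha> Y = 0" if "Y \<in> vf_par S \<delta>" for Y \<delta>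
    using fun_par_disjoint[of "\<alpha> Y" "\<delta> + \<epsilon>"] dual_parD(4)[OF assms(1) that] dual_parD(4)[OF assms(2) that] by simp
  show "\<alpha> X = 0 X"
  proof (cases "X \<in> vf S")
    case True
    then obtain Y Z where "Y \<in> vf_par S 0" "Z \<in> vf_par S 1" "X = Y + Z" by (rule vf_decomp)
    then show ?thesis using z dual_parD(2)[OF assms(1)] vf_par_vf by (metis add.right_neutral zero_fun_apply)
  qed (simp add: dual_parD(1)[OF assms(1)])
qed

lemma hom_even_apply:
  assumes h: "h \<in> hom_even S"
  shows "Y \<notin> vf S \<Longrightarrow> h X Y = 0"
    "X \<in> vf S \<Longrightarrow> Y \<in> vf S \<Longrightarrow> X' \<in> vf S \<Longrightarrow> h (X + X') Y = h X Y + h X' Y"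
    "X \<in> vf S \<Longrightarrow> Y \<in> vf S \<Longrightarrow> Y' \<in> vf S \<Longrightarrow> h X (Y + Y') = h X Y + h X Y'"
proof -
  show "h X Y = 0" if "Y \<notin> vf S"
  proof (cases "X \<in> vf S")
    case True
    then show ?thesis using dual_outside[OF hom_even_dual[OF h True] that] by simp
  next
    case False
    then show ?thesis using hom_evenD(1)[OF h False] by simp
  qed
  show "h (X + X') Y = h X Y + h X' Y" if "X \<in> vf S" "Y \<in> vf S" "X' \<in> vf S"
    using hom_evenD(2)[OF h that(1,3)] by (metis plus_fun_apply)
  show "h X (Y + Y') = h X Y + h X Y'" if "X \<in> vf S" "Y \<in> vf S" "Y' \<in> vf S"
    using dual_add_arg[OF hom_even_dual[OF h that(1)] that(2,3)] .
qed

text \<open>Bilinear forms are determined by their values on vector fields of definite parity. These are the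
  arguments for which sign rules are available.\<close>

lemma hom_even_eqI:
  assumes h: "h \<in> hom_even S" and k: "k \<in> hom_even S"
    and eq: "\<And>\<epsilon> \<delta> X Y. X \<in> vf_par S \<epsilon> \<Longrightarrow> Y \<in> vf_par S \<delta> \<Longrightarrow> h X Y = k X Y"
  shows "h = k"
proof (intro ext)
  fix X Y
  show "h X Y = k X Y"
  proof (cases "X \<in> vf S \<and> Y \<in> vf S")
    case True
    then obtain X0 X1 where X: "X0 \<in> vf_par S 0" "X1 \<in> vf_par S 1" "X = X0 + X1" by (blast elim: vf_decomp)
    obtain Y0 Y1 where Y: "Y0 \<in> vf_par S 0" "Y1 \<in> vf_par S 1" "Y = Y0 + Y1" using True by (blast elim: vf_decomp)
    note v = vf_par_vf[OF X(1)] vf_par_vf[OF X(2)] vf_par_vf[OF Y(1)] vf_par_vf[OF Y(2)]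
    show ?thesis unfolding X(3) Y(3)
      by (simp only: hom_even_apply(2,3)[OF h] hom_even_apply(2,3)[OF k] v vf_add
          eq[OF X(1) Y(1)] eq[OF X(1) Y(2)] eq[OF X(2) Y(1)] eq[OF X(2) Y(2)])
  next
    case False
    then consider "X \<notin> vf S" | "Y \<notin> vf S" by blast
    then show ?thesis
    proof cases
      case 1
      then show ?thesis by (metis hom_evenD(1)[OF h 1] hom_evenD(1)[OF k 1])
    next
      case 2
      then show ?thesis by (simp only: hom_even_apply(1)[OF h 2] hom_even_apply(1)[OF k 2])
    qed
  qed
qed

context
  fixes \<phi>
  assumes \<phi>: "\<phi> \<in> automorphisms S"
begin

lemma inv_cancel: "\<phi> (inv \<phi> a) = a" "inv \<phi> (\<phi> a) = a"
  using automorphismD(1)[OF \<phi>] by (simp_all add: bij_is_surj surj_f_inv_f bij_is_inj inv_f_f)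

lemma inv_linear: "linear (inv \<phi>)" and inv_mult: "inv \<phi> (a * b) = inv \<phi> a * inv \<phi> b"
  using automorphismD(2,3)[OF automorphism_inv[OF \<phi>]] by auto

lemma inv_inv: "inv (inv \<phi>) = \<phi>"
  using automorphismD(1)[OF \<phi>] by (simp add: inv_inv_eq)

lemma pull_apply: "pull \<phi> X a = inv \<phi> (X (\<phi> a))"
  by (simp add: pull_def)

lemma pull_par: assumes X: "X \<in> vf_par S \<epsilon>" shows "pull \<phi> X \<in> vf_par S \<epsilon>"
proof (rule vf_parI)
  show "linear (pull \<phi> X)"
    unfolding pull_def using inv_linear vf_par_linear[OF X] automorphismD(2)[OF \<phi>]
    by (intro linear_compose)
  fix \<delta> a b assume a: "a \<in> fun_par S \<delta>"
  note \<phi>a = automorphismD(4)[OF \<phi> a]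
  show "pull \<phi> X a \<in> fun_par S (\<delta> + \<epsilon>)"
    unfolding pull_apply by (intro automorphismD(4)[OF automorphism_inv[OF \<phi>]] vf_par_maps[OF X \<phi>a])
  show "pull \<phi> X (a * b) = pull \<phi> X a * b + (- 1) ^ (\<epsilon> * \<delta>) *\<^sub>R (a * pull \<phi> X b)"
    by (simp add: pull_apply automorphismD(3)[OF \<phi>] vf_par_Leibniz[OF X \<phi>a] linear_add[OF inv_linear]
        linear_scale[OF inv_linear] inv_mult inv_cancel)
qed

lemma pull_add: "pull \<phi> (X + Y) = pull \<phi> X + pull \<phi> Y"
  by (rule ext) (simp add: pull_apply linear_add[OF inv_linear])

lemma pull_lmult: "pull \<phi> (lmult f X) = lmult (inv \<phi> f) (pull \<phi> X)"
  by (rule ext) (simp add: pull_apply lmult_def inv_mult)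

lemma pull_vf: assumes "X \<in> vf S" shows "pull \<phi> X \<in> vf S"
proof -
  obtain Y Z where "Y \<in> vf_par S 0" "Z \<in> vf_par S 1" "X = Y + Z" using vf_decomp[OF assms] .
  then show ?thesis using vfI[OF pull_par pull_par] pull_add by metis
qed

lemma pull_filt: "X \<in> filt (vf_deg S) k \<Longrightarrow> pull \<phi> X \<in> filt (vf_deg S) k"
  unfolding filt_vf_iff using pull_vf automorphism_filt[OF \<phi>] automorphism_filt[OF automorphism_inv[OF \<phi>]]
  by (auto simp: pull_apply)

lemma pull_inv: "pull (inv \<phi>) (pull \<phi> X) = X" "pull \<phi> (pull (inv \<phi>) X) = X"
  by (rule ext, simp add: pull_def inv_inv inv_cancel)+

end

lemma pull_vf_iff: "\<phi> \<in> automorphisms S \<Longrightarrow> pull \<phi> X \<in> vf S \<longleftrightarrow> X \<in> vf S"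
  using pull_vf[of \<phi> X] pull_vf[OF automorphism_inv, of \<phi> "pull \<phi> X"] pull_inv(1)[of \<phi> X] by metis

lemma pull_comp:
  assumes "\<phi> \<in> automorphisms S" "\<psi> \<in> automorphisms S"
  shows "pull (\<phi> \<circ> \<psi>) X = pull \<psi> (pull \<phi> X)"
  using o_inv_distrib[OF automorphismD(1)[OF assms(1)] automorphismD(1)[OF assms(2)]]
  by (auto simp: pull_def fun_eq_iff)

lemma act_metric_comp:
  assumes "\<phi> \<in> automorphisms S" "\<psi> \<in> automorphisms S"
  shows "act_metric (\<phi> \<circ> \<psi>) h = act_metric \<phi> (act_metric \<psi> h)"
  by (intro ext) (simp add: act_metric_apply pull_comp[OF assms])

lemma act_metric_inv:
  assumes \<phi>: "\<phi> \<in> automorphisms S"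
  shows "act_metric (inv \<phi>) (act_metric \<phi> h) = h" "act_metric \<phi> (act_metric (inv \<phi>) h) = h"
  by (intro ext, simp add: act_metric_apply pull_inv[OF \<phi>] inv_cancel[OF \<phi>])+

context
  fixes \<phi>
  assumes \<phi>: "\<phi> \<in> automorphisms S"
begin

lemma act_dual_par: assumes \<alpha>: "\<alpha> \<in> dual_par S \<epsilon>" shows "act_dual \<phi> \<alpha> \<in> dual_par S \<epsilon>"
proof (rule dual_parI)
  note lin = automorphismD(2)[OF \<phi>]
  show "act_dual \<phi> \<alpha> X = 0" if "X \<notin> vf S" for X
    using that dual_parD(1)[OF \<alpha>] linear_0[OF lin] by (simp add: act_dual_def pull_vf_iff[OF \<phi>])
  show "act_dual \<phi> \<alpha> (X + Y) = act_dual \<phi> \<alpha> X + act_dual \<phi> \<alpha> Y" if "X \<in> vf S" "Y \<in> vf S" for X Y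
    using dual_parD(2)[OF \<alpha> pull_vf[OF \<phi> that(1)] pull_vf[OF \<phi> that(2)]]
    by (simp add: act_dual_def pull_add[OF \<phi>] linear_add[OF lin])
  show "act_dual \<phi> \<alpha> (lmult f X) = (- 1) ^ (\<epsilon> * \<delta>) *\<^sub>R (f * act_dual \<phi> \<alpha> X)"
    if "f \<in> fun_par S \<delta>" "X \<in> vf S" for f \<delta> X
    using dual_parD(3)[OF \<alpha> automorphismD(4)[OF automorphism_inv[OF \<phi>] that(1)] pull_vf[OF \<phi> that(2)]]
    by (simp add: act_dual_def pull_lmult[OF \<phi>] linear_scale[OF lin] automorphismD(3)[OF \<phi>] inv_cancel[OF \<phi>])
  show "act_dual \<phi> \<alpha> X \<in> fun_par S (\<delta> + \<epsilon>)" if "X \<in> vf_par S \<delta>" for \<delta> X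
    unfolding act_dual_def by (rule automorphismD(4)[OF \<phi> dual_parD(4)[OF \<alpha> pull_par[OF \<phi> that]]])
qed

lemma act_dual_add: "act_dual \<phi> (\<alpha> + \<beta>) = act_dual \<phi> \<alpha> + act_dual \<phi> \<beta>"
  by (rule ext) (simp add: act_dual_def linear_add[OF automorphismD(2)[OF \<phi>]])

lemma act_dual_dual: assumes "\<alpha> \<in> dual S" shows "act_dual \<phi> \<alpha> \<in> dual S"
proof -
  obtain \<beta> \<gamma> where "\<beta> \<in> dual_par S 0" "\<gamma> \<in> dual_par S 1" "\<alpha> = \<beta> + \<gamma>" using dual_decomp[OF assms] .
  then show ?thesis using dualI[OF act_dual_par act_dual_par] act_dual_add by metis
qed

lemma act_hom_even: assumes h: "h \<in> hom_even S" shows "act_metric \<phi> h \<in> hom_even S"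
proof (rule hom_evenI)
  note lin = automorphismD(2)[OF \<phi>]
  show "act_metric \<phi> h X = 0" if "X \<notin> vf S" for X
  proof
    have "pull \<phi> X \<notin> vf S" using that by (simp add: pull_vf_iff[OF \<phi>])
    then have "h (pull \<phi> X) = 0" by (rule hom_evenD(1)[OF h])
    then show "act_metric \<phi> h X Y = 0 Y" for Y by (simp add: act_metric_apply linear_0[OF lin])
  qed
  show "act_metric \<phi> h (X + Y) = act_metric \<phi> h X + act_metric \<phi> h Y" if "X \<in> vf S" "Y \<in> vf S" for X Y
    unfolding act_metric_eq pull_add[OF \<phi>] hom_evenD(2)[OF h pull_vf[OF \<phi> that(1)] pull_vf[OF \<phi> that(2)]]
    by (rule act_dual_add)
  show "act_metric \<phi> h (lmult f X) = lmult f (act_metric \<phi> h X)" if "X \<in> vf S" for f X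
  proof -
    have "h (pull \<phi> (lmult f X)) = lmult (inv \<phi> f) (h (pull \<phi> X))"
      unfolding pull_lmult[OF \<phi>] by (rule hom_evenD(3)[OF h pull_vf[OF \<phi> that]])
    then show ?thesis
      by (intro ext) (simp add: act_metric_apply lmult_def automorphismD(3)[OF \<phi>] inv_cancel[OF \<phi>])
  qed
  show "act_metric \<phi> h X \<in> dual_par S \<delta>" if "X \<in> vf_par S \<delta>" for \<delta> X
    unfolding act_metric_eq by (rule act_dual_par[OF hom_evenD(4)[OF h pull_par[OF \<phi> that]]])
qed

lemma act_hom_filt: assumes h: "h \<in> filt (hom_deg S) k" shows "act_metric \<phi> h \<in> filt (hom_deg S) k"
  unfolding filt_hom_iff
proof (intro conjI allI ballI)
  show "act_metric \<phi> h \<in> hom_even S" using h act_hom_even by (simp add: filt_hom_iff)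
  show "act_metric \<phi> h X Y \<in> filt (fun_deg S) (i + j + k)"
    if "X \<in> filt (vf_deg S) i" "Y \<in> filt (vf_deg S) j" for i j X Y
    unfolding act_metric_apply using h that pull_filt[OF \<phi>] unfolding filt_hom_iff
    by (intro automorphism_filt[OF \<phi>]) blast
qed

lemma act_metric_diff: "act_metric \<phi> (h - k) = act_metric \<phi> h - act_metric \<phi> k"
  by (intro ext) (simp add: act_metric_apply linear_diff[OF automorphismD(2)[OF \<phi>]])

lemma act_supersymmetric: "supersymmetric h \<Longrightarrow> supersymmetric (act_metric \<phi> h)"
  unfolding supersymmetric_def act_metric_apply
proof (intro allI ballI)
  fix \<epsilon> \<delta> X Y
  assume h: "\<forall>\<epsilon> \<delta>. \<forall>X\<in>vf_par S \<epsilon>. \<forall>Y\<in>vf_par S \<delta>. h X Y = (- 1) ^ (\<epsilon> * \<delta>) *\<^sub>R h Y X"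
    and "X \<in> vf_par S \<epsilon>" "Y \<in> vf_par S \<delta>"
  then have "h (pull \<phi> X) (pull \<phi> Y) = (- 1) ^ (\<epsilon> * \<delta>) *\<^sub>R h (pull \<phi> Y) (pull \<phi> X)"
    using pull_par[OF \<phi>] by blast
  then show "\<phi> (h (pull \<phi> X) (pull \<phi> Y)) = (- 1) ^ (\<epsilon> * \<delta>) *\<^sub>R \<phi> (h (pull \<phi> Y) (pull \<phi> X))"
    by (simp add: linear_scale[OF automorphismD(2)[OF \<phi>]])
qed

end

lemma riemannian_metric_iff:
  "riemannian_metric S g \<longleftrightarrow> g \<in> hom_even S \<and> bij_betw g (vf S) (dual S) \<and> supersymmetric g"
  unfolding riemannian_metric_def supersymmetric_def ..

lemma act_riemannian:
  assumes \<phi>: "\<phi> \<in> automorphisms S" and g: "riemannian_metric S g"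
  shows "riemannian_metric S (act_metric \<phi> g)"
proof -
  note \<phi>i = automorphism_inv[OF \<phi>]
  have 1: "bij_betw (pull \<phi>) (vf S) (vf S)"
    by (rule bij_betw_byWitness[of _ "pull (inv \<phi>)"])
      (use pull_inv[OF \<phi>] pull_vf[OF \<phi>] pull_vf[OF \<phi>i] in auto)
  have c: "act_dual (inv \<phi>) (act_dual \<phi> \<alpha>) = \<alpha>" "act_dual \<phi> (act_dual (inv \<phi>) \<alpha>) = \<alpha>" for \<alpha>
    by (rule ext, simp add: act_dual_def pull_inv[OF \<phi>] inv_cancel[OF \<phi>])+
  have 2: "bij_betw (act_dual \<phi>) (dual S) (dual S)"
    by (rule bij_betw_byWitness[of _ "act_dual (inv \<phi>)"])
      (use c act_dual_dual[OF \<phi>] act_dual_dual[OF \<phi>i] in auto)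
  have "bij_betw (act_dual \<phi> \<circ> (g \<circ> pull \<phi>)) (vf S) (dual S)"
    using bij_betw_trans[OF bij_betw_trans[OF 1, of g] 2] g by (simp add: riemannian_metric_iff)
  moreover have "act_dual \<phi> \<circ> (g \<circ> pull \<phi>) = act_metric \<phi> g"
    by (rule ext) (simp add: act_metric_eq)
  ultimately show ?thesis
    using g act_hom_even[OF \<phi>] act_supersymmetric[OF \<phi>] by (simp add: riemannian_metric_iff)
qed

section \<open>The inverse of a metric lowers the filtration by two\<close>

text \<open>The differential of a superfunction \<open>a\<close> of parity \<open>\<delta>\<close> is \<open>X \<mapsto> (-1)\<^bsup>|X|\<delta>\<^esup> X a\<close>. The sign makes it linear
  in the sense of the sign rule. It refers to the parity of \<open>X\<close>, so that the even and odd parts enter separately.\<close>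

definition differential :: "nat \<Rightarrow> 'a \<Rightarrow> ('a \<Rightarrow> 'a) \<Rightarrow> 'a" where
  "differential \<delta> a X = (if X \<in> vf S
     then THE v. \<exists>Y Z. Y \<in> vf_par S 0 \<and> Z \<in> vf_par S 1 \<and> X = Y + Z \<and> v = Y a + (- 1) ^ \<delta> *\<^sub>R Z a
     else 0)"

lemma vf_parts_unique:
  assumes "Y \<in> vf_par S 0" "Z \<in> vf_par S 1" "Y' \<in> vf_par S 0" "Z' \<in> vf_par S 1" "Y + Z = Y' + Z'"
  shows "Y = Y'" "Z = Z'"
proof -
  have eq: "Y - Y' = Z' - Z" using assms(5) by (metis add_diff_cancel_left' add_diff_cancel_right' diff_diff_eq2 diff_add_eq)
  have "Y - Y' \<in> vf_par S 0" "Y - Y' \<in> vf_par S (Suc 0)"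
    using vf_par_diff[OF assms(1,3)] vf_par_diff[OF assms(4,2)] unfolding eq by simp_all
  then have "Y - Y' = 0" by (rule vf_par_disjoint)
  then show "Y = Y'" "Z = Z'" using eq by simp_all
qed

lemma differential_eq:
  assumes "Y \<in> vf_par S 0" "Z \<in> vf_par S 1"
  shows "differential \<delta> a (Y + Z) = Y a + (- 1) ^ \<delta> *\<^sub>R Z a"
proof -
  have "(THE v. \<exists>Y' Z'. Y' \<in> vf_par S 0 \<and> Z' \<in> vf_par S 1 \<and> Y + Z = Y' + Z' \<and> v = Y' a + (- 1) ^ \<delta> *\<^sub>R Z' a)
      = Y a + (- 1) ^ \<delta> *\<^sub>R Z a"
  proof (rule the_equality)
    show "\<exists>Y' Z'. Y' \<in> vf_par S 0 \<and> Z' \<in> vf_par S 1 \<and> Y + Z = Y' + Z' \<and>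
        Y a + (- 1) ^ \<delta> *\<^sub>R Z a = Y' a + (- 1) ^ \<delta> *\<^sub>R Z' a"
      using assms by blast
    fix v assume "\<exists>Y' Z'. Y' \<in> vf_par S 0 \<and> Z' \<in> vf_par S 1 \<and> Y + Z = Y' + Z' \<and> v = Y' a + (- 1) ^ \<delta> *\<^sub>R Z' a"
    then show "v = Y a + (- 1) ^ \<delta> *\<^sub>R Z a" using vf_parts_unique[OF assms] by metis
  qed
  then show ?thesis using vfI[OF assms] by (simp add: differential_def)
qed

lemma differential_dual:
  assumes a: "a \<in> fun_par S \<delta>"
  shows "differential \<delta> a \<in> dual_par S \<delta>"
proof (rule dual_parI)
  show "differential \<delta> a X = 0" if "X \<notin> vf S" for X using that by (simp add: differential_def)
  show "differential \<delta> a (X + X') = differential \<delta> a X + differential \<delta> a X'" if X: "X \<in> vf S" "X' \<in> vf S" for X X'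
  proof -
    obtain Y Z where 1: "Y \<in> vf_par S 0" "Z \<in> vf_par S 1" "X = Y + Z" using vf_decomp[OF X(1)] .
    obtain Y' Z' where 2: "Y' \<in> vf_par S 0" "Z' \<in> vf_par S 1" "X' = Y' + Z'" using vf_decomp[OF X(2)] .
    have "X + X' = (Y + Y') + (Z + Z')" unfolding 1 2 by (simp add: ac_simps)
    then have "differential \<delta> a (X + X') = (Y + Y') a + (- 1) ^ \<delta> *\<^sub>R (Z + Z') a"
      using differential_eq[OF vf_par_add[OF 1(1) 2(1)] vf_par_add[OF 1(2) 2(2)]] by metis
    then show ?thesis unfolding 1(3) 2(3) differential_eq[OF 1(1,2)] differential_eq[OF 2(1,2)]
      by (simp add: scaleR_add_right)
  qed
  show "differential \<delta> a (lmult f X) = (- 1) ^ (\<delta> * \<gamma>) *\<^sub>R (f * differential \<delta> a X)"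
    if f: "f \<in> fun_par S \<gamma>" and X: "X \<in> vf S" for \<gamma> f X
  proof -
    obtain Y Z where 1: "Y \<in> vf_par S 0" "Z \<in> vf_par S 1" "X = Y + Z" using vf_decomp[OF X] .
    have fYZ: "lmult f Y \<in> vf_par S \<gamma>" "lmult f Z \<in> vf_par S (\<gamma> + 1)"
      using vf_par_lmult[OF f 1(1)] vf_par_lmult[OF f 1(2)] by simp_all
    show ?thesis
    proof (cases "even \<gamma>")
      case True
      then have "lmult f Y \<in> vf_par S 0" "lmult f Z \<in> vf_par S 1"
        using fYZ vf_par_cong[of \<gamma> 0] vf_par_cong[of "\<gamma> + 1" 1] by auto
      then show ?thesis unfolding 1(3) lmult_add_right differential_eq[OF 1(1,2)]
        using True by (simp add: differential_eq) (simp add: lmult_def minus_one_power_iff distrib_left)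
    next
      case False
      then have "lmult f Y \<in> vf_par S 1" "lmult f Z \<in> vf_par S 0"
        using fYZ vf_par_cong[of \<gamma> 1] vf_par_cong[of "\<gamma> + 1" 0] by auto
      then have "differential \<delta> a (lmult f Z + lmult f Y) = f * Z a + (- 1) ^ \<delta> *\<^sub>R (f * Y a)"
        by (simp add: differential_eq) (simp add: lmult_def)
      then show ?thesis unfolding 1(3) lmult_add_right differential_eq[OF 1(1,2)] add.commute[of "lmult f Y"]
        using False by (simp add: minus_one_power_iff algebra_simps)
    qed
  qed
  show "differential \<delta> a X \<in> fun_par S (\<epsilon> + \<delta>)" if X: "X \<in> vf_par S \<epsilon>" for \<epsilon> X
  proof (cases "even \<epsilon>")
    case True
    then have X0: "X \<in> vf_par S 0" using X vf_par_cong[of \<epsilon> 0] by simp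
    have "differential \<delta> a X = X a"
      using differential_eq[OF X0 vf_par_zero, of \<delta> a] by simp
    then show ?thesis using vf_par_maps[OF X a] by (simp add: add.commute)
  next
    case False
    then have X1: "X \<in> vf_par S 1" using X vf_par_cong[of \<epsilon> 1] by simp
    have "differential \<delta> a X = (- 1) ^ \<delta> *\<^sub>R X a"
      using differential_eq[OF vf_par_zero X1, of \<delta> a] by simp
    then show ?thesis using fun_par_scale[OF vf_par_maps[OF X a]] by (simp add: add.commute)
  qed
qed

context
  fixes g
  assumes g: "riemannian_metric S g"
begin

lemma metric_hom: "g \<in> hom_even S" and metric_bij: "bij_betw g (vf S) (dual S)"
  and metric_sym: "supersymmetric g"
  using g by (auto simp: riemannian_metric_iff)

lemma metric_injD: "X \<in> vf S \<Longrightarrow> Y \<in> vf S \<Longrightarrow> g X = g Y \<Longrightarrow> X = Y"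
  using metric_bij by (auto simp: bij_betw_def dest: inj_onD)

lemma metric_zero: "g 0 = 0"
  using hom_evenD(2)[OF metric_hom vf_zero vf_zero] by simp

lemma metric_reflects_parity:
  assumes X: "X \<in> vf S" and gX: "g X \<in> dual_par S \<delta>"
  shows "X \<in> vf_par S \<delta>"
proof -
  obtain Y Z where YZ: "Y \<in> vf_par S 0" "Z \<in> vf_par S 1" "X = Y + Z" using vf_decomp[OF X] .
  note v = vf_par_vf[OF YZ(1)] vf_par_vf[OF YZ(2)]
  have gYZ: "g Y \<in> dual_par S 0" "g Z \<in> dual_par S (Suc 0)"
    using hom_evenD(4)[OF metric_hom YZ(1)] hom_evenD(4)[OF metric_hom YZ(2)] by simp_all
  have sum: "g X = g Y + g Z" unfolding YZ(3) by (rule hom_evenD(2)[OF metric_hom v])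
  show ?thesis
  proof (cases "even \<delta>")
    case True
    then have "g X \<in> dual_par S 0" using gX dual_par_cong[of \<delta> 0] by simp
    then have "g X - g Y \<in> dual_par S 0" using gYZ(1) by (rule dual_par_diff)
    then have "g Z \<in> dual_par S 0" unfolding sum by (metis add_diff_cancel_left')
    then have "g Z = g 0" using dual_par_disjoint gYZ(2) metric_zero by metis
    then have "Z = 0" using metric_injD[OF v(2) vf_zero] by simp
    then show ?thesis using YZ True vf_par_cong[of \<delta> 0] by simp
  next
    case False
    then have "g X \<in> dual_par S (Suc 0)" using gX dual_par_cong[of \<delta> "Suc 0"] by simp
    then have "g X - g Z \<in> dual_par S (Suc 0)" using gYZ(2) by (rule dual_par_diff)
    then have "g Y \<in> dual_par S (Suc 0)" unfolding sum by (metis add_diff_cancel_right')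
    then have "g Y = g 0" using dual_par_disjoint gYZ(1) metric_zero by metis
    then have "Y = 0" using metric_injD[OF v(1) vf_zero] by simp
    then show ?thesis using YZ False vf_par_cong[of \<delta> "Suc 0"] by simp
  qed
qed

text \<open>The value \<open>X a\<close> is, up to a sign, the product of \<open>X\<close> with the gradient of \<open>a\<close>, and the gradient has
  degree at least \<open>-1\<close>. So a lower bound for the degree of \<open>g X\<close> gives lower bounds for the degree of
  \<open>X\<close> on generators.\<close>

lemma metric_inverse_filt:
  assumes X: "X \<in> vf S" and gX: "\<And>j Y. Y \<in> filt (vf_deg S) j \<Longrightarrow> g X Y \<in> filt (fun_deg S) (j + k)"
  shows "X \<in> filt (vf_deg S) (k - 2)"
proof -
  obtain Y Z where YZ: "Y \<in> vf_par S 0" "Z \<in> vf_par S 1" "X = Y + Z" using vf_decomp[OF X] .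
  note v = vf_par_vf[OF YZ(1)] vf_par_vf[OF YZ(2)]
  have Xa: "X a \<in> filt (fun_deg S) (k - 1)" if a: "a \<in> fun_par S \<delta>" for a \<delta>
  proof -
    note da = differential_dual[OF a]
    obtain G where G: "G \<in> vf S" "g G = differential \<delta> a"
      using metric_bij dual_par_dual[OF da] unfolding bij_betw_def by (metis imageE)
    have Gp: "G \<in> vf_par S \<delta>" using metric_reflects_parity[OF G(1)] da G(2) by metis
    have "g X G = g Y G + g Z G"
      unfolding YZ(3) by (rule hom_even_apply(2)[OF metric_hom v(1) G(1) v(2)])
    also have "g Y G = differential \<delta> a Y"
      using supersymmetricD[OF metric_sym YZ(1) Gp] G(2) by simp
    also have "g Z G = (- 1) ^ \<delta> *\<^sub>R differential \<delta> a Z"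
      using supersymmetricD[OF metric_sym YZ(2) Gp] G(2) by simp
    also have "differential \<delta> a Y = Y a"
      using differential_eq[OF YZ(1) vf_par_zero, of \<delta> a] by simp
    also have "differential \<delta> a Z = (- 1) ^ \<delta> *\<^sub>R Z a"
      using differential_eq[OF vf_par_zero YZ(2), of \<delta> a] by simp
    finally have "g X G = Y a + (- 1) ^ \<delta> *\<^sub>R (- 1) ^ \<delta> *\<^sub>R Z a" .
    then have "g X G = Y a + Z a" by (cases "even \<delta>") simp_all
    then have "g X G = X a" using YZ(3) by (metis plus_fun_apply)
    moreover have "g X G \<in> filt (fun_deg S) (- 1 + k)"
      using gX[of G "- 1"] G(1) vf_eq_filt by simp
    ultimately show ?thesis by simp
  qed
  show ?thesis unfolding filt_vf_iff
  proof (intro conjI X allI ballI)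
    fix i a assume a: "a \<in> filt (fun_deg S) i"
    show "X a \<in> filt (fun_deg S) (i + (k - 2))"
    proof (rule vf_filt_from_generators[OF X _ _ a])
      show "X a \<in> filt (fun_deg S) (k - 2)" if "a \<in> fun_deg S 0" for a
        using A.filt_mono[OF Xa[OF fun_deg_par[OF that, of 0]], of "k - 2"] by simp
      show "X a \<in> filt (fun_deg S) (k - 2 + 1)" if "a \<in> fun_deg S 1" for a
        using Xa[OF fun_deg_par[OF that, of 1]] by simp
    qed
  qed
qed

end

end

section \<open>Lie derivatives and infinitesimal automorphisms\<close>

context supermanifold
begin

text \<open>The Lie derivative of a bilinear form along an even vector field. This is the operator in
  the definition of \<^const>\<open>vf_filt_g0\<close>, and up to sign and raising an index it is \<^const>\<open>G_map\<close>.\<close>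

definition lie :: "('a \<Rightarrow> 'a) \<Rightarrow> (('a \<Rightarrow> 'a) \<Rightarrow> ('a \<Rightarrow> 'a) \<Rightarrow> 'a) \<Rightarrow> ('a \<Rightarrow> 'a) \<Rightarrow> ('a \<Rightarrow> 'a) \<Rightarrow> 'a" where
  "lie \<zeta> h = (\<lambda>X Y. - (h (ad S \<zeta> X) Y + h X (ad S \<zeta> Y)) + \<zeta> (h X Y))"

lemma lie_apply: "lie \<zeta> h X Y = - (h (ad S \<zeta> X) Y + h X (ad S \<zeta> Y)) + \<zeta> (h X Y)"
  by (simp add: lie_def)

context
  fixes \<zeta>
  assumes \<zeta>: "\<zeta> \<in> vf_par S 0"
begin

lemma even_vf_linear: "linear \<zeta>" and even_vf_par: "a \<in> fun_par S \<delta> \<Longrightarrow> \<zeta> a \<in> fun_par S \<delta>"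
  using vf_par_linear[OF \<zeta>] vf_par_maps[OF \<zeta>, of a \<delta>] by simp_all

lemma even_vf_Leibniz: "\<zeta> (a * b) = \<zeta> a * b + a * \<zeta> b"
proof -
  obtain c d where cd: "c \<in> fun_par S 0" "d \<in> fun_par S 1" "a = c + d" by (rule fun_par_decomp)
  show ?thesis unfolding cd(3) using vf_par_Leibniz[OF \<zeta> cd(1)] vf_par_Leibniz[OF \<zeta> cd(2)]
    by (simp add: distrib_right linear_add[OF even_vf_linear])
qed

lemma ad_apply: "X \<in> vf S \<Longrightarrow> ad S \<zeta> X a = \<zeta> (X a) - X (\<zeta> a)"
  by (simp add: ad_def)

lemma ad_outside: "X \<notin> vf S \<Longrightarrow> ad S \<zeta> X = 0"
  by (simp add: ad_def)

lemma ad_par: assumes X: "X \<in> vf_par S \<epsilon>" shows "ad S \<zeta> X \<in> vf_par S \<epsilon>"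
proof (rule vf_parI)
  note ad = ad_apply[OF vf_par_vf[OF X]]
  note lin = vf_par_linear[OF X] even_vf_linear
  show "linear (ad S \<zeta> X)"
    by (rule linearI) (simp_all add: ad linear_add[OF lin(1)] linear_add[OF lin(2)] linear_scale[OF lin(1)]
        linear_scale[OF lin(2)] scaleR_diff_right)
  fix \<delta> a b assume a: "a \<in> fun_par S \<delta>"
  show "ad S \<zeta> X a \<in> fun_par S (\<delta> + \<epsilon>)"
    unfolding ad by (intro fun_par_diff even_vf_par vf_par_maps[OF X] a)
  show "ad S \<zeta> X (a * b) = ad S \<zeta> X a * b + (- 1) ^ (\<epsilon> * \<delta>) *\<^sub>R (a * ad S \<zeta> X b)"
    by (simp add: ad vf_par_Leibniz[OF X a] vf_par_Leibniz[OF X even_vf_par[OF a]] even_vf_Leibniz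
        linear_add[OF lin(1)] linear_add[OF lin(2)] linear_scale[OF lin(2)] algebra_simps)
qed

lemma ad_add: "X \<in> vf S \<Longrightarrow> Y \<in> vf S \<Longrightarrow> ad S \<zeta> (X + Y) = ad S \<zeta> X + ad S \<zeta> Y"
  by (rule ext) (simp add: ad_apply vf_add linear_add[OF even_vf_linear])

lemma ad_vf: "ad S \<zeta> X \<in> vf S"
proof (cases "X \<in> vf S")
  case True
  then obtain Y Z where YZ: "Y \<in> vf_par S 0" "Z \<in> vf_par S 1" "X = Y + Z" by (rule vf_decomp)
  then show ?thesis using vfI[OF ad_par ad_par] ad_add vf_par_vf by metis
qed (simp add: ad_def vf_zero)

lemma ad_lmult: "X \<in> vf S \<Longrightarrow> ad S \<zeta> (lmult f X) = lmult (\<zeta> f) X + lmult f (ad S \<zeta> X)"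
  by (rule ext) (simp add: ad_apply vf_lmult, simp add: lmult_def even_vf_Leibniz ad_apply algebra_simps)

lemma ad_filt:
  assumes "\<zeta> \<in> filt (vf_deg S) k" "X \<in> filt (vf_deg S) i"
  shows "ad S \<zeta> X \<in> filt (vf_deg S) (i + k)"
  unfolding filt_vf_iff
proof (intro conjI allI ballI ad_vf)
  fix j a assume a: "a \<in> filt (fun_deg S) j"
  have X: "X \<in> vf S" and Xf: "\<And>a j. a \<in> filt (fun_deg S) j \<Longrightarrow> X a \<in> filt (fun_deg S) (j + i)"
    and \<zeta>f: "\<And>a j. a \<in> filt (fun_deg S) j \<Longrightarrow> \<zeta> a \<in> filt (fun_deg S) (j + k)"
    using assms unfolding filt_vf_iff by blast+
  have "\<zeta> (X a) - X (\<zeta> a) \<in> filt (fun_deg S) (j + i + k)"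
    using A.filt_diff[OF \<zeta>f[OF Xf[OF a]], of "X (\<zeta> a)"] Xf[OF \<zeta>f[OF a]] by (simp add: ac_simps)
  then show "ad S \<zeta> X a \<in> filt (fun_deg S) (j + (i + k))"
    by (simp add: ad_apply[OF X] add.assoc)
qed

lemma lie_dual_par:
  assumes h: "h \<in> hom_even S" and X: "X \<in> vf_par S \<delta>"
  shows "lie \<zeta> h X \<in> dual_par S \<delta>"
proof (rule dual_parI)
  note hX = hom_evenD(4)[OF h X] and haX = hom_evenD(4)[OF h ad_par[OF X]]
  note lin = even_vf_linear
  have h0: "h X 0 = 0" using dual_parD(2)[OF hX vf_zero vf_zero] by simp
  show "lie \<zeta> h X Y = 0" if "Y \<notin> vf S" for Y
    by (simp only: lie_apply ad_outside[OF that] h0 dual_parD(1)[OF hX that] dual_parD(1)[OF haX that] linear_0[OF lin])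
      simp
  show "lie \<zeta> h X (Y + Y') = lie \<zeta> h X Y + lie \<zeta> h X Y'" if Y: "Y \<in> vf S" "Y' \<in> vf S" for Y Y'
    by (simp only: lie_apply ad_add[OF Y] dual_parD(2)[OF hX Y] dual_parD(2)[OF haX Y]
        dual_parD(2)[OF hX ad_vf ad_vf] linear_add[OF lin]) (simp add: algebra_simps)
  show "lie \<zeta> h X Y \<in> fun_par S (\<epsilon> + \<delta>)" if Y: "Y \<in> vf_par S \<epsilon>" for \<epsilon> Y
    unfolding lie_apply
    by (intro fun_par_add fun_par_uminus even_vf_par dual_parD(4)[OF hX] dual_parD(4)[OF haX] Y ad_par)
  show "lie \<zeta> h X (lmult f Y) = (- 1) ^ (\<delta> * \<epsilon>) *\<^sub>R (f * lie \<zeta> h X Y)"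
    if f: "f \<in> fun_par S \<epsilon>" and Y: "Y \<in> vf S" for \<epsilon> f Y
    by (simp only: lie_apply ad_lmult[OF Y] dual_parD(3)[OF hX f Y] dual_parD(3)[OF haX f Y]
        dual_parD(2)[OF hX vf_lmult[OF Y] vf_lmult[OF ad_vf]] dual_parD(3)[OF hX f ad_vf]
        dual_parD(3)[OF hX even_vf_par[OF f] Y] linear_scale[OF lin] even_vf_Leibniz)
      (simp add: algebra_simps)
qed

lemma lie_hom: assumes h: "h \<in> hom_even S" shows "lie \<zeta> h \<in> hom_even S"
proof (rule hom_evenI)
  note lin = even_vf_linear
  have h00: "h 0 = 0" using hom_evenD(2)[OF h vf_zero vf_zero] by simp
  have hX0: "h X 0 = 0" for X
  proof (cases "X \<in> vf S")
    case True
    then show ?thesis using hom_even_apply(3)[OF h True vf_zero vf_zero] by simp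
  qed (simp add: hom_evenD(1)[OF h])
  show "lie \<zeta> h X = 0" if "X \<notin> vf S" for X
  proof
    fix Y
    have "h X = 0" by (rule hom_evenD(1)[OF h that])
    then show "lie \<zeta> h X Y = 0 Y"
      by (simp add: lie_apply ad_outside[OF that] h00 linear_0[OF lin])
  qed
  have outside: "lie \<zeta> h X Y = 0" if "Y \<notin> vf S" for X Y
    by (simp only: lie_apply ad_outside[OF that] hX0 hom_even_apply(1)[OF h that] linear_0[OF lin]) simp
  show "lie \<zeta> h (X + X') = lie \<zeta> h X + lie \<zeta> h X'" if X: "X \<in> vf S" "X' \<in> vf S" for X X'
  proof
    fix Y show "lie \<zeta> h (X + X') Y = (lie \<zeta> h X + lie \<zeta> h X') Y"
    proof (cases "Y \<in> vf S")
      case True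
      have "lie \<zeta> h (X + X') Y = lie \<zeta> h X Y + lie \<zeta> h X' Y"
        by (simp only: lie_apply ad_add[OF X] hom_even_apply(2)[OF h X(1) True X(2)]
            hom_even_apply(2)[OF h X(1) ad_vf X(2)] hom_even_apply(2)[OF h ad_vf True ad_vf] linear_add[OF lin])
          (simp add: algebra_simps)
      then show ?thesis by simp
    qed (simp add: outside)
  qed
  show "lie \<zeta> h (lmult f X) = lmult f (lie \<zeta> h X)" if X: "X \<in> vf S" for f X
  proof
    fix Y show "lie \<zeta> h (lmult f X) Y = lmult f (lie \<zeta> h X) Y"
    proof (cases "Y \<in> vf S")
      case True
      have hl: "h (lmult k X) Z = k * h X Z" "h (lmult k (ad S \<zeta> X)) Z = k * h (ad S \<zeta> X) Z" for k Z
        using hom_evenD(3)[OF h X, of k] hom_evenD(3)[OF h ad_vf, of k X] by (simp_all add: lmult_def)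
      have "lie \<zeta> h (lmult f X) Y = f * lie \<zeta> h X Y"
        by (simp only: lie_apply ad_lmult[OF X] hl
            hom_even_apply(2)[OF h vf_lmult[OF X] True vf_lmult[OF ad_vf]] even_vf_Leibniz)
          (simp add: algebra_simps)
      then show ?thesis by (simp add: lmult_def)
    qed (simp add: outside lmult_def)
  qed
qed (rule lie_dual_par[OF h])

lemma lie_filt:
  assumes \<zeta>k: "\<zeta> \<in> filt (vf_deg S) k" and h: "h \<in> filt (hom_deg S) n"
  shows "lie \<zeta> h \<in> filt (hom_deg S) (n + k)"
  unfolding filt_hom_iff
proof (intro conjI allI ballI)
  show "lie \<zeta> h \<in> hom_even S" using h by (intro lie_hom) (simp add: filt_hom_iff)
  fix i j X Y assume X: "X \<in> filt (vf_deg S) i" and Y: "Y \<in> filt (vf_deg S) j"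
  have hf: "h X Y \<in> filt (fun_deg S) (i + j + n)" if "X \<in> filt (vf_deg S) i" "Y \<in> filt (vf_deg S) j" for X Y i j
    using h that unfolding filt_hom_iff by blast
  have "h (ad S \<zeta> X) Y \<in> filt (fun_deg S) (i + j + (n + k))"
    using hf[OF ad_filt[OF \<zeta>k X] Y] by (simp add: ac_simps)
  moreover have "h X (ad S \<zeta> Y) \<in> filt (fun_deg S) (i + j + (n + k))"
    using hf[OF X ad_filt[OF \<zeta>k Y]] by (simp add: ac_simps)
  moreover have "\<zeta> (h X Y) \<in> filt (fun_deg S) (i + j + (n + k))"
    using \<zeta>k hf[OF X Y] unfolding filt_vf_iff by (metis add.assoc)
  ultimately show "lie \<zeta> h X Y \<in> filt (fun_deg S) (i + j + (n + k))"
    unfolding lie_apply by (intro A.filt_add A.filt_uminus)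
qed

lemma lie_add: "lie \<zeta> (h + k) = lie \<zeta> h + lie \<zeta> k"
  by (intro ext) (simp add: lie_apply linear_add[OF even_vf_linear])

lemma lie_diff: "lie \<zeta> (h - k) = lie \<zeta> h - lie \<zeta> k"
  by (intro ext) (simp add: lie_apply linear_diff[OF even_vf_linear])

end

lemma ad_plus: "ad S (\<zeta> + \<eta>) X = ad S \<zeta> X + ad S \<eta> X"
proof (cases "X \<in> vf S")
  case True
  show ?thesis using True by (intro ext) (simp add: ad_def linear_add[OF vf_linear[OF True]])
qed (simp add: ad_def)

lemma lie_plus: assumes "h \<in> hom_even S" "\<zeta> \<in> vf_par S 0" "\<eta> \<in> vf_par S 0"
  shows "lie (\<zeta> + \<eta>) h = lie \<zeta> h + lie \<eta> h"
proof (rule hom_even_eqI)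
  note p = vf_par_add[OF assms(2,3)]
  show "lie (\<zeta> + \<eta>) h \<in> hom_even S" by (rule lie_hom[OF p assms(1)])
  show "lie \<zeta> h + lie \<eta> h \<in> hom_even S"
    using H.carrier_add lie_hom[OF assms(2,1)] lie_hom[OF assms(3,1)] by blast
  fix \<epsilon> \<delta> X Y assume "X \<in> vf_par S \<epsilon>" "Y \<in> vf_par S \<delta>"
  note v = vf_par_vf[OF this(1)] vf_par_vf[OF this(2)]
  have "lie (\<zeta> + \<eta>) h X Y = lie \<zeta> h X Y + lie \<eta> h X Y"
    by (simp only: lie_apply ad_plus hom_even_apply(2)[OF assms(1) ad_vf[OF assms(2)] v(2) ad_vf[OF assms(3)]]
        hom_even_apply(3)[OF assms(1) v(1) ad_vf[OF assms(2)] ad_vf[OF assms(3)]] plus_fun_apply)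
      (simp add: algebra_simps)
  then show "lie (\<zeta> + \<eta>) h X Y = (lie \<zeta> h + lie \<eta> h) X Y" by simp
qed

lemma lie_uminus: assumes h: "h \<in> hom_even S" and \<zeta>: "\<zeta> \<in> vf_par S 0"
  shows "lie (- \<zeta>) h = - lie \<zeta> h"
proof -
  have "lie (\<zeta> + - \<zeta>) h = lie \<zeta> h + lie (- \<zeta>) h" by (rule lie_plus[OF h \<zeta> vf_par_uminus[OF \<zeta>]])
  moreover have "lie (\<zeta> + - \<zeta>) h = 0"
  proof (intro ext)
    fix X Y
    have a: "ad S (\<zeta> + - \<zeta>) Z = 0" for Z
    proof (cases "Z \<in> vf S")
      case True
      then show ?thesis by (intro ext) (simp add: ad_def linear_0[OF vf_linear[OF True]])
    qed (simp add: ad_def)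
    have "h 0 = 0" using hom_evenD(2)[OF h vf_zero vf_zero] by simp
    moreover have "h X 0 = 0"
    proof (cases "X \<in> vf S")
      case True
      then show ?thesis using hom_even_apply(3)[OF h True vf_zero vf_zero] by simp
    qed (simp add: hom_evenD(1)[OF h])
    ultimately show "lie (\<zeta> + - \<zeta>) h X Y = 0 X Y"
      unfolding lie_apply a by simp
  qed
  ultimately show ?thesis by (metis add.inverse_unique)
qed

lemma act_lie:
  assumes \<phi>: "\<phi> \<in> automorphisms S" and \<zeta>: "\<zeta> \<in> vf_par S 0" and h: "h \<in> hom_even S"
  shows "act_metric \<phi> (lie \<zeta> h) = lie (pull (inv \<phi>) \<zeta>) (act_metric \<phi> h)"
proof -
  note \<phi>i = automorphism_inv[OF \<phi>]
  have p: "pull (inv \<phi>) \<zeta> \<in> vf_par S 0" by (rule pull_par[OF \<phi>i \<zeta>])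
  have ad: "pull \<phi> (ad S (pull (inv \<phi>) \<zeta>) X) = ad S \<zeta> (pull \<phi> X)" if "X \<in> vf S" for X
    by (rule ext) (simp add: ad_apply[OF \<zeta> pull_vf[OF \<phi> that]] ad_apply[OF p that] pull_apply[OF \<phi>]
        pull_apply[OF \<phi>i] linear_diff[OF inv_linear[OF \<phi>]] inv_inv[OF \<phi>] inv_cancel[OF \<phi>])
  show ?thesis
  proof (rule hom_even_eqI)
    show "act_metric \<phi> (lie \<zeta> h) \<in> hom_even S" by (rule act_hom_even[OF \<phi> lie_hom[OF \<zeta> h]])
    show "lie (pull (inv \<phi>) \<zeta>) (act_metric \<phi> h) \<in> hom_even S" by (rule lie_hom[OF p act_hom_even[OF \<phi> h]])
    fix \<epsilon> \<delta> X Y assume "X \<in> vf_par S \<epsilon>" "Y \<in> vf_par S \<delta>"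
    note v = vf_par_vf[OF this(1)] vf_par_vf[OF this(2)]
    show "act_metric \<phi> (lie \<zeta> h) X Y = lie (pull (inv \<phi>) \<zeta>) (act_metric \<phi> h) X Y"
      unfolding act_metric_apply lie_apply ad[OF v(1)] ad[OF v(2)] pull_apply[OF \<phi>i] inv_inv[OF \<phi>] inv_cancel[OF \<phi>]
      by (simp add: linear_add[OF automorphismD(2)[OF \<phi>]] linear_neg[OF automorphismD(2)[OF \<phi>]]
          linear_diff[OF automorphismD(2)[OF \<phi>]])
  qed
qed

section \<open>Nilpotent flows\<close>

text \<open>The exponential of a vector field \<open>\<zeta>\<close> with \<open>\<zeta>\<^sup>2 = 0\<close>.\<close>

definition flow :: "('a \<Rightarrow> 'a) \<Rightarrow> 'a \<Rightarrow> 'a" where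
  "flow \<zeta> a = a + \<zeta> a"

context
  fixes l :: int
  assumes l2: "2 \<le> l" and top: "int (odd_dim S) + 1 < 2 * l"
begin

lemma fun_vanish: "a \<in> filt (fun_deg S) k \<Longrightarrow> 2 * l - 1 \<le> k \<Longrightarrow> a = 0"
  using A.filt_trivial[of k a] top by simp

text \<open>A vector field of degree at least \<open>2 l - 1\<close> vanishes because its values have degree above the
  odd dimension.\<close>

lemma vf_vanish: "X \<in> filt (vf_deg S) k \<Longrightarrow> 2 * l - 1 \<le> k \<Longrightarrow> X = 0"
  using V.D.filt_trivial[of k X] top by simp

lemma vf_filt_apply: "\<zeta> \<in> filt (vf_deg S) k \<Longrightarrow> a \<in> filt (fun_deg S) i \<Longrightarrow> \<zeta> a \<in> filt (fun_deg S) (i + k)"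
  by (simp add: filt_vf_iff)

lemma fun_all_filt: "k \<le> 0 \<Longrightarrow> a \<in> filt (fun_deg S) k"
  using A.filt_all[of k] by simp

text \<open>On superfunctions the composition raises the degree by at least \<open>2 l\<close>, which exceeds the odd dimension.\<close>

lemma vf_comp_zero:
  assumes \<zeta>: "\<zeta> \<in> filt (vf_deg S) l" and \<eta>: "\<eta> \<in> filt (vf_deg S) l"
  shows "\<zeta> (\<eta> a) = 0"
  using fun_vanish[OF vf_filt_apply[OF \<zeta> vf_filt_apply[OF \<eta> fun_all_filt[OF order_refl]]]] by simp

lemma flow_flow:
  assumes \<zeta>: "\<zeta> \<in> filt (vf_deg S) l" and \<eta>: "\<eta> \<in> filt (vf_deg S) l"
  shows "flow \<zeta> (flow \<eta> a) = flow (\<zeta> + \<eta>) a"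
  using vf_comp_zero[OF assms] linear_add[OF vf_linear[OF V.D.filt_carrier[OF \<zeta>]]]
  by (simp add: flow_def)

lemma flow_inv:
  assumes \<zeta>: "\<zeta> \<in> filt (vf_deg S) l"
  shows "bij (flow \<zeta>)" "inv (flow \<zeta>) = flow (- \<zeta>)"
proof -
  note m = V.D.filt_uminus[OF \<zeta>]
  have 1: "flow (- \<zeta>) (flow \<zeta> a) = a" "flow \<zeta> (flow (- \<zeta>) a) = a" for a
    using flow_flow[OF m \<zeta>, of a] flow_flow[OF \<zeta> m, of a] by (simp_all add: flow_def)
  then show "bij (flow \<zeta>)" by (intro o_bij[of "flow (- \<zeta>)"]) auto
  show "inv (flow \<zeta>) = flow (- \<zeta>)" by (rule inv_unique_comp) (auto simp: fun_eq_iff 1)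
qed

lemma flow_automorphism:
  assumes \<zeta>0: "\<zeta> \<in> vf_par S 0" and \<zeta>: "\<zeta> \<in> filt (vf_deg S) l"
  shows "flow \<zeta> \<in> automorphisms S"
  unfolding automorphisms_def
proof (intro CollectI conjI allI)
  show "bij (flow \<zeta>)" by (rule flow_inv(1)[OF \<zeta>])
  show "linear (flow \<zeta>)"
    by (rule linearI) (simp_all add: flow_def linear_add[OF even_vf_linear[OF \<zeta>0]]
        linear_scale[OF even_vf_linear[OF \<zeta>0]] scaleR_add_right)
  have \<zeta>l: "\<zeta> a \<in> filt (fun_deg S) l" for a using vf_filt_apply[OF \<zeta> fun_all_filt[OF order_refl]] by simp
  show "flow \<zeta> (a * b) = flow \<zeta> a * flow \<zeta> b" for a b
  proof -
    have "\<zeta> a * \<zeta> b \<in> filt (fun_deg S) (l + l)" by (rule filt_fun_mult[OF \<zeta>l \<zeta>l])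
    then have "\<zeta> a * \<zeta> b = 0" by (rule fun_vanish) simp
    then show ?thesis by (simp add: flow_def even_vf_Leibniz[OF \<zeta>0] distrib_left distrib_right)
  qed
  show "flow \<zeta> ` fun_par S \<delta> \<subseteq> fun_par S \<delta>" for \<delta>
    by (auto simp: flow_def fun_par_add even_vf_par[OF \<zeta>0])
  show "\<exists>\<sigma>. diffeo S \<sigma> \<and> (\<forall>a. body S (flow \<zeta> a) = body S a \<circ> \<sigma>)"
  proof (intro exI[of _ id] conjI allI)
    show "diffeo S id" by (simp add: diffeo_def smooth_map_def inv_id)
    have "model S (\<zeta> a) p [] = 0" for a p
    proof -
      have "hA 0 (\<zeta> a) = 0" using \<zeta>l[of a] l2 by (simp add: A.filt_iff)
      then have "model S (hA 0 (\<zeta> a)) p [] = 0" by (simp add: model_zero)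
      then show ?thesis by (simp add: model_hcomponent)
    qed
    then show "body S (flow \<zeta> a) = body S a \<circ> id" for a
      by (simp add: fun_eq_iff body_def flow_def model_add)
  qed
qed

text \<open>The quadratic term \<open>\<zeta> X \<zeta>\<close> raises the degree by at least \<open>2 l - 1\<close>, because \<open>X\<close> lowers it by at
  most \<open>1\<close>.\<close>

lemma pull_flow:
  assumes \<zeta>0: "\<zeta> \<in> vf_par S 0" and \<zeta>: "\<zeta> \<in> filt (vf_deg S) l" and X: "X \<in> vf S"
  shows "pull (flow \<zeta>) X = X - ad S \<zeta> X"
proof
  fix a
  have "\<zeta> (X (\<zeta> a)) \<in> filt (fun_deg S) (0 + l - 1 + l)"
    using vf_filt_apply[OF \<zeta> vf_lowers_by_1[OF X vf_filt_apply[OF \<zeta> fun_all_filt[OF order_refl]]]] .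
  then have "\<zeta> (X (\<zeta> a)) = 0" by (rule fun_vanish) simp
  then show "pull (flow \<zeta>) X a = (X - ad S \<zeta> X) a"
    by (simp add: pull_def flow_inv(2)[OF \<zeta>] flow_def ad_apply[OF \<zeta>0 X] linear_add[OF vf_linear[OF X]]
        linear_add[OF even_vf_linear[OF \<zeta>0]])
qed

text \<open>In the expansion of the transformed metric the second order terms are \<open>L L g / 2\<close> with \<open>L = lie \<zeta>\<close>. This has
  degree at least \<open>2 l + 2\<close> and vanishes, although the single summands of \<open>L L g\<close> need not vanish for
  degree reasons.\<close>

lemma flow_act:
  assumes \<zeta>0: "\<zeta> \<in> vf_par S 0" and \<zeta>: "\<zeta> \<in> filt (vf_deg S) l"
    and g: "g \<in> hom_even S" and L: "lie \<zeta> g \<in> filt (hom_deg S) (l + 2)"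
  shows "act_metric (flow \<zeta>) g = g + lie \<zeta> g"
proof (rule hom_even_eqI)
  note aut = flow_automorphism[OF \<zeta>0 \<zeta>]
  show "act_metric (flow \<zeta>) g \<in> hom_even S" by (rule act_hom_even[OF aut g])
  show "g + lie \<zeta> g \<in> hom_even S" by (rule H.carrier_add[OF g lie_hom[OF \<zeta>0 g]])
  fix \<epsilon> \<delta> X Y assume "X \<in> vf_par S \<epsilon>" "Y \<in> vf_par S \<delta>"
  note v = vf_par_vf[OF this(1)] vf_par_vf[OF this(2)]
  let ?X = "ad S \<zeta> X" and ?Y = "ad S \<zeta> Y"
  note a = ad_vf[OF \<zeta>0]
  have X1: "X \<in> filt (vf_deg S) (- 1)" "Y \<in> filt (vf_deg S) (- 1)" using v vf_eq_filt by auto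
  note X2 = ad_filt[OF \<zeta>0 \<zeta> X1(1)] ad_filt[OF \<zeta>0 \<zeta> X1(2)]
  note lin = even_vf_linear[OF \<zeta>0]
  have L': "lie \<zeta> g Z Z' \<in> filt (fun_deg S) (i + j + (l + 2))"
    if "Z \<in> filt (vf_deg S) i" "Z' \<in> filt (vf_deg S) j" for Z Z' i j
    using L that unfolding filt_hom_iff by blast
  have aa: "ad S \<zeta> ?X = 0" "ad S \<zeta> ?Y = 0"
    by (rule vf_vanish[OF ad_filt[OF \<zeta>0 \<zeta> X2(1)]], simp, rule vf_vanish[OF ad_filt[OF \<zeta>0 \<zeta> X2(2)]], simp)
  have g0: "g 0 Z = 0" "g Z 0 = 0" if "Z \<in> vf S" for Z
    using hom_even_apply(2)[OF g vf_zero that vf_zero] hom_even_apply(3)[OF g that vf_zero vf_zero] by simp_all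
  \<comment> \<open>the form \<open>L = lie \<zeta> g\<close> vanishes at \<open>([\<zeta>, X], Y)\<close> and at \<open>(X, [\<zeta>, Y])\<close>, and so does \<open>\<zeta> (L X Y)\<close>\<close>
  have 1: "\<zeta> (g ?X Y) = g ?X ?Y"
  proof -
    have "lie \<zeta> g ?X Y = 0" by (rule fun_vanish[OF L'[OF X2(1) X1(2)]]) simp
    then show ?thesis by (simp add: lie_apply aa g0(1)[OF v(2)])
  qed
  have 2: "\<zeta> (g X ?Y) = g ?X ?Y"
  proof -
    have "lie \<zeta> g X ?Y = 0" by (rule fun_vanish[OF L'[OF X1(1) X2(2)]]) simp
    then show ?thesis by (simp add: lie_apply aa g0(2)[OF v(1)])
  qed
  have 3: "g ?X ?Y = 0"
  proof -
    have z: "\<zeta> (lie \<zeta> g X Y) = 0" by (rule fun_vanish[OF vf_filt_apply[OF \<zeta> L'[OF X1]]]) simp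
    have "\<zeta> (lie \<zeta> g X Y) = - (\<zeta> (g ?X Y) + \<zeta> (g X ?Y)) + \<zeta> (\<zeta> (g X Y))"
      by (simp only: lie_apply linear_add[OF lin] linear_neg[OF lin])
    then have "- (g ?X ?Y + g ?X ?Y) = 0"
      unfolding 1 2 vf_comp_zero[OF \<zeta> \<zeta>] z add_0_right by (rule sym)
    then have "2 *\<^sub>R g ?X ?Y = 0" unfolding scaleR_2 by (simp only: neg_equal_0_iff_equal)
    then show ?thesis by simp
  qed
  have d: "g (X - ?X) Z = g X Z - g ?X Z" if Z: "Z \<in> vf S" for Z
    using hom_even_apply(2)[OF g vf_diff[OF v(1) a[of X]] Z a[of X]]
    by (simp only: diff_add_cancel add_diff_cancel_right')
  have d': "g Z (Y - ?Y) = g Z Y - g Z ?Y" if Z: "Z \<in> vf S" for Z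
    using hom_even_apply(3)[OF g Z vf_diff[OF v(2) a[of Y]] a[of Y]]
    by (simp only: diff_add_cancel add_diff_cancel_right')
  have "act_metric (flow \<zeta>) g X Y = flow \<zeta> (g (X - ?X) (Y - ?Y))"
    unfolding act_metric_apply pull_flow[OF \<zeta>0 \<zeta> v(1)] pull_flow[OF \<zeta>0 \<zeta> v(2)] ..
  also have "g (X - ?X) (Y - ?Y) = g X Y - g X ?Y - g ?X Y"
    by (simp only: d[OF vf_diff[OF v(2) a[of Y]]] d'[OF v(1)] d'[OF a[of X]] 3 diff_0_right)
  also have "flow \<zeta> \<dots> = g X Y + lie \<zeta> g X Y"
    by (simp add: flow_def lie_apply linear_diff[OF lin] 1 2 3)
  finally show "act_metric (flow \<zeta>) g X Y = (g + lie \<zeta> g) X Y" by simp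
qed

end

end

section \<open>Metrics with a given reduction\<close>

locale split_metric = supermanifold S
  for S :: "('m::{t2_space, second_countable_topology}, 'v::real_vector, 'a::real_algebra_1) batchelor" +
  fixes gR :: "('a \<Rightarrow> 'a) \<Rightarrow> (('a \<Rightarrow> 'a) \<Rightarrow> 'a)" and l :: int
  assumes metric: "riemannian_metric S gR" and reduced: "reduction S gR = gR"
    and l2: "2 \<le> l" and l_even: "even l" and top: "int (odd_dim S) + 1 < 2 * l"
begin

abbreviation FA where "FA \<equiv> filt (fun_deg S)"
abbreviation FV where "FV \<equiv> filt (vf_deg S)"
abbreviation FH where "FH \<equiv> filt (hom_deg S)"

definition sharp :: "(('a \<Rightarrow> 'a) \<Rightarrow> 'a) \<Rightarrow> 'a \<Rightarrow> 'a" where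
  "sharp = inv_into (vf S) gR"

lemmas gR_hom = metric_hom[OF metric] and gR_bij = metric_bij[OF metric] and gR_sym = metric_sym[OF metric]

lemma sharp_vf: "\<alpha> \<in> dual S \<Longrightarrow> sharp \<alpha> \<in> vf S"
  using bij_betw_apply[OF bij_betw_inv_into[OF gR_bij]] by (simp add: sharp_def)

lemma gR_sharp: "\<alpha> \<in> dual S \<Longrightarrow> gR (sharp \<alpha>) = \<alpha>"
  using bij_betw_inv_into_right[OF gR_bij] by (simp add: sharp_def)

lemma sharp_gR: "X \<in> vf S \<Longrightarrow> sharp (gR X) = X"
  using bij_betw_inv_into_left[OF gR_bij] by (simp add: sharp_def)

lemma sharp_eqI: "X \<in> vf S \<Longrightarrow> gR X = \<alpha> \<Longrightarrow> sharp \<alpha> = X"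
  using sharp_gR by blast

lemma sharp_zero: "sharp 0 = 0"
  by (rule sharp_eqI[OF vf_zero metric_zero[OF metric]])

lemma sharp_add: "\<alpha> \<in> dual S \<Longrightarrow> \<beta> \<in> dual S \<Longrightarrow> sharp (\<alpha> + \<beta>) = sharp \<alpha> + sharp \<beta>"
  by (rule sharp_eqI) (simp_all only: vf_add sharp_vf hom_evenD(2)[OF gR_hom] gR_sharp)

lemma sharp_diff: "\<alpha> \<in> dual S \<Longrightarrow> \<beta> \<in> dual S \<Longrightarrow> sharp (\<alpha> - \<beta>) = sharp \<alpha> - sharp \<beta>"
  using sharp_add[OF dual_diff, of \<alpha> \<beta> \<beta>] by (simp add: algebra_simps)

lemma sharp_lmult: "\<alpha> \<in> dual S \<Longrightarrow> sharp (lmult f \<alpha>) = lmult f (sharp \<alpha>)"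
  by (rule sharp_eqI) (simp_all only: vf_lmult sharp_vf hom_evenD(3)[OF gR_hom] gR_sharp)

lemma sharp_par: "\<alpha> \<in> dual_par S \<delta> \<Longrightarrow> sharp \<alpha> \<in> vf_par S \<delta>"
  by (rule metric_reflects_parity[OF metric]) (simp_all add: sharp_vf gR_sharp dual_par_dual)

lemma sharp_hom_end: assumes h: "h \<in> hom_even S" shows "sharp \<circ> h \<in> end_even S"
proof (rule end_evenI)
  show "(sharp \<circ> h) X = 0" if "X \<notin> vf S" for X
    using hom_evenD(1)[OF h that] sharp_zero by simp
  show "(sharp \<circ> h) (X + Y) = (sharp \<circ> h) X + (sharp \<circ> h) Y" if "X \<in> vf S" "Y \<in> vf S" for X Y
    unfolding comp_apply hom_evenD(2)[OF h that]
    by (rule sharp_add[OF hom_even_dual[OF h that(1)] hom_even_dual[OF h that(2)]])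
  show "(sharp \<circ> h) (lmult f X) = lmult f ((sharp \<circ> h) X)" if "X \<in> vf S" for f X
    unfolding comp_apply hom_evenD(3)[OF h that] by (rule sharp_lmult[OF hom_even_dual[OF h that]])
  show "(sharp \<circ> h) X \<in> vf_par S \<delta>" if "X \<in> vf_par S \<delta>" for X \<delta>
    unfolding comp_apply by (rule sharp_par[OF hom_evenD(4)[OF h that]])
qed

lemma hom_comp_end: assumes h: "h \<in> hom_even S" and W: "W \<in> end_even S" shows "h \<circ> W \<in> hom_even S"
proof (rule hom_evenI)
  show "(h \<circ> W) X = 0" if "X \<notin> vf S" for X
    using end_evenD(1)[OF W that] hom_evenD(2)[OF h vf_zero vf_zero] by simp
  show "(h \<circ> W) (X + Y) = (h \<circ> W) X + (h \<circ> W) Y" if "X \<in> vf S" "Y \<in> vf S" for X Y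
    unfolding comp_apply end_evenD(2)[OF W that]
    by (rule hom_evenD(2)[OF h end_even_vf[OF W that(1)] end_even_vf[OF W that(2)]])
  show "(h \<circ> W) (lmult f X) = lmult f ((h \<circ> W) X)" if "X \<in> vf S" for f X
    unfolding comp_apply end_evenD(3)[OF W that] by (rule hom_evenD(3)[OF h end_even_vf[OF W that]])
  show "(h \<circ> W) X \<in> dual_par S \<delta>" if "X \<in> vf_par S \<delta>" for X \<delta>
    unfolding comp_apply by (rule hom_evenD(4)[OF h end_evenD(4)[OF W that]])
qed

lemma gR_sharp_hom: assumes h: "h \<in> hom_even S" shows "gR \<circ> (sharp \<circ> h) = h"
proof
  fix X show "(gR \<circ> (sharp \<circ> h)) X = h X"
  proof (cases "X \<in> vf S")
    case True
    then show ?thesis using gR_sharp[OF hom_even_dual[OF h]] by simp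
  next
    case False
    then show ?thesis using hom_evenD(1)[OF h False] metric_zero[OF metric] sharp_zero by simp
  qed
qed

lemma sharp_gR_end: assumes W: "W \<in> end_even S" shows "sharp \<circ> (gR \<circ> W) = W"
proof
  fix X show "(sharp \<circ> (gR \<circ> W)) X = W X"
  proof (cases "X \<in> vf S")
    case True
    then show ?thesis using sharp_gR[OF end_even_vf[OF W]] by simp
  next
    case False
    then show ?thesis using end_evenD(1)[OF W False] metric_zero[OF metric] sharp_zero by simp
  qed
qed

lemma FH_apply: "h \<in> FH k \<Longrightarrow> X \<in> FV i \<Longrightarrow> Y \<in> FV j \<Longrightarrow> h X Y \<in> FA (i + j + k)"
  unfolding filt_hom_iff by blast

lemma FH_hom: "h \<in> FH k \<Longrightarrow> h \<in> hom_even S"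
  by (simp add: filt_hom_iff)

lemma sharp_filt:
  assumes h: "h \<in> FH (k + 2)" and X: "X \<in> FV i"
  shows "sharp (h X) \<in> FV (i + k)"
proof -
  have hX: "h X \<in> dual S" using hom_even_dual[OF FH_hom[OF h] V.D.filt_carrier[OF X]] .
  have "sharp (h X) \<in> FV ((i + k + 2) - 2)"
  proof (rule metric_inverse_filt[OF metric sharp_vf[OF hX]])
    fix j Y assume "Y \<in> FV j"
    from FH_apply[OF h X this] show "gR (sharp (h X)) Y \<in> FA (j + (i + k + 2))"
      by (simp add: gR_sharp[OF hX] ac_simps)
  qed
  then show ?thesis by simp
qed

lemma sharp_end_filt: "h \<in> FH (k + 2) \<Longrightarrow> sharp \<circ> h \<in> filt (end_deg S) k"
  unfolding filt_end_iff using sharp_hom_end[OF FH_hom] sharp_filt by auto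

lemma gR_split:
  obtains g2 where "gR = hcomponent (hom_deg S) 0 gR + g2" "g2 \<in> FH 2"
    "hcomponent (hom_deg S) 0 gR \<in> hom_even S"
proof (rule that)
  show "gR = hcomponent (hom_deg S) 0 gR + hcomponent (hom_deg S) 2 gR"
    using reduced by (simp add: reduction_def)
  show "hcomponent (hom_deg S) 2 gR \<in> FH 2"
    by (rule H.homogeneous_filt[OF H.hcomponent_mem[OF gR_hom]]) simp
  show "hcomponent (hom_deg S) 0 gR \<in> hom_even S" by (rule H.hcomponent_carrier[OF gR_hom])
qed

lemma FH_comp_end:
  assumes h: "h \<in> FH n" and W: "W \<in> filt (end_deg S) k"
  shows "h \<circ> W \<in> FH (k + n)"
  unfolding filt_hom_iff
proof (intro conjI allI ballI)
  show "h \<circ> W \<in> hom_even S" using W by (intro hom_comp_end FH_hom[OF h]) (simp add: filt_end_iff)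
  fix i j X Y assume X: "X \<in> FV i" and Y: "Y \<in> FV j"
  have "W X \<in> FV (i + k)" using W X unfolding filt_end_iff by blast
  from FH_apply[OF h this Y] show "(h \<circ> W) X Y \<in> FA (i + j + (k + n))" by (simp add: ac_simps)
qed

text \<open>The condition on \<open>g\<^sub>0 W\<close> is one on \<open>gR W\<close>, as \<open>g\<^sub>2 W\<close> satisfies it for degree reasons. Conversely the
  bound for \<open>gR W\<close> implies the one for \<open>W\<close>, since the inverse metric lowers degrees by at most \<open>2\<close>.\<close>

lemma end_filt_g0_iff: "W \<in> end_filt_g0 S gR k \<longleftrightarrow> W \<in> end_even S \<and> gR \<circ> W \<in> FH (k + 2)"
proof -
  obtain g2 where g: "gR = hcomponent (hom_deg S) 0 gR + g2" "g2 \<in> FH 2"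
    "hcomponent (hom_deg S) 0 gR \<in> hom_even S" by (rule gR_split)
  have split: "gR \<circ> W = (hcomponent (hom_deg S) 0 gR \<circ> W) + (g2 \<circ> W)"
  proof
    fix X
    have "gR (W X) = (hcomponent (hom_deg S) 0 gR + g2) (W X)" using g(1) by (rule arg_cong)
    then show "(gR \<circ> W) X = ((hcomponent (hom_deg S) 0 gR \<circ> W) + (g2 \<circ> W)) X" by simp
  qed
  have 2: "g2 \<circ> W \<in> FH (k + 2)" if "W \<in> filt (end_deg S) k" using FH_comp_end[OF g(2) that] .
  show ?thesis
  proof
    assume W: "W \<in> end_filt_g0 S gR k"
    then have "W \<in> filt (end_deg S) k" "hcomponent (hom_deg S) 0 gR \<circ> W \<in> FH (k + 2)"
      by (auto simp: end_filt_g0_def)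
    then show "W \<in> end_even S \<and> gR \<circ> W \<in> FH (k + 2)"
      using 2 H.filt_add unfolding split by (simp add: filt_end_iff)
  next
    assume W: "W \<in> end_even S \<and> gR \<circ> W \<in> FH (k + 2)"
    then have Wk: "W \<in> filt (end_deg S) k"
      using sharp_end_filt[of "gR \<circ> W" k] sharp_gR_end by simp
    then have "(gR \<circ> W) - (g2 \<circ> W) \<in> FH (k + 2)" using H.filt_diff W 2 by blast
    moreover have "(gR \<circ> W) - (g2 \<circ> W) = hcomponent (hom_deg S) 0 gR \<circ> W" unfolding split by (rule add_diff_cancel_right')
    ultimately show "W \<in> end_filt_g0 S gR k" using Wk by (simp add: end_filt_g0_def)
  qed
qed

text \<open>The symmetric forms of high degree. They parametrise both the metrics with reduction \<open>gR\<close> and,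
  by raising an index, the space \<open>F_space S gR l\<close>.\<close>

definition sym_forms :: "(('a \<Rightarrow> 'a) \<Rightarrow> (('a \<Rightarrow> 'a) \<Rightarrow> 'a)) set" where
  "sym_forms = {h \<in> FH (l + 2). supersymmetric h}"

lemma dual_par_comp_end:
  assumes \<alpha>: "\<alpha> \<in> dual_par S \<delta>" and W: "W \<in> end_even S"
  shows "\<alpha> \<circ> W \<in> dual_par S \<delta>"
proof (rule dual_parI)
  have \<alpha>0: "\<alpha> 0 = 0" using dual_parD(2)[OF \<alpha> vf_zero vf_zero] by simp
  show "(\<alpha> \<circ> W) X = 0" if "X \<notin> vf S" for X
    by (simp only: comp_apply end_evenD(1)[OF W that] \<alpha>0)
  show "(\<alpha> \<circ> W) (X + Y) = (\<alpha> \<circ> W) X + (\<alpha> \<circ> W) Y" if "X \<in> vf S" "Y \<in> vf S" for X Y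
    unfolding comp_apply end_evenD(2)[OF W that]
    by (rule dual_parD(2)[OF \<alpha> end_even_vf[OF W that(1)] end_even_vf[OF W that(2)]])
  show "(\<alpha> \<circ> W) (lmult f X) = (- 1) ^ (\<delta> * \<epsilon>) *\<^sub>R (f * (\<alpha> \<circ> W) X)"
    if "f \<in> fun_par S \<epsilon>" "X \<in> vf S" for \<epsilon> f X
    unfolding comp_apply end_evenD(3)[OF W that(2)] by (rule dual_parD(3)[OF \<alpha> that(1) end_even_vf[OF W that(2)]])
  show "(\<alpha> \<circ> W) X \<in> fun_par S (\<epsilon> + \<delta>)" if "X \<in> vf_par S \<epsilon>" for \<epsilon> X
    unfolding comp_apply by (rule dual_parD(4)[OF \<alpha> end_evenD(4)[OF W that]])
qed

text \<open>Sign rules apply to arguments of definite parity only. The even and odd parts of a vector field obey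
  the same degree bound as the field.\<close>

lemma supersymmetric_filt_swap:
  assumes sym: "\<And>\<epsilon> \<delta> X Y. X \<in> vf_par S \<epsilon> \<Longrightarrow> Y \<in> vf_par S \<delta> \<Longrightarrow> k X Y = (- 1) ^ (\<epsilon> * \<delta>) *\<^sub>R h Y X"
    and h: "h \<in> FH n" and k: "k \<in> hom_even S"
  shows "k \<in> FH n"
  unfolding filt_hom_iff
proof (intro conjI k allI ballI)
  fix i j X Y assume X: "X \<in> FV i" and Y: "Y \<in> FV j"
  obtain X0 X1 where Xp: "X0 \<in> vf_par S 0" "X1 \<in> vf_par S 1" "X = X0 + X1"
    using vf_decomp[OF V.D.filt_carrier[OF X]] .
  obtain Y0 Y1 where Yp: "Y0 \<in> vf_par S 0" "Y1 \<in> vf_par S 1" "Y = Y0 + Y1"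
    using vf_decomp[OF V.D.filt_carrier[OF Y]] .
  note v = vf_par_vf[OF Xp(1)] vf_par_vf[OF Xp(2)] vf_par_vf[OF Yp(1)] vf_par_vf[OF Yp(2)]
  have Xf: "X0 \<in> FV i" "X1 \<in> FV i" using filt_vf_parts[OF Xp(1,2)] X Xp(3) by metis+
  have Yf: "Y0 \<in> FV j" "Y1 \<in> FV j" using filt_vf_parts[OF Yp(1,2)] Y Yp(3) by metis+
  have s: "k Z Z' \<in> FA (i + j + n)"
    if "Z \<in> vf_par S \<epsilon>" "Z' \<in> vf_par S \<delta>" "Z \<in> FV i" "Z' \<in> FV j" for \<epsilon> \<delta> Z Z'
    unfolding sym[OF that(1,2)] using filt_fun_scale[OF FH_apply[OF h that(4,3)]] by (simp add: ac_simps)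
  show "k X Y \<in> FA (i + j + n)"
    unfolding Xp(3) Yp(3)
    by (simp only: hom_even_apply(2,3)[OF k] v vf_add)
      (intro A.filt_add s[OF Xp(1) Yp(1) Xf(1) Yf(1)] s[OF Xp(1) Yp(2) Xf(1) Yf(2)]
        s[OF Xp(2) Yp(1) Xf(2) Yf(1)] s[OF Xp(2) Yp(2) Xf(2) Yf(2)])
qed

text \<open>The map \<^const>\<open>F_map\<close> is symmetrisation: with an index lowered it takes \<open>h = gR W\<close> to the sum of \<open>h\<close> and
  its transpose.\<close>

lemma symmetrisation:
  assumes W: "W \<in> end_even S" and gW: "gR \<circ> W \<in> FH (l + 2)"
  shows "(\<lambda>X. gR (W X) + (gR X \<circ> W)) \<in> sym_forms" "F_map S gR W = sharp \<circ> (\<lambda>X. gR (W X) + (gR X \<circ> W))"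
proof -
  let ?k = "\<lambda>X. gR X \<circ> W"
  have k: "?k \<in> hom_even S"
  proof (rule hom_evenI)
    show "?k X = 0" if "X \<notin> vf S" for X
      using hom_evenD(1)[OF gR_hom that] by (simp add: fun_eq_iff)
    show "?k (X + Y) = ?k X + ?k Y" if "X \<in> vf S" "Y \<in> vf S" for X Y
      unfolding hom_evenD(2)[OF gR_hom that] by (rule ext) simp
    show "?k (lmult f X) = lmult f (?k X)" if "X \<in> vf S" for f X
      unfolding hom_evenD(3)[OF gR_hom that] by (rule ext) (simp add: lmult_def)
    show "?k X \<in> dual_par S \<delta>" if "X \<in> vf_par S \<delta>" for X \<delta>
      by (rule dual_par_comp_end[OF hom_evenD(4)[OF gR_hom that] W])
  qed
  have swap: "?k X Y = (- 1) ^ (\<epsilon> * \<delta>) *\<^sub>R (gR \<circ> W) Y X" if "X \<in> vf_par S \<epsilon>" "Y \<in> vf_par S \<delta>" for \<epsilon> \<delta> X Y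
    using supersymmetricD[OF gR_sym that(1) end_evenD(4)[OF W that(2)]] by simp
  have kf: "?k \<in> FH (l + 2)" by (rule supersymmetric_filt_swap[OF swap gW k])
  have eq: "(\<lambda>X. gR (W X) + (gR X \<circ> W)) = (gR \<circ> W) + ?k" by (rule ext) simp
  have "supersymmetric ((gR \<circ> W) + ?k)" unfolding supersymmetric_def
  proof (intro allI ballI)
    fix \<epsilon> \<delta> X Y assume X: "X \<in> vf_par S \<epsilon>" and Y: "Y \<in> vf_par S \<delta>"
    have "(gR \<circ> W) X Y = (- 1) ^ (\<epsilon> * \<delta>) *\<^sub>R ?k Y X"
      using swap[OF Y X] by (simp add: minus_one_power_iff)
    then show "((gR \<circ> W) + ?k) X Y = (- 1) ^ (\<epsilon> * \<delta>) *\<^sub>R ((gR \<circ> W) + ?k) Y X"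
      using swap[OF X Y] by (simp add: scaleR_add_right)
  qed
  then show "(\<lambda>X. gR (W X) + (gR X \<circ> W)) \<in> sym_forms"
    unfolding sym_forms_def eq using H.filt_add[OF gW kf] by blast
  show "F_map S gR W = sharp \<circ> (\<lambda>X. gR (W X) + (gR X \<circ> W))"
  proof
    fix X show "F_map S gR W X = (sharp \<circ> (\<lambda>X. gR (W X) + (gR X \<circ> W))) X"
    proof (cases "X \<in> vf S")
      case True
      have "sharp (gR (W X) + ?k X) = W X + sharp (?k X)"
        using sharp_add[OF hom_even_dual[OF gR_hom end_even_vf[OF W True]] hom_even_dual[OF k True]]
          sharp_gR[OF end_even_vf[OF W True]] by simp
      then show ?thesis by (simp add: F_map_def sharp_def)
    next
      case False
      have z: "W X = 0" "?k X = 0" using end_evenD(1)[OF W False] hom_evenD(1)[OF k False] by simp_all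
      have "sharp (gR (W X) + ?k X) = W X + sharp (?k X)"
        unfolding z by (simp only: metric_zero[OF metric] add_0 sharp_zero)
      then show ?thesis by (simp add: F_map_def sharp_def)
    qed
  qed
qed

text \<open>A symmetric form \<open>h\<close> is the symmetrisation of \<open>h / 2\<close>.\<close>

lemma F_space_eq: "F_space S gR l = (\<lambda>h. sharp \<circ> h) ` sym_forms"
proof
  show "F_space S gR l \<subseteq> (\<lambda>h. sharp \<circ> h) ` sym_forms"
    unfolding F_space_def using symmetrisation by (auto simp: end_filt_g0_iff)
  show "(\<lambda>h. sharp \<circ> h) ` sym_forms \<subseteq> F_space S gR l"
  proof clarify
    fix h assume "h \<in> sym_forms"
    then have h: "h \<in> FH (l + 2)" "supersymmetric h" by (auto simp: sym_forms_def)
    let ?c = "(1 / 2) *\<^sub>R (1 :: 'a)"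
    let ?h = "\<lambda>X. lmult ?c (h X)"
    have hh: "?h X Y = (1 / 2) *\<^sub>R h X Y" for X Y by (simp add: lmult_def)
    have h2: "?h \<in> hom_even S"
    proof (rule hom_evenI)
      show "?h X = 0" if "X \<notin> vf S" for X using hom_evenD(1)[OF FH_hom[OF h(1)] that] by (simp add: lmult_zero)
      show "?h (X + Y) = ?h X + ?h Y" if "X \<in> vf S" "Y \<in> vf S" for X Y
        unfolding hom_evenD(2)[OF FH_hom[OF h(1)] that] by (rule lmult_add_right)
      show "?h (lmult f X) = lmult f (?h X)" if "X \<in> vf S" for f X
        unfolding hom_evenD(3)[OF FH_hom[OF h(1)] that] by (rule ext) (simp add: lmult_def)
      show "?h X \<in> dual_par S \<delta>" if "X \<in> vf_par S \<delta>" for X \<delta>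
      proof -
        have "?c \<in> fun_par S 0" by (rule fun_par_scale[OF fun_deg_par[OF one_fun_deg]]) simp
        from dual_par_lmult[OF this hom_evenD(4)[OF FH_hom[OF h(1)] that]] show ?thesis by simp
      qed
    qed
    have h2f: "?h \<in> FH (l + 2)"
      unfolding filt_hom_iff
    proof (intro conjI h2 allI ballI)
      show "?h X Y \<in> FA (i + j + (l + 2))" if "X \<in> FV i" "Y \<in> FV j" for i j X Y
        unfolding hh by (rule filt_fun_scale[OF FH_apply[OF h(1) that]])
    qed
    let ?W = "sharp \<circ> ?h"
    have W: "?W \<in> end_even S" "gR \<circ> ?W = ?h" using sharp_hom_end[OF h2] gR_sharp_hom[OF h2] by auto
    have S: "(\<lambda>X. gR (?W X) + (gR X \<circ> ?W)) \<in> sym_forms" "F_map S gR ?W = sharp \<circ> (\<lambda>X. gR (?W X) + (gR X \<circ> ?W))"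
      using symmetrisation[OF W(1)] h2f unfolding W(2) by blast+
    have "(\<lambda>X. gR (?W X) + (gR X \<circ> ?W)) = h"
    proof (rule hom_even_eqI[OF _ FH_hom[OF h(1)]])
      show "(\<lambda>X. gR (?W X) + (gR X \<circ> ?W)) \<in> hom_even S" using S(1) FH_hom unfolding sym_forms_def by blast
      fix \<epsilon> \<delta> X Y assume X: "X \<in> vf_par S \<epsilon>" and Y: "Y \<in> vf_par S \<delta>"
      have "gR (?W Z) = ?h Z" for Z using W(2) by (metis comp_apply)
      moreover have "(gR X \<circ> ?W) Y = (- 1) ^ (\<epsilon> * \<delta>) *\<^sub>R gR (?W Y) X"
        using supersymmetricD[OF gR_sym X end_evenD(4)[OF W(1) Y]] by simp
      ultimately have "(gR (?W X) + (gR X \<circ> ?W)) Y = (1 / 2) *\<^sub>R h X Y + (- 1) ^ (\<epsilon> * \<delta>) *\<^sub>R (1 / 2) *\<^sub>R h Y X"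
        by (simp only: plus_fun_apply hh)
      also have "\<dots> = (1 / 2) *\<^sub>R h X Y + (1 / 2) *\<^sub>R h X Y"
        using supersymmetricD[OF h(2) X Y] by (simp add: minus_one_power_iff)
      also have "\<dots> = h X Y" by (simp flip: scaleR_add_left)
      finally show "(gR (?W X) + (gR X \<circ> ?W)) Y = h X Y" .
    qed
    then have "sharp \<circ> h = F_map S gR ?W" using S(2) by simp
    moreover have "?W \<in> end_filt_g0 S gR l" unfolding end_filt_g0_iff using W h2f by simp
    ultimately show "sharp \<circ> h \<in> F_space S gR l" unfolding F_space_def by blast
  qed
qed

lemma F_space_mem: "h \<in> sym_forms \<Longrightarrow> sharp \<circ> h \<in> F_space S gR l"
  by (simp add: F_space_eq)

lemma sharp_inj: "h \<in> hom_even S \<Longrightarrow> k \<in> hom_even S \<Longrightarrow> sharp \<circ> h = sharp \<circ> k \<Longrightarrow> h = k"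
  using gR_sharp_hom by metis

lemma sharp_comp_diff: assumes "h \<in> hom_even S" "k \<in> hom_even S"
  shows "sharp \<circ> (h - k) = (sharp \<circ> h) - (sharp \<circ> k)"
proof
  fix X
  have "sharp ((h - k) X) = sharp (h X) - sharp (k X)"
  proof (cases "X \<in> vf S")
    case True
    then show ?thesis using sharp_diff[OF hom_even_dual[OF assms(1)] hom_even_dual[OF assms(2)]] by simp
  next
    case False
    have z: "h X = 0" "k X = 0" "(h - k) X = 0"
      using hom_evenD(1)[OF assms(1) False] hom_evenD(1)[OF assms(2) False] by simp_all
    show ?thesis by (simp only: z sharp_zero diff_self)
  qed
  then show "(sharp \<circ> (h - k)) X = ((sharp \<circ> h) - (sharp \<circ> k)) X" by simp
qed

text \<open>Products of two endomorphisms of degree at least \<open>l\<close> vanish.\<close>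

lemma sharp_sharp_zero:
  assumes h: "h \<in> FH (l + 2)" and k: "k \<in> FH (l + 2)" and X: "X \<in> vf S"
  shows "k (sharp (h X)) = 0"
proof
  fix Y show "k (sharp (h X)) Y = 0 Y"
  proof (cases "Y \<in> vf S")
    case True
    have "X \<in> FV (- 1)" using X vf_eq_filt by simp
    then have "sharp (h X) \<in> FV (- 1 + l)" by (rule sharp_filt[OF h])
    then have "k (sharp (h X)) Y \<in> FA (- 1 + l + - 1 + (l + 2))"
      using FH_apply[OF k] True vf_eq_filt by blast
    then have "k (sharp (h X)) Y = 0" by (rule fun_vanish[OF l2 top]) simp
    then show ?thesis by simp
  next
    case False
    then show ?thesis using hom_even_apply(1)[OF FH_hom[OF k]] by simp
  qed
qed

definition split_metrics :: "(('a \<Rightarrow> 'a) \<Rightarrow> (('a \<Rightarrow> 'a) \<Rightarrow> 'a)) set" where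
  "split_metrics = (\<lambda>h. gR + h) ` sym_forms"

text \<open>With \<open>U = gR\<^sup>-\<^sup>1 h\<close> one has \<open>gR + h = gR (1 + U)\<close>, and \<open>1 - U\<close> inverts \<open>1 + U\<close>.\<close>

lemma split_metric_bij:
  assumes h: "h \<in> FH (l + 2)"
  shows "bij_betw (gR + h) (vf S) (dual S)"
  unfolding bij_betw_def
proof
  note hh = FH_hom[OF h]
  have hz: "h (sharp (h X)) = 0" if "X \<in> vf S" for X by (rule sharp_sharp_zero[OF h h that])
  have hd: "h (X - Y) = h X - h Y" if "X \<in> vf S" "Y \<in> vf S" for X Y
    using hom_evenD(2)[OF hh vf_diff[OF that] that(2)] by (simp add: algebra_simps)
  have gd: "gR (X - Y) = gR X - gR Y" if "X \<in> vf S" "Y \<in> vf S" for X Y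
    using hom_evenD(2)[OF gR_hom vf_diff[OF that] that(2)] by (simp add: algebra_simps)
  show "inj_on (gR + h) (vf S)"
  proof (rule inj_onI)
    fix X Y assume v: "X \<in> vf S" "Y \<in> vf S" and "(gR + h) X = (gR + h) Y"
    then have "gR X + h X = gR Y + h Y" by simp
    then have e: "gR (X - Y) = - h (X - Y)" unfolding gd[OF v] hd[OF v] by (simp add: algebra_simps)
    note d = vf_diff[OF v]
    have "X - Y = sharp (0 - h (X - Y))" using sharp_gR[OF d] e by simp
    also have "\<dots> = 0 - sharp (h (X - Y))"
      using sharp_diff[OF dual_zero hom_even_dual[OF hh d]] sharp_zero by simp
    finally have "X - Y = 0 - sharp (h (X - Y))" .
    then have "h (X - Y) = h 0 - h (sharp (h (X - Y)))"
      using hd[OF vf_zero sharp_vf[OF hom_even_dual[OF hh d]]] by metis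
    also have "\<dots> = 0" using hz[OF d] hd[OF vf_zero vf_zero] by simp
    finally have "gR (X - Y) = gR 0" using e metric_zero[OF metric] by simp
    then show "X = Y" using metric_injD[OF metric d vf_zero] by simp
  qed
  show "(gR + h) ` vf S = dual S"
  proof
    show "(gR + h) ` vf S \<subseteq> dual S"
      using dual_add[OF hom_even_dual[OF gR_hom] hom_even_dual[OF hh]] by auto
    show "dual S \<subseteq> (gR + h) ` vf S"
    proof
      fix \<alpha> assume \<alpha>: "\<alpha> \<in> dual S"
      let ?Y = "sharp \<alpha>"
      note Y = sharp_vf[OF \<alpha>]
      note hY = hom_even_dual[OF hh Y]
      let ?X = "?Y - sharp (h ?Y)"
      have "(gR + h) ?X = gR ?Y - gR (sharp (h ?Y)) + (h ?Y - h (sharp (h ?Y)))"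
        unfolding plus_fun_apply[of gR] gd[OF Y sharp_vf[OF hY]] hd[OF Y sharp_vf[OF hY]] ..
      also have "\<dots> = \<alpha>" unfolding gR_sharp[OF \<alpha>] gR_sharp[OF hY] hz[OF Y] by simp
      finally have e: "(gR + h) ?X = \<alpha>" .
      show "\<alpha> \<in> (gR + h) ` vf S" by (rule rev_image_eqI[OF vf_diff[OF Y sharp_vf[OF hY]]]) (rule e[symmetric])
    qed
  qed
qed

lemma fun_deg_par_even:
  assumes a: "a \<in> fun_deg S n" "a \<in> fun_par S \<epsilon>" "a \<noteq> 0"
  shows "even (n - int \<epsilon>)"
proof -
  have "hA n a = a" using A.hcomponent_homogeneous[OF a(1), of n] by simp
  then show ?thesis using a(2,3) unfolding fun_par_iff by metis
qed

text \<open>A component of the wrong degree would have values whose degrees contradict their parities.\<close>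

lemma hV_parity:
  assumes X: "X \<in> vf_par S \<epsilon>" and odd: "odd (i - int \<epsilon>)"
  shows "hV i X = 0"
proof
  note lin = vf_par_linear[OF hV_par[OF X]]
  have hom: "hV i X a = 0" if a: "a \<in> fun_deg S n" for a n
  proof (rule ccontr)
    assume nz: "hV i X a \<noteq> 0"
    then have "a \<noteq> 0" using linear_0[OF lin] by metis
    then have n: "0 \<le> n" using A.bounded[OF a] by fastforce
    then have ap: "a \<in> fun_par S (nat n)" using fun_deg_par[OF a, of "nat n"] by simp
    have "hV i X a \<in> fun_deg S (n + i)" unfolding hV_apply[OF vf_par_vf[OF X] a] by (rule hcomp_mem)
    then have "even (n + i - int (nat n + \<epsilon>))"
      using vf_par_maps[OF hV_par[OF X] ap] nz by (rule fun_deg_par_even)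
    then show False using odd n by simp
  qed
  fix a
  have "hV i X (\<Sum>n\<in>{0..int (odd_dim S)}. hA n a) = 0"
    unfolding linear_sum[OF lin] by (simp add: hom[OF hcomp_mem])
  then show "hV i X a = 0 a" by (simp add: A.sum_hcomponent)
qed

lemma hom_even_sum:
  assumes k: "k \<in> hom_even S" and f: "\<And>i. f i \<in> vf S" and Z: "Z \<in> vf S"
  shows "k (sum f I) Z = (\<Sum>i\<in>I. k (f i) Z)" "k Z (sum f I) = (\<Sum>i\<in>I. k Z (f i))"
proof -
  have 0: "k 0 Z = 0" "k Z 0 = 0"
    using hom_even_apply(2)[OF k vf_zero Z vf_zero] hom_even_apply(3)[OF k Z vf_zero vf_zero] by simp_all
  show "k (sum f I) Z = (\<Sum>i\<in>I. k (f i) Z)"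
  proof (induction I rule: infinite_finite_induct)
    case (insert i I)
    show ?case
      unfolding sum.insert[OF insert.hyps] hom_even_apply(2)[OF k f Z vf_sum[OF f]] insert.IH ..
  next
    case (infinite I)
    show ?case unfolding sum.infinite[OF infinite] by (rule 0(1))
  qed (simp only: sum.empty 0)
  show "k Z (sum f I) = (\<Sum>i\<in>I. k Z (f i))"
  proof (induction I rule: infinite_finite_induct)
    case (insert i I)
    show ?case
      unfolding sum.insert[OF insert.hyps] hom_even_apply(3)[OF k Z f vf_sum[OF f]] insert.IH ..
  next
    case (infinite I)
    show ?case unfolding sum.infinite[OF infinite] by (rule 0(2))
  qed (simp only: sum.empty 0)
qed

text \<open>An even map takes homogeneous arguments to values of the parity of the sum of their degrees, which
  leaves no room for components of odd degree.\<close>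

lemma FH_odd:
  assumes h: "h \<in> FH (l + 1)" shows "h \<in> FH (l + 2)"
proof -
  let ?k = "hcomponent (hom_deg S) (l + 1) h"
  have k: "?k \<in> hom_even S" by (rule H.hcomponent_carrier[OF FH_hom[OF h]])
  have kd: "?k \<in> hom_deg S (l + 1)" by (rule H.hcomponent_mem[OF FH_hom[OF h]])
  have "?k = 0"
  proof (rule hom_even_eqI[OF k H.carrier_zero])
    fix \<epsilon> \<delta> X Y assume X: "X \<in> vf_par S \<epsilon>" and Y: "Y \<in> vf_par S \<delta>"
    note v = vf_par_vf[OF X] vf_par_vf[OF Y]
    note vh = V.D.hcomponent_carrier[OF v(1)] V.D.hcomponent_carrier[OF v(2)]
    have hom: "?k (hV i X) (hV j Y) = 0" for i j
    proof (rule ccontr)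
      assume nz: "?k (hV i X) (hV j Y) \<noteq> 0"
      have "?k (hV i X) (hV j Y) \<in> fun_deg S (j + (i + (l + 1)))"
        using kd V.D.hcomponent_mem[OF v(1), of i] V.D.hcomponent_mem[OF v(2), of j]
        unfolding hom_deg_def dual_deg_def by blast
      then have "even (j + (i + (l + 1)) - int (\<delta> + \<epsilon>))"
        using dual_parD(4)[OF hom_evenD(4)[OF k hV_par[OF X]] hV_par[OF Y]] nz by (rule fun_deg_par_even)
      moreover have "hV i X \<noteq> 0"
        using nz hom_even_apply(2)[OF k vf_zero vh(2) vf_zero, of j] by auto
      then have "even (i - int \<epsilon>)" using hV_parity[OF X] by blast
      moreover have "hV j Y \<noteq> 0"
        using nz hom_even_apply(3)[OF k vh(1) vf_zero vf_zero, of i] by auto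
      then have "even (j - int \<delta>)" using hV_parity[OF Y] by blast
      ultimately show False using l_even by presburger
    qed
    let ?I = "{- int (odd_dim S)..int (odd_dim S)}"
    have "?k (\<Sum>i\<in>?I. hV i X) (\<Sum>j\<in>?I. hV j Y) = (\<Sum>i\<in>?I. \<Sum>j\<in>?I. ?k (hV i X) (hV j Y))"
      unfolding hom_even_sum(1)[OF k vh(1) vf_sum[OF vh(2)]] hom_even_sum(2)[OF k vh(2) vh(1)] ..
    also have "\<dots> = 0" by (simp only: hom sum.neutral_const)
    finally show "?k X Y = 0 X Y"
      unfolding V.D.sum_hcomponent[OF v(1)] V.D.sum_hcomponent[OF v(2)] by simp
  qed
  then have "hcomponent (hom_deg S) j h = 0" if "j < l + 2" for j
    using h that by (cases "j = l + 1") (auto simp: H.filt_iff)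
  then show ?thesis using FH_hom[OF h] by (simp add: H.filt_iff)
qed

lemma supersymmetric_add: "supersymmetric h \<Longrightarrow> supersymmetric k \<Longrightarrow> supersymmetric (h + k)"
  unfolding supersymmetric_def plus_fun_apply scaleR_add_right by (intro allI ballI arg_cong2[where f = "(+)"]) blast+

lemma supersymmetric_diff: "supersymmetric h \<Longrightarrow> supersymmetric k \<Longrightarrow> supersymmetric (h - k)"
  unfolding supersymmetric_def minus_apply scaleR_diff_right by (intro allI ballI arg_cong2[where f = "(-)"]) blast+

text \<open>The degree bound \<open>l + 1\<close> amounts to \<open>l + 2\<close> by parity. The terms of degree at least \<open>l + 2\<close> do not
  contribute to the reduction, because \<open>l + 2 > 2\<close>.\<close>

lemma split_metrics_iff:
  assumes d: "d = l + 1 \<or> d = l + 2"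
  shows "g \<in> split_metrics \<longleftrightarrow> riemannian_metric S g \<and> reduction S g = gR \<and> g - gR \<in> FH d"
proof
  assume "g \<in> split_metrics"
  then obtain h where h: "h \<in> FH (l + 2)" "supersymmetric h" "g = gR + h"
    unfolding split_metrics_def sym_forms_def by blast
  have "supersymmetric g"
    unfolding h(3) by (rule supersymmetric_add[OF gR_sym h(2)])
  then have "riemannian_metric S g"
    unfolding riemannian_metric_iff using split_metric_bij[OF h(1)] H.carrier_add[OF gR_hom FH_hom[OF h(1)]] h(3) by simp
  moreover have "reduction S g = reduction S gR"
  proof -
    have "hcomponent (hom_deg S) 0 h = 0" "hcomponent (hom_deg S) 2 h = 0"
      using h(1) l2 by (auto simp: H.filt_iff)
    then show ?thesis
      unfolding reduction_def h(3) H.hcomponent_add[OF gR_hom FH_hom[OF h(1)]] by (simp only: add_0_right)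
  qed
  moreover have "g - gR \<in> FH d"
    unfolding h(3) add_diff_cancel_left' using H.filt_mono[OF h(1), of d] d by auto
  ultimately show "riemannian_metric S g \<and> reduction S g = gR \<and> g - gR \<in> FH d" using reduced by simp
next
  assume g: "riemannian_metric S g \<and> reduction S g = gR \<and> g - gR \<in> FH d"
  then have h: "g - gR \<in> FH (l + 2)" using d FH_odd by blast
  have "supersymmetric g" using g metric_sym by blast
  then have "supersymmetric (g - gR)"
    using gR_sym by (rule supersymmetric_diff)
  then have "g - gR \<in> sym_forms" using h by (simp add: sym_forms_def)
  moreover have "g = gR + (g - gR)" by simp
  ultimately show "g \<in> split_metrics" unfolding split_metrics_def by blast
qed

end

section \<open>The exponential parametrisation\<close>

context split_metric
begin

text \<open>The endomorphism \<open>W\<close> with \<open>g = gR (1 + W)\<close>. For the metrics in question \<open>W\<^sup>2 = 0\<close>, so that it is the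
  logarithm of \<open>gR\<^sup>-\<^sup>1 g\<close>.\<close>

definition log_of :: "(('a \<Rightarrow> 'a) \<Rightarrow> (('a \<Rightarrow> 'a) \<Rightarrow> 'a)) \<Rightarrow> (('a \<Rightarrow> 'a) \<Rightarrow> ('a \<Rightarrow> 'a))" where
  "log_of g = sharp \<circ> (g - gR)"

lemma split_metrics_diff: "g \<in> split_metrics \<Longrightarrow> g - gR \<in> sym_forms"
  by (auto simp: split_metrics_def)

lemma split_metrics_FH: "g \<in> split_metrics \<Longrightarrow> g - gR \<in> FH (l + 2)"
  using split_metrics_diff by (auto simp: sym_forms_def)

lemma split_metrics_riemannian: "g \<in> split_metrics \<Longrightarrow> riemannian_metric S g"
  using split_metrics_iff[of "l + 2" g] by simp

lemma log_of_F_space: "g \<in> split_metrics \<Longrightarrow> log_of g \<in> F_space S gR l"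
  unfolding log_of_def by (rule F_space_mem[OF split_metrics_diff])

lemma F_space_log_of: "F_space S gR l = log_of ` split_metrics"
proof -
  have "log_of (gR + h) = sharp \<circ> h" for h unfolding log_of_def by simp
  then show ?thesis unfolding F_space_eq split_metrics_def image_image by simp
qed

lemma log_of_inj: assumes "g \<in> split_metrics" "g' \<in> split_metrics" "log_of g = log_of g'" shows "g = g'"
proof -
  have "g - gR = g' - gR"
    using sharp_inj[OF FH_hom[OF split_metrics_FH[OF assms(1)]] FH_hom[OF split_metrics_FH[OF assms(2)]]] assms(3)
    unfolding log_of_def by blast
  then show ?thesis by (metis diff_add_cancel)
qed

lemma log_of_vf: assumes g: "g \<in> split_metrics" and X: "X \<in> FV i" shows "log_of g X \<in> FV (i + l)"
  unfolding log_of_def comp_apply by (rule sharp_filt[OF split_metrics_FH[OF g] X])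

lemma log_of_end: "g \<in> split_metrics \<Longrightarrow> log_of g \<in> end_even S"
  unfolding log_of_def by (rule sharp_hom_end[OF FH_hom[OF split_metrics_FH]])

lemma gR_log_of: assumes g: "g \<in> split_metrics" shows "gR \<circ> log_of g = g - gR"
  unfolding log_of_def by (rule gR_sharp_hom[OF FH_hom[OF split_metrics_FH[OF g]]])

lemma end_filt_pow:
  assumes W: "\<And>i X. X \<in> FV i \<Longrightarrow> W X \<in> FV (i + k)" and X: "X \<in> FV i"
  shows "(W ^^ n) X \<in> FV (i + int n * k)"
proof (induction n)
  case (Suc n)
  then show ?case using W[OF Suc] by (simp add: algebra_simps)
qed (simp add: X)

lemma nilp_exp_sum:
  assumes W: "\<And>i X. X \<in> FV i \<Longrightarrow> W X \<in> FV (i + 2)" and X: "X \<in> vf S" and M: "l \<le> int M"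
  shows "nilp_exp W X a = (\<Sum>n<M. (1 / fact n) *\<^sub>R (W ^^ n) X a)"
proof -
  have "(W ^^ n) X = 0" if "M \<le> n" for n
  proof (rule vf_vanish[OF l2 top])
    show "(W ^^ n) X \<in> FV (- 1 + int n * 2)"
      by (rule end_filt_pow[OF W]) (use X vf_eq_filt in auto)
    show "2 * l - 1 \<le> - 1 + int n * 2" using M that by simp
  qed
  then have "{n. (1 / fact n) *\<^sub>R (W ^^ n) X a \<noteq> 0} \<subseteq> {..<M}"
    by (intro subsetI) (force simp: not_le[symmetric])
  then show ?thesis unfolding nilp_exp_def by (rule Sum_any.expand_superset[OF finite_lessThan])
qed

lemma nilp_exp_outside:
  assumes W: "W \<in> end_even S" and X: "X \<notin> vf S"
  shows "nilp_exp W X = X"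
proof
  fix a
  have "W 0 = 0" using end_evenD(2)[OF W vf_zero vf_zero] by simp
  moreover have "W X = 0" by (rule end_evenD(1)[OF W X])
  ultimately have "(W ^^ Suc n) X = 0" for n
    by (induction n) simp_all
  then have "(1 / fact n) *\<^sub>R (W ^^ n) X a = 0" if "n \<noteq> 0" for n
    using that by (cases n) simp_all
  then have "{n. (1 / fact n) *\<^sub>R (W ^^ n) X a \<noteq> 0} \<subseteq> {0}" by blast
  then have "nilp_exp W X a = (\<Sum>n\<in>{0}. (1 / fact n) *\<^sub>R (W ^^ n) X a)"
    unfolding nilp_exp_def by (rule Sum_any.expand_superset[rotated]) simp
  then show "nilp_exp W X a = X a" by simp
qed

text \<open>The remainder of the exponential series after the linear term is written as a combination with
  coefficients in the superfunctions, to which linearity and the filtration of the module apply.\<close>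

lemma nilp_exp_lmult:
  assumes W: "\<And>i X. X \<in> FV i \<Longrightarrow> W X \<in> FV (i + 2)" and X: "X \<in> vf S" and M: "l \<le> int (M + 2)"
  shows "nilp_exp W X = X + W X + (\<Sum>n<M. lmult ((1 / fact (n + 2)) *\<^sub>R 1) ((W ^^ (n + 2)) X))"
proof
  fix a
  have "nilp_exp W X a = (\<Sum>n<Suc (Suc M). (1 / fact n) *\<^sub>R (W ^^ n) X a)"
    using nilp_exp_sum[OF W X, where M = "M + 2"] M by simp
  also have "\<dots> = X a + (W X a + (\<Sum>n<M. (1 / fact (Suc (Suc n))) *\<^sub>R (W ^^ Suc (Suc n)) X a))"
    unfolding sum.lessThan_Suc_shift by simp
  also have "(\<Sum>n<M. (1 / fact (Suc (Suc n))) *\<^sub>R (W ^^ Suc (Suc n)) X a) =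
      (\<Sum>n<M. lmult ((1 / fact (n + 2)) *\<^sub>R 1) ((W ^^ (n + 2)) X)) a"
    unfolding fun_sum_apply by (rule sum.cong[OF refl]) (simp add: lmult_def)
  finally show "nilp_exp W X a = (X + W X + (\<Sum>n<M. lmult ((1 / fact (n + 2)) *\<^sub>R 1) ((W ^^ (n + 2)) X))) a"
    by (simp add: add.assoc)
qed

lemma lmult_scalar_filt: "X \<in> FV i \<Longrightarrow> lmult (r *\<^sub>R 1) X \<in> FV i"
  using V.filt_lmult[OF A.homogeneous_filt[OF fun_deg_scale[OF one_fun_deg] order_refl]] by fastforce

lemma exp_log_of:
  assumes g: "g \<in> split_metrics"
  shows "log_of g \<in> end_filt_g0 S gR 2" "g = gR \<circ> nilp_exp (log_of g)"
proof -
  note W = log_of_end[OF g]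
  have "g - gR \<in> FH (2 + 2)" by (rule H.filt_mono[OF split_metrics_FH[OF g]]) (use l2 in simp)
  then show "log_of g \<in> end_filt_g0 S gR 2"
    unfolding end_filt_g0_iff gR_log_of[OF g] using W by blast
  have W2: "log_of g X \<in> FV (i + 2)" if "X \<in> FV i" for i X
    by (rule V.D.filt_mono[OF log_of_vf[OF g that]]) (use l2 in simp)
  have gh: "g \<in> hom_even S" using split_metrics_riemannian[OF g] by (simp add: riemannian_metric_iff)
  show "g = gR \<circ> nilp_exp (log_of g)"
  proof
    fix X show "g X = (gR \<circ> nilp_exp (log_of g)) X"
    proof (cases "X \<in> vf S")
      case True
      have X1: "X \<in> FV (- 1)" using True vf_eq_filt by simp
      have "(log_of g ^^ (n + 2)) X = 0" for n
      proof (rule vf_vanish[OF l2 top end_filt_pow[OF log_of_vf[OF g] X1, where n = "n + 2"]])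
        show "2 * l - 1 \<le> - 1 + int (n + 2) * l" using l2 by (simp add: algebra_simps)
      qed
      then have "nilp_exp (log_of g) X = X + log_of g X"
        using nilp_exp_lmult[OF W2 True, where M = "nat l"] by (simp only: lmult_zero sum.neutral_const add_0_right)
      then have "gR (nilp_exp (log_of g) X) = gR X + gR (log_of g X)"
        using hom_evenD(2)[OF gR_hom True end_even_vf[OF W True]] by simp
      also have "gR (log_of g X) = (g - gR) X" using gR_log_of[OF g] by (metis comp_apply)
      finally show ?thesis by simp
    next
      case False
      show ?thesis unfolding comp_apply nilp_exp_outside[OF W False] hom_evenD(1)[OF gh False]
        by (rule hom_evenD(1)[OF gR_hom False, symmetric])
    qed
  qed
qed

text \<open>Uniqueness of the logarithm: the equation \<open>exp W = 1 + U\<close> raises a lower bound \<open>k < l\<close> for the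
  degree of \<open>W\<close>, until \<open>W\<^sup>2 = 0\<close>.\<close>

lemma log_unique:
  assumes g: "g \<in> split_metrics" and W: "W \<in> end_filt_g0 S gR 2" and gW: "g = gR \<circ> nilp_exp W"
  shows "W = log_of g"
proof -
  let ?U = "log_of g"
  have We: "W \<in> end_even S" using W by (simp add: end_filt_g0_iff)
  have W2: "W X \<in> FV (i + 2)" if "X \<in> FV i" for i X
    using W that unfolding end_filt_g0_def filt_end_iff by blast
  define R where "R X = (\<Sum>n<nat l. lmult ((1 / fact (n + 2)) *\<^sub>R 1) ((W ^^ (n + 2)) X))" for X
  have pow_vf: "(W ^^ n) X \<in> vf S" if "X \<in> vf S" for n X
    by (induction n) (simp_all add: that end_even_vf[OF We])
  have R_vf: "R X \<in> vf S" if "X \<in> vf S" for X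
    unfolding R_def by (rule vf_sum[OF vf_lmult[OF pow_vf[OF that]]])
  have eq: "W X = ?U X - R X" if X: "X \<in> vf S" for X
  proof -
    note WX = end_even_vf[OF We X] and UX = end_even_vf[OF log_of_end[OF g] X]
    have "nilp_exp W X = X + W X + R X"
      unfolding R_def using l2 by (intro nilp_exp_lmult[OF W2 X]) auto
    then have "g X = gR (X + W X + R X)" using gW by (metis comp_apply)
    moreover have "g X = gR (X + ?U X)"
    proof -
      have "gR (X + ?U X) = gR X + (g - gR) X"
        using hom_evenD(2)[OF gR_hom X UX] gR_log_of[OF g] by (metis comp_apply)
      then show ?thesis by simp
    qed
    ultimately have "X + W X + R X = X + ?U X"
      using metric_injD[OF metric vf_add[OF vf_add[OF X WX] R_vf[OF X]] vf_add[OF X UX]] by simp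
    then have "W X + R X = ?U X" by (simp only: add.assoc add_left_cancel)
    then show ?thesis by (metis add_diff_cancel_right')
  qed
  have R_filt: "R X \<in> FV (i + 2 * k)"
    if k: "\<And>i X. X \<in> FV i \<Longrightarrow> W X \<in> FV (i + k)" "0 \<le> k" and X: "X \<in> FV i" for i k X
    unfolding R_def
  proof (rule V.D.filt_sum, rule lmult_scalar_filt)
    fix n
    have "2 * k \<le> int (n + 2) * k" using k(2) by (intro mult_right_mono) auto
    then show "(W ^^ (n + 2)) X \<in> FV (i + 2 * k)"
      by (intro V.D.filt_mono[OF end_filt_pow[OF k(1) X]]) auto
  qed
  have raise: "W X \<in> FV (i + min l (2 + int n))" if "X \<in> FV i" for n i X
    using that
  proof (induction n arbitrary: i X)
    case 0
    show ?case by (rule V.D.filt_mono[OF W2[OF 0]]) simp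
  next
    case (Suc n)
    let ?k = "min l (2 + int n)"
    have k: "2 \<le> ?k" using l2 by simp
    have "R X \<in> FV (i + 2 * ?k)" by (rule R_filt[OF Suc.IH _ Suc.prems]) (use k in auto)
    then have 1: "R X \<in> FV (i + min l (2 + int (Suc n)))" by (rule V.D.filt_mono) (use l2 in \<open>auto simp: min_def\<close>)
    have 2: "?U X \<in> FV (i + min l (2 + int (Suc n)))" by (rule V.D.filt_mono[OF log_of_vf[OF g Suc.prems]]) simp
    show ?case unfolding eq[OF V.D.filt_carrier[OF Suc.prems]] by (rule V.D.filt_diff[OF 2 1])
  qed
  have Wl: "W X \<in> FV (i + l)" if "X \<in> FV i" for i X
    using raise[OF that, of "nat l"] l2 by simp
  show ?thesis
  proof
    fix X show "W X = ?U X"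
    proof (cases "X \<in> vf S")
      case True
      have "R X \<in> FV (- 1 + 2 * l)" by (rule R_filt[OF Wl]) (use True vf_eq_filt l2 in auto)
      then have "R X = 0" by (rule vf_vanish[OF l2 top]) simp
      then show ?thesis using eq[OF True] by simp
    next
      case False
      show ?thesis unfolding end_evenD(1)[OF We False] end_evenD(1)[OF log_of_end[OF g] False] ..
    qed
  qed
qed

section \<open>Orbits\<close>

lemma Iso_iff: "\<psi> \<in> Iso S gR (l + 2) \<longleftrightarrow> \<psi> \<in> automorphisms S \<and> act_metric \<psi> gR - gR \<in> FH (l + 2)"
  unfolding Iso_def using H.filt_uminus[of "gR - act_metric \<psi> gR" "l + 2"] H.filt_uminus[of "act_metric \<psi> gR - gR" "l + 2"]
  by (auto simp: minus_diff_eq)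

lemma Iso_automorphism: "\<psi> \<in> Iso S gR (l + 2) \<Longrightarrow> \<psi> \<in> automorphisms S"
  by (simp add: Iso_iff)

lemma act_diff_gR:
  assumes \<psi>: "\<psi> \<in> automorphisms S"
  shows "act_metric \<psi> g - gR = (act_metric \<psi> gR - gR) + act_metric \<psi> (g - gR)"
  unfolding act_metric_diff[OF \<psi>] by (simp add: algebra_simps)

lemma split_metricsI:
  assumes "riemannian_metric S g" "g - gR \<in> FH (l + 2)"
  shows "g \<in> split_metrics"
proof -
  have "supersymmetric (g - gR)" by (rule supersymmetric_diff[OF metric_sym[OF assms(1)] gR_sym])
  then have "g - gR \<in> sym_forms" using assms(2) by (simp add: sym_forms_def)
  moreover have "g = gR + (g - gR)" by simp
  ultimately show ?thesis unfolding split_metrics_def by blast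
qed

text \<open>Both sides say that \<open>\<psi>.gR - gR\<close> has degree at least \<open>l + 2\<close>, as \<open>\<psi>.(g - gR)\<close> has it.\<close>

lemma act_split_metrics_iff:
  assumes \<psi>: "\<psi> \<in> automorphisms S" and g: "g \<in> split_metrics"
  shows "act_metric \<psi> g \<in> split_metrics \<longleftrightarrow> \<psi> \<in> Iso S gR (l + 2)"
proof -
  have h: "act_metric \<psi> (g - gR) \<in> FH (l + 2)" by (rule act_hom_filt[OF \<psi> split_metrics_FH[OF g]])
  show ?thesis
  proof
    assume "act_metric \<psi> g \<in> split_metrics"
    then have "(act_metric \<psi> g - gR) - act_metric \<psi> (g - gR) \<in> FH (l + 2)"
      by (intro H.filt_diff[OF split_metrics_FH h])
    then have "act_metric \<psi> gR - gR \<in> FH (l + 2)" unfolding act_diff_gR[OF \<psi>, of g] by (simp only: add_diff_cancel_right')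
    then show "\<psi> \<in> Iso S gR (l + 2)" using \<psi> by (simp add: Iso_iff)
  next
    assume "\<psi> \<in> Iso S gR (l + 2)"
    then have "act_metric \<psi> g - gR \<in> FH (l + 2)"
      unfolding act_diff_gR[OF \<psi>, of g] by (intro H.filt_add h) (simp add: Iso_iff)
    then show "act_metric \<psi> g \<in> split_metrics"
      by (rule split_metricsI[OF act_riemannian[OF \<psi> split_metrics_riemannian[OF g]]])
  qed
qed

lemma gR_split_metrics: "gR \<in> split_metrics"
  by (rule split_metricsI[OF metric]) (simp only: diff_self H.filt_zero)

lemma Iso_iff_act: "\<psi> \<in> Iso S gR (l + 2) \<longleftrightarrow> \<psi> \<in> automorphisms S \<and> act_metric \<psi> gR \<in> split_metrics"
  using act_split_metrics_iff[OF _ gR_split_metrics] Iso_automorphism by blast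

lemma Iso_id: "id \<in> Iso S gR (l + 2)"
  unfolding Iso_iff_act act_metric_id using automorphism_id gR_split_metrics by blast

lemma Iso_comp:
  assumes "\<phi> \<in> Iso S gR (l + 2)" "\<psi> \<in> Iso S gR (l + 2)"
  shows "\<phi> \<circ> \<psi> \<in> Iso S gR (l + 2)"
proof -
  note a = Iso_automorphism[OF assms(1)] Iso_automorphism[OF assms(2)]
  have "act_metric \<psi> gR \<in> split_metrics" using assms(2) by (simp add: Iso_iff_act)
  then have "act_metric \<phi> (act_metric \<psi> gR) \<in> split_metrics" using act_split_metrics_iff[OF a(1)] assms(1) by blast
  then show ?thesis unfolding Iso_iff_act act_metric_comp[OF a] using automorphism_comp[OF a] by blast
qed

lemma Iso_inv:
  assumes \<phi>: "\<phi> \<in> Iso S gR (l + 2)"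
  shows "inv \<phi> \<in> Iso S gR (l + 2)"
proof -
  note a = Iso_automorphism[OF \<phi>]
  have "act_metric \<phi> gR \<in> split_metrics" using \<phi> by (simp add: Iso_iff_act)
  from act_split_metrics_iff[OF automorphism_inv[OF a] this] gR_split_metrics
  show ?thesis unfolding act_metric_inv(1)[OF a] by blast
qed

text \<open>In terms of metrics, \<^const>\<open>iso_act\<close> is the action of automorphisms. The transform of \<open>W = gR\<^sup>-\<^sup>1 h\<close> is
  \<open>(\<psi>.gR)\<^sup>-\<^sup>1 (\<psi>.h)\<close>, and it agrees with \<open>gR\<^sup>-\<^sup>1 (\<psi>.h)\<close>, because the difference is a product of two terms of
  degree at least \<open>l\<close>.\<close>

lemma iso_act_log_of:
  assumes \<psi>: "\<psi> \<in> Iso S gR (l + 2)" and g: "g \<in> split_metrics"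
  shows "iso_act S gR \<psi> (log_of g) = log_of (act_metric \<psi> g)"
proof
  note a = Iso_automorphism[OF \<psi>]
  let ?k = "act_metric \<psi> gR - gR" and ?h = "act_metric \<psi> (g - gR)"
  have k: "?k \<in> FH (l + 2)" using \<psi> by (simp add: Iso_iff)
  have h: "?h \<in> FH (l + 2)" by (rule act_hom_filt[OF a split_metrics_FH[OF g]])
  fix X
  have act: "act_end \<psi> (log_of g) X = pull (inv \<psi>) (log_of g (pull \<psi> X))"
    using automorphismD(1)[OF a] by (simp add: act_end_def pull_def inv_inv_eq)
  have k_apply: "act_metric \<psi> gR X - gR X = ?k X" by simp
  show "iso_act S gR \<psi> (log_of g) X = log_of (act_metric \<psi> g) X"
  proof (cases "X \<in> vf S")
    case True
    note p = pull_vf[OF a True]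
    have hp: "(g - gR) (pull \<psi> X) \<in> dual S" by (rule hom_even_dual[OF FH_hom[OF split_metrics_FH[OF g]] p])
    let ?Z = "pull (inv \<psi>) (log_of g (pull \<psi> X))"
    have lp: "log_of g (pull \<psi> X) \<in> FV (- 1 + l)" using log_of_vf[OF g, of "pull \<psi> X" "- 1"] p vf_eq_filt by simp
    have Zf: "?Z \<in> FV (- 1 + l)" by (rule pull_filt[OF automorphism_inv[OF a] lp])
    have Z: "?Z \<in> vf S" by (rule V.D.filt_carrier[OF Zf])
    have "act_metric \<psi> gR ?Z = act_dual \<psi> (gR (log_of g (pull \<psi> X)))"
      unfolding act_metric_eq pull_inv(2)[OF a] ..
    also have "gR (log_of g (pull \<psi> X)) = (g - gR) (pull \<psi> X)"
      using gR_log_of[OF g] by (metis comp_apply)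
    finally have "act_metric \<psi> gR ?Z = ?h X" unfolding act_metric_eq .
    moreover have "act_metric \<psi> gR ?Z = gR ?Z"
    proof -
      have "?k ?Z = 0"
      proof
        fix Y show "?k ?Z Y = 0 Y"
        proof (cases "Y \<in> vf S")
          case True
          then have "?k ?Z Y \<in> FA (- 1 + l + - 1 + (l + 2))" using FH_apply[OF k Zf] vf_eq_filt by blast
          then have "?k ?Z Y = 0" by (rule fun_vanish[OF l2 top]) simp
          then show ?thesis by simp
        next
          case False
          show ?thesis using hom_even_apply(1)[OF FH_hom[OF k] False] by simp
        qed
      qed
      then show ?thesis by simp
    qed
    ultimately have "gR ?Z = ?h X" by simp
    then have "?Z = sharp (?h X)" using sharp_eqI[OF Z] by simp
    then have "iso_act S gR \<psi> (log_of g) X = sharp (?k X) + sharp (?h X)"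
      unfolding iso_act_def act k_apply by (simp add: sharp_def)
    also have "\<dots> = sharp (?k X + ?h X)"
      by (rule sharp_add[OF hom_even_dual[OF FH_hom[OF k] True] hom_even_dual[OF FH_hom[OF h] True], symmetric])
    also have "?k X + ?h X = (act_metric \<psi> g - gR) X"
      unfolding act_diff_gR[OF a, of g] by simp
    finally show ?thesis unfolding log_of_def comp_apply .
  next
    case False
    then have np: "pull \<psi> X \<notin> vf S" by (simp add: pull_vf_iff[OF a])
    have g': "act_metric \<psi> g \<in> split_metrics" using act_split_metrics_iff[OF a g] \<psi> by blast
    have "pull (inv \<psi>) 0 = 0" using pull_add[OF automorphism_inv[OF a], of 0 0] by simp
    moreover have "log_of g (pull \<psi> X) = 0" by (rule end_evenD(1)[OF log_of_end[OF g] np])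
    moreover have "sharp (?k X) = 0" unfolding hom_evenD(1)[OF FH_hom[OF k] False] by (rule sharp_zero)
    ultimately have "iso_act S gR \<psi> (log_of g) X = 0"
      unfolding iso_act_def act k_apply by (simp add: sharp_def)
    then show ?thesis using end_evenD(1)[OF log_of_end[OF g'] False] by simp
  qed
qed

abbreviation Vg where "Vg \<equiv> vf_filt_g0 S gR l"

lemma Vg_iff: "\<zeta> \<in> Vg \<longleftrightarrow> \<zeta> \<in> vf_par S 0 \<and> \<zeta> \<in> FV l \<and> lie \<zeta> gR \<in> FH (l + 2)"
proof -
  obtain g2 where g: "gR = hcomponent (hom_deg S) 0 gR + g2" "g2 \<in> FH 2"
    "hcomponent (hom_deg S) 0 gR \<in> hom_even S" by (rule gR_split)
  let ?g0 = "hcomponent (hom_deg S) 0 gR"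
  have "lie \<zeta> ?g0 \<in> FH (l + 2) \<longleftrightarrow> lie \<zeta> gR \<in> FH (l + 2)" if \<zeta>: "\<zeta> \<in> vf_par S 0" "\<zeta> \<in> FV l"
  proof -
    have 2: "lie \<zeta> g2 \<in> FH (l + 2)" using lie_filt[OF \<zeta> g(2)] by (simp add: add.commute)
    have s: "lie \<zeta> gR = lie \<zeta> ?g0 + lie \<zeta> g2"
      using lie_add[OF \<zeta>(1), of ?g0 g2] g(1) by metis
    show ?thesis
    proof
      assume "lie \<zeta> ?g0 \<in> FH (l + 2)"
      then show "lie \<zeta> gR \<in> FH (l + 2)" unfolding s by (rule H.filt_add[OF _ 2])
    next
      assume "lie \<zeta> gR \<in> FH (l + 2)"
      then have "lie \<zeta> gR - lie \<zeta> g2 \<in> FH (l + 2)" by (rule H.filt_diff[OF _ 2])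
      then show "lie \<zeta> ?g0 \<in> FH (l + 2)" unfolding s by (simp only: add_diff_cancel_right')
    qed
  qed
  then show ?thesis unfolding vf_filt_g0_def Let_def lie_def[symmetric] by blast
qed

lemma VgD: assumes "\<zeta> \<in> Vg" shows "\<zeta> \<in> vf_par S 0" "\<zeta> \<in> FV l" "lie \<zeta> gR \<in> FH (l + 2)"
  using assms by (simp_all add: Vg_iff)

lemma Vg_uminus: "\<zeta> \<in> Vg \<Longrightarrow> - \<zeta> \<in> Vg"
  unfolding Vg_iff by (auto simp: lie_uminus[OF gR_hom] vf_par_uminus V.D.filt_uminus H.filt_uminus)

lemma Vg_zero: "0 \<in> Vg"
proof -
  have "lie 0 gR = lie 0 gR + lie 0 gR" using lie_plus[OF gR_hom vf_par_zero vf_par_zero] by simp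
  then have "lie 0 gR = 0" by (metis add_cancel_right_right)
  then show ?thesis unfolding Vg_iff using vf_par_zero V.D.filt_zero H.filt_zero by metis
qed

text \<open>The Lie derivative of \<open>g - gR\<close> has degree at least \<open>2 l + 2\<close> and vanishes. So \<open>g\<close> may be replaced by \<open>gR\<close>
  in the formula for the action of the flow.\<close>

lemma flow_split_metrics:
  assumes \<zeta>: "\<zeta> \<in> Vg" and g: "g \<in> split_metrics"
  shows "act_metric (flow \<zeta>) g = g + lie \<zeta> gR" "flow \<zeta> \<in> Iso S gR (l + 2)"
proof -
  have z: "\<zeta> \<in> vf_par S 0" "\<zeta> \<in> FV l" "lie \<zeta> gR \<in> FH (l + 2)" by (rule VgD[OF \<zeta>])+
  have gh: "g \<in> hom_even S" using split_metrics_riemannian[OF g] by (simp add: riemannian_metric_iff)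
  have "lie \<zeta> (g - gR) \<in> FH (l + 2 + l)" by (rule lie_filt[OF z(1,2) split_metrics_FH[OF g]])
  then have hz: "lie \<zeta> (g - gR) = 0"
  proof -
    assume L: "lie \<zeta> (g - gR) \<in> FH (l + 2 + l)"
    show ?thesis
    proof (rule hom_even_eqI[OF FH_hom[OF L] H.carrier_zero])
      fix \<epsilon> \<delta> X Y assume "X \<in> vf_par S \<epsilon>" "Y \<in> vf_par S \<delta>"
      then have "X \<in> FV (- 1)" "Y \<in> FV (- 1)" using vf_par_vf vf_eq_filt by blast+
      then have "lie \<zeta> (g - gR) X Y \<in> FA (- 1 + - 1 + (l + 2 + l))" by (rule FH_apply[OF L])
      then have "lie \<zeta> (g - gR) X Y = 0" by (rule fun_vanish[OF l2 top]) simp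
      then show "lie \<zeta> (g - gR) X Y = 0 X Y" by simp
    qed
  qed
  have lg: "lie \<zeta> g = lie \<zeta> gR"
    using lie_diff[OF z(1), of g gR] unfolding hz by (metis eq_iff_diff_eq_0)
  show 1: "act_metric (flow \<zeta>) g = g + lie \<zeta> gR"
    using flow_act[OF l2 top z(1,2) gh] z(3) unfolding lg by blast
  note aut = flow_automorphism[OF l2 top z(1,2)]
  have "act_metric (flow \<zeta>) gR - gR = lie \<zeta> gR"
    using flow_act[OF l2 top z(1,2) gR_hom z(3)] by simp
  then show "flow \<zeta> \<in> Iso S gR (l + 2)" unfolding Iso_iff using aut z(3) by simp
qed

lemma G_map_eq:
  assumes \<zeta>: "\<zeta> \<in> vf_par S 0"
  shows "G_map S gR \<zeta> = sharp \<circ> (- lie \<zeta> gR)"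
proof
  fix X
  let ?\<beta> = "(gR X \<circ> ad S \<zeta>) - (\<zeta> \<circ> gR X)"
  have \<beta>: "?\<beta> = - lie \<zeta> gR X - gR (ad S \<zeta> X)"
    by (rule ext) (simp add: lie_apply)
  have lh: "- lie \<zeta> gR \<in> hom_even S" by (rule H.carrier_uminus[OF lie_hom[OF \<zeta> gR_hom]])
  show "G_map S gR \<zeta> X = (sharp \<circ> (- lie \<zeta> gR)) X"
  proof (cases "X \<in> vf S")
    case True
    have "(- lie \<zeta> gR) X \<in> dual S" by (rule hom_even_dual[OF lh True])
    then have "sharp ((- lie \<zeta> gR) X - gR (ad S \<zeta> X)) = sharp ((- lie \<zeta> gR) X) - sharp (gR (ad S \<zeta> X))"
      by (rule sharp_diff[OF _ hom_even_dual[OF gR_hom ad_vf[OF \<zeta>]]])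
    then have "sharp ?\<beta> = sharp ((- lie \<zeta> gR) X) - ad S \<zeta> X"
      unfolding \<beta> sharp_gR[OF ad_vf[OF \<zeta>]] by simp
    then show ?thesis unfolding G_map_def sharp_def[symmetric] by simp
  next
    case False
    have "ad S \<zeta> X = 0" by (rule ad_outside[OF \<zeta> False])
    moreover have "(- lie \<zeta> gR) X = 0" by (rule hom_evenD(1)[OF lh False])
    moreover have "?\<beta> = 0"
      unfolding hom_evenD(1)[OF gR_hom False] by (rule ext) (simp add: linear_0[OF even_vf_linear[OF \<zeta>]])
    ultimately show ?thesis unfolding G_map_def sharp_def[symmetric] comp_apply by (simp only: sharp_zero add_0)
  qed
qed

text \<open>The orbits of these automorphisms on metrics correspond to the classes of \<^const>\<open>G_rel\<close>.\<close>

definition flows :: "('a \<Rightarrow> 'a) set" where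
  "flows = flow ` Vg"

lemma flows_Iso: "\<kappa> \<in> flows \<Longrightarrow> \<kappa> \<in> Iso S gR (l + 2)"
  unfolding flows_def using flow_split_metrics(2)[OF _ gR_split_metrics] by blast

text \<open>Since \<open>G_map S gR \<zeta>\<close> is \<open>- gR\<^sup>-\<^sup>1 (lie \<zeta> gR)\<close>, adding an element of its range to \<open>log_of g\<close> is moving \<open>g\<close> by a
  flow.\<close>

lemma G_rel_iff:
  assumes g: "g \<in> split_metrics" and g': "g' \<in> split_metrics"
  shows "(log_of g, log_of g') \<in> G_rel S gR l \<longleftrightarrow> (\<exists>\<kappa>\<in>flows. g' = act_metric \<kappa> g)"
proof -
  have h: "g - gR \<in> hom_even S" "g' - gR \<in> hom_even S"
    using FH_hom split_metrics_FH g g' by blast+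
  have d: "log_of g' - log_of g = sharp \<circ> (g' - g)"
    using sharp_comp_diff[OF h(2,1)] unfolding log_of_def by simp
  have gg: "g' - g \<in> hom_even S" using H.carrier_diff[OF h(2,1)] by simp
  have "(log_of g, log_of g') \<in> G_rel S gR l \<longleftrightarrow> log_of g' - log_of g \<in> G_map S gR ` Vg"
    by (simp only: G_rel_def mem_Collect_eq case_prod_conv log_of_F_space[OF g] log_of_F_space[OF g'] simp_thms)
  also have "\<dots> \<longleftrightarrow> (\<exists>\<zeta>\<in>Vg. log_of g' - log_of g = G_map S gR \<zeta>)" by (rule image_iff)
  also have "\<dots> \<longleftrightarrow> (\<exists>\<zeta>\<in>Vg. g' - g = - lie \<zeta> gR)"
  proof (rule bex_cong[OF refl])
    fix \<zeta> assume "\<zeta> \<in> Vg"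
    then have z: "\<zeta> \<in> vf_par S 0" by (rule VgD(1))
    have lh: "- lie \<zeta> gR \<in> hom_even S" by (rule H.carrier_uminus[OF lie_hom[OF z gR_hom]])
    show "log_of g' - log_of g = G_map S gR \<zeta> \<longleftrightarrow> g' - g = - lie \<zeta> gR"
      unfolding d G_map_eq[OF z]
    proof
      show "g' - g = - lie \<zeta> gR" if "sharp \<circ> (g' - g) = sharp \<circ> (- lie \<zeta> gR)"
        by (rule sharp_inj[OF gg lh that])
    qed (simp only:)
  qed
  also have "\<dots> \<longleftrightarrow> (\<exists>\<zeta>\<in>Vg. g' = g + lie \<zeta> gR)"
  proof
    assume "\<exists>\<zeta>\<in>Vg. g' - g = - lie \<zeta> gR"
    then obtain \<zeta> where z: "\<zeta> \<in> Vg" "g' - g = - lie \<zeta> gR" by blast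
    have "lie (- \<zeta>) gR = - lie \<zeta> gR" by (rule lie_uminus[OF gR_hom VgD(1)[OF z(1)]])
    then have "g' - g = lie (- \<zeta>) gR" using z(2) by (simp only:)
    then have "g' = g + lie (- \<zeta>) gR" by (simp only: diff_eq_eq add.commute)
    then show "\<exists>\<zeta>\<in>Vg. g' = g + lie \<zeta> gR" by (rule bexI[OF _ Vg_uminus[OF z(1)]])
  next
    assume "\<exists>\<zeta>\<in>Vg. g' = g + lie \<zeta> gR"
    then obtain \<zeta> where z: "\<zeta> \<in> Vg" "g' = g + lie \<zeta> gR" by blast
    have "lie (- \<zeta>) gR = - lie \<zeta> gR" by (rule lie_uminus[OF gR_hom VgD(1)[OF z(1)]])
    then have "- lie (- \<zeta>) gR = lie \<zeta> gR" by (simp only: minus_minus)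
    then have "g' - g = - lie (- \<zeta>) gR" by (simp only: z(2) add_diff_cancel_left')
    then show "\<exists>\<zeta>\<in>Vg. g' - g = - lie \<zeta> gR" by (rule bexI[OF _ Vg_uminus[OF z(1)]])
  qed
  also have "\<dots> \<longleftrightarrow> (\<exists>\<kappa>\<in>flows. g' = act_metric \<kappa> g)"
    by (simp only: flows_def bex_simps flow_split_metrics(1)[OF _ g] cong: bex_cong)
  finally show ?thesis .
qed

text \<open>The conjugate of the flow of \<open>\<zeta>\<close> is the flow of \<open>\<psi> \<zeta> \<psi>\<^sup>-\<^sup>1\<close>. Its Lie derivative of \<open>\<psi>.gR\<close> has high degree by
  naturality, and \<open>gR\<close> differs from \<open>\<psi>.gR\<close> by terms of high degree.\<close>

lemma flows_conjugate:
  assumes \<psi>: "\<psi> \<in> Iso S gR (l + 2)" and \<kappa>: "\<kappa> \<in> flows"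
  shows "\<exists>\<kappa>'\<in>flows. \<psi> \<circ> \<kappa> = \<kappa>' \<circ> \<psi>"
proof -
  note a = Iso_automorphism[OF \<psi>] and ai = automorphism_inv[OF Iso_automorphism[OF \<psi>]]
  obtain \<zeta> where z: "\<zeta> \<in> Vg" "\<kappa> = flow \<zeta>" using \<kappa> unfolding flows_def by blast
  have \<zeta>: "\<zeta> \<in> vf_par S 0" "\<zeta> \<in> FV l" "lie \<zeta> gR \<in> FH (l + 2)" by (rule VgD[OF z(1)])+
  let ?\<zeta> = "pull (inv \<psi>) \<zeta>"
  have p: "?\<zeta> \<in> vf_par S 0" "?\<zeta> \<in> FV l" using pull_par[OF ai \<zeta>(1)] pull_filt[OF ai \<zeta>(2)] by auto
  have k: "act_metric \<psi> gR - gR \<in> FH (l + 2)" using \<psi> by (simp add: Iso_iff)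
  have "lie ?\<zeta> (act_metric \<psi> gR) \<in> FH (l + 2)"
    using act_lie[OF a \<zeta>(1) gR_hom] act_hom_filt[OF a \<zeta>(3)] by metis
  moreover have "lie ?\<zeta> (act_metric \<psi> gR - gR) \<in> FH (l + 2)"
    by (rule H.filt_mono[OF lie_filt[OF p k]]) (use l2 in simp)
  ultimately have "lie ?\<zeta> (act_metric \<psi> gR) - lie ?\<zeta> (act_metric \<psi> gR - gR) \<in> FH (l + 2)" by (rule H.filt_diff)
  moreover have "lie ?\<zeta> (act_metric \<psi> gR) - lie ?\<zeta> (act_metric \<psi> gR - gR) = lie ?\<zeta> gR"
    unfolding lie_diff[OF p(1)] by simp
  ultimately have "?\<zeta> \<in> Vg" using p by (simp add: Vg_iff)
  moreover have "\<psi> \<circ> flow \<zeta> = flow ?\<zeta> \<circ> \<psi>"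
    by (rule ext) (simp add: flow_def pull_apply[OF ai] inv_inv[OF a] inv_cancel[OF a] linear_add[OF automorphismD(2)[OF a]])
  ultimately show ?thesis unfolding z(2) flows_def by blast
qed

lemma flows_id: "id \<in> flows"
proof -
  have "flow 0 = (id :: 'a \<Rightarrow> 'a)" by (rule ext) (simp add: flow_def)
  then show ?thesis unfolding flows_def using Vg_zero by (metis imageI)
qed

text \<open>The class of \<open>log_of g\<close> modulo \<^const>\<open>G_rel\<close>, as an orbit of the flows.\<close>

definition coset :: "(('a \<Rightarrow> 'a) \<Rightarrow> (('a \<Rightarrow> 'a) \<Rightarrow> 'a)) \<Rightarrow> (('a \<Rightarrow> 'a) \<Rightarrow> ('a \<Rightarrow> 'a)) set" where
  "coset g = {log_of (act_metric \<kappa> g) | \<kappa>. \<kappa> \<in> flows}"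

lemma cosetI: "\<kappa> \<in> flows \<Longrightarrow> log_of (act_metric \<kappa> g) \<in> coset g"
  by (auto simp: coset_def)

lemma cosetE:
  assumes "W \<in> coset g"
  obtains \<kappa> where "\<kappa> \<in> flows" "W = log_of (act_metric \<kappa> g)"
  using assms by (auto simp: coset_def)

lemma act_Iso_split: "\<psi> \<in> Iso S gR (l + 2) \<Longrightarrow> g \<in> split_metrics \<Longrightarrow> act_metric \<psi> g \<in> split_metrics"
  using act_split_metrics_iff[OF Iso_automorphism] by blast

lemma G_rel_class: assumes g: "g \<in> split_metrics" shows "G_rel S gR l `` {log_of g} = coset g"
proof
  show "G_rel S gR l `` {log_of g} \<subseteq> coset g"
  proof
    fix W assume "W \<in> G_rel S gR l `` {log_of g}"
    then have W: "(log_of g, W) \<in> G_rel S gR l" by simp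
    then have "W \<in> F_space S gR l" unfolding G_rel_def by blast
    then obtain g' where g': "g' \<in> split_metrics" "W = log_of g'" unfolding F_space_log_of by blast
    have "\<exists>\<kappa>\<in>flows. g' = act_metric \<kappa> g" using W unfolding g'(2) by (rule G_rel_iff[OF g g'(1), THEN iffD1])
    then obtain \<kappa> where "\<kappa> \<in> flows" "g' = act_metric \<kappa> g" by (rule bexE)
    then show "W \<in> coset g" unfolding g'(2) by (simp only: cosetI)
  qed
  show "coset g \<subseteq> G_rel S gR l `` {log_of g}"
  proof
    fix W assume "W \<in> coset g"
    then obtain \<kappa> where \<kappa>: "\<kappa> \<in> flows" "W = log_of (act_metric \<kappa> g)" by (rule cosetE)
    have "(log_of g, log_of (act_metric \<kappa> g)) \<in> G_rel S gR l"
      by (rule G_rel_iff[OF g act_Iso_split[OF flows_Iso[OF \<kappa>(1)] g], THEN iffD2, OF bexI[OF refl \<kappa>(1)]])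
    then show "W \<in> G_rel S gR l `` {log_of g}" unfolding \<kappa>(2) Image_singleton_iff .
  qed
qed

text \<open>Automorphisms permute the cosets by normality of the flows.\<close>

lemma iso_act_coset:
  assumes \<psi>: "\<psi> \<in> Iso S gR (l + 2)" and g: "g \<in> split_metrics"
  shows "iso_act S gR \<psi> ` coset g = coset (act_metric \<psi> g)"
proof -
  note a = Iso_automorphism[OF \<psi>]
  have flows_aut: "\<kappa> \<in> automorphisms S" if "\<kappa> \<in> flows" for \<kappa> using Iso_automorphism[OF flows_Iso[OF that]] .
  have 1: "iso_act S gR \<psi> (log_of (act_metric \<kappa> g)) = log_of (act_metric (\<psi> \<circ> \<kappa>) g)" if "\<kappa> \<in> flows" for \<kappa>
    unfolding iso_act_log_of[OF \<psi> act_Iso_split[OF flows_Iso[OF that] g]] act_metric_comp[OF a flows_aut[OF that]] ..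
  show ?thesis
  proof
    show "iso_act S gR \<psi> ` coset g \<subseteq> coset (act_metric \<psi> g)"
    proof clarify
      fix W assume "W \<in> coset g"
      then obtain \<kappa> where \<kappa>: "\<kappa> \<in> flows" "W = log_of (act_metric \<kappa> g)" by (rule cosetE)
      obtain \<kappa>' where \<kappa>': "\<kappa>' \<in> flows" "\<psi> \<circ> \<kappa> = \<kappa>' \<circ> \<psi>" by (rule bexE[OF flows_conjugate[OF \<psi> \<kappa>(1)]])
      have "iso_act S gR \<psi> W = log_of (act_metric \<kappa>' (act_metric \<psi> g))"
        unfolding \<kappa>(2) 1[OF \<kappa>(1)] \<kappa>'(2) act_metric_comp[OF flows_aut[OF \<kappa>'(1)] a] ..
      then show "iso_act S gR \<psi> W \<in> coset (act_metric \<psi> g)" by (simp only: cosetI[OF \<kappa>'(1)])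
    qed
    show "coset (act_metric \<psi> g) \<subseteq> iso_act S gR \<psi> ` coset g"
    proof
      fix W assume "W \<in> coset (act_metric \<psi> g)"
      then obtain \<kappa> where \<kappa>: "\<kappa> \<in> flows" "W = log_of (act_metric \<kappa> (act_metric \<psi> g))" by (rule cosetE)
      obtain \<kappa>' where \<kappa>': "\<kappa>' \<in> flows" "inv \<psi> \<circ> \<kappa> = \<kappa>' \<circ> inv \<psi>" by (rule bexE[OF flows_conjugate[OF Iso_inv[OF \<psi>] \<kappa>(1)]])
      have "\<kappa> \<circ> \<psi> = \<psi> \<circ> \<kappa>'"
      proof
        fix x
        have "inv \<psi> (\<kappa> (\<psi> x)) = \<kappa>' (inv \<psi> (\<psi> x))"
          using fun_cong[OF \<kappa>'(2), of "\<psi> x"] by (simp only: comp_apply)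
        then have "\<psi> (inv \<psi> (\<kappa> (\<psi> x))) = \<psi> (\<kappa>' x)" by (simp only: inv_cancel[OF a])
        then show "(\<kappa> \<circ> \<psi>) x = (\<psi> \<circ> \<kappa>') x" by (simp only: inv_cancel[OF a] comp_apply)
      qed
      then have "act_metric (\<kappa> \<circ> \<psi>) g = act_metric (\<psi> \<circ> \<kappa>') g" by (rule arg_cong)
      then have "W = iso_act S gR \<psi> (log_of (act_metric \<kappa>' g))"
        unfolding \<kappa>(2) 1[OF \<kappa>'(1)] act_metric_comp[OF flows_aut[OF \<kappa>(1)] a] by (rule arg_cong)
      then show "W \<in> iso_act S gR \<psi> ` coset g" by (rule image_eqI[OF _ cosetI[OF \<kappa>'(1)]])
    qed
  qed
qed

definition orbit_of :: "(('a \<Rightarrow> 'a) \<Rightarrow> (('a \<Rightarrow> 'a) \<Rightarrow> 'a)) \<Rightarrow> (('a \<Rightarrow> 'a) \<Rightarrow> ('a \<Rightarrow> 'a)) set set" where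
  "orbit_of g = iso_orbit S gR (l + 2) (G_rel S gR l `` {log_of g})"

lemma orbit_of_eq: assumes g: "g \<in> split_metrics"
  shows "orbit_of g = {coset (act_metric \<psi> g) | \<psi>. \<psi> \<in> Iso S gR (l + 2)}"
  unfolding orbit_of_def iso_orbit_def G_rel_class[OF g] setcompr_eq_image
  by (rule image_cong[OF _ iso_act_coset[OF _ g]]) simp_all

lemma orbit_ofI: "g \<in> split_metrics \<Longrightarrow> \<psi> \<in> Iso S gR (l + 2) \<Longrightarrow> coset (act_metric \<psi> g) \<in> orbit_of g"
  unfolding orbit_of_eq by (rule CollectI, intro exI conjI, rule refl)

lemma orbit_ofE:
  assumes "g \<in> split_metrics" "C \<in> orbit_of g"
  obtains \<psi> where "\<psi> \<in> Iso S gR (l + 2)" "C = coset (act_metric \<psi> g)"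
  using assms(2) unfolding orbit_of_eq[OF assms(1)] by (elim CollectE exE conjE) (rule that)

text \<open>Unfolding an equality of orbits to metrics gives \<open>\<psi>\<close> in \<open>Iso\<close> and a flow \<open>\<kappa>\<close> with \<open>g' = \<kappa>.\<psi>.g\<close>.
  Conversely an isometry between two metrics of the form \<open>gR + h\<close> belongs to \<open>Iso\<close>, and it permutes the orbit.\<close>

lemma orbit_of_eq_iff:
  assumes g: "g \<in> split_metrics" and g': "g' \<in> split_metrics"
  shows "orbit_of g = orbit_of g' \<longleftrightarrow> (\<exists>\<phi>\<in>automorphisms S. g' = act_metric \<phi> g)"
proof
  assume eq: "orbit_of g = orbit_of g'"
  have "coset g' \<in> orbit_of g'" using orbit_ofI[OF g' Iso_id] by (simp only: act_metric_id)
  then have "coset g' \<in> orbit_of g" unfolding eq .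
  then obtain \<psi> where \<psi>: "\<psi> \<in> Iso S gR (l + 2)" "coset g' = coset (act_metric \<psi> g)"
    by (rule orbit_ofE[OF g])
  have "log_of g' \<in> coset g'" using cosetI[OF flows_id, of g'] by (simp only: act_metric_id)
  then obtain \<kappa> where \<kappa>: "\<kappa> \<in> flows" "log_of g' = log_of (act_metric \<kappa> (act_metric \<psi> g))"
    unfolding \<psi>(2) by (rule cosetE)
  have "g' = act_metric \<kappa> (act_metric \<psi> g)"
    by (rule log_of_inj[OF g' act_Iso_split[OF flows_Iso[OF \<kappa>(1)] act_Iso_split[OF \<psi>(1) g]] \<kappa>(2)])
  then have "g' = act_metric (\<kappa> \<circ> \<psi>) g"
    using act_metric_comp[OF Iso_automorphism[OF flows_Iso[OF \<kappa>(1)]] Iso_automorphism[OF \<psi>(1)]] by simp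
  then show "\<exists>\<phi>\<in>automorphisms S. g' = act_metric \<phi> g"
    using Iso_automorphism[OF Iso_comp[OF flows_Iso[OF \<kappa>(1)] \<psi>(1)]] by blast
next
  assume "\<exists>\<phi>\<in>automorphisms S. g' = act_metric \<phi> g"
  then obtain \<phi> where \<phi>: "\<phi> \<in> automorphisms S" "g' = act_metric \<phi> g" by blast
  then have \<phi>I: "\<phi> \<in> Iso S gR (l + 2)" using act_split_metrics_iff[OF \<phi>(1) g] g' by simp
  show "orbit_of g = orbit_of g'"
  proof
    show "orbit_of g' \<subseteq> orbit_of g"
    proof
      fix C assume "C \<in> orbit_of g'"
      then obtain \<psi> where \<psi>: "\<psi> \<in> Iso S gR (l + 2)" "C = coset (act_metric \<psi> g')" by (rule orbit_ofE[OF g'])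
      have "C = coset (act_metric (\<psi> \<circ> \<phi>) g)"
        unfolding \<psi>(2) \<phi>(2) act_metric_comp[OF Iso_automorphism[OF \<psi>(1)] \<phi>(1)] ..
      then show "C \<in> orbit_of g" by (simp only: orbit_ofI[OF g Iso_comp[OF \<psi>(1) \<phi>I]])
    qed
    show "orbit_of g \<subseteq> orbit_of g'"
    proof
      fix C assume "C \<in> orbit_of g"
      then obtain \<psi> where \<psi>: "\<psi> \<in> Iso S gR (l + 2)" "C = coset (act_metric \<psi> g)" by (rule orbit_ofE[OF g])
      note i = Iso_inv[OF \<phi>I]
      have "act_metric (\<psi> \<circ> inv \<phi>) g' = act_metric \<psi> g"
        unfolding \<phi>(2) act_metric_comp[OF Iso_automorphism[OF \<psi>(1)] Iso_automorphism[OF i]] act_metric_inv(1)[OF \<phi>(1)] ..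
      then have "C = coset (act_metric (\<psi> \<circ> inv \<phi>) g')" using \<psi>(2) by simp
      then show "C \<in> orbit_of g'" by (simp only: orbit_ofI[OF g' Iso_comp[OF \<psi>(1) i]])
    qed
  qed
qed

lemma orbit_image: "iso_orbit S gR (l + 2) ` (F_space S gR l // G_rel S gR l) = orbit_of ` split_metrics"
  unfolding quotient_def orbit_of_def F_space_log_of by auto

text \<open>Each isometry class contains a metric of the form \<open>gR + h\<close>, by a change of the Batchelor model. The
  value of the bijection on the class is the orbit of any such representative.\<close>

lemma isometry_classes_bij:
  assumes d: "d = l + 1 \<or> d = l + 2"
  defines "M \<equiv> metrics_split_upto S gR d"
  shows "\<exists>\<Phi>. bij_betw \<Phi> (M // isometry_rel S M) (orbit_of ` split_metrics) \<and>
    (\<forall>g\<in>split_metrics. \<Phi> (isometry_rel S M `` {g}) = orbit_of g)"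
proof -
  let ?R = "isometry_rel S M"
  have M: "g \<in> M \<longleftrightarrow> riemannian_metric S g \<and> (\<exists>\<phi>\<in>automorphisms S. act_metric \<phi> g \<in> split_metrics)" for g
    unfolding M_def metrics_split_upto_def split_metrics_iff[OF d] using act_riemannian by blast
  have sub: "g \<in> M" if "g \<in> split_metrics" for g
    unfolding M using split_metrics_riemannian[OF that] automorphism_id that act_metric_id by metis
  have R: "(g, g') \<in> ?R \<longleftrightarrow> g \<in> M \<and> g' \<in> M \<and> (\<exists>\<phi>\<in>automorphisms S. g' = act_metric \<phi> g)" for g g'
    unfolding isometry_rel_def by simp
  have equiv: "equiv M ?R"
  proof (rule equivI)
    show "?R \<subseteq> M \<times> M" unfolding isometry_rel_def by blast
    show "refl_on M ?R" unfolding refl_on_def R using automorphism_id act_metric_id by metis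
    show "sym ?R"
    proof (rule symI)
      fix g g' assume "(g, g') \<in> ?R"
      then obtain \<phi> where "g \<in> M" "g' \<in> M" "\<phi> \<in> automorphisms S" "g' = act_metric \<phi> g" unfolding R by blast
      then show "(g', g) \<in> ?R" unfolding R using automorphism_inv act_metric_inv(1) by metis
    qed
    show "trans ?R"
    proof (rule transI)
      fix g g' g'' assume "(g, g') \<in> ?R" "(g', g'') \<in> ?R"
      then obtain \<phi> \<psi> where *: "g \<in> M" "g'' \<in> M" "\<phi> \<in> automorphisms S" "g' = act_metric \<phi> g"
        "\<psi> \<in> automorphisms S" "g'' = act_metric \<psi> g'" unfolding R by blast
      then have "g'' = act_metric (\<psi> \<circ> \<phi>) g" using act_metric_comp by metis
      then show "(g, g'') \<in> ?R" unfolding R using * automorphism_comp by metis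
    qed
  qed
  have same: "?R `` {g} = ?R `` {g'} \<longleftrightarrow> (\<exists>\<phi>\<in>automorphisms S. g' = act_metric \<phi> g)"
    if "g \<in> M" "g' \<in> M" for g g'
    using eq_equiv_class_iff[OF equiv that] R that by blast
  define \<Phi> where "\<Phi> c = orbit_of (SOME g. g \<in> split_metrics \<and> c = ?R `` {g})" for c
  have \<Phi>: "\<Phi> (?R `` {g}) = orbit_of g" if g: "g \<in> split_metrics" for g
  proof -
    let ?g = "SOME g'. g' \<in> split_metrics \<and> ?R `` {g} = ?R `` {g'}"
    have s: "?g \<in> split_metrics \<and> ?R `` {g} = ?R `` {?g}"
      by (rule someI[of _ g]) (simp add: g)
    then have "\<exists>\<phi>\<in>automorphisms S. ?g = act_metric \<phi> g" using same[OF sub[OF g] sub] by blast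
    then have "orbit_of g = orbit_of ?g" using orbit_of_eq_iff[OF g] s by blast
    then show ?thesis unfolding \<Phi>_def by simp
  qed
  have classes: "M // ?R = (\<lambda>g. ?R `` {g}) ` split_metrics"
  proof
    show "M // ?R \<subseteq> (\<lambda>g. ?R `` {g}) ` split_metrics"
    proof
      fix c assume "c \<in> M // ?R"
      then obtain g where g: "g \<in> M" "c = ?R `` {g}" by (rule quotientE)
      then obtain \<phi> where \<phi>: "\<phi> \<in> automorphisms S" "act_metric \<phi> g \<in> split_metrics" unfolding M by blast
      then have "c = ?R `` {act_metric \<phi> g}" using same[OF g(1) sub[OF \<phi>(2)]] g(2) by blast
      then show "c \<in> (\<lambda>g. ?R `` {g}) ` split_metrics" using \<phi>(2) by blast
    qed
    show "(\<lambda>g. ?R `` {g}) ` split_metrics \<subseteq> M // ?R" using sub by (auto intro: quotientI)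
  qed
  have "bij_betw \<Phi> (M // ?R) (orbit_of ` split_metrics)"
    unfolding bij_betw_def
  proof
    show "inj_on \<Phi> (M // ?R)"
    proof (rule inj_onI)
      fix c c' assume "c \<in> M // ?R" "c' \<in> M // ?R" and eq: "\<Phi> c = \<Phi> c'"
      then obtain g g' where g: "g \<in> split_metrics" "c = ?R `` {g}" and g': "g' \<in> split_metrics" "c' = ?R `` {g'}"
        unfolding classes by blast
      then have "orbit_of g = orbit_of g'" using eq \<Phi> by simp
      then show "c = c'" using orbit_of_eq_iff[OF g(1) g'(1)] same[OF sub[OF g(1)] sub[OF g'(1)]] g(2) g'(2) by blast
    qed
    show "\<Phi> ` (M // ?R) = orbit_of ` split_metrics"
      unfolding classes image_image by (rule image_cong[OF refl \<Phi>])
  qed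
  then show ?thesis using \<Phi> by blast
qed

end

theorem proposition2p4:
  fixes S :: "('m::{t2_space, second_countable_topology}, 'v::real_vector, 'a::real_algebra_1) batchelor"
    and gR :: "('a \<Rightarrow> 'a) \<Rightarrow> (('a \<Rightarrow> 'a) \<Rightarrow> 'a)"
    and m r :: nat
  assumes "batchelor_model S"
    and "odd_dim S = 2 * (2 * m + r)" and "r \<in> {0, 1}"
    and "riemannian_metric S gR" and "reduction S gR = gR"
  defines "d \<equiv> int ((2 * m + r) + 3)"
    and "l \<equiv> int (2 * (m + 1))"
  defines "metrics \<equiv> metrics_split_upto S gR d"
    and "Q \<equiv> F_space S gR l // G_rel S gR l"
    and "orbit \<equiv> iso_orbit S gR (int (2 * (m + 2)))"
  shows "\<exists>\<Phi>. bij_betw \<Phi> (metrics // isometry_rel S metrics) (orbit ` Q) \<and>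
    (\<forall>g. riemannian_metric S g \<and> reduction S g = gR \<and> g - gR \<in> filt (hom_deg S) d \<longrightarrow>
       (\<exists>W \<in> end_filt_g0 S gR 2. g = gR \<circ> nilp_exp W) \<and>
       (\<forall>W \<in> end_filt_g0 S gR 2. g = gR \<circ> nilp_exp W \<longrightarrow>
          W \<in> F_space S gR l \<and>
          \<Phi> (isometry_rel S metrics `` {g}) = orbit (G_rel S gR l `` {W})))"
proof -
  interpret split_metric S gR l
  proof
    show "batchelor_model S" "riemannian_metric S gR" "reduction S gR = gR" by fact+
    show "2 \<le> l" "even l" unfolding l_def by simp_all
    show "int (odd_dim S) + 1 < 2 * l"
      unfolding l_def assms(2) using assms(3) by auto
  qed
  have d: "d = l + 1 \<or> d = l + 2" unfolding d_def l_def using assms(3) by auto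
  have orbit: "orbit = iso_orbit S gR (l + 2)" unfolding orbit_def l_def by (simp add: algebra_simps)
  obtain \<Phi> where \<Phi>: "bij_betw \<Phi> (metrics // isometry_rel S metrics) (orbit_of ` split_metrics)"
    "\<And>g. g \<in> split_metrics \<Longrightarrow> \<Phi> (isometry_rel S metrics `` {g}) = orbit_of g"
    using isometry_classes_bij[OF d] unfolding metrics_def by blast
  show ?thesis
  proof (intro exI[of _ \<Phi>] conjI allI impI)
    show "bij_betw \<Phi> (metrics // isometry_rel S metrics) (orbit ` Q)"
      unfolding orbit Q_def orbit_image by (rule \<Phi>(1))
  next
    fix g assume "riemannian_metric S g \<and> reduction S g = gR \<and> g - gR \<in> filt (hom_deg S) d"
    then have g: "g \<in> split_metrics" unfolding split_metrics_iff[OF d] .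
    show "\<exists>W \<in> end_filt_g0 S gR 2. g = gR \<circ> nilp_exp W" using exp_log_of[OF g] by blast
    show "\<forall>W \<in> end_filt_g0 S gR 2. g = gR \<circ> nilp_exp W \<longrightarrow>
          W \<in> F_space S gR l \<and> \<Phi> (isometry_rel S metrics `` {g}) = orbit (G_rel S gR l `` {W})"
    proof (intro ballI impI)
      fix W assume "W \<in> end_filt_g0 S gR 2" "g = gR \<circ> nilp_exp W"
      then have W: "W = log_of g" by (rule log_unique[OF g])
      show "W \<in> F_space S gR l \<and> \<Phi> (isometry_rel S metrics `` {g}) = orbit (G_rel S gR l `` {W})"
        unfolding W orbit \<Phi>(2)[OF g] orbit_of_def using log_of_F_space[OF g] by simp
    qed
  qed
qed

end
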